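(* Let $k$ be an algebraically closed field of characteristic zero. Let $G$ be a special finite solvable group and let $V$ be a finite-dimensional faithful linear representation of $G$ over $k$. Then the quotient variety $V/G$ admits a toric rational tower $$X_n \to X_{n-1}\to \cdots \to X_1\to X_0 := V/G.$$
   Context: Quotients are considered up to $k$-birational equivalence: $V/G$ is a model of the field of invariants $k(V)^G$. Special solvable group: a finite solvable group $G$ is called special if there exists a filtration $G=G_0\supsetneq G_1\supsetneq\cdots\supsetneq G_r=1$ such that for all $i=0,\dots,r-1$: (a) $G_i$ is a normal subgroup of $G$; (b) the kernel $G_i/G_{i+1}$ of the natural projection $p_i: G/G_{i+1}\to G/G_i$ is abelian; (c) there exists a section $s_i: G/G_i\to G/G_{i+1}$ of $p_i$, i.e. a group homomorphism with $p_i\circ s_i=\mathrm{id}$. Toric rational tower: a variety $X$ over a field $k$ admits a toric rational tower if there exists a sequence of dominant rational maps over $k$ $$X_n\xrightarrow{\pi_n}X_{n-1}\to\cdots\to X_1\xrightarrow{\pi_1}X_0:=X$$ such that (1) the source $X_n$ is rational over $k$; (2) for every $i$, the generic fiber of $\pi_i$ is geometrically rational and irreducible over the function field $k(X_{i-1})$; (2') for every $i$, the generic fiber of $\pi_i$ is birational, over $k(X_{i-1})$, to a torsor under an algebraic torus over $k(X_{i-1})$. *)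

theory Defs
  imports
    "HOL-Algebra.Algebraic_Closure_Type"
    "HOL-Algebra.Group_Action"
    "HOL-Algebra.Solvable_Groups"
    "HOL-Library.Poly_Mapping"
    "HOL-Computational_Algebra.Polynomial_Factorial"
begin

text \<open>
  Elements of \<open>G Mod H\<close> are cosets; for \<open>H \<subseteq> N\<close> the natural projection sends the coset \<open>H x\<close>
  to \<open>N x\<close>, which is the product set of \<open>N\<close> and \<open>H x\<close>.
\<close>

definition natural_proj :: "('g, 'b) monoid_scheme \<Rightarrow> 'g set \<Rightarrow> 'g set \<Rightarrow> 'g set" where
  "natural_proj G N = (\<lambda>C. N <#>\<^bsub>G\<^esub> C)"

definition special_solvable :: "('g, 'b) monoid_scheme \<Rightarrow> bool" where
  "special_solvable G \<longleftrightarrow>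
     group G \<and> finite (carrier G) \<and> solvable G \<and>
     (\<exists>(r::nat) H.
        H 0 = carrier G \<and> H r = {\<one>\<^bsub>G\<^esub>} \<and>
        (\<forall>i<r.
           H (Suc i) \<subset> H i \<and>
           H i \<lhd> G \<and>
           comm_group ((G Mod H (Suc i))
             \<lparr>carrier := kernel (G Mod H (Suc i)) (G Mod H i) (natural_proj G (H i))\<rparr>) \<and>
           (\<exists>s \<in> hom (G Mod H i) (G Mod H (Suc i)).
              \<forall>C \<in> carrier (G Mod H i). natural_proj G (H i) (s C) = C)))"

text \<open>
  Algebraic geometry is set up in Weil's language. For a field \<open>k\<close>, the field \<open>'k udom\<close> is the
  algebraic closure of \<open>k(t\<^sub>0, t\<^sub>1, t\<^sub>2, \<dots>)\<close>: it is algebraically closed and of infinite transcendence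
  degree over \<open>k\<close>, so all finitely generated extensions of \<open>k\<close> embed in it, and every irreducible
  variety over a subfield that is finitely generated over \<open>k\<close> has generic points with coordinates
  in it.
\<close>

type_synonym 'k udom = "((nat \<Rightarrow>\<^sub>0 nat) \<Rightarrow>\<^sub>0 'k) fract alg_closure"

definition udom_of :: "'k::field \<Rightarrow> 'k udom" where
  "udom_of c = to_ac (to_fract (Poly_Mapping.single 0 c))"

definition ground :: "'k::field udom set" where
  "ground = range udom_of"

definition is_subfield :: "'a::field set \<Rightarrow> bool" where
  "is_subfield F \<longleftrightarrow> 0 \<in> F \<and> 1 \<in> F \<and>
     (\<forall>x\<in>F. \<forall>y\<in>F. x + y \<in> F \<and> x * y \<in> F) \<and>
     (\<forall>x\<in>F. - x \<in> F \<and> inverse x \<in> F)"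

definition field_adjoin :: "'a::field set \<Rightarrow> 'a set \<Rightarrow> 'a set" where
  "field_adjoin F S = is_subfield hull (F \<union> S)"

text \<open>If the ambient field is algebraically closed, this is an algebraic closure of \<open>F\<close>.\<close>

definition algebraic_closure_of :: "'a::field set \<Rightarrow> 'a set" where
  "algebraic_closure_of F = {x. \<exists>p. p \<noteq> 0 \<and> (\<forall>i. Polynomial.coeff p i \<in> F) \<and> poly p x = 0}"

text \<open>
  From here on \<open>'a\<close> plays the role of a universal domain \<open>\<Omega>\<close> of characteristic zero, \<open>F\<close> is a
  subfield, and affine \<open>n\<close>-space is the set of lists of length \<open>n\<close> over \<open>\<Omega>\<close>. As \<open>\<Omega>\<close> is infinite,
  \<open>F[x\<^sub>0, \<dots>, x\<^sub>n\<^sub>-\<^sub>1]\<close> is identified with the polynomial functions on affine space with coefficients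
  in \<open>F\<close>. As \<open>F\<close> is perfect, zero loci of such polynomials are the same as reduced closed subschemes
  of affine space over \<open>F\<close>, a scheme being represented by the set of its \<open>\<Omega>\<close>-points.
\<close>

definition affine_space :: "nat \<Rightarrow> 'a list set" where
  "affine_space n = {x. length x = n}"

inductive_set polys :: "'a::field set \<Rightarrow> nat \<Rightarrow> ('a list \<Rightarrow> 'a) set"
  for F :: "'a::field set" and n :: nat where
  const: "c \<in> F \<Longrightarrow> (\<lambda>_. c) \<in> polys F n"
| coord: "i < n \<Longrightarrow> (\<lambda>x. x ! i) \<in> polys F n"
| add: "p \<in> polys F n \<Longrightarrow> q \<in> polys F n \<Longrightarrow> (\<lambda>x. p x + q x) \<in> polys F n"
| mult: "p \<in> polys F n \<Longrightarrow> q \<in> polys F n \<Longrightarrow> (\<lambda>x. p x * q x) \<in> polys F n"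

definition zclosed :: "'a::field set \<Rightarrow> nat \<Rightarrow> 'a list set \<Rightarrow> bool" where
  "zclosed F n W \<longleftrightarrow> (\<exists>S \<subseteq> polys F n. W = {x \<in> affine_space n. \<forall>p\<in>S. p x = 0})"

definition irreducible_over :: "'a::field set \<Rightarrow> nat \<Rightarrow> 'a list set \<Rightarrow> bool" where
  "irreducible_over F n W \<longleftrightarrow> W \<subseteq> affine_space n \<and> W \<noteq> {} \<and>
     (\<forall>A B. zclosed F n A \<longrightarrow> zclosed F n B \<longrightarrow> W \<subseteq> A \<union> B \<longrightarrow> W \<subseteq> A \<or> W \<subseteq> B)"

text \<open>
  Integral quasi-affine varieties; since every integral variety has a dense affine open subset, these
  suffice for all questions of birational nature.
\<close>

definition variety :: "'a::field set \<Rightarrow> nat \<Rightarrow> 'a list set \<Rightarrow> bool" where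
  "variety F n W \<longleftrightarrow> (\<exists>A B. zclosed F n A \<and> zclosed F n B \<and> W = A - B) \<and> irreducible_over F n W"

definition generic_point :: "'a::field set \<Rightarrow> nat \<Rightarrow> 'a list set \<Rightarrow> 'a list \<Rightarrow> bool" where
  "generic_point F n W x \<longleftrightarrow> x \<in> W \<and> (\<forall>A. zclosed F n A \<longrightarrow> x \<in> A \<longrightarrow> W \<subseteq> A)"

text \<open>
  A rational map is represented by a list of fractions \<open>p / q\<close>, given as pairs of polynomials; it is
  considered on the dense open subset where none of the denominators vanishes.
\<close>

type_synonym 'a ratmap = "(('a list \<Rightarrow> 'a) \<times> ('a list \<Rightarrow> 'a)) list"

definition rdom :: "'a::field ratmap \<Rightarrow> 'a list set \<Rightarrow> 'a list set" where
  "rdom f W = {x \<in> W. \<forall>(p, q) \<in> set f. q x \<noteq> 0}"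

definition reval :: "'a::field ratmap \<Rightarrow> 'a list \<Rightarrow> 'a list" where
  "reval f x = map (\<lambda>(p, q). p x / q x) f"

definition rational_map ::
    "'a::field set \<Rightarrow> nat \<Rightarrow> 'a list set \<Rightarrow> nat \<Rightarrow> 'a list set \<Rightarrow> 'a ratmap \<Rightarrow> bool" where
  "rational_map F n W m Y f \<longleftrightarrow> length f = m \<and>
     (\<forall>(p, q) \<in> set f. p \<in> polys F n \<and> q \<in> polys F n \<and> (\<exists>x\<in>W. q x \<noteq> 0)) \<and>
     reval f ` rdom f W \<subseteq> Y"

definition dominant_map ::
    "'a::field set \<Rightarrow> nat \<Rightarrow> 'a list set \<Rightarrow> nat \<Rightarrow> 'a list set \<Rightarrow> 'a ratmap \<Rightarrow> bool" where
  "dominant_map F n W m Y f \<longleftrightarrow> rational_map F n W m Y f \<and>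
     (\<forall>A. zclosed F m A \<longrightarrow> reval f ` rdom f W \<subseteq> A \<longrightarrow> Y \<subseteq> A)"

definition birational ::
    "'a::field set \<Rightarrow> nat \<Rightarrow> 'a list set \<Rightarrow> nat \<Rightarrow> 'a list set \<Rightarrow> bool" where
  "birational F n W m Y \<longleftrightarrow>
     (\<exists>f g. dominant_map F n W m Y f \<and> dominant_map F m Y n W g \<and>
        (\<forall>x \<in> rdom f W. reval f x \<in> rdom g Y \<longrightarrow> reval g (reval f x) = x) \<and>
        (\<forall>y \<in> rdom g Y. reval g y \<in> rdom f W \<longrightarrow> reval f (reval g y) = y))"

definition rational_over :: "'a::field set \<Rightarrow> nat \<Rightarrow> 'a list set \<Rightarrow> bool" where
  "rational_over F n W \<longleftrightarrow> (\<exists>d. birational F n W d (affine_space d))"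

definition geom_irreducible :: "'a::field set \<Rightarrow> nat \<Rightarrow> 'a list set \<Rightarrow> bool" where
  "geom_irreducible F n W \<longleftrightarrow> irreducible_over (algebraic_closure_of F) n W"

definition geom_rational :: "'a::field set \<Rightarrow> nat \<Rightarrow> 'a list set \<Rightarrow> bool" where
  "geom_rational F n W \<longleftrightarrow> rational_over (algebraic_closure_of F) n W"

text \<open>On Zariski closed sets, morphisms over \<open>F\<close> are given by polynomials with coefficients in \<open>F\<close>.\<close>

definition morphism ::
    "'a::field set \<Rightarrow> nat \<Rightarrow> 'a list set \<Rightarrow> nat \<Rightarrow> 'a list set \<Rightarrow> ('a list \<Rightarrow> 'a list) \<Rightarrow> bool" where
  "morphism F n W m Y f \<longleftrightarrow>
     (\<exists>ps. length ps = m \<and> set ps \<subseteq> polys F n \<and> (\<forall>x\<in>W. f x = map (\<lambda>p. p x) ps)) \<and> f ` W \<subseteq> Y"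

definition isomorphism ::
    "'a::field set \<Rightarrow> nat \<Rightarrow> 'a list set \<Rightarrow> nat \<Rightarrow> 'a list set \<Rightarrow> ('a list \<Rightarrow> 'a list) \<Rightarrow> bool" where
  "isomorphism F n W m Y f \<longleftrightarrow> morphism F n W m Y f \<and>
     (\<exists>g. morphism F m Y n W g \<and> (\<forall>x\<in>W. g (f x) = x) \<and> (\<forall>y\<in>Y. f (g y) = y))"

text \<open>The product of subsets of affine \<open>m\<close>- and \<open>n\<close>-space, inside affine \<open>(m + n)\<close>-space.\<close>

definition fprod :: "'a list set \<Rightarrow> 'a list set \<Rightarrow> 'a list set" where
  "fprod W Y = {x @ y |x y. x \<in> W \<and> y \<in> Y}"

definition algebraic_group :: "'a::field set \<Rightarrow> nat \<Rightarrow> 'a list monoid \<Rightarrow> bool" where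
  "algebraic_group F m T \<longleftrightarrow> zclosed F m (carrier T) \<and> group T \<and>
     set \<one>\<^bsub>T\<^esub> \<subseteq> F \<and>
     morphism F (m + m) (fprod (carrier T) (carrier T)) m (carrier T)
       (\<lambda>w. take m w \<otimes>\<^bsub>T\<^esub> drop m w) \<and>
     morphism F m (carrier T) m (carrier T) (\<lambda>t. inv\<^bsub>T\<^esub> t)"

text \<open>
  The \<open>d\<close>-th power of the multiplicative group, embedded in affine \<open>2d\<close>-space by
  \<open>(x\<^sub>1, \<dots>, x\<^sub>d) \<mapsto> (x\<^sub>1, \<dots>, x\<^sub>d, 1/x\<^sub>1, \<dots>, 1/x\<^sub>d)\<close>.
\<close>

definition Gm_power :: "nat \<Rightarrow> 'a::field list monoid" where
  "Gm_power d =
     \<lparr>carrier = {x. length x = 2 * d \<and> (\<forall>i<d. x ! i * x ! (d + i) = 1)},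
      monoid.mult = (\<lambda>x y. map2 (*) x y),
      monoid.one = replicate (2 * d) 1\<rparr>"

definition torus :: "'a::field set \<Rightarrow> nat \<Rightarrow> 'a list monoid \<Rightarrow> bool" where
  "torus F m T \<longleftrightarrow> algebraic_group F m T \<and>
     (\<exists>d. \<exists>f \<in> hom T (Gm_power d).
        isomorphism (algebraic_closure_of F) m (carrier T) (2 * d) (carrier (Gm_power d)) f)"

text \<open>
  A torsor \<open>Y\<close> under \<open>T\<close>: a nonempty variety with an action such that
  \<open>T \<times> Y \<rightarrow> Y \<times> Y, (t, y) \<mapsto> (t y, y)\<close> is an isomorphism. Torsors under affine algebraic groups
  over a field are affine.
\<close>

definition torsor ::
    "'a::field set \<Rightarrow> nat \<Rightarrow> 'a list monoid \<Rightarrow> nat \<Rightarrow> 'a list set \<Rightarrow>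
     ('a list \<Rightarrow> 'a list \<Rightarrow> 'a list) \<Rightarrow> bool" where
  "torsor F m T l Y act \<longleftrightarrow> zclosed F l Y \<and> Y \<noteq> {} \<and>
     (\<forall>y\<in>Y. act \<one>\<^bsub>T\<^esub> y = y) \<and>
     (\<forall>s\<in>carrier T. \<forall>t\<in>carrier T. \<forall>y\<in>Y. act (s \<otimes>\<^bsub>T\<^esub> t) y = act s (act t y)) \<and>
     morphism F (m + l) (fprod (carrier T) Y) l Y (\<lambda>w. act (take m w) (drop m w)) \<and>
     isomorphism F (m + l) (fprod (carrier T) Y) (l + l) (fprod Y Y)
       (\<lambda>w. act (take m w) (drop m w) @ drop m w)"

definition birational_to_torus_torsor :: "'a::field set \<Rightarrow> nat \<Rightarrow> 'a list set \<Rightarrow> bool" where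
  "birational_to_torus_torsor F n Z \<longleftrightarrow>
     (\<exists>m T l Y act. torus F m T \<and> torsor F m T l Y act \<and> birational F n Z l Y)"

text \<open>
  Let \<open>\<pi>\<close> be a dominant rational map from \<open>W\<close> to \<open>Y\<close> over \<open>k\<close> and \<open>y\<close> a generic point of \<open>Y\<close> over
  \<open>k\<close>. Evaluation at \<open>y\<close> identifies the function field of \<open>Y\<close> with \<open>k(y)\<close>, and the generic fibre of
  \<open>\<pi>\<close> is the fibre over \<open>y\<close>, a variety over \<open>k(y)\<close>. Any two generic points of \<open>Y\<close> are conjugate under
  the automorphisms of the universal domain over \<open>k\<close>, so the choice of \<open>y\<close> is irrelevant below.
\<close>

definition fibre :: "'a::field ratmap \<Rightarrow> 'a list set \<Rightarrow> 'a list \<Rightarrow> 'a list set" where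
  "fibre f W y = {x \<in> rdom f W. reval f x = y}"

definition toric_rational_tower :: "'a::field set \<Rightarrow> nat \<Rightarrow> 'a list set \<Rightarrow> bool" where
  "toric_rational_tower k n\<^sub>0 W\<^sub>0 \<longleftrightarrow>
     (\<exists>(N::nat) (d :: nat \<Rightarrow> nat) (W :: nat \<Rightarrow> 'a list set) (\<pi> :: nat \<Rightarrow> 'a ratmap).
        d 0 = n\<^sub>0 \<and> W 0 = W\<^sub>0 \<and>
        (\<forall>i\<le>N. variety k (d i) (W i)) \<and>
        rational_over k (d N) (W N) \<and>
        (\<forall>i\<in>{1..N}.
           dominant_map k (d i) (W i) (d (i - 1)) (W (i - 1)) (\<pi> i) \<and>
           (\<exists>y. generic_point k (d (i - 1)) (W (i - 1)) y \<and>
              (let K = field_adjoin k (set y); Z = fibre (\<pi> i) (W i) y in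
                 geom_rational K (d i) Z \<and> geom_irreducible K (d i) Z \<and>
                 birational_to_torus_torsor K (d i) Z))))"

definition linear_representation ::
    "('k::field \<Rightarrow> 'v::ab_group_add \<Rightarrow> 'v) \<Rightarrow> ('g, 'b) monoid_scheme \<Rightarrow> ('g \<Rightarrow> 'v \<Rightarrow> 'v) \<Rightarrow> bool" where
  "linear_representation scale G \<rho> \<longleftrightarrow>
     group_action G UNIV \<rho> \<and> (\<forall>g\<in>carrier G. Vector_Spaces.linear scale scale (\<rho> g))"

text \<open>The ring \<open>k[V]\<close> of polynomial functions on \<open>V\<close> (with \<open>k\<close> infinite).\<close>

inductive_set poly_functions :: "('k::field \<Rightarrow> 'v::ab_group_add \<Rightarrow> 'v) \<Rightarrow> ('v \<Rightarrow> 'k) set"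
  for scale :: "'k::field \<Rightarrow> 'v::ab_group_add \<Rightarrow> 'v" where
  const: "(\<lambda>_. c) \<in> poly_functions scale"
| linear: "Vector_Spaces.linear scale (*) l \<Longrightarrow> l \<in> poly_functions scale"
| add: "p \<in> poly_functions scale \<Longrightarrow> q \<in> poly_functions scale \<Longrightarrow>
    (\<lambda>v. p v + q v) \<in> poly_functions scale"
| mult: "p \<in> poly_functions scale \<Longrightarrow> q \<in> poly_functions scale \<Longrightarrow>
    (\<lambda>v. p v * q v) \<in> poly_functions scale"

text \<open>
  A generic point of \<open>V\<close> over \<open>k\<close> is an injective homomorphism \<open>\<phi>\<close> of \<open>k\<close>-algebras from \<open>k[V]\<close> to the
  universal domain. It identifies \<open>k(V)\<close> with the field of all \<open>\<phi> p / \<phi> q\<close>.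
\<close>

definition generic_embedding ::
    "('k::field \<Rightarrow> 'v::ab_group_add \<Rightarrow> 'v) \<Rightarrow> (('v \<Rightarrow> 'k) \<Rightarrow> 'k udom) \<Rightarrow> bool" where
  "generic_embedding scale \<phi> \<longleftrightarrow>
     (\<forall>c. \<phi> (\<lambda>_. c) = udom_of c) \<and>
     (\<forall>p\<in>poly_functions scale. \<forall>q\<in>poly_functions scale.
        \<phi> (\<lambda>v. p v + q v) = \<phi> p + \<phi> q \<and> \<phi> (\<lambda>v. p v * q v) = \<phi> p * \<phi> q) \<and>
     inj_on \<phi> (poly_functions scale)"

text \<open>
  The field of invariants \<open>k(V)\<^sup>G\<close> inside the universal domain: \<open>p / q\<close> is invariant under \<open>g\<close> iff
  \<open>(p \<circ> g) / (q \<circ> g) = p / q\<close>, which is stated without denominators.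
\<close>

definition invariant_field ::
    "('k::field \<Rightarrow> 'v::ab_group_add \<Rightarrow> 'v) \<Rightarrow> ('g, 'b) monoid_scheme \<Rightarrow> ('g \<Rightarrow> 'v \<Rightarrow> 'v) \<Rightarrow>
     (('v \<Rightarrow> 'k) \<Rightarrow> 'k udom) \<Rightarrow> 'k udom set" where
  "invariant_field scale G \<rho> \<phi> =
     {\<phi> p / \<phi> q |p q. p \<in> poly_functions scale \<and> q \<in> poly_functions scale \<and> q \<noteq> (\<lambda>_. 0) \<and>
        (\<forall>g\<in>carrier G. \<forall>v. p (\<rho> g v) * q v = p v * q (\<rho> g v))}"

text \<open>
  The quotient \<open>V/G\<close> up to birational equivalence: a variety over \<open>k\<close> whose function field is
  \<open>k(V)\<^sup>G\<close>, that is, which has a generic point \<open>x\<close> with \<open>k(x) = k(V)\<^sup>G\<close>.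
\<close>

definition quotient_model ::
    "('k::field \<Rightarrow> 'v::ab_group_add \<Rightarrow> 'v) \<Rightarrow> ('g, 'b) monoid_scheme \<Rightarrow> ('g \<Rightarrow> 'v \<Rightarrow> 'v) \<Rightarrow>
     nat \<Rightarrow> 'k udom list set \<Rightarrow> bool" where
  "quotient_model scale G \<rho> n W \<longleftrightarrow> variety ground n W \<and>
     (\<exists>\<phi> x. generic_embedding scale \<phi> \<and> generic_point ground n W x \<and>
        field_adjoin ground (set x) = invariant_field scale G \<rho> \<phi>)"

end

theory Submission
  imports Defs "Jordan_Normal_Form.Determinant"
begin

text \<open>
  Up to birational equivalence, \<open>V/G\<close> is the field \<open>k(V)\<^sup>G\<close>. By the no-name lemma, which is Hilbert 90
  for the general linear group, the invariants of the sum of a faithful representation \<open>V\<close> and any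
  representation \<open>V'\<close> are purely transcendental over those of \<open>V\<close>. So it suffices to find a tower for the
  invariants of one faithful representation of \<open>G\<close>, after adding independent variables.

  This representation is built along the filtration. Let \<open>B\<close> be a split extension of \<open>Q\<close> by an abelian
  group \<open>A\<close>, and let \<open>x\<close> be coordinates of a faithful representation of \<open>Q\<close> as wanted. Take new
  variables \<open>w\<close>, one for each of a family of characters that separates the points of \<open>A\<close> and is stable
  under \<open>Q\<close>; then \<open>A\<close> acts on \<open>w\<close> through the characters and \<open>Q\<close> permutes \<open>w\<close>. Put \<open>E = k(x,w)\<^sup>A\<close> and
  \<open>K = k(x,w)\<^sup>B = E\<^sup>Q\<close>. The monomials in \<open>w\<close> that are invariant under \<open>A\<close> form a lattice of relations,
  which is saturated in the lattice with one further coordinate for each element of \<open>A\<close>. It cuts out a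
  torus that \<open>Q\<close> twists to a torus over \<open>K\<close>, and prescribing the values of these monomials as those at
  \<open>w\<close> gives a torsor over \<open>K\<close>. The coordinates \<open>z\<close> of a generic point of this torsor are independent over
  \<open>k(x)\<close> and are permuted by \<open>Q\<close>, and its function field is \<open>k(x,z)\<^sup>Q\<close>. By the no-name lemma this is
  purely transcendental over \<open>k(x)\<^sup>Q\<close>, so the tower for \<open>Q\<close> continues the one for \<open>B\<close>.
\<close>

section \<open>Subfields and polynomial functions\<close>

text \<open>The invariant monomials alone have finite index in the lattice of all monomials in
  \<open>w\<close>, so prescribing their values would leave only finitely many points. A further
  coordinate for each kernel element absorbs the division by the order of the kernel. The relations
  then form the kernel of an integer matrix, hence a saturated lattice, and their solutions form a
  coset of a torus instead of a finite group. The section of the extension enters here: through it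
  the quotient permutes \<open>w\<close> without roots of unity, so that it also permutes the values
  of the relations and the coordinates of the coset. As linear forms these coordinates have
  coefficients only in the Galois extension fixed by the kernel; an equivariant matrix, the one that
  proves Hilbert 90, replaces them by coordinates in which torsor and group law are defined over the
  field of invariants. The construction works throughout with fields generated by points of the
  universal domain. Varieties reappear in one place, where a tower of function fields is realized by
  loci of generic points and coordinate projections.\<close>

instance fract :: ("{idom,ring_char_0}") field_char_0
proof
  show "inj (of_nat :: nat \<Rightarrow> 'a fract)"
    by (rule injI) (simp only: of_nat_fract eq_fract zero_neq_one[symmetric] not_False_eq_True mult_1_right of_nat_eq_iff)
qed

lemma subfield_zero: "is_subfield F \<Longrightarrow> 0 \<in> F"
  and subfield_one: "is_subfield F \<Longrightarrow> 1 \<in> F"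
  and subfield_add: "is_subfield F \<Longrightarrow> x \<in> F \<Longrightarrow> y \<in> F \<Longrightarrow> x + y \<in> F"
  and subfield_mult: "is_subfield F \<Longrightarrow> x \<in> F \<Longrightarrow> y \<in> F \<Longrightarrow> x * y \<in> F"
  and subfield_minus: "is_subfield F \<Longrightarrow> x \<in> F \<Longrightarrow> - x \<in> F"
  and subfield_inverse: "is_subfield F \<Longrightarrow> x \<in> F \<Longrightarrow> inverse x \<in> F"
  by (auto simp: is_subfield_def)

lemma subfield_diff: "is_subfield F \<Longrightarrow> x \<in> F \<Longrightarrow> y \<in> F \<Longrightarrow> x - y \<in> F"
  using subfield_add[of F x "- y"] subfield_minus by auto

lemma subfield_divide: "is_subfield F \<Longrightarrow> x \<in> F \<Longrightarrow> y \<in> F \<Longrightarrow> x / y \<in> F"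
  by (simp add: divide_inverse subfield_mult subfield_inverse)

lemma subfield_power: "is_subfield F \<Longrightarrow> x \<in> F \<Longrightarrow> x ^ n \<in> F"
  by (induction n) (auto simp: subfield_one subfield_mult)

lemma subfield_powi: "is_subfield F \<Longrightarrow> x \<in> F \<Longrightarrow> x powi n \<in> F"
  by (auto simp: power_int_def subfield_power subfield_inverse)

lemma subfield_sum: "is_subfield F \<Longrightarrow> (\<And>i. i \<in> A \<Longrightarrow> f i \<in> F) \<Longrightarrow> sum f A \<in> F"
  by (induction A rule: infinite_finite_induct) (auto simp: subfield_zero subfield_add)

lemma subfield_prod: "is_subfield F \<Longrightarrow> (\<And>i. i \<in> A \<Longrightarrow> f i \<in> F) \<Longrightarrow> prod f A \<in> F"
  by (induction A rule: infinite_finite_induct) (auto simp: subfield_one subfield_mult)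

lemma subfield_of_nat: "is_subfield F \<Longrightarrow> of_nat n \<in> F"
  by (induction n) (auto simp: subfield_zero subfield_one subfield_add)

lemmas subfield_intros = subfield_zero subfield_one subfield_add subfield_mult subfield_minus
  subfield_inverse subfield_diff subfield_divide subfield_power subfield_powi subfield_sum
  subfield_prod subfield_of_nat

lemma subfield_Inter: "(\<And>T. T \<in> S \<Longrightarrow> is_subfield T) \<Longrightarrow> is_subfield (\<Inter> S)"
  by (simp add: is_subfield_def)

lemma field_adjoin_subfield: "is_subfield (field_adjoin F S)"
  unfolding field_adjoin_def by (rule hull_in, rule subfield_Inter, auto)

lemma field_adjoin_base: "F \<subseteq> field_adjoin F S"
  and field_adjoin_gens: "S \<subseteq> field_adjoin F S"
  using hull_subset[of "F \<union> S" is_subfield] by (auto simp: field_adjoin_def)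

lemma field_adjoin_least: "is_subfield K \<Longrightarrow> F \<subseteq> K \<Longrightarrow> S \<subseteq> K \<Longrightarrow> field_adjoin F S \<subseteq> K"
  unfolding field_adjoin_def by (rule hull_minimal) auto

lemma field_adjoin_adjoin: "field_adjoin (field_adjoin F S) T = field_adjoin F (S \<union> T)"
proof (rule equalityI)
  show "field_adjoin (field_adjoin F S) T \<subseteq> field_adjoin F (S \<union> T)"
    using field_adjoin_base[of F "S \<union> T"] field_adjoin_gens[of "S \<union> T" F]
    by (intro field_adjoin_least field_adjoin_subfield) auto
  show "field_adjoin F (S \<union> T) \<subseteq> field_adjoin (field_adjoin F S) T"
    using field_adjoin_base[of F S] field_adjoin_base[of "field_adjoin F S" T]
      field_adjoin_gens[of S F] field_adjoin_gens[of T "field_adjoin F S"]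
    by (intro field_adjoin_least field_adjoin_subfield) auto
qed

lemma udom_of_hom:
  fixes a b :: "'k :: field"
  shows "udom_of (0 :: 'k) = 0" "udom_of (1 :: 'k) = 1" "udom_of (a + b) = udom_of a + udom_of b"
  "udom_of (a * b) = udom_of a * udom_of b" "udom_of (- a) = - udom_of a"
  "udom_of (inverse a) = inverse (udom_of a)"
proof -
  show 0: "udom_of (0 :: 'k) = 0" by (simp add: udom_of_def)
  show 1: "udom_of (1 :: 'k) = 1" by (simp add: udom_of_def)
  have add: "udom_of (a + b) = udom_of a + udom_of b" for a b :: 'k
    by (simp add: udom_of_def single_add)
  have m: "udom_of (a * b) = udom_of a * udom_of b" for a b :: 'k
    by (simp add: udom_of_def mult_single[symmetric, of 0 0, simplified])
  show "udom_of (a + b) = udom_of a + udom_of b" "udom_of (a * b) = udom_of a * udom_of b"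
    by (rule add m)+
  show "udom_of (- a) = - udom_of a"
    using add[of a "- a"] 0 by (simp add: add_eq_0_iff)
  show "udom_of (inverse a) = inverse (udom_of a)"
  proof (cases "a = 0")
    case False
    then show ?thesis using m[of a "inverse a"] 1
      by (metis inverse_unique right_inverse)
  qed (simp add: 0)
qed

lemma udom_of_eq_iff [simp]: "udom_of a = udom_of b \<longleftrightarrow> a = b"
proof
  assume "udom_of a = udom_of b"
  then have "Poly_Mapping.single (0 :: nat \<Rightarrow>\<^sub>0 nat) a = Poly_Mapping.single 0 b"
    by (simp add: udom_of_def)
  then show "a = b" by (metis lookup_single_eq)
qed simp

lemma ground_subfield: "is_subfield ground"
  unfolding is_subfield_def ground_def
  by (auto simp flip: udom_of_hom)

section \<open>Polynomial functions with coefficients in a subfield\<close>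

lemma polys_mono: "p \<in> polys F n \<Longrightarrow> F \<subseteq> F' \<Longrightarrow> n \<le> n' \<Longrightarrow> p \<in> polys F' n'"
  by (induction rule: polys.induct) (auto intro: polys.intros)

lemma polys_append: "p \<in> polys F n \<Longrightarrow> length x = n \<Longrightarrow> p (x @ y) = p x"
  by (induction rule: polys.induct) (auto simp: nth_append)

lemma polys_take: "p \<in> polys F n \<Longrightarrow> p (take n x) = p x"
  by (induction rule: polys.induct) auto

lemma polys_minus: "- 1 \<in> F \<Longrightarrow> p \<in> polys F n \<Longrightarrow> (\<lambda>x. - p x) \<in> polys F n"
  using polys.mult[OF polys.const[of "- 1"]] by fastforce

lemma polys_diff: "- 1 \<in> F \<Longrightarrow> p \<in> polys F n \<Longrightarrow> q \<in> polys F n \<Longrightarrow> (\<lambda>x. p x - q x) \<in> polys F n"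
  using polys.add[OF _ polys_minus, of p F n q] by simp

lemma polys_sum: "0 \<in> F \<Longrightarrow> (\<And>i. i \<in> A \<Longrightarrow> f i \<in> polys F n) \<Longrightarrow> (\<lambda>x. \<Sum>i\<in>A. f i x) \<in> polys F n"
  by (induction A rule: infinite_finite_induct) (auto intro: polys.intros)

lemma polys_prod: "1 \<in> F \<Longrightarrow> (\<And>i. i \<in> A \<Longrightarrow> f i \<in> polys F n) \<Longrightarrow> (\<lambda>x. \<Prod>i\<in>A. f i x) \<in> polys F n"
  by (induction A rule: infinite_finite_induct) (auto intro: polys.intros)

lemma polys_power: "1 \<in> F \<Longrightarrow> p \<in> polys F n \<Longrightarrow> (\<lambda>x. p x ^ k) \<in> polys F n"
  by (induction k) (auto intro: polys.intros)

lemma polys_compose: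
  "p \<in> polys F n \<Longrightarrow> (\<And>i. i < n \<Longrightarrow> q i \<in> polys F m) \<Longrightarrow> (\<lambda>x. p (map (\<lambda>i. q i x) [0..<n])) \<in> polys F m"
  by (induction rule: polys.induct) (auto intro: polys.intros)

lemma polys_eval_in:
  "p \<in> polys F n \<Longrightarrow> is_subfield E \<Longrightarrow> F \<subseteq> E \<Longrightarrow> (\<And>i. i < n \<Longrightarrow> x ! i \<in> E) \<Longrightarrow> p x \<in> E"
  by (induction rule: polys.induct) (auto intro: subfield_intros)

text \<open>A large enough power of the common denominator \<open>b\<close> makes a polynomial in
  fractions polynomial again. The exponent does not depend on the point, so vanishing can be
  transported between \<open>p\<close> and \<open>Q\<close> wherever \<open>b\<close> is
  nonzero.\<close>

lemma polys_clear:
  assumes "p \<in> polys F n" "\<And>i. i < n \<Longrightarrow> a i \<in> polys F m" "b \<in> polys F m" "1 \<in> F"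
  shows "\<exists>Q \<in> polys F m. \<exists>N. \<forall>x. b x \<noteq> 0 \<longrightarrow> p (map (\<lambda>i. a i x / b x) [0..<n]) * b x ^ N = Q x"
  using assms(1)
proof induction
  case (const c)
  then show ?case by (intro bexI[of _ "\<lambda>_. c"] exI[of _ 0]) (auto intro: polys.intros)
next
  case (coord i)
  then show ?case using assms by (intro bexI[of _ "a i"] exI[of _ 1]) auto
next
  case (add p q)
  then obtain P M Q N where *: "P \<in> polys F m" "Q \<in> polys F m"
    "\<And>x. b x \<noteq> 0 \<Longrightarrow> p (map (\<lambda>i. a i x / b x) [0..<n]) * b x ^ M = P x"
    "\<And>x. b x \<noteq> 0 \<Longrightarrow> q (map (\<lambda>i. a i x / b x) [0..<n]) * b x ^ N = Q x" by metis
  show ?case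
    by (intro bexI[of _ "\<lambda>x. P x * b x ^ N + Q x * b x ^ M"] exI[of _ "M + N"])
      (auto intro!: polys.intros polys_power assms * simp: *(3,4)[symmetric] algebra_simps power_add)
next
  case (mult p q)
  then obtain P M Q N where *: "P \<in> polys F m" "Q \<in> polys F m"
    "\<And>x. b x \<noteq> 0 \<Longrightarrow> p (map (\<lambda>i. a i x / b x) [0..<n]) * b x ^ M = P x"
    "\<And>x. b x \<noteq> 0 \<Longrightarrow> q (map (\<lambda>i. a i x / b x) [0..<n]) * b x ^ N = Q x" by metis
  show ?case
    by (intro bexI[of _ "\<lambda>x. P x * Q x"] exI[of _ "M + N"])
      (auto intro!: polys.intros * simp: *(3,4)[symmetric] algebra_simps power_add)
qed

text \<open>Along a line a polynomial function is a polynomial in one variable, so questions of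
  nonvanishing reduce to the finiteness of its roots.\<close>

lemma polys_line:
  assumes "p \<in> polys F n"
  shows "\<exists>P. \<forall>tt. p (map (\<lambda>i. u i + tt * v i) [0..<n]) = poly P tt"
  using assms
proof induction
  case (const c)
  then show ?case by (intro exI[of _ "[:c:]"]) auto
next
  case (coord i)
  then show ?case by (intro exI[of _ "[:u i, v i:]"]) auto
next
  case (add p q)
  then obtain P Q where "\<And>tt. p (map (\<lambda>i. u i + tt * v i) [0..<n]) = poly P tt"
    "\<And>tt. q (map (\<lambda>i. u i + tt * v i) [0..<n]) = poly Q tt" by metis
  then show ?case by (intro exI[of _ "P + Q"]) auto
next
  case (mult p q)
  then obtain P Q where "\<And>tt. p (map (\<lambda>i. u i + tt * v i) [0..<n]) = poly P tt"
    "\<And>tt. q (map (\<lambda>i. u i + tt * v i) [0..<n]) = poly Q tt" by metis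
  then show ?case by (intro exI[of _ "P * Q"]) auto
qed

lemma infinite_Nats: "infinite (range (of_nat :: nat \<Rightarrow> 'a :: field_char_0))"
  by (rule range_inj_infinite, rule injI) (rule of_nat_eq_iff[THEN iffD1])

lemma poly_nonroot_nat: "(P :: 'a :: field_char_0 poly) \<noteq> 0 \<Longrightarrow> \<exists>m :: nat. poly P (of_nat m) \<noteq> 0"
proof (rule ccontr)
  assume "P \<noteq> 0" "\<not> ?thesis"
  then have "range of_nat \<subseteq> {x. poly P x = 0}" by auto
  then show False using poly_roots_finite[OF \<open>P \<noteq> 0\<close>] infinite_Nats finite_subset by metis
qed

text \<open>This is the irreducibility of affine space: on the line from \<open>u\<close> to
  \<open>v\<close> both functions become nonzero polynomials in one variable, and so does their
  product.\<close>

lemma polys_common_nonzero: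
  fixes u v :: "'a :: field_char_0 list"
  assumes p: "p \<in> polys F n" and q: "q \<in> polys F n" and u: "u \<in> affine_space n" "p u \<noteq> 0"
    and v: "v \<in> affine_space n" "q v \<noteq> 0"
  shows "\<exists>w \<in> affine_space n. p w \<noteq> 0 \<and> q w \<noteq> 0"
proof -
  let ?w = "\<lambda>tt. map (\<lambda>i. u ! i + tt * (v ! i - u ! i)) [0..<n]"
  obtain P where P: "\<And>tt. p (?w tt) = poly P tt" using polys_line[OF p] by meson
  obtain Q where Q: "\<And>tt. q (?w tt) = poly Q tt" using polys_line[OF q] by meson
  have "?w 0 = u" "?w 1 = v" using u v by (auto simp: affine_space_def intro: nth_equalityI)
  then have "poly P 0 \<noteq> 0" "poly Q 1 \<noteq> 0" using u v P[of 0] Q[of 1] by auto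
  then have "P * Q \<noteq> 0" by auto
  from poly_nonroot_nat[OF this] obtain m :: nat where "poly (P * Q) (of_nat m) \<noteq> 0" by auto
  then have "p (?w (of_nat m)) \<noteq> 0" "q (?w (of_nat m)) \<noteq> 0" by (simp_all add: P Q)
  then show ?thesis by (intro bexI[of _ "?w (of_nat m)"]) (auto simp: affine_space_def)
qed

text \<open>The coordinates of a nonzero are replaced one at a time. Natural numbers are wanted
  because they lie in every subfield and are fixed by every field homomorphism.\<close>

lemma polys_nonzero_nat:
  fixes u :: "'a :: field_char_0 list"
  assumes p: "p \<in> polys F n" and u: "u \<in> affine_space n" "p u \<noteq> 0"
  shows "\<exists>w :: nat list. length w = n \<and> p (map of_nat w) \<noteq> 0"
proof -
  have "\<exists>w. length w = n \<and> (\<forall>i<k. w ! i \<in> range of_nat) \<and> p w \<noteq> 0" if "k \<le> n" for k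
    using that
  proof (induction k)
    case 0
    then show ?case using u by (auto simp: affine_space_def)
  next
    case (Suc k)
    then obtain w where w: "length w = n" "\<forall>i<k. w ! i \<in> range of_nat" "p w \<noteq> 0" by auto
    let ?w = "\<lambda>tt. map (\<lambda>i. (if i = k then 0 else w ! i) + tt * (if i = k then 1 else 0)) [0..<n]"
    obtain P where P: "\<And>tt. p (?w tt) = poly P tt" using polys_line[OF p] by meson
    have "?w (w ! k) = w" using w Suc by (auto intro!: nth_equalityI)
    then have "P \<noteq> 0" using P[of "w ! k"] w by auto
    from poly_nonroot_nat[OF this] obtain m :: nat where m: "poly P (of_nat m) \<noteq> 0" by auto
    have "\<forall>i<Suc k. ?w (of_nat m) ! i \<in> range of_nat"
      using w Suc by (auto simp: less_Suc_eq)
    then show ?case using m P[of "of_nat m"] by (intro exI[of _ "?w (of_nat m)"]) auto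
  qed
  from this[of n] obtain w where w: "length w = n" "\<forall>i<n. w ! i \<in> range of_nat" "p w \<noteq> 0" by auto
  then have "\<forall>i. \<exists>m :: nat. i < n \<longrightarrow> w ! i = of_nat m" by auto
  then obtain f where f: "\<And>i. i < n \<Longrightarrow> w ! i = of_nat (f i :: nat)" by metis
  have "map of_nat (map f [0..<n]) = w" using f w by (auto intro: nth_equalityI)
  then show ?thesis using w by (intro exI[of _ "map f [0..<n]"]) auto
qed

section \<open>Generic points of affine space\<close>

text \<open>Algebraic independence over \<open>F\<close>. As polynomials are functions here, being
  the zero polynomial is expressed by vanishing everywhere; in other words, \<open>x\<close> is a
  generic point of affine space.\<close>

definition indep :: "'a :: field set \<Rightarrow> 'a list \<Rightarrow> bool" where
  "indep F x \<longleftrightarrow> (\<forall>p \<in> polys F (length x). p x = 0 \<longrightarrow> (\<forall>v \<in> affine_space (length x). p v = 0))"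

lemma indepD: "indep F x \<Longrightarrow> p \<in> polys F n \<Longrightarrow> n = length x \<Longrightarrow> p x = 0 \<Longrightarrow> length v = n \<Longrightarrow> p v = 0"
  by (auto simp: indep_def affine_space_def)

lemma indep_mono: "indep F x \<Longrightarrow> F' \<subseteq> F \<Longrightarrow> indep F' x"
  by (simp add: indep_def polys_mono[of _ F' _ F])

text \<open>The two points have the same vanishing ideal over \<open>F\<close>, which is what an
  isomorphism between the fields they generate requires.\<close>

definition eqv :: "'a :: field set \<Rightarrow> 'a list \<Rightarrow> 'a list \<Rightarrow> bool" where
  "eqv F z z' \<longleftrightarrow> length z' = length z \<and> (\<forall>p \<in> polys F (length z). p z = 0 \<longleftrightarrow> p z' = 0)"

lemma indep_eqv: "indep F z \<Longrightarrow> indep F z' \<Longrightarrow> length z = length z' \<Longrightarrow> eqv F z z'"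
  unfolding eqv_def by (auto intro: indepD[of F z _ _ z'] indepD[of F z' _ _ z])

definition fracs :: "'a :: field set \<Rightarrow> 'a list \<Rightarrow> 'a set" where
  "fracs F z = field_adjoin F (set z)"

lemma fracs_subfield: "is_subfield (fracs F z)"
  and fracs_base: "F \<subseteq> fracs F z" and fracs_gens: "set z \<subseteq> fracs F z"
  by (simp_all add: fracs_def field_adjoin_subfield field_adjoin_base field_adjoin_gens)

lemma fracs_least: "is_subfield K \<Longrightarrow> F \<subseteq> K \<Longrightarrow> set z \<subseteq> K \<Longrightarrow> fracs F z \<subseteq> K"
  by (simp add: fracs_def field_adjoin_least)

lemma polys_in_fracs: "p \<in> polys F (length z) \<Longrightarrow> p z \<in> fracs F z"
  by (rule polys_eval_in[OF _ fracs_subfield fracs_base]) (use fracs_gens[of z F] in auto)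

lemma fracs_append: "fracs (fracs F x) y = fracs F (x @ y)"
  by (simp add: fracs_def field_adjoin_adjoin)

lemma fracs_eq:
  assumes F: "is_subfield F"
  shows "fracs F z = {p z / q z |p q. p \<in> polys F (length z) \<and> q \<in> polys F (length z) \<and> q z \<noteq> 0}"
    (is "_ = ?R")
proof (rule equalityI)
  show "?R \<subseteq> fracs F z"
    using polys_in_fracs[of _ F z] by (auto intro!: subfield_divide fracs_subfield)
  have m1: "- 1 \<in> F" "1 \<in> F" "0 \<in> F" using F by (auto intro: subfield_intros)
  have c: "c \<in> F \<Longrightarrow> c \<in> ?R" for c
    using m1 by (intro CollectI exI[of _ "\<lambda>_. c"] exI[of _ "\<lambda>_. 1"]) (auto intro: polys.intros)
  have "is_subfield ?R"
    unfolding is_subfield_def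
  proof (intro conjI ballI)
    show "0 \<in> ?R" "1 \<in> ?R" using c m1 by blast+
    fix x y assume "x \<in> ?R" "y \<in> ?R"
    then obtain p q p' q' where *: "x = p z / q z" "y = p' z / q' z" "q z \<noteq> 0" "q' z \<noteq> 0"
      "p \<in> polys F (length z)" "q \<in> polys F (length z)"
      "p' \<in> polys F (length z)" "q' \<in> polys F (length z)" by auto
    show "x + y \<in> ?R"
      by (intro CollectI exI[of _ "\<lambda>v. p v * q' v + p' v * q v"] exI[of _ "\<lambda>v. q v * q' v"])
        (auto simp: * field_simps intro!: polys.intros *(5-8))
    show "x * y \<in> ?R"
      by (intro CollectI exI[of _ "\<lambda>v. p v * p' v"] exI[of _ "\<lambda>v. q v * q' v"])
        (auto simp: * field_simps intro!: polys.intros *(5-8))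
  next
    fix x assume "x \<in> ?R"
    then obtain p q where *: "x = p z / q z" "q z \<noteq> 0"
      "p \<in> polys F (length z)" "q \<in> polys F (length z)" by auto
    show "- x \<in> ?R"
      by (intro CollectI exI[of _ "\<lambda>v. - p v"] exI[of _ q])
        (auto simp: * intro!: polys_minus m1 *(3,4))
    show "inverse x \<in> ?R"
    proof (cases "p z = 0")
      case True
      then show ?thesis using c[OF m1(3)] * by simp
    next
      case False
      then show ?thesis using * by (intro CollectI exI[of _ q] exI[of _ p]) auto
    qed
  qed
  moreover have "set z \<subseteq> ?R"
  proof
    fix x assume "x \<in> set z"
    then obtain i where "i < length z" "x = z ! i" by (auto simp: in_set_conv_nth)
    then show "x \<in> ?R" using m1
      by (intro CollectI exI[of _ "\<lambda>v. v ! i"] exI[of _ "\<lambda>_. 1"]) (auto intro: polys.intros)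
  qed
  ultimately show "fracs F z \<subseteq> ?R" using c by (intro fracs_least) auto
qed

text \<open>A common denominator, so that a tuple of elements of \<open>F(z)\<close> becomes a
  rational map.\<close>

lemma fracs_common:
  assumes F: "is_subfield F" and e: "\<And>i. i < (n :: nat) \<Longrightarrow> e i \<in> fracs F z"
  shows "\<exists>a q. (\<forall>i<n. a i \<in> polys F (length z)) \<and> q \<in> polys F (length z) \<and> q z \<noteq> 0 \<and>
    (\<forall>i<n. e i = a i z / q z)"
  using e
proof (induction n)
  case 0
  show ?case using F by (intro exI[of _ "\<lambda>_ _. 1"] exI[of _ "\<lambda>_. 1"]) (auto intro: polys.intros subfield_intros)
next
  case (Suc n)
  then obtain a q where *: "\<forall>i<n. a i \<in> polys F (length z)" "q \<in> polys F (length z)" "q z \<noteq> 0"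
    "\<forall>i<n. e i = a i z / q z" by (metis less_SucI)
  obtain p' q' where **: "p' \<in> polys F (length z)" "q' \<in> polys F (length z)" "q' z \<noteq> 0"
    "e n = p' z / q' z" using Suc(2)[of n] unfolding fracs_eq[OF F] by auto
  show ?case
    by (intro exI[of _ "\<lambda>i v. if i < n then a i v * q' v else p' v * q v"] exI[of _ "\<lambda>v. q v * q' v"])
      (use * ** in \<open>auto intro!: polys.intros simp: less_Suc_eq\<close>)
qed

text \<open>Clearing the denominators of the coefficients trades a polynomial over
  \<open>F(a)\<close> for one over \<open>F\<close> in additional variables. As \<open>q\<close> is
  nonzero at \<open>a\<close>, the zeros over \<open>a\<close> are unchanged.\<close>

lemma fracs_polys_clear:
  assumes F: "is_subfield F" and p: "p \<in> polys (fracs F a) m" and n: "n = length a"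
  shows "\<exists>P \<in> polys F (n + m). \<exists>q \<in> polys F n. q a \<noteq> 0 \<and> (\<forall>v. length v = m \<longrightarrow> P (a @ v) = q a * p v)"
  using p
proof induction
  case (const c)
  then obtain p q where "p \<in> polys F n" "q \<in> polys F n" "q a \<noteq> 0" "c = p a / q a"
    unfolding fracs_eq[OF F] n by auto
  then show ?case using n by (intro bexI[of _ p] bexI[of _ q])
      (auto simp: polys_append intro: polys_mono)
next
  case (coord i)
  then show ?case using n F
    by (intro bexI[of _ "\<lambda>v. v ! (n + i)"] bexI[of _ "\<lambda>_. 1"])
      (auto simp: nth_append intro: polys.intros subfield_one)
next
  case (add p q)
  then obtain P r Q s where *: "P \<in> polys F (n + m)" "r \<in> polys F n" "r a \<noteq> 0"
      "\<And>v. length v = m \<Longrightarrow> P (a @ v) = r a * p v"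
    "Q \<in> polys F (n + m)" "s \<in> polys F n" "s a \<noteq> 0" "\<And>v. length v = m \<Longrightarrow> Q (a @ v) = s a * q v"
    by metis
  have rs: "r \<in> polys F (n + m)" "s \<in> polys F (n + m)" using * by (auto intro: polys_mono)
  show ?case
    by (intro bexI[of _ "\<lambda>v. P v * s v + Q v * r v"] bexI[of _ "\<lambda>v. r v * s v"])
      (use * n rs in \<open>auto intro!: polys.intros simp: polys_append algebra_simps\<close>)
next
  case (mult p q)
  then obtain P r Q s where *: "P \<in> polys F (n + m)" "r \<in> polys F n" "r a \<noteq> 0"
      "\<And>v. length v = m \<Longrightarrow> P (a @ v) = r a * p v"
    "Q \<in> polys F (n + m)" "s \<in> polys F n" "s a \<noteq> 0" "\<And>v. length v = m \<Longrightarrow> Q (a @ v) = s a * q v"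
    by metis
  show ?case
    by (intro bexI[of _ "\<lambda>v. P v * Q v"] bexI[of _ "\<lambda>v. r v * s v"])
      (use * n in \<open>auto intro!: polys.intros simp: polys_append algebra_simps\<close>)
qed

lemma polys_specialize_left_const:
  assumes "P \<in> polys F (n + m)" "length a = n" "set a \<subseteq> F"
  shows "\<exists>p \<in> polys F m. \<forall>v. length v = m \<longrightarrow> P (a @ v) = p v"
  using assms(1)
proof induction
  case (const c)
  then show ?case by (intro bexI[of _ "\<lambda>_. c"]) (auto intro: polys.intros)
next
  case (coord i)
  then show ?case
  proof (cases "i < n")
    case True
    then show ?thesis using assms(2,3)
      by (intro bexI[of _ "\<lambda>_. a ! i"]) (auto intro!: polys.intros simp: nth_append)
  next
    case False
    then show ?thesis using coord assms(2)
      by (intro bexI[of _ "\<lambda>v. v ! (i - n)"]) (auto intro!: polys.intros simp: nth_append)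
  qed
next
  case (add p q)
  then obtain p' q' where "p' \<in> polys F m" "q' \<in> polys F m"
    "\<forall>v. length v = m \<longrightarrow> p (a @ v) = p' v" "\<forall>v. length v = m \<longrightarrow> q (a @ v) = q' v" by metis
  then show ?case by (intro bexI[of _ "\<lambda>v. p' v + q' v"]) (auto intro: polys.intros)
next
  case (mult p q)
  then obtain p' q' where "p' \<in> polys F m" "q' \<in> polys F m"
    "\<forall>v. length v = m \<longrightarrow> p (a @ v) = p' v" "\<forall>v. length v = m \<longrightarrow> q (a @ v) = q' v" by metis
  then show ?case by (intro bexI[of _ "\<lambda>v. p' v * q' v"]) (auto intro: polys.intros)
qed

text \<open>Converse passage to \<open>fracs_polys_clear\<close>: equations over \<open>F\<close> in
  all variables restrict to equations over \<open>F(a)\<close> on the fibre over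
  \<open>a\<close>.\<close>

lemma polys_specialize_left:
  assumes "P \<in> polys F (n + m)" "length a = n"
  shows "\<exists>p \<in> polys (fracs F a) m. \<forall>v. length v = m \<longrightarrow> P (a @ v) = p v"
  by (rule polys_specialize_left_const[OF polys_mono[OF assms(1) fracs_base order_refl] assms(2) fracs_gens])

lemma polys_specialize_right:
  assumes "P \<in> polys F (n + m)" "length v = m" "set v \<subseteq> F"
  shows "\<exists>p \<in> polys F n. \<forall>a. length a = n \<longrightarrow> P (a @ v) = p a"
  using assms(1)
proof induction
  case (const c)
  then show ?case by (intro bexI[of _ "\<lambda>_. c"]) (auto intro: polys.intros)
next
  case (coord i)
  then show ?case
  proof (cases "i < n")
    case True
    then show ?thesis by (intro bexI[of _ "\<lambda>a. a ! i"]) (auto intro!: polys.intros simp: nth_append)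
  next
    case False
    then show ?thesis using coord assms(2,3)
      by (intro bexI[of _ "\<lambda>_. v ! (i - n)"]) (auto intro!: polys.intros simp: nth_append)
  qed
next
  case (add p q)
  then obtain p' q' where "p' \<in> polys F n" "q' \<in> polys F n"
    "\<forall>a. length a = n \<longrightarrow> p (a @ v) = p' a" "\<forall>a. length a = n \<longrightarrow> q (a @ v) = q' a" by metis
  then show ?case by (intro bexI[of _ "\<lambda>v. p' v + q' v"]) (auto intro: polys.intros)
next
  case (mult p q)
  then obtain p' q' where "p' \<in> polys F n" "q' \<in> polys F n"
    "\<forall>a. length a = n \<longrightarrow> p (a @ v) = p' a" "\<forall>a. length a = n \<longrightarrow> q (a @ v) = q' a" by metis
  then show ?case by (intro bexI[of _ "\<lambda>v. p' v * q' v"]) (auto intro: polys.intros)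
qed

lemma indep_appendD1:
  fixes a w :: "'a :: field list"
  assumes "indep F (a @ w)"
  shows "indep F a"
  unfolding indep_def
proof safe
  fix p and v :: "'a list" assume p: "p \<in> polys F (length a)" "p a = 0" and v: "v \<in> affine_space (length a)"
  have "p (v @ w) = 0"
  proof (rule indepD[OF assms _ refl])
    show "p \<in> polys F (length (a @ w))" by (rule polys_mono[OF p(1)]) auto
    show "p (a @ w) = 0" using polys_append[OF p(1), of a w] p(2) by simp
    show "length (v @ w) = length (a @ w)" using v by (simp add: affine_space_def)
  qed
  then show "p v = 0" using v polys_append[OF p(1), of v w] by (simp add: affine_space_def)
qed

lemma indep_appendD2:
  fixes a w :: "'a :: field list"
  assumes F: "is_subfield F" and i: "indep F (a @ w)"
  shows "indep (fracs F a) w"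
  unfolding indep_def
proof safe
  fix p and v :: "'a list" assume p: "p \<in> polys (fracs F a) (length w)" "p w = 0" and v: "v \<in> affine_space (length w)"
  obtain P q where P: "P \<in> polys F (length a + length w)" "q \<in> polys F (length a)" "q a \<noteq> 0"
    "\<forall>v. length v = length w \<longrightarrow> P (a @ v) = q a * p v"
    using fracs_polys_clear[OF F p(1) refl] by metis
  then have "P (a @ w) = 0" using p by simp
  then have "P (a @ v) = 0" using v by (simp add: affine_space_def indepD[OF i P(1)])
  then show "p v = 0" using P v by (auto simp: affine_space_def)
qed

text \<open>For arbitrary \<open>v\<close> the polynomial in the first block that \<open>P\<close>
  becomes at \<open>v\<close> need not have coefficients in \<open>F\<close>, so the independence of
  \<open>a\<close> cannot be used at once. It can for \<open>v\<close> with natural coordinates, and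
  a polynomial that vanishes at all natural points is zero.\<close>

lemma indep_appendI:
  fixes a w :: "'a :: field_char_0 list"
  assumes F: "is_subfield F" and a: "indep F a" and w: "indep (fracs F a) w"
  shows "indep F (a @ w)"
  unfolding indep_def
proof safe
  fix P and u :: "'a list" assume P: "P \<in> polys F (length (a @ w))" "P (a @ w) = 0"
    and u: "u \<in> affine_space (length (a @ w))"
  let ?n = "length a" and ?m = "length w"
  have P': "P \<in> polys F (?n + ?m)" using P by simp
  have a0: "P (a @ v) = 0" if "length v = ?m" for v
  proof -
    obtain p where p: "p \<in> polys (fracs F a) ?m" "\<forall>v. length v = ?m \<longrightarrow> P (a @ v) = p v"
      using polys_specialize_left[OF P'] by blast
    then have "p v = 0" using P that by (simp add: indepD[OF w p(1) refl])
    then show ?thesis using p that by simp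
  qed
  have nat0: "P (map of_nat s) = 0" if "length s = ?n + ?m" for s
  proof -
    let ?v = "map of_nat (drop ?n s) :: 'a list" and ?u = "map of_nat (take ?n s) :: 'a list"
    have vF: "length ?v = ?m" "set ?v \<subseteq> F" using that subfield_of_nat[OF F] by auto
    obtain p where p: "p \<in> polys F ?n" "\<forall>a. length a = ?n \<longrightarrow> P (a @ ?v) = p a"
      using polys_specialize_right[OF P' vF] by blast
    then have "p a = 0" using a0[of ?v] that by simp
    then have "p ?u = 0" using that by (simp add: indepD[OF a p(1) refl])
    then have "P (?u @ ?v) = 0" using p that by simp
    then show ?thesis by (simp flip: map_append)
  qed
  show "P u = 0"
    using polys_nonzero_nat[OF P', of u] nat0 u by (auto simp: affine_space_def)
qed

text \<open>A surjective polynomial map sends generic points to generic points: a relation on the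
  image pulls back to a relation on \<open>z\<close>, hence vanishes everywhere.\<close>

lemma indep_transform:
  fixes z z' :: "'a :: field list"
  assumes i: "indep F z" and T: "\<And>i. i < length z' \<Longrightarrow> T i \<in> polys F (length z)"
    and z': "\<And>i. i < length z' \<Longrightarrow> z' ! i = T i z"
    and onto: "\<And>v. length v = length z' \<Longrightarrow> \<exists>u. length u = length z \<and> v = map (\<lambda>i. T i u) [0..<length z']"
  shows "indep F z'"
  unfolding indep_def
proof safe
  fix p and v :: "'a list" assume p: "p \<in> polys F (length z')" "p z' = 0" and v: "v \<in> affine_space (length z')"
  let ?q = "\<lambda>u. p (map (\<lambda>i. T i u) [0..<length z'])"
  have q: "?q \<in> polys F (length z)" by (rule polys_compose[OF p(1)]) (rule T)
  have "map (\<lambda>i. T i z) [0..<length z'] = z'" using z' by (auto intro: nth_equalityI)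
  then have "?q z = 0" using p by simp
  then have "?q u = 0" if "length u = length z" for u using indepD[OF i q] that by simp
  then show "p v = 0" using onto[of v] v by (auto simp: affine_space_def)
qed

lemma indep_swap:
  assumes "indep F (a @ b @ c)"
  shows "indep F (b @ a @ c)"
proof (rule indep_transform[OF assms, where
      T = "\<lambda>i v. if i < length b then v ! (length a + i)
        else if i < length a + length b then v ! (i - length b) else v ! i"])
  fix v assume "length v = length (b @ a @ c)"
  then show "\<exists>u. length u = length (a @ b @ c) \<and> v = map (\<lambda>i. if i < length b then u ! (length a + i)
        else if i < length a + length b then u ! (i - length b) else u ! i) [0..<length (b @ a @ c)]"
    by (intro exI[of _ "take (length a) (drop (length b) v) @ take (length b) v @ drop (length a + length b) v"])
      (auto intro!: nth_equalityI simp: nth_append)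
next
  fix i assume i: "i < length (b @ a @ c)"
  show "(\<lambda>v. if i < length b then v ! (length a + i)
        else if i < length a + length b then v ! (i - length b) else v ! i) \<in> polys F (length (a @ b @ c))"
    using i by (cases "i < length b"; cases "i < length a + length b") (auto intro!: polys.coord)
  show "(b @ a @ c) ! i = (if i < length b then (a @ b @ c) ! (length a + i)
        else if i < length a + length b then (a @ b @ c) ! (i - length b) else (a @ b @ c) ! i)"
    using i by (auto simp: nth_append add.commute)
qed

section \<open>Field homomorphisms and finite group actions\<close>

text \<open>Functions are total, so only the behaviour on \<open>E\<close> is prescribed. The
  condition on 1 excludes the zero map, and thereby nonzero elements of \<open>E\<close> have
  nonzero images.\<close>

definition subfield_hom :: "'a :: field set \<Rightarrow> ('a \<Rightarrow> 'a) \<Rightarrow> bool" where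
  "subfield_hom E \<sigma> \<longleftrightarrow> is_subfield E \<and> \<sigma> 1 = 1 \<and>
     (\<forall>x\<in>E. \<forall>y\<in>E. \<sigma> (x + y) = \<sigma> x + \<sigma> y \<and> \<sigma> (x * y) = \<sigma> x * \<sigma> y)"

lemma subfield_hom_subfield: "subfield_hom E \<sigma> \<Longrightarrow> is_subfield E"
  and subfield_hom_one: "subfield_hom E \<sigma> \<Longrightarrow> \<sigma> 1 = 1"
  and subfield_hom_add: "subfield_hom E \<sigma> \<Longrightarrow> x \<in> E \<Longrightarrow> y \<in> E \<Longrightarrow> \<sigma> (x + y) = \<sigma> x + \<sigma> y"
  and subfield_hom_mult: "subfield_hom E \<sigma> \<Longrightarrow> x \<in> E \<Longrightarrow> y \<in> E \<Longrightarrow> \<sigma> (x * y) = \<sigma> x * \<sigma> y"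
  by (auto simp: subfield_hom_def)

lemma subfield_hom_zero: "subfield_hom E \<sigma> \<Longrightarrow> \<sigma> 0 = 0"
  using subfield_hom_add[of E \<sigma> 0 0] add_left_cancel[of "\<sigma> 0" "\<sigma> 0" 0]
  by (metis add.right_neutral subfield_hom_subfield subfield_zero)

lemma subfield_hom_minus: "subfield_hom E \<sigma> \<Longrightarrow> x \<in> E \<Longrightarrow> \<sigma> (- x) = - \<sigma> x"
  using subfield_hom_add[of E \<sigma> x "- x"] subfield_hom_zero[of E \<sigma>]
  by (simp add: subfield_hom_subfield subfield_minus add_eq_0_iff)

lemma subfield_hom_diff: "subfield_hom E \<sigma> \<Longrightarrow> x \<in> E \<Longrightarrow> y \<in> E \<Longrightarrow> \<sigma> (x - y) = \<sigma> x - \<sigma> y"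
  using subfield_hom_add[of E \<sigma> x "- y"] subfield_hom_minus[of E \<sigma> y]
  by (simp add: subfield_hom_subfield subfield_minus)

lemma subfield_hom_inverse:
  assumes "subfield_hom E \<sigma>" "x \<in> E"
  shows "\<sigma> (inverse x) = inverse (\<sigma> x)"
proof (cases "x = 0")
  case True
  then show ?thesis using subfield_hom_zero[OF assms(1)] by simp
next
  case False
  have "\<sigma> x * \<sigma> (inverse x) = 1"
    using subfield_hom_mult[OF assms(1), of x "inverse x"] False assms
    by (simp add: subfield_hom_subfield[THEN subfield_inverse] subfield_hom_one)
  then show ?thesis by (metis inverse_unique)
qed

lemma subfield_hom_divide: "subfield_hom E \<sigma> \<Longrightarrow> x \<in> E \<Longrightarrow> y \<in> E \<Longrightarrow> \<sigma> (x / y) = \<sigma> x / \<sigma> y"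
  by (simp add: divide_inverse subfield_hom_mult subfield_hom_inverse subfield_hom_subfield subfield_inverse)

lemma subfield_hom_eq_0_iff: "subfield_hom E \<sigma> \<Longrightarrow> x \<in> E \<Longrightarrow> \<sigma> x = 0 \<longleftrightarrow> x = 0"
  using subfield_hom_mult[of E \<sigma> x "inverse x"] subfield_hom_zero[of E \<sigma>] subfield_hom_one[of E \<sigma>]
  by (metis subfield_hom_subfield mult_zero_left right_inverse subfield_inverse zero_neq_one)

lemma subfield_hom_sum: "subfield_hom E \<sigma> \<Longrightarrow> (\<And>i. i \<in> A \<Longrightarrow> f i \<in> E) \<Longrightarrow> \<sigma> (\<Sum>i\<in>A. f i) = (\<Sum>i\<in>A. \<sigma> (f i))"
  by (induction A rule: infinite_finite_induct)
    (auto simp: subfield_hom_zero subfield_hom_add subfield_hom_subfield subfield_sum)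

lemma subfield_hom_prod: "subfield_hom E \<sigma> \<Longrightarrow> (\<And>i. i \<in> A \<Longrightarrow> f i \<in> E) \<Longrightarrow> \<sigma> (\<Prod>i\<in>A. f i) = (\<Prod>i\<in>A. \<sigma> (f i))"
  by (induction A rule: infinite_finite_induct)
    (auto simp: subfield_hom_one subfield_hom_mult subfield_hom_subfield subfield_prod)

lemma subfield_hom_power: "subfield_hom E \<sigma> \<Longrightarrow> x \<in> E \<Longrightarrow> \<sigma> (x ^ n) = \<sigma> x ^ n"
  by (induction n) (auto simp: subfield_hom_one subfield_hom_mult subfield_hom_subfield subfield_power)

lemma subfield_hom_powi: "subfield_hom E \<sigma> \<Longrightarrow> x \<in> E \<Longrightarrow> \<sigma> (x powi n) = \<sigma> x powi n"
  by (auto simp: power_int_def subfield_hom_power subfield_hom_inverse subfield_hom_subfield subfield_inverse)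

lemma subfield_hom_of_nat: "subfield_hom E \<sigma> \<Longrightarrow> \<sigma> (of_nat n) = of_nat n"
  by (induction n)
    (auto simp: subfield_hom_zero subfield_hom_one subfield_hom_add subfield_hom_subfield subfield_of_nat subfield_one)

lemma subfield_hom_mono: "subfield_hom E \<sigma> \<Longrightarrow> is_subfield E' \<Longrightarrow> E' \<subseteq> E \<Longrightarrow> subfield_hom E' \<sigma>"
  by (auto simp: subfield_hom_def)

lemma subfield_hom_polys:
  assumes "p \<in> polys F n" "subfield_hom E \<sigma>" "F \<subseteq> E" "\<And>c. c \<in> F \<Longrightarrow> \<sigma> c = c" "length x = n" "set x \<subseteq> E"
  shows "\<sigma> (p x) = p (map \<sigma> x)"
proof -
  have in_E: "p x \<in> E" if "p \<in> polys F n" for p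
    by (rule polys_eval_in[OF that subfield_hom_subfield[OF assms(2)] assms(3)]) (use assms(5,6) in auto)
  show ?thesis
    using assms(1)
proof induction
  case (add p q)
  then show ?case using subfield_hom_add[OF assms(2) in_E in_E] by simp
next
  case (mult p q)
  then show ?case using subfield_hom_mult[OF assms(2) in_E in_E] by simp
qed (use assms in auto)
qed

text \<open>The elements on which both maps agree form a subfield that contains the
  generators.\<close>

lemma subfield_hom_eq:
  assumes "subfield_hom (fracs F z) \<sigma>" "subfield_hom (fracs F z) \<tau>"
    "\<And>c. c \<in> F \<Longrightarrow> \<sigma> c = \<tau> c" "\<And>c. c \<in> set z \<Longrightarrow> \<sigma> c = \<tau> c" "x \<in> fracs F z"
  shows "\<sigma> x = \<tau> x"
proof -
  let ?K = "{x \<in> fracs F z. \<sigma> x = \<tau> x}"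
  have "is_subfield ?K"
    unfolding is_subfield_def using fracs_subfield[of F z]
    by (auto simp: subfield_intros subfield_hom_zero[OF assms(1)] subfield_hom_zero[OF assms(2)]
        subfield_hom_one[OF assms(1)] subfield_hom_one[OF assms(2)]
        subfield_hom_add[OF assms(1)] subfield_hom_add[OF assms(2)]
        subfield_hom_mult[OF assms(1)] subfield_hom_mult[OF assms(2)]
        subfield_hom_minus[OF assms(1)] subfield_hom_minus[OF assms(2)]
        subfield_hom_inverse[OF assms(1)] subfield_hom_inverse[OF assms(2)])
  then have "fracs F z \<subseteq> ?K"
    using fracs_base[of F z] fracs_gens[of z F] assms by (intro fracs_least) auto
  then show ?thesis using assms by auto
qed

text \<open>The homomorphism of fields over \<open>F\<close> that sends the coordinates of \<open>z\<close> to those of \<open>z'\<close>; it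
  exists if the two points satisfy the same polynomial equations.\<close>

definition subst_map :: "'a :: field set \<Rightarrow> 'a list \<Rightarrow> 'a list \<Rightarrow> 'a \<Rightarrow> 'a" where
  "subst_map F z z' e = (SOME e'. \<exists>p \<in> polys F (length z). \<exists>q \<in> polys F (length z).
     q z \<noteq> 0 \<and> e = p z / q z \<and> e' = p z' / q z')"

context
  fixes F :: "'a :: field set" and z z' :: "'a list"
  assumes F: "is_subfield F" and z: "eqv F z z'"
begin

text \<open>Independence of the chosen fraction: \<open>p * q' - p' * q\<close> vanishes at
  \<open>z\<close>, hence at \<open>z'\<close>, and the denominators stay nonzero there.\<close>

lemma subst_map_frac:
  assumes "p \<in> polys F (length z)" "q \<in> polys F (length z)" "q z \<noteq> 0"
  shows "subst_map F z z' (p z / q z) = p z' / q z'"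
  unfolding subst_map_def
proof (rule someI2)
  show "\<exists>p' \<in> polys F (length z). \<exists>q' \<in> polys F (length z).
     q' z \<noteq> 0 \<and> p z / q z = p' z / q' z \<and> p z' / q z' = p' z' / q' z'"
    using assms by blast
  fix e' assume "\<exists>p' \<in> polys F (length z). \<exists>q' \<in> polys F (length z).
     q' z \<noteq> 0 \<and> p z / q z = p' z / q' z \<and> e' = p' z' / q' z'"
  then obtain p' q' where *: "p' \<in> polys F (length z)" "q' \<in> polys F (length z)"
    "q' z \<noteq> 0" "p z / q z = p' z / q' z" "e' = p' z' / q' z'" by blast
  have m1: "- 1 \<in> F" using F by (auto intro: subfield_intros)
  have "(\<lambda>v. p v * q' v - p' v * q v) \<in> polys F (length z)"
    using * assms m1 by (intro polys_diff polys.mult)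
  moreover have "\<forall>f \<in> polys F (length z). f z = 0 \<longleftrightarrow> f z' = 0" using z by (simp add: eqv_def)
  moreover have "p z * q' z - p' z * q z = 0" using * assms by (simp add: field_simps)
  ultimately have "p z' * q' z' - p' z' * q z' = 0" by (auto dest: bspec)
  moreover have "q z' \<noteq> 0" "q' z' \<noteq> 0" using z assms * unfolding eqv_def by auto
  ultimately show "e' = p z' / q z'" by (simp add: * field_simps)
qed

lemma subst_map_poly: "p \<in> polys F (length z) \<Longrightarrow> subst_map F z z' (p z) = p z'"
  using subst_map_frac[of p "\<lambda>_. 1"] F by (auto intro: polys.intros subfield_one)

lemma subst_map_const: "c \<in> F \<Longrightarrow> subst_map F z z' c = c"
  using subst_map_poly[of "\<lambda>_. c"] by (auto intro: polys.intros)

lemma subst_map_nth: "i < length z \<Longrightarrow> subst_map F z z' (z ! i) = z' ! i"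
  using subst_map_poly[of "\<lambda>v. v ! i"] by (auto intro: polys.intros)

lemma subst_map_hom: "subfield_hom (fracs F z) (subst_map F z z')"
  unfolding subfield_hom_def
proof (intro conjI ballI)
  show "is_subfield (fracs F z)" by (rule fracs_subfield)
  show "subst_map F z z' 1 = 1" using F by (simp add: subst_map_const subfield_one)
  fix x y assume "x \<in> fracs F z" "y \<in> fracs F z"
  then obtain p q p' q' where *: "x = p z / q z" "y = p' z / q' z" "q z \<noteq> 0" "q' z \<noteq> 0"
      "p \<in> polys F (length z)" "q \<in> polys F (length z)"
      "p' \<in> polys F (length z)" "q' \<in> polys F (length z)" by (auto simp: fracs_eq[OF F])
  then have nz: "q z' \<noteq> 0" "q' z' \<noteq> 0" using z unfolding eqv_def by auto
  have xy: "subst_map F z z' x = p z' / q z'" "subst_map F z z' y = p' z' / q' z'"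
    using * by (auto intro: subst_map_frac)
  have "x + y = (p z * q' z + p' z * q z) / (q z * q' z)" using * by (simp add: field_simps)
  then have "subst_map F z z' (x + y) = (p z' * q' z' + p' z' * q z') / (q z' * q' z')"
    using subst_map_frac[of "\<lambda>v. p v * q' v + p' v * q v" "\<lambda>v. q v * q' v"] *(3,4)
      polys.add[OF polys.mult[OF *(5,8)] polys.mult[OF *(7,6)]] polys.mult[OF *(6,8)] by simp
  then show "subst_map F z z' (x + y) = subst_map F z z' x + subst_map F z z' y"
    using nz by (simp add: xy field_simps)
  have "x * y = (p z * p' z) / (q z * q' z)" by (simp add: *)
  then have "subst_map F z z' (x * y) = (p z' * p' z') / (q z' * q' z')"
    using subst_map_frac[of "\<lambda>v. p v * p' v" "\<lambda>v. q v * q' v"] *(3,4)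
      polys.mult[OF *(5,7)] polys.mult[OF *(6,8)] by simp
  then show "subst_map F z z' (x * y) = subst_map F z z' x * subst_map F z z' y"
    using nz by (simp add: xy)
qed

lemma subst_map_in: "x \<in> fracs F z \<Longrightarrow> subst_map F z z' x \<in> fracs F z'"
proof -
  assume "x \<in> fracs F z"
  then obtain p q where *: "x = p z / q z" "q z \<noteq> 0" "p \<in> polys F (length z)" "q \<in> polys F (length z)"
    by (auto simp: fracs_eq[OF F])
  then have "subst_map F z z' x = p z' / q z'" "length z' = length z"
    using z by (auto intro: subst_map_frac simp: eqv_def)
  then show ?thesis using * polys_in_fracs[of p F z'] polys_in_fracs[of q F z']
    by (auto intro!: subfield_divide fracs_subfield)
qed

lemma subst_map_unique:
  assumes "subfield_hom (fracs F z) \<sigma>" "\<And>c. c \<in> F \<Longrightarrow> \<sigma> c = c" "\<And>i. i < length z \<Longrightarrow> \<sigma> (z ! i) = z' ! i"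
    "x \<in> fracs F z"
  shows "\<sigma> x = subst_map F z z' x"
  by (rule subfield_hom_eq[OF assms(1) subst_map_hom _ _ assms(4)])
    (use assms in \<open>auto simp: subst_map_const in_set_conv_nth subst_map_nth\<close>)

end

section \<open>Finite groups acting on a field\<close>

definition field_action :: "('g, 'b) monoid_scheme \<Rightarrow> 'a :: field set \<Rightarrow> ('g \<Rightarrow> 'a \<Rightarrow> 'a) \<Rightarrow> bool" where
  "field_action H E \<sigma> \<longleftrightarrow> group H \<and> finite (carrier H) \<and>
     (\<forall>h\<in>carrier H. subfield_hom E (\<sigma> h) \<and> (\<forall>x\<in>E. \<sigma> h x \<in> E)) \<and>
     (\<forall>g\<in>carrier H. \<forall>h\<in>carrier H. \<forall>x\<in>E. \<sigma> (g \<otimes>\<^bsub>H\<^esub> h) x = \<sigma> g (\<sigma> h x)) \<and>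
     (\<forall>x\<in>E. \<sigma> \<one>\<^bsub>H\<^esub> x = x)"

definition fixed :: "('g, 'b) monoid_scheme \<Rightarrow> 'a :: field set \<Rightarrow> ('g \<Rightarrow> 'a \<Rightarrow> 'a) \<Rightarrow> 'a set" where
  "fixed H E \<sigma> = {x \<in> E. \<forall>h\<in>carrier H. \<sigma> h x = x}"

lemma fixed_subfield:
  assumes "field_action H E \<sigma>"
  shows "is_subfield (fixed H E \<sigma>)"
proof -
  interpret group H using assms by (simp add: field_action_def)
  have h: "subfield_hom E (\<sigma> h)" if "h \<in> carrier H" for h using assms that by (simp add: field_action_def)
  have "is_subfield E" using h[OF one_closed] by (rule subfield_hom_subfield)
  then show ?thesis
    unfolding is_subfield_def fixed_def
    by (auto simp: subfield_intros h[THEN subfield_hom_zero] h[THEN subfield_hom_one] h[THEN subfield_hom_add]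
        h[THEN subfield_hom_mult] h[THEN subfield_hom_minus] h[THEN subfield_hom_inverse])
qed

lemma (in group) bij_betw_mult_left: "g \<in> carrier G \<Longrightarrow> bij_betw (\<lambda>h. g \<otimes> h) (carrier G) (carrier G)"
  by (rule bij_betwI[where g = "\<lambda>h. inv g \<otimes> h"]) (auto simp: m_assoc[symmetric])

text \<open>Multiplying numerator and denominator of an invariant fraction by the conjugates of the
  denominator makes both invariant.\<close>

lemma fixed_subset_if_averages:
  fixes E :: "'a :: field_char_0 set"
  assumes act: "field_action H E \<sigma>" and RE: "R \<subseteq> E"
    and Rm: "\<And>x y. x \<in> R \<Longrightarrow> y \<in> R \<Longrightarrow> x * y \<in> R" and R1: "1 \<in> R"
    and Rs: "\<And>h x. h \<in> carrier H \<Longrightarrow> x \<in> R \<Longrightarrow> \<sigma> h x \<in> R"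
    and frac: "\<And>e. e \<in> E \<Longrightarrow> \<exists>r\<in>R. \<exists>s\<in>R. s \<noteq> 0 \<and> e = r / s"
    and D: "is_subfield D" and avg: "\<And>r. r \<in> R \<Longrightarrow> (\<Sum>h\<in>carrier H. \<sigma> h r) \<in> D"
  shows "fixed H E \<sigma> \<subseteq> D"
proof
  fix e assume e: "e \<in> fixed H E \<sigma>"
  interpret group H using act by (simp add: field_action_def)
  have fin: "finite (carrier H)" and hom: "\<And>h. h \<in> carrier H \<Longrightarrow> subfield_hom E (\<sigma> h)"
    and cl: "\<And>h x. h \<in> carrier H \<Longrightarrow> x \<in> E \<Longrightarrow> \<sigma> h x \<in> E"
    and one: "\<And>x. x \<in> E \<Longrightarrow> \<sigma> \<one>\<^bsub>H\<^esub> x = x"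
    and comp: "\<And>g h x. g \<in> carrier H \<Longrightarrow> h \<in> carrier H \<Longrightarrow> x \<in> E \<Longrightarrow> \<sigma> (g \<otimes>\<^bsub>H\<^esub> h) x = \<sigma> g (\<sigma> h x)"
    using act by (auto simp: field_action_def)
  have eE: "e \<in> E" using e by (auto simp: fixed_def)
  then obtain r s where rs: "r \<in> R" "s \<in> R" "s \<noteq> 0" "e = r / s" using frac by blast
  have prodR: "(\<Prod>h\<in>A. \<sigma> h s) \<in> R" if "A \<subseteq> carrier H" for A
    using finite_subset[OF that fin] that
    by (induction A rule: finite_induct) (auto intro!: Rm Rs R1 rs)
  define s' where "s' = (\<Prod>h\<in>carrier H. \<sigma> h s)"
  define r' where "r' = r * (\<Prod>h\<in>carrier H - {\<one>\<^bsub>H\<^esub>}. \<sigma> h s)"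
  have s'R: "s' \<in> R" and r'R: "r' \<in> R" unfolding s'_def r'_def using prodR rs by (auto intro!: Rm)
  have s'_eq: "s' = s * (\<Prod>h\<in>carrier H - {\<one>\<^bsub>H\<^esub>}. \<sigma> h s)"
    unfolding s'_def using fin rs RE one by (subst prod.remove[of _ "\<one>\<^bsub>H\<^esub>"]) auto
  have s'0: "s' \<noteq> 0"
    unfolding s'_def using rs RE fin subfield_hom_eq_0_iff[OF hom] by (auto simp: prod_zero_iff)
  then have e': "e = r' / s'" unfolding s'_eq r'_def using rs by simp
  have inv_s: "\<sigma> g s' = s'" if g: "g \<in> carrier H" for g
  proof -
    have "\<sigma> g s' = (\<Prod>h\<in>carrier H. \<sigma> g (\<sigma> h s))"
      unfolding s'_def using rs RE cl by (intro subfield_hom_prod[OF hom[OF g]]) auto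
    also have "\<dots> = (\<Prod>h\<in>carrier H. \<sigma> (g \<otimes>\<^bsub>H\<^esub> h) s)"
      using g rs RE by (intro prod.cong) (auto simp: comp)
    also have "\<dots> = s'" unfolding s'_def
      using prod.reindex_bij_betw[OF bij_betw_mult_left[OF g], of "\<lambda>h. \<sigma> h s"] by simp
    finally show ?thesis .
  qed
  have inv_r: "\<sigma> g r' = r'" if g: "g \<in> carrier H" for g
  proof -
    have "r' = e * s'" using e' s'0 by simp
    then have "\<sigma> g r' = \<sigma> g e * \<sigma> g s'" using subfield_hom_mult[OF hom[OF g]] eE s'R RE by auto
    also have "\<dots> = e * s'" using inv_s[OF g] e g by (auto simp: fixed_def)
    finally show ?thesis using e' s'0 by simp
  qed
  \<comment> \<open>An invariant element is its own average up to division by the order of the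
    group, which is possible in characteristic zero.\<close>
  have "x \<in> D" if "x \<in> R" "\<And>g. g \<in> carrier H \<Longrightarrow> \<sigma> g x = x" for x
  proof -
    have "(\<Sum>h\<in>carrier H. \<sigma> h x) = of_nat (card (carrier H)) * x" using that by simp
    then have "of_nat (card (carrier H)) * x \<in> D" using avg[OF that(1)] by simp
    moreover have "(of_nat (card (carrier H)) :: 'a) \<noteq> 0" using fin by (auto simp: card_eq_0_iff)
    ultimately have "(of_nat (card (carrier H)) * x) / of_nat (card (carrier H)) \<in> D"
      using D by (intro subfield_divide subfield_of_nat)
    then show ?thesis using \<open>of_nat (card (carrier H)) \<noteq> 0\<close> by simp
  qed
  then have "r' \<in> D" "s' \<in> D" using s'R r'R inv_s inv_r by auto
  then show "e \<in> D" unfolding e' using D by (rule subfield_divide[rotated])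
qed

text \<open>The additive span of products. Averages over a group are computed product by product,
  and every element of the composite field is a fraction of elements of this span.\<close>

inductive_set prodspan :: "'a :: field set \<Rightarrow> 'a set \<Rightarrow> 'a set" for A B :: "'a set" where
  gen: "a \<in> A \<Longrightarrow> b \<in> B \<Longrightarrow> a * b \<in> prodspan A B"
| add: "x \<in> prodspan A B \<Longrightarrow> y \<in> prodspan A B \<Longrightarrow> x + y \<in> prodspan A B"

lemma prodspan_mult:
  assumes A: "\<And>x y. x \<in> A \<Longrightarrow> y \<in> A \<Longrightarrow> x * y \<in> A" and B: "\<And>x y. x \<in> B \<Longrightarrow> y \<in> B \<Longrightarrow> x * y \<in> B"
    and x: "x \<in> prodspan A B" and y: "y \<in> prodspan A B"
  shows "x * y \<in> prodspan A B"
  using x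
proof induction
  case (gen a b)
  from y show ?case
  proof induction
    case (gen a' b')
    then show ?case using \<open>a \<in> A\<close> \<open>b \<in> B\<close> prodspan.gen[of "a * a'" A "b * b'" B]
      by (simp add: A B mult_ac)
  qed (auto simp: distrib_left intro: prodspan.add)
qed (auto simp: distrib_right intro: prodspan.add)

lemma prodspan_polys:
  assumes "p \<in> polys F n" and A: "\<And>x y. x \<in> A \<Longrightarrow> y \<in> A \<Longrightarrow> x * y \<in> A" "1 \<in> A" "F \<subseteq> A"
    and B: "\<And>x y. x \<in> B \<Longrightarrow> y \<in> B \<Longrightarrow> x * y \<in> B" "1 \<in> B" and v: "\<And>i. i < n \<Longrightarrow> v ! i \<in> A \<union> B"
  shows "p v \<in> prodspan A B"
  using assms(1)
proof induction
  case (const c)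
  then show ?case using prodspan.gen[of c A 1 B] A B by auto
next
  case (coord i)
  then show ?case using prodspan.gen[of "v ! i" A 1 B] prodspan.gen[of 1 A "v ! i" B] A(2) B(2) v[of i]
    by auto
qed (use assms in \<open>auto intro: prodspan.add prodspan_mult\<close>)

text \<open>A primitive element: for each nontrivial \<open>g\<close> the differences
  \<open>\<sigma> g (z ! i) - z ! i\<close> are the coefficients of a nonzero polynomial. A natural
  number that is a root of none of these polynomials gives a combination of the coordinates that no
  such \<open>g\<close> fixes.\<close>

lemma exists_distinct_conjugates:
  fixes E :: "'a :: field_char_0 set"
  assumes act: "field_action H E \<sigma>" and z: "set z \<subseteq> E"
    and faithful: "\<And>g. g \<in> carrier H \<Longrightarrow> g \<noteq> \<one>\<^bsub>H\<^esub> \<Longrightarrow> \<exists>i<length z. \<sigma> g (z ! i) \<noteq> z ! i"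
  shows "\<exists>\<theta>\<in>E. inj_on (\<lambda>g. \<sigma> g \<theta>) (carrier H)"
proof -
  interpret group H using act by (simp add: field_action_def)
  have fin: "finite (carrier H)" and hom: "\<And>h. h \<in> carrier H \<Longrightarrow> subfield_hom E (\<sigma> h)"
    and cl: "\<And>h x. h \<in> carrier H \<Longrightarrow> x \<in> E \<Longrightarrow> \<sigma> h x \<in> E"
    and one: "\<And>x. x \<in> E \<Longrightarrow> \<sigma> \<one>\<^bsub>H\<^esub> x = x"
    and comp: "\<And>g h x. g \<in> carrier H \<Longrightarrow> h \<in> carrier H \<Longrightarrow> x \<in> E \<Longrightarrow> \<sigma> (g \<otimes>\<^bsub>H\<^esub> h) x = \<sigma> g (\<sigma> h x)"
    using act by (auto simp: field_action_def)
  have E: "is_subfield E" using hom[OF one_closed] by (rule subfield_hom_subfield)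
  have zE: "i < length z \<Longrightarrow> z ! i \<in> E" for i using z by auto
  define P where "P g = (\<Sum>i<length z. monom (\<sigma> g (z ! i) - z ! i) i)" for g
  have "P g \<noteq> 0" if gH: "g \<in> carrier H" "g \<noteq> \<one>\<^bsub>H\<^esub>" for g
  proof -
    obtain i where i: "i < length z" "\<sigma> g (z ! i) \<noteq> z ! i" using faithful[OF gH] by auto
    then have "coeff (P g) i \<noteq> 0" by (simp add: P_def coeff_sum if_distrib cong: if_cong)
    then show ?thesis by auto
  qed
  then have "(\<Prod>g\<in>carrier H - {\<one>\<^bsub>H\<^esub>}. P g) \<noteq> 0" using fin by (auto simp: prod_zero_iff)
  from poly_nonroot_nat[OF this] obtain m :: nat
    where "poly (\<Prod>g\<in>carrier H - {\<one>\<^bsub>H\<^esub>}. P g) (of_nat m) \<noteq> 0" by blast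
  then have m: "poly (P g) (of_nat m) \<noteq> 0" if "g \<in> carrier H" "g \<noteq> \<one>\<^bsub>H\<^esub>" for g
    using that fin by (auto simp: poly_prod prod_zero_iff)
  define \<theta> where "\<theta> = (\<Sum>i<length z. z ! i * of_nat m ^ i)"
  have tE: "\<theta> \<in> E" unfolding \<theta>_def using E zE by (auto intro!: subfield_intros)
  have ne: "\<sigma> g \<theta> \<noteq> \<theta>" if g: "g \<in> carrier H" "g \<noteq> \<one>\<^bsub>H\<^esub>" for g
  proof -
    have "\<sigma> g \<theta> = (\<Sum>i<length z. \<sigma> g (z ! i * of_nat m ^ i))"
      unfolding \<theta>_def by (intro subfield_hom_sum[OF hom]) (use E zE g in \<open>auto intro!: subfield_intros\<close>)
    also have "\<dots> = (\<Sum>i<length z. \<sigma> g (z ! i) * of_nat m ^ i)"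
      by (intro sum.cong refl) (use zE g E in \<open>auto simp: subfield_hom_mult[OF hom] subfield_hom_power[OF hom]
        subfield_hom_of_nat[OF hom] subfield_of_nat subfield_power\<close>)
    finally have "\<sigma> g \<theta> - \<theta> = poly (P g) (of_nat m)"
      by (simp add: \<theta>_def P_def poly_sum poly_monom sum_subtractf algebra_simps)
    then show ?thesis using m[OF g] by auto
  qed
  have "inj_on (\<lambda>g. \<sigma> g \<theta>) (carrier H)"
  proof (rule inj_onI)
    fix g h assume gh: "g \<in> carrier H" "h \<in> carrier H" "\<sigma> g \<theta> = \<sigma> h \<theta>"
    have "\<sigma> (inv\<^bsub>H\<^esub> h \<otimes>\<^bsub>H\<^esub> g) \<theta> = \<sigma> (inv\<^bsub>H\<^esub> h) (\<sigma> g \<theta>)" using gh tE by (simp add: comp)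
    also have "\<dots> = \<theta>" using gh tE comp[of "inv\<^bsub>H\<^esub> h" h \<theta>] one by simp
    finally have "inv\<^bsub>H\<^esub> h \<otimes>\<^bsub>H\<^esub> g = \<one>\<^bsub>H\<^esub>" using ne[of "inv\<^bsub>H\<^esub> h \<otimes>\<^bsub>H\<^esub> g"] gh by auto
    then show "g = h" using gh by (metis inv_closed inv_equality inv_inv)
  qed
  then show ?thesis using tE by blast
qed

section \<open>Linear representations and their invariants\<close>

text \<open>The row \<open>M g i\<close> holds the coefficients of the linear form to which
  \<open>g\<close> sends the \<open>i\<close>-th coordinate. Applying first \<open>h\<close> and
  then \<open>g\<close> substitutes into the forms of \<open>h\<close>, whence the reversed order of
  the factors.\<close>

definition lin_rep :: "'a :: field set \<Rightarrow> ('g, 'b) monoid_scheme \<Rightarrow> nat \<Rightarrow> ('g \<Rightarrow> nat \<Rightarrow> nat \<Rightarrow> 'a) \<Rightarrow> bool" where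
  "lin_rep F H n M \<longleftrightarrow> (\<forall>g\<in>carrier H. \<forall>i<n. \<forall>j<n. M g i j \<in> F) \<and>
     (\<forall>i<n. \<forall>j<n. M \<one>\<^bsub>H\<^esub> i j = of_bool (i = j)) \<and>
     (\<forall>g\<in>carrier H. \<forall>h\<in>carrier H. \<forall>i<n. \<forall>j<n. M (g \<otimes>\<^bsub>H\<^esub> h) i j = (\<Sum>l<n. M h i l * M g l j))"

definition mact :: "nat \<Rightarrow> ('g \<Rightarrow> nat \<Rightarrow> nat \<Rightarrow> 'a :: field) \<Rightarrow> 'g \<Rightarrow> 'a list \<Rightarrow> 'a list" where
  "mact n M g z = map (\<lambda>i. \<Sum>j<n. M g i j * z ! j) [0..<n]"

definition dsum :: "nat \<Rightarrow> ('g \<Rightarrow> nat \<Rightarrow> nat \<Rightarrow> 'a :: field) \<Rightarrow> ('g \<Rightarrow> nat \<Rightarrow> nat \<Rightarrow> 'a) \<Rightarrow> 'g \<Rightarrow> nat \<Rightarrow> nat \<Rightarrow> 'a" where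
  "dsum n M M' g i j = (if i < n \<and> j < n then M g i j else if n \<le> i \<and> n \<le> j then M' g (i - n) (j - n) else 0)"

definition triv :: "'g \<Rightarrow> nat \<Rightarrow> nat \<Rightarrow> 'a :: field" where
  "triv g i j = of_bool (i = j)"

text \<open>For independent \<open>z\<close> this is the field of invariants of \<open>F(z)\<close>
  under the linear substitutions \<open>M g\<close>.\<close>

definition lin_fix :: "'a :: field set \<Rightarrow> ('g, 'b) monoid_scheme \<Rightarrow> ('g \<Rightarrow> nat \<Rightarrow> nat \<Rightarrow> 'a) \<Rightarrow> 'a list \<Rightarrow> 'a set" where
  "lin_fix F H M z = fixed H (fracs F z) (\<lambda>g. subst_map F z (mact (length z) M g z))"

lemma length_mact [simp]: "length (mact n M g z) = n"
  by (simp add: mact_def)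

lemma nth_mact: "i < n \<Longrightarrow> mact n M g z ! i = (\<Sum>j<n. M g i j * z ! j)"
  by (simp add: mact_def)

lemma sum_lessThan_add: "(\<Sum>j<n + m. f j) = (\<Sum>j<n. f j) + (\<Sum>j<m. f (n + j))"
  for f :: "nat \<Rightarrow> 'a :: comm_monoid_add"
  by (induction m) (simp_all add: add.assoc)

lemma sum_of_bool_mult:
  fixes f :: "nat \<Rightarrow> 'a :: field"
  shows "i < n \<Longrightarrow> (\<Sum>j<n. of_bool (i = j) * f j) = f i" "i < n \<Longrightarrow> (\<Sum>j<n. f j * of_bool (j = i)) = f i"
  by (simp_all add: of_bool_def if_distrib[of "\<lambda>x. x * _"] if_distrib[of "\<lambda>x. _ * x"] cong: if_cong)

lemma mact_dsum:
  assumes "length x = n" "length w = m"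
  shows "mact (n + m) (dsum n M M') g (x @ w) = mact n M g x @ mact m M' g w"
proof (rule nth_equalityI)
  fix i assume "i < length (mact (n + m) (dsum n M M') g (x @ w))"
  then have i: "i < n + m" by simp
  have 1: "mact (n + m) (dsum n M M') g (x @ w) ! i =
      (\<Sum>j<n. dsum n M M' g i j * x ! j) + (\<Sum>j<m. dsum n M M' g i (n + j) * w ! j)"
    using i assms by (simp add: nth_mact sum_lessThan_add nth_append)
  show "mact (n + m) (dsum n M M') g (x @ w) ! i = (mact n M g x @ mact m M' g w) ! i"
  proof (cases "i < n")
    case True
    then show ?thesis unfolding 1 by (simp add: dsum_def nth_append nth_mact)
  next
    case False
    then show ?thesis unfolding 1 using i by (simp add: dsum_def nth_append nth_mact)
  qed
qed simp

lemma mact_triv: "length t = m \<Longrightarrow> mact m triv g t = t"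
  by (rule nth_equalityI) (simp_all add: nth_mact triv_def sum_of_bool_mult)

lemma lin_rep_triv: "is_subfield F \<Longrightarrow> lin_rep F H n triv"
  unfolding lin_rep_def triv_def by (auto simp: subfield_one subfield_zero sum_of_bool_mult)

lemma lin_rep_dsum:
  assumes F: "is_subfield F" and M: "lin_rep F H n M" and M': "lin_rep F H m M'"
  shows "lin_rep F H (n + m) (dsum n M M')"
  unfolding lin_rep_def
proof (intro conjI ballI allI impI)
  fix g i j assume "g \<in> carrier H" "i < n + m" "j < n + m"
  then show "dsum n M M' g i j \<in> F" using M M' F by (auto simp: dsum_def lin_rep_def subfield_zero)
next
  fix i j assume "i < n + m" "j < n + m"
  then show "dsum n M M' \<one>\<^bsub>H\<^esub> i j = of_bool (i = j)" using M M' by (auto simp: dsum_def lin_rep_def)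
next
  fix g h i j assume *: "g \<in> carrier H" "h \<in> carrier H" "i < n + m" "j < n + m"
  have "(\<Sum>l<n + m. dsum n M M' h i l * dsum n M M' g l j) =
    (\<Sum>l<n. dsum n M M' h i l * dsum n M M' g l j) + (\<Sum>l<m. dsum n M M' h i (n + l) * dsum n M M' g (n + l) j)"
    by (rule sum_lessThan_add)
  also have "\<dots> = dsum n M M' (g \<otimes>\<^bsub>H\<^esub> h) i j"
  proof (cases "i < n"; cases "j < n")
    assume "i < n" "j < n"
    then show ?thesis using M * unfolding lin_rep_def by (simp add: dsum_def)
  next
    assume "\<not> i < n" "\<not> j < n"
    then have "i - n < m" "j - n < m" "n \<le> i" "n \<le> j" using * by auto
    then show ?thesis using M' * unfolding lin_rep_def by (simp add: dsum_def)
  qed (auto simp: dsum_def)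
  finally show "dsum n M M' (g \<otimes>\<^bsub>H\<^esub> h) i j = (\<Sum>l<n + m. dsum n M M' h i l * dsum n M M' g l j)" ..
qed

lemma mact_mact:
  assumes "lin_rep F H n M" "g \<in> carrier H" "h \<in> carrier H"
  shows "mact n M h (mact n M g v) = mact n M (g \<otimes>\<^bsub>H\<^esub> h) v"
proof (rule nth_equalityI)
  fix i assume "i < length (mact n M h (mact n M g v))"
  then have i: "i < n" by simp
  have "mact n M h (mact n M g v) ! i = (\<Sum>l<n. \<Sum>j<n. M h i l * (M g l j * v ! j))"
    using i by (simp add: nth_mact sum_distrib_left)
  also have "\<dots> = (\<Sum>j<n. (\<Sum>l<n. M h i l * M g l j) * v ! j)"
    by (subst sum.swap) (simp add: sum_distrib_right mult.assoc)
  also have "\<dots> = mact n M (g \<otimes>\<^bsub>H\<^esub> h) v ! i"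
    using i assms by (simp add: nth_mact lin_rep_def)
  finally show "mact n M h (mact n M g v) ! i = mact n M (g \<otimes>\<^bsub>H\<^esub> h) v ! i" .
qed simp

lemma mact_one: "lin_rep F H n M \<Longrightarrow> length v = n \<Longrightarrow> mact n M \<one>\<^bsub>H\<^esub> v = v"
  by (rule nth_equalityI) (simp_all add: nth_mact lin_rep_def sum_of_bool_mult)

text \<open>The matrix of the inverse element makes the substitution surjective, so it takes generic
  points to generic points.\<close>

lemma indep_mact:
  fixes z :: "'a :: field list"
  assumes F: "is_subfield F" and H: "group H" and M: "lin_rep F H (length z) M" and i: "indep F z"
    and g: "g \<in> carrier H"
  shows "indep F (mact (length z) M g z)"
proof (rule indep_transform[OF i, where T = "\<lambda>i v. \<Sum>j<length z. M g i j * v ! j"])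
  interpret group H by (rule H)
  fix i assume "i < length (mact (length z) M g z)"
  then show "(\<lambda>v. \<Sum>j<length z. M g i j * v ! j) \<in> polys F (length z)"
    using M g F by (auto intro!: polys_sum polys.intros subfield_zero simp: lin_rep_def)
next
  interpret group H by (rule H)
  fix v :: "'a list" assume "length v = length (mact (length z) M g z)"
  then have "v = mact (length z) M g (mact (length z) M (inv\<^bsub>H\<^esub> g) v)"
    using g by (simp add: mact_mact[OF M] mact_one[OF M])
  then show "\<exists>u. length u = length z \<and> v = map (\<lambda>i. \<Sum>j<length z. M g i j * u ! j) [0..<length (mact (length z) M g z)]"
    by (intro exI[of _ "mact (length z) M (inv\<^bsub>H\<^esub> g) v"]) (simp flip: mact_def)
qed (simp add: nth_mact)

lemma lin_action:
  fixes z :: "'a :: field list"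
  assumes F: "is_subfield F" and H: "group H" "finite (carrier H)" and M: "lin_rep F H (length z) M"
    and i: "indep F z"
  defines "\<sigma> \<equiv> (\<lambda>g. subst_map F z (mact (length z) M g z))"
  shows "field_action H (fracs F z) \<sigma>"
    and "\<And>g c. g \<in> carrier H \<Longrightarrow> c \<in> F \<Longrightarrow> \<sigma> g c = c"
    and "\<And>g i. g \<in> carrier H \<Longrightarrow> i < length z \<Longrightarrow> \<sigma> g (z ! i) = (\<Sum>j<length z. M g i j * z ! j)"
proof -
  let ?n = "length z"
  interpret group H by (rule H)
  have eqv: "eqv F z (mact ?n M g z)" if "g \<in> carrier H" for g
    using indep_mact[OF F H(1) M i that] i by (intro indep_eqv) auto
  show const: "\<sigma> g c = c" if "g \<in> carrier H" "c \<in> F" for g c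
    unfolding \<sigma>_def using subst_map_const[OF F eqv] that by blast
  show nth: "\<sigma> g (z ! i) = (\<Sum>j<?n. M g i j * z ! j)" if "g \<in> carrier H" "i < ?n" for g i
    unfolding \<sigma>_def using subst_map_nth[OF F eqv] that by (simp add: nth_mact)
  have hom: "subfield_hom (fracs F z) (\<sigma> g)" if "g \<in> carrier H" for g
    unfolding \<sigma>_def using subst_map_hom[OF F eqv] that by blast
  have zE: "i < ?n \<Longrightarrow> z ! i \<in> fracs F z" for i using fracs_gens[of z F] by auto
  have FE: "c \<in> F \<Longrightarrow> c \<in> fracs F z" for c using fracs_base[of F z] by auto
  have cl: "\<sigma> g x \<in> fracs F z" if g: "g \<in> carrier H" and x: "x \<in> fracs F z" for g x
  proof -
    have "\<sigma> g x \<in> fracs F (mact ?n M g z)" unfolding \<sigma>_def using subst_map_in[OF F eqv] g x by blast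
    moreover have "set (mact ?n M g z) \<subseteq> fracs F z"
      using M g zE FE by (auto simp: mact_def lin_rep_def intro!: subfield_sum subfield_mult fracs_subfield)
    ultimately show ?thesis using fracs_least[OF fracs_subfield fracs_base] by blast
  qed
  have MF: "M g i j \<in> F" if "g \<in> carrier H" "i < ?n" "j < ?n" for g i j
    using M that by (auto simp: lin_rep_def)
  have comp: "\<sigma> (g \<otimes>\<^bsub>H\<^esub> h) x = \<sigma> g (\<sigma> h x)" if g: "g \<in> carrier H" and h: "h \<in> carrier H" and x: "x \<in> fracs F z" for g h x
  proof (rule subfield_hom_eq[OF hom _ _ _ x])
    show "subfield_hom (fracs F z) (\<lambda>x. \<sigma> g (\<sigma> h x))"
      unfolding subfield_hom_def using cl[OF h] g h
      by (auto simp: fracs_subfield subfield_hom_one[OF hom] subfield_hom_add[OF hom] subfield_hom_mult[OF hom])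
    show "\<sigma> (g \<otimes>\<^bsub>H\<^esub> h) c = \<sigma> g (\<sigma> h c)" if "c \<in> F" for c using that g h const by simp
    fix c assume "c \<in> set z"
    then obtain i where i: "i < ?n" "c = z ! i" by (auto simp: in_set_conv_nth)
    have "\<sigma> g (\<sigma> h c) = \<sigma> g (\<Sum>j<?n. M h i j * z ! j)" using i h nth by simp
    also have "\<dots> = (\<Sum>j<?n. \<sigma> g (M h i j * z ! j))"
      by (rule subfield_hom_sum[OF hom[OF g]]) (use zE FE MF i h in \<open>auto intro!: subfield_mult fracs_subfield\<close>)
    also have "\<dots> = (\<Sum>j<?n. M h i j * mact ?n M g z ! j)"
    proof (intro sum.cong refl)
      fix j assume "j \<in> {..<?n}"
      then show "\<sigma> g (M h i j * z ! j) = M h i j * mact ?n M g z ! j"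
        using subfield_hom_mult[OF hom[OF g], of "M h i j" "z ! j"] FE[OF MF[OF h i(1)], of j] zE[of j]
          const[OF g MF[OF h i(1)], of j] nth[OF g, of j] by (simp add: nth_mact)
    qed
    also have "\<dots> = mact ?n M h (mact ?n M g z) ! i" using i by (simp add: nth_mact)
    also have "\<dots> = \<sigma> (g \<otimes>\<^bsub>H\<^esub> h) c" using mact_mact[OF M g h, of z] nth[of "g \<otimes>\<^bsub>H\<^esub> h" i] i g h by (simp add: nth_mact)
    finally show "\<sigma> (g \<otimes>\<^bsub>H\<^esub> h) c = \<sigma> g (\<sigma> h c)" ..
  qed (use g h in auto)
  have one: "\<sigma> \<one>\<^bsub>H\<^esub> x = x" if "x \<in> fracs F z" for x
  proof (rule subfield_hom_eq[OF hom _ _ _ that])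
    show "subfield_hom (fracs F z) (\<lambda>x. x)" by (simp add: subfield_hom_def fracs_subfield)
    fix c assume "c \<in> set z"
    then obtain i where i: "i < ?n" "c = z ! i" by (auto simp: in_set_conv_nth)
    then show "\<sigma> \<one>\<^bsub>H\<^esub> c = c" using nth[of "\<one>\<^bsub>H\<^esub>" i] mact_one[OF M, of z] by (simp add: nth_mact[symmetric, of i ?n M])
  qed (use const in auto)
  show "field_action H (fracs F z) \<sigma>"
    unfolding field_action_def using H hom cl comp one by blast
qed

section \<open>Equivariant bases and the no-name lemma\<close>

lemma det_in_subfield:
  assumes A: "A \<in> carrier_mat n n" and E: "is_subfield E" and e: "\<And>i j. i < n \<Longrightarrow> j < n \<Longrightarrow> A $$ (i, j) \<in> E"
  shows "det A \<in> E"
  unfolding det_def'[OF A]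
proof (intro subfield_sum subfield_mult subfield_prod E)
  fix p i assume "p \<in> {p. p permutes {0..<n}}" "i \<in> {0..<n}"
  then show "A $$ (i, p i) \<in> E" using permutes_in_image[of p "{0..<n}" i] by (auto intro: e)
qed (simp add: sign_def subfield_one subfield_minus E)

text \<open>Matrices whose determinant is nonzero at suitable conjugate coefficients exist because the
  determinant of a general average is a nonzero polynomial in its parameters: Lagrange interpolation
  at the conjugates of \<open>\<theta>\<close> makes the average the identity matrix.\<close>

lemma equivariant_basis:
  fixes E :: "'a :: field_char_0 set"
  assumes act: "field_action H E \<sigma>" and FE: "F \<subseteq> E" and fx: "\<And>g c. g \<in> carrier H \<Longrightarrow> c \<in> F \<Longrightarrow> \<sigma> g c = c"
    and M: "lin_rep F H m M" and tE: "\<theta> \<in> E" and inj: "inj_on (\<lambda>g. \<sigma> g \<theta>) (carrier H)"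
  obtains c d where
    "\<And>i j. i < m \<Longrightarrow> j < m \<Longrightarrow> c i j \<in> E" "\<And>i j. i < m \<Longrightarrow> j < m \<Longrightarrow> d i j \<in> E"
    "\<And>i j. i < m \<Longrightarrow> j < m \<Longrightarrow> (\<Sum>k<m. c i k * d k j) = of_bool (i = j)"
    "\<And>i j. i < m \<Longrightarrow> j < m \<Longrightarrow> (\<Sum>k<m. d i k * c k j) = of_bool (i = j)"
    "\<And>g i l. g \<in> carrier H \<Longrightarrow> i < m \<Longrightarrow> l < m \<Longrightarrow> (\<Sum>j<m. \<sigma> g (c i j) * M g j l) = c i l"
proof -
  interpret group H using act by (simp add: field_action_def)
  have fin: "finite (carrier H)" and hom: "\<And>h. h \<in> carrier H \<Longrightarrow> subfield_hom E (\<sigma> h)"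
    and cl: "\<And>h x. h \<in> carrier H \<Longrightarrow> x \<in> E \<Longrightarrow> \<sigma> h x \<in> E"
    and one: "\<And>x. x \<in> E \<Longrightarrow> \<sigma> \<one>\<^bsub>H\<^esub> x = x"
    and comp: "\<And>g h x. g \<in> carrier H \<Longrightarrow> h \<in> carrier H \<Longrightarrow> x \<in> E \<Longrightarrow> \<sigma> (g \<otimes>\<^bsub>H\<^esub> h) x = \<sigma> g (\<sigma> h x)"
    using act by (auto simp: field_action_def)
  have E: "is_subfield E" using hom[OF one_closed] by (rule subfield_hom_subfield)
  have MF: "g \<in> carrier H \<Longrightarrow> i < m \<Longrightarrow> j < m \<Longrightarrow> M g i j \<in> F" for g i j
    using M by (auto simp: lin_rep_def)
  have ME: "g \<in> carrier H \<Longrightarrow> i < m \<Longrightarrow> j < m \<Longrightarrow> M g i j \<in> E" for g i j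
    using MF FE by blast
  define N where "N = card (carrier H)"
  have N0: "N > 0" unfolding N_def using fin by (auto simp: card_gt_0_iff)
  \<comment> \<open>The parameters are the coefficients of \<open>m * m\<close> polynomials of
    degree below \<open>N\<close> in \<open>\<theta>\<close>, stored in one list.\<close>
  define idx where "idx i j p = (i * m + j) * N + p" for i j p :: nat
  have idx: "idx i j p < m * m * N" if "i < m" "j < m" "p < N" for i j p
  proof -
    have "i * m + j < m * m" using that
      by (metis add.commute add_less_cancel_left less_le_trans mult_Suc mult_le_mono1 Suc_leI)
    then have "(i * m + j + 1) * N \<le> m * m * N" by (intro mult_le_mono1) auto
    then show ?thesis using that by (simp add: idx_def)
  qed
  \<comment> \<open>With natural parameters this is the sum over \<open>g\<close> of the matrix
    products of \<open>\<sigma> g a\<close> and \<open>M g\<close>, where the entries of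
    \<open>a\<close> are polynomials in \<open>\<theta>\<close>.\<close>
  define C where "C lam i l = (\<Sum>g\<in>carrier H. \<Sum>j<m. (\<Sum>p<N. lam ! idx i j p * \<sigma> g \<theta> ^ p) * M g j l)"
    for lam :: "'a list" and i l
  define Cm where "Cm lam = mat m m (\<lambda>(i, l). C lam i l)" for lam
  have Cm: "Cm lam \<in> carrier_mat m m" for lam by (simp add: Cm_def)
  have Cp: "(\<lambda>lam. C lam i l) \<in> polys UNIV (m * m * N)" if "i < m" for i l
    unfolding C_def using that by (intro polys_sum polys.mult polys.coord polys.const idx) auto
  have detp: "(\<lambda>lam. det (Cm lam)) \<in> polys UNIV (m * m * N)"
  proof -
    have *: "det (Cm lam) = (\<Sum>p\<in>{p. p permutes {0..<m}}. signof p * (\<Prod>i = 0..<m. C lam i (p i)))" for lam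
      unfolding det_def'[OF Cm]
      by (intro sum.cong prod.cong refl arg_cong2[of _ _ _ _ "(*)"])
        (auto simp: Cm_def permutes_in_image[of _ "{0..<m}", simplified] dest: permutes_in_image[of _ "{0..<m}", THEN iffD2])
    show ?thesis unfolding *
      by (intro polys_sum polys.mult polys_prod polys.const Cp) simp_all
  qed
  \<comment> \<open>\<open>L\<close> is the interpolation polynomial with value 1 at
    \<open>\<theta>\<close> and 0 at its other conjugates.\<close>
  define q where "q = (\<Prod>h\<in>carrier H - {\<one>\<^bsub>H\<^esub>}. [:- \<sigma> h \<theta>, 1:])"
  define L where "L = smult (inverse (poly q \<theta>)) q"
  have q0: "poly q \<theta> \<noteq> 0"
    unfolding q_def poly_prod using fin inj tE one
    by (auto simp: prod_zero_iff inj_on_def)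
  have L: "(\<Sum>p<N. coeff L p * \<sigma> g \<theta> ^ p) = of_bool (g = \<one>\<^bsub>H\<^esub>)" if g: "g \<in> carrier H" for g
  proof -
    have "degree q \<le> (\<Sum>h\<in>carrier H - {\<one>\<^bsub>H\<^esub>}. degree [:- \<sigma> h \<theta>, 1:])"
      unfolding q_def using fin degree_prod_sum_le[of "carrier H - {\<one>\<^bsub>H\<^esub>}" "\<lambda>h. [:- \<sigma> h \<theta>, 1:]"] by (simp add: o_def)
    also have "\<dots> = N - 1" using fin by (simp add: N_def card_Diff_singleton)
    finally have dL: "degree L < N" unfolding L_def using N0 by (auto intro: le_less_trans[OF degree_smult_le])
    have "(\<Sum>p<N. coeff L p * \<sigma> g \<theta> ^ p) = poly L (\<sigma> g \<theta>)"
      unfolding poly_altdef using dL by (intro sum.mono_neutral_right) (auto simp: coeff_eq_0)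
    also have "\<dots> = of_bool (g = \<one>\<^bsub>H\<^esub>)"
    proof (cases "g = \<one>\<^bsub>H\<^esub>")
      case True
      then show ?thesis using q0 tE one by (simp add: L_def)
    next
      case False
      then have "poly q (\<sigma> g \<theta>) = 0" unfolding q_def poly_prod using g fin by (auto simp: prod_zero_iff)
      then show ?thesis using False by (simp add: L_def)
    qed
    finally show ?thesis .
  qed
  \<comment> \<open>These parameters select \<open>L\<close> on the diagonal and 0 elsewhere, so
    that only the summand of the identity element survives.\<close>
  define lam0 where "lam0 = map (\<lambda>k. of_bool (k div N div m = k div N mod m) * coeff L (k mod N)) [0..<m * m * N]"
  have lam0: "lam0 ! idx i j p = of_bool (i = j) * coeff L p" if "i < m" "j < m" "p < N" for i j p
  proof -
    have "idx i j p div N = i * m + j" "idx i j p mod N = p" using that by (simp_all add: idx_def)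
    then show ?thesis unfolding lam0_def using idx[OF that] that by simp
  qed
  have C0: "C lam0 i l = of_bool (i = l)" if "i < m" "l < m" for i l
  proof -
    have "(\<Sum>p<N. lam0 ! idx i j p * \<sigma> g \<theta> ^ p) = of_bool (i = j) * of_bool (g = \<one>\<^bsub>H\<^esub>)"
      if "g \<in> carrier H" "j < m" for g j
      using L[OF that(1)] lam0[OF \<open>i < m\<close> that(2)] by (simp add: mult.assoc flip: sum_distrib_left)
    then have "C lam0 i l = (\<Sum>g\<in>carrier H. \<Sum>j<m. of_bool (i = j) * (of_bool (g = \<one>\<^bsub>H\<^esub>) * M g j l))"
      unfolding C_def by (intro sum.cong refl) (simp add: mult.assoc)
    also have "\<dots> = (\<Sum>g\<in>carrier H. of_bool (g = \<one>\<^bsub>H\<^esub>) * M g i l)"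
      by (simp only: sum_of_bool_mult(1)[OF that(1)])
    also have "\<dots> = (\<Sum>g\<in>{\<one>\<^bsub>H\<^esub>}. M g i l)"
      using fin by (intro sum.mono_neutral_cong_right) auto
    also have "\<dots> = of_bool (i = l)" using M that by (simp add: lin_rep_def)
    finally show ?thesis .
  qed
  have "Cm lam0 = 1\<^sub>m m" unfolding Cm_def using C0 by (intro eq_matI) auto
  then have "det (Cm lam0) \<noteq> 0" by simp
  moreover have "lam0 \<in> affine_space (m * m * N)" by (simp add: lam0_def affine_space_def)
  \<comment> \<open>The parameters \<open>lam0\<close> need not be fixed by the conjugations, so the
    matrix they give need not be equivariant. Natural parameters with nonzero determinant are fixed,
    and they do yield an equivariant matrix.\<close>
  ultimately obtain w :: "nat list" where w: "length w = m * m * N" "det (Cm (map of_nat w)) \<noteq> 0"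
    using polys_nonzero_nat[OF detp] by blast
  define a where "a i j = (\<Sum>p<N. of_nat (w ! idx i j p) * \<theta> ^ p)" for i j
  define c where "c i l = C (map of_nat w) i l" for i l
  have aE: "a i j \<in> E" for i j unfolding a_def using E tE by (intro subfield_intros)
  have sa: "\<sigma> g (a i j) = (\<Sum>p<N. of_nat (w ! idx i j p) * \<sigma> g \<theta> ^ p)" if "g \<in> carrier H" for g i j
    unfolding a_def using E tE hom[OF that]
    by (subst subfield_hom_sum[OF hom[OF that]])
      (auto simp: subfield_hom_mult subfield_hom_of_nat subfield_hom_power subfield_of_nat subfield_power
        intro!: sum.cong subfield_intros)
  have c: "c i l = (\<Sum>g\<in>carrier H. \<Sum>j<m. \<sigma> g (a i j) * M g j l)" if "i < m" for i l
    unfolding c_def C_def using idx[OF that] w by (intro sum.cong refl) (simp add: sa)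
  have cE: "c i l \<in> E" if "i < m" "l < m" for i l
    unfolding c[OF that(1)] using cl aE ME that by (auto intro!: subfield_sum subfield_mult E)
  define D where "D = det (Cm (map of_nat w))"
  have Cme: "Cm (map of_nat w) $$ (i, l) = c i l" if "i < m" "l < m" for i l
    using that by (simp add: Cm_def c_def)
  have DE: "D \<in> E" unfolding D_def by (rule det_in_subfield[OF Cm E]) (simp add: Cme cE)
  \<comment> \<open>The inverse as adjugate over determinant, which shows that its entries lie in
    \<open>E\<close>.\<close>
  define d where "d i l = adj_mat (Cm (map of_nat w)) $$ (i, l) / D" for i l
  note adj = adj_mat[OF Cm[of "map of_nat w"]]
  show thesis
  proof (rule that[of c d])
    show "c i j \<in> E" if "i < m" "j < m" for i j using cE that by blast
    show "d i j \<in> E" if ij: "i < m" "j < m" for i j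
    proof -
      have "mat_delete (Cm (map of_nat w)) j i \<in> carrier_mat (m - 1) (m - 1)"
        using mat_delete_carrier[OF Cm] by blast
      then have "det (mat_delete (Cm (map of_nat w)) j i) \<in> E"
        by (rule det_in_subfield[OF _ E]) (use ij in \<open>auto simp: mat_delete_def Cm_def simp flip: c_def intro!: cE\<close>)
      then show ?thesis using ij Cm[of "map of_nat w"]
        by (simp add: d_def adj_mat_def cofactor_def subfield_intros E DE)
    qed
    show "(\<Sum>k<m. c i k * d k j) = of_bool (i = j)" if ij: "i < m" "j < m" for i j
    proof -
      have "(Cm (map of_nat w) * adj_mat (Cm (map of_nat w))) $$ (i, j) = (D \<cdot>\<^sub>m 1\<^sub>m m) $$ (i, j)"
        unfolding D_def adj(2) ..
      then have "(\<Sum>k<m. c i k * adj_mat (Cm (map of_nat w)) $$ (k, j)) = D * of_bool (i = j)"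
        using ij Cm[of "map of_nat w"] adj(1) by (simp add: scalar_prod_def Cme lessThan_atLeast0)
      then show ?thesis using w by (simp add: d_def D_def flip: sum_divide_distrib)
    qed
    show "(\<Sum>k<m. d i k * c k j) = of_bool (i = j)" if ij: "i < m" "j < m" for i j
    proof -
      have "(adj_mat (Cm (map of_nat w)) * Cm (map of_nat w)) $$ (i, j) = (D \<cdot>\<^sub>m 1\<^sub>m m) $$ (i, j)"
        unfolding D_def adj(3) ..
      then have "(\<Sum>k<m. adj_mat (Cm (map of_nat w)) $$ (i, k) * c k j) = D * of_bool (i = j)"
        using ij Cm[of "map of_nat w"] adj(1) by (simp add: scalar_prod_def Cme lessThan_atLeast0)
      then show ?thesis using w by (simp add: d_def D_def flip: sum_divide_distrib)
    qed
    show "(\<Sum>j<m. \<sigma> g (c i j) * M g j l) = c i l" if g: "g \<in> carrier H" and i: "i < m" and l: "l < m" for g i l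
    proof -
      have "\<sigma> g (c i j) = (\<Sum>h\<in>carrier H. \<Sum>k<m. \<sigma> (g \<otimes>\<^bsub>H\<^esub> h) (a i k) * M h k j)" if j: "j < m" for j
      proof -
        have in_E: "\<sigma> h (a i k) * M h k j \<in> E" if "h \<in> carrier H" "k < m" for h k
          using cl aE ME that j E by (auto intro: subfield_mult)
        have "\<sigma> g (c i j) = (\<Sum>h\<in>carrier H. \<sigma> g (\<Sum>k<m. \<sigma> h (a i k) * M h k j))"
          unfolding c[OF i] by (rule subfield_hom_sum[OF hom[OF g]]) (use in_E in \<open>auto intro!: subfield_sum E\<close>)
        also have "\<dots> = (\<Sum>h\<in>carrier H. \<Sum>k<m. \<sigma> g (\<sigma> h (a i k) * M h k j))"
          by (intro sum.cong refl subfield_hom_sum[OF hom[OF g]]) (use in_E in auto)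
        also have "\<dots> = (\<Sum>h\<in>carrier H. \<Sum>k<m. \<sigma> (g \<otimes>\<^bsub>H\<^esub> h) (a i k) * M h k j)"
        proof (intro sum.cong refl)
          fix h k assume hk: "h \<in> carrier H" "k \<in> {..<m}"
          then show "\<sigma> g (\<sigma> h (a i k) * M h k j) = \<sigma> (g \<otimes>\<^bsub>H\<^esub> h) (a i k) * M h k j"
            using subfield_hom_mult[OF hom[OF g], of "\<sigma> h (a i k)" "M h k j"] cl[OF hk(1) aE] ME[of h k j] j
              comp[OF g hk(1) aE, of i k] fx[OF g MF[of h k j]] by simp
        qed
        finally show ?thesis .
      qed
      then have "(\<Sum>j<m. \<sigma> g (c i j) * M g j l) =
          (\<Sum>j<m. \<Sum>h\<in>carrier H. \<Sum>k<m. \<sigma> (g \<otimes>\<^bsub>H\<^esub> h) (a i k) * M h k j * M g j l)"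
        by (simp add: sum_distrib_right)
      also have "\<dots> = (\<Sum>h\<in>carrier H. \<Sum>k<m. \<Sum>j<m. \<sigma> (g \<otimes>\<^bsub>H\<^esub> h) (a i k) * M h k j * M g j l)"
        by (subst sum.swap) (intro sum.cong refl sum.swap)
      also have "\<dots> = (\<Sum>h\<in>carrier H. \<Sum>k<m. \<sigma> (g \<otimes>\<^bsub>H\<^esub> h) (a i k) * M (g \<otimes>\<^bsub>H\<^esub> h) k l)"
        using M g l by (intro sum.cong refl) (simp add: lin_rep_def sum_distrib_left mult.assoc)
      also have "\<dots> = (\<Sum>h\<in>carrier H. \<Sum>k<m. \<sigma> h (a i k) * M h k l)"
        using sum.reindex_bij_betw[OF bij_betw_mult_left[OF g], of "\<lambda>h. \<Sum>k<m. \<sigma> h (a i k) * M h k l"] .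
      finally show ?thesis by (simp add: c[OF i])
    qed
  qed
qed

lemma eqv_appendD: "eqv F (a @ w) (a' @ w') \<Longrightarrow> length a = length a' \<Longrightarrow> eqv F a a'"
  unfolding eqv_def using polys_append polys_mono[OF _ subset_refl, of _ F "length a" "length (a @ w)"]
  by (metis le_add1 length_append)

lemma subst_map_append:
  assumes F: "is_subfield F" and e: "eqv F (a @ w) (a' @ w')" and l: "length a = length a'"
    and x: "x \<in> fracs F a"
  shows "subst_map F (a @ w) (a' @ w') x = subst_map F a a' x"
proof (rule subst_map_unique[OF F eqv_appendD[OF e l] _ _ _ x])
  have "fracs F a \<subseteq> fracs F (a @ w)"
    using fracs_gens[of "a @ w" F] by (intro fracs_least fracs_subfield fracs_base) auto
  then show "subfield_hom (fracs F a) (subst_map F (a @ w) (a' @ w'))"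
    by (rule subfield_hom_mono[OF subst_map_hom[OF F e] fracs_subfield])
  show "subst_map F (a @ w) (a' @ w') (a ! i) = a' ! i" if "i < length a" for i
    using subst_map_nth[OF F e, of i] that l by (simp add: nth_append)
qed (use subst_map_const[OF F e] in auto)

lemma fracs_mono_append: "fracs F a \<subseteq> fracs F (a @ w)" "fracs F w \<subseteq> fracs F (a @ w)"
  using fracs_gens[of "a @ w" F] by (intro fracs_least fracs_subfield fracs_base; simp)+

lemma linear_change_of_basis:
  fixes c d :: "nat \<Rightarrow> nat \<Rightarrow> 'a :: field" and w :: "'a list"
  assumes dc: "\<And>i j. i < m \<Longrightarrow> j < m \<Longrightarrow> (\<Sum>k<m. d i k * c k j) = of_bool (i = j)" and w: "length w = m"
    and i: "i < m"
  shows "(\<Sum>j<m. d i j * map (\<lambda>i. \<Sum>j<m. c i j * w ! j) [0..<m] ! j) = w ! i"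
proof -
  have "(\<Sum>j<m. d i j * map (\<lambda>i. \<Sum>j<m. c i j * w ! j) [0..<m] ! j) = (\<Sum>j<m. \<Sum>k<m. d i j * c j k * w ! k)"
    by (simp add: sum_distrib_left mult.assoc)
  also have "\<dots> = (\<Sum>k<m. (\<Sum>j<m. d i j * c j k) * w ! k)"
    by (subst sum.swap) (simp add: sum_distrib_right)
  also have "\<dots> = w ! i" using i by (simp add: dc sum_of_bool_mult)
  finally show ?thesis .
qed

text \<open>The no-name lemma: if the action on the coordinates \<open>a\<close> is faithful, then the invariants of
  \<open>F(a, w)\<close> are purely transcendental over those of \<open>F(a)\<close>.\<close>

lemma no_name:
  fixes F :: "'a :: field_char_0 set" and a w :: "'a list"
  assumes F: "is_subfield F" and H: "group H" "finite (carrier H)"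
    and M: "lin_rep F H n M" and M': "lin_rep F H m M'" and i: "indep F (a @ w)"
    and a: "length a = n" and w: "length w = m"
    and faithful: "\<And>g. g \<in> carrier H \<Longrightarrow> g \<noteq> \<one>\<^bsub>H\<^esub> \<Longrightarrow> \<exists>i<n. \<exists>j<n. M g i j \<noteq> of_bool (i = j)"
  obtains c d y where
    "\<And>i j. i < m \<Longrightarrow> j < m \<Longrightarrow> c i j \<in> fracs F a" "\<And>i j. i < m \<Longrightarrow> j < m \<Longrightarrow> d i j \<in> fracs F a"
    "\<And>i j. i < m \<Longrightarrow> j < m \<Longrightarrow> (\<Sum>k<m. c i k * d k j) = of_bool (i = j)"
    "\<And>i j. i < m \<Longrightarrow> j < m \<Longrightarrow> (\<Sum>k<m. d i k * c k j) = of_bool (i = j)"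
    "\<And>g i l. g \<in> carrier H \<Longrightarrow> i < m \<Longrightarrow> l < m \<Longrightarrow>
       (\<Sum>j<m. subst_map F a (mact n M g a) (c i j) * M' g j l) = c i l"
    "y = map (\<lambda>i. \<Sum>j<m. c i j * w ! j) [0..<m]"
    "\<And>s. indep F (a @ w @ s) \<Longrightarrow> indep F (a @ y @ s)"
    "lin_fix F H (dsum n M M') (a @ w) = lin_fix F H (dsum n M triv) (a @ y)"
    "lin_fix F H (dsum n M triv) (a @ y) = fracs (lin_fix F H M a) y"
proof -
  interpret group H by (rule H)
  let ?Ea = "fracs F a" and ?E = "fracs F (a @ w)"
  define \<sigma>a where "\<sigma>a g = subst_map F a (mact n M g a)" for g
  define \<sigma> where "\<sigma> g = subst_map F (a @ w) (mact (n + m) (dsum n M M') g (a @ w))" for g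
  have ia: "indep F a" using indep_appendD1[OF i] .
  have acta: "field_action H ?Ea \<sigma>a"
    and consta: "\<And>g c. g \<in> carrier H \<Longrightarrow> c \<in> F \<Longrightarrow> \<sigma>a g c = c"
    and ntha: "\<And>g i. g \<in> carrier H \<Longrightarrow> i < n \<Longrightarrow> \<sigma>a g (a ! i) = (\<Sum>j<n. M g i j * a ! j)"
    using lin_action[OF F H _ ia, of M] M a unfolding \<sigma>a_def by auto
  have MM: "lin_rep F H (n + m) (dsum n M M')" by (rule lin_rep_dsum[OF F M M'])
  have act: "field_action H ?E \<sigma>"
    and const: "\<And>g c. g \<in> carrier H \<Longrightarrow> c \<in> F \<Longrightarrow> \<sigma> g c = c"
    using lin_action[OF F H _ i, of "dsum n M M'"] MM a w unfolding \<sigma>_def by auto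
  have eqv: "eqv F (a @ w) (mact n M g a @ mact m M' g w)" if "g \<in> carrier H" for g
    using indep_mact[OF F H(1) _ i that, of "dsum n M M'"] MM i a w
    by (auto simp: mact_dsum[OF a w] intro!: indep_eqv)
  have \<sigma>_eq: "\<sigma> g = subst_map F (a @ w) (mact n M g a @ mact m M' g w)" for g
    unfolding \<sigma>_def mact_dsum[OF a w] ..
  have \<sigma>\<sigma>a: "\<sigma> g x = \<sigma>a g x" if "g \<in> carrier H" "x \<in> ?Ea" for g x
    unfolding \<sigma>_eq \<sigma>a_def using subst_map_append[OF F eqv[OF that(1)] _ that(2)] a by simp
  have hom: "subfield_hom ?E (\<sigma> g)" if "g \<in> carrier H" for g using act that by (simp add: field_action_def)
  have \<sigma>w: "\<sigma> g (w ! j) = (\<Sum>l<m. M' g j l * w ! l)" if "g \<in> carrier H" "j < m" for g j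
    unfolding \<sigma>_eq using subst_map_nth[OF F eqv[OF that(1)], of "n + j"] that a w
    by (simp add: nth_append nth_mact)
  \<comment> \<open>Because the coordinates of \<open>a\<close> are independent, \<open>g\<close>
    fixes all of them only if its matrix is the identity.\<close>
  have "\<exists>i<length a. \<sigma>a g (a ! i) \<noteq> a ! i" if g: "g \<in> carrier H" "g \<noteq> \<one>\<^bsub>H\<^esub>" for g
  proof (rule ccontr)
    assume "\<not> ?thesis"
    then have *: "\<sigma>a g (a ! i) = a ! i" if "i < n" for i using that a by auto
    obtain i j where ij: "i < n" "j < n" "M g i j \<noteq> of_bool (i = j)" using faithful[OF g] by auto
    let ?p = "\<lambda>v. (\<Sum>j<n. M g i j * v ! j) - v ! i"
    have m1: "- 1 \<in> F" "0 \<in> F" using F by (auto intro: subfield_intros)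
    have p: "?p \<in> polys F n" using M g ij m1
      by (intro polys_diff polys_sum polys.mult polys.const polys.coord) (auto simp: lin_rep_def)
    have "?p a = 0" using *[OF ij(1)] ntha[OF g(1) ij(1)] by simp
    then have "?p (map (\<lambda>k. of_bool (k = j)) [0..<n]) = 0"
      by (rule indepD[OF ia p a[symmetric]]) simp
    then show False using ij by (simp add: sum_of_bool_mult)
  qed
  then obtain \<theta> where \<theta>: "\<theta> \<in> ?Ea" "inj_on (\<lambda>g. \<sigma>a g \<theta>) (carrier H)"
    using exists_distinct_conjugates[OF acta fracs_gens] by blast
  obtain c d where c: "\<And>i j. i < m \<Longrightarrow> j < m \<Longrightarrow> c i j \<in> ?Ea" and d: "\<And>i j. i < m \<Longrightarrow> j < m \<Longrightarrow> d i j \<in> ?Ea"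
    and cd: "\<And>i j. i < m \<Longrightarrow> j < m \<Longrightarrow> (\<Sum>k<m. c i k * d k j) = of_bool (i = j)"
    and dc: "\<And>i j. i < m \<Longrightarrow> j < m \<Longrightarrow> (\<Sum>k<m. d i k * c k j) = of_bool (i = j)"
    and eq: "\<And>g i l. g \<in> carrier H \<Longrightarrow> i < m \<Longrightarrow> l < m \<Longrightarrow> (\<Sum>j<m. \<sigma>a g (c i j) * M' g j l) = c i l"
    using equivariant_basis[OF acta fracs_base consta M' \<theta>, of thesis] by blast
  define y where "y = map (\<lambda>i. \<Sum>j<m. c i j * w ! j) [0..<m]"
  have ly: "length y = m" by (simp add: y_def)
  have ind: "indep F (a @ y @ s)" if s: "indep F (a @ w @ s)" for s
  proof (rule indep_appendI[OF F ia])
    have ws: "indep ?Ea (w @ s)" using indep_appendD2[OF F s] .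
    have m0: "0 \<in> ?Ea" by (simp add: subfield_zero fracs_subfield)
    show "indep ?Ea (y @ s)"
    proof (rule indep_transform[OF ws, where
          T = "\<lambda>i v. if i < m then \<Sum>j<m. c i j * v ! j else v ! i"])
      fix i assume il: "i < length (y @ s)"
      show "(\<lambda>v. if i < m then \<Sum>j<m. c i j * v ! j else v ! i) \<in> polys ?Ea (length (w @ s))"
        using il c m0 w ly by (cases "i < m") (auto intro!: polys_sum polys.intros)
      show "(y @ s) ! i = (if i < m then \<Sum>j<m. c i j * (w @ s) ! j else (w @ s) ! i)"
        using il w ly by (auto simp: nth_append y_def)
    next
      fix v :: "'a list" assume v: "length v = length (y @ s)"
      let ?u = "map (\<lambda>i. \<Sum>j<m. d i j * v ! j) [0..<m] @ drop m v"
      have "v ! i = (if i < m then \<Sum>j<m. c i j * ?u ! j else ?u ! i)" if "i < length v" for i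
        using linear_change_of_basis[where d = c and c = d and w = "take m v" and i = i, OF cd] that v ly
        by (auto simp: nth_append)
      then show "\<exists>u. length u = length (w @ s) \<and>
          v = map (\<lambda>i. if i < m then \<Sum>j<m. c i j * u ! j else u ! i) [0..<length (y @ s)]"
        using v ly w by (intro exI[of _ ?u]) (auto intro!: nth_equalityI)
    qed
  qed
  have iy: "indep F (a @ y)" using ind[of "[]"] i by simp
  have cE: "c i j \<in> ?E" if "i < m" "j < m" for i j using c[OF that] fracs_mono_append by blast
  have wE: "w ! j \<in> ?E" if "j < m" for j using fracs_gens[of "a @ w" F] that w by auto
  have sety: "set y \<subseteq> ?E" using cE wE by (auto simp: y_def intro!: subfield_sum subfield_mult fracs_subfield)
  have wy: "w ! i = (\<Sum>j<m. d i j * y ! j)" if "i < m" for i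
    using linear_change_of_basis[OF dc w that] by (simp add: y_def)
  \<comment> \<open>The matrix \<open>c\<close> is invertible over \<open>F(a)\<close>, so
    \<open>w\<close> and \<open>y\<close> generate the same field over it.\<close>
  have fields: "fracs F (a @ y) = ?E"
  proof (rule equalityI)
    show "fracs F (a @ y) \<subseteq> ?E" using sety fracs_gens[of "a @ w" F]
      by (intro fracs_least fracs_subfield fracs_base) auto
    have "w ! i \<in> fracs F (a @ y)" if "i < m" for i
      unfolding wy[OF that] using d that ly fracs_mono_append[where a = a and F = F and w = y] fracs_gens[of "a @ y" F]
      by (intro subfield_sum subfield_mult fracs_subfield) auto
    then have "set w \<subseteq> fracs F (a @ y)" using w by (auto simp: in_set_conv_nth)
    then show "?E \<subseteq> fracs F (a @ y)" using fracs_gens[of "a @ y" F]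
      by (intro fracs_least fracs_subfield fracs_base) auto
  qed
  \<comment> \<open>The equivariance of \<open>c\<close> cancels the action on
    \<open>w\<close>.\<close>
  have \<sigma>y: "\<sigma> g (y ! i) = y ! i" if g: "g \<in> carrier H" and i: "i < m" for g i
  proof -
    have "\<sigma> g (y ! i) = (\<Sum>j<m. \<sigma> g (c i j * w ! j))"
      using i cE wE by (simp add: y_def) (rule subfield_hom_sum[OF hom[OF g]], simp add: subfield_mult fracs_subfield)
    also have "\<dots> = (\<Sum>j<m. \<sigma>a g (c i j) * (\<Sum>l<m. M' g j l * w ! l))"
      using g i by (intro sum.cong refl) (simp add: subfield_hom_mult[OF hom[OF g]] cE wE \<sigma>\<sigma>a c \<sigma>w)
    also have "\<dots> = (\<Sum>l<m. (\<Sum>j<m. \<sigma>a g (c i j) * M' g j l) * w ! l)"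
      by (simp add: sum_distrib_left sum_distrib_right mult.assoc) (rule sum.swap)
    also have "\<dots> = y ! i" using i g eq by (simp add: y_def)
    finally show ?thesis .
  qed
  define \<tau> where "\<tau> g = subst_map F (a @ y) (mact (n + m) (dsum n M triv) g (a @ y))" for g
  have Mt: "lin_rep F H (n + m) (dsum n M triv)" by (rule lin_rep_dsum[OF F M lin_rep_triv[OF F]])
  have eqvy: "eqv F (a @ y) (mact n M g a @ y)" if "g \<in> carrier H" for g
    using indep_mact[OF F H(1) _ iy that, of "dsum n M triv"] Mt iy a ly
    by (auto simp: mact_dsum[OF a ly] mact_triv[OF ly] intro!: indep_eqv)
  have \<sigma>\<tau>: "\<sigma> g x = \<tau> g x" if g: "g \<in> carrier H" and x: "x \<in> ?E" for g x
    unfolding \<tau>_def mact_dsum[OF a ly] mact_triv[OF ly]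
  proof (rule subst_map_unique[OF F eqvy[OF g]])
    show "subfield_hom (fracs F (a @ y)) (\<sigma> g)" unfolding fields by (rule hom[OF g])
    show "\<sigma> g ((a @ y) ! i) = (mact n M g a @ y) ! i" if "i < length (a @ y)" for i
    proof (cases "i < n")
      case True
      then have "a ! i \<in> ?Ea" using fracs_gens[of a F] a by auto
      then show ?thesis using True a \<sigma>\<sigma>a[OF g] ntha[OF g] by (simp add: nth_append nth_mact)
    qed (use that a ly g \<sigma>y[of g "i - n"] in \<open>auto simp: nth_append\<close>)
  qed (use x g const fields in auto)
  have L1: "lin_fix F H (dsum n M M') (a @ w) = fixed H ?E \<sigma>"
    unfolding lin_fix_def \<sigma>_def using a w by simp
  have L2: "lin_fix F H (dsum n M triv) (a @ y) = fixed H ?E \<sigma>"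
    unfolding lin_fix_def fixed_def using a ly fields \<sigma>\<tau> by (auto simp: \<tau>_def)
  have L3: "lin_fix F H M a = fixed H ?Ea \<sigma>a"
    unfolding lin_fix_def \<sigma>a_def using a by simp
  let ?D = "fracs (fixed H ?Ea \<sigma>a) y"
  have "fixed H ?E \<sigma> = ?D"
  proof (rule equalityI)
    show "?D \<subseteq> fixed H ?E \<sigma>"
    proof (rule fracs_least[OF fixed_subfield[OF act]])
      show "fixed H ?Ea \<sigma>a \<subseteq> fixed H ?E \<sigma>"
        using fracs_mono_append(1)[of F a w] \<sigma>\<sigma>a by (auto simp: fixed_def)
      show "set y \<subseteq> fixed H ?E \<sigma>" using sety \<sigma>y ly by (auto simp: fixed_def in_set_conv_nth)
    qed
    \<comment> \<open>On a product of an element of \<open>F(a)\<close> and one of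
      \<open>F(y)\<close>, the sum over the group is the trace of the first factor times the second,
      so it lies in the candidate field.\<close>
    let ?R = "prodspan ?Ea (fracs F y)"
    have Ry: "fracs F y \<subseteq> ?E" using fracs_mono_append(2)[where a = a and F = F and w = y] fields by simp
    have Ra: "?Ea \<subseteq> ?E" using fracs_mono_append(1) .
    have \<sigma>fy: "\<sigma> g b = b" if g: "g \<in> carrier H" and b: "b \<in> fracs F y" for g b
    proof (rule subfield_hom_eq[OF _ _ _ _ b])
      show "subfield_hom (fracs F y) (\<sigma> g)" by (rule subfield_hom_mono[OF hom[OF g] fracs_subfield Ry])
      show "subfield_hom (fracs F y) (\<lambda>x. x)" by (simp add: subfield_hom_def fracs_subfield)
    qed (use g const \<sigma>y ly in \<open>auto simp: in_set_conv_nth\<close>)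
    have cl: "\<sigma> g x \<in> ?Ea" if "g \<in> carrier H" "x \<in> ?Ea" for g x
      using acta \<sigma>\<sigma>a[OF that] that by (simp add: field_action_def)
    have RE: "?R \<subseteq> ?E"
    proof
      fix x assume "x \<in> ?R" then show "x \<in> ?E"
        using Ra Ry by induction (auto intro!: subfield_mult subfield_add fracs_subfield)
    qed
    show "fixed H ?E \<sigma> \<subseteq> ?D"
    proof (rule fixed_subset_if_averages[OF act RE])
      show "x * y \<in> ?R" if "x \<in> ?R" "y \<in> ?R" for x y
        by (rule prodspan_mult[OF _ _ that]) (auto intro: subfield_mult fracs_subfield)
      show "1 \<in> ?R" using prodspan.gen[of 1 ?Ea 1 "fracs F y"] by (simp add: subfield_one fracs_subfield)
      show "\<sigma> h x \<in> ?R" if h: "h \<in> carrier H" and x: "x \<in> ?R" for h x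
        using x
      proof induction
        case (gen a b)
        then show ?case using Ra Ry cl[OF h] \<sigma>fy[OF h]
          by (subst subfield_hom_mult[OF hom[OF h]]) (auto intro: prodspan.gen)
      next
        case (add x y)
        then show ?case using RE by (subst subfield_hom_add[OF hom[OF h]]) (auto intro: prodspan.add)
      qed
      show "\<exists>r\<in>?R. \<exists>s\<in>?R. s \<noteq> 0 \<and> e = r / s" if "e \<in> ?E" for e
      proof -
        have in_R: "p (a @ y) \<in> ?R" if "p \<in> polys F (length (a @ y))" for p
        proof (rule prodspan_polys[OF that])
          show "(a @ y) ! i \<in> ?Ea \<union> fracs F y" if "i < length (a @ y)" for i
          proof (cases "i < length a")
            case True
            then show ?thesis using fracs_gens[of a F] by (auto simp: nth_append)
          next
            case False
            then have "y ! (i - length a) \<in> set y" using that by (intro nth_mem) auto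
            then show ?thesis using False fracs_gens[of y F] by (auto simp: nth_append)
          qed
        qed (auto intro: subfield_mult subfield_one fracs_subfield fracs_base[THEN subsetD])
        have "e \<in> fracs F (a @ y)" using that fields by simp
        then obtain p q where "p \<in> polys F (length (a @ y))" "q \<in> polys F (length (a @ y))"
          "q (a @ y) \<noteq> 0" "e = p (a @ y) / q (a @ y)" unfolding fracs_eq[OF F] by blast
        then show ?thesis using in_R by blast
      qed
      show "is_subfield ?D" by (rule fracs_subfield)
      show "(\<Sum>h\<in>carrier H. \<sigma> h r) \<in> ?D" if "r \<in> ?R" for r
        using that
      proof induction
        case (gen x b)
        have "(\<Sum>h\<in>carrier H. \<sigma> h (x * b)) = (\<Sum>h\<in>carrier H. \<sigma>a h x) * b"
          unfolding sum_distrib_right using gen Ra Ry \<sigma>fy \<sigma>\<sigma>a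
          by (intro sum.cong refl) (subst subfield_hom_mult[OF hom], auto)
        moreover have "(\<Sum>h\<in>carrier H. \<sigma>a h x) \<in> fixed H ?Ea \<sigma>a"
          unfolding fixed_def
        proof (intro CollectI conjI ballI)
          have hx: "h \<in> carrier H \<Longrightarrow> \<sigma>a h x \<in> ?Ea" for h using acta gen by (simp add: field_action_def)
          then show "(\<Sum>h\<in>carrier H. \<sigma>a h x) \<in> ?Ea" by (intro subfield_sum fracs_subfield)
          fix g assume g: "g \<in> carrier H"
          have "\<sigma>a g (\<Sum>h\<in>carrier H. \<sigma>a h x) = (\<Sum>h\<in>carrier H. \<sigma>a g (\<sigma>a h x))"
            using acta g hx by (intro subfield_hom_sum[where E = ?Ea]) (auto simp: field_action_def)
          also have "\<dots> = (\<Sum>h\<in>carrier H. \<sigma>a (g \<otimes>\<^bsub>H\<^esub> h) x)"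
            using acta g gen by (intro sum.cong refl) (simp add: field_action_def)
          also have "\<dots> = (\<Sum>h\<in>carrier H. \<sigma>a h x)"
            using sum.reindex_bij_betw[OF bij_betw_mult_left[OF g], of "\<lambda>h. \<sigma>a h x"] .
          finally show "\<sigma>a g (\<Sum>h\<in>carrier H. \<sigma>a h x) = (\<Sum>h\<in>carrier H. \<sigma>a h x)" .
        qed
        moreover have "b \<in> ?D"
        proof -
          have "F \<subseteq> fixed H ?Ea \<sigma>a" using consta fracs_base[of F a] by (auto simp: fixed_def)
          then have "fracs F y \<subseteq> ?D" using fracs_base[of "fixed H ?Ea \<sigma>a" y] fracs_gens[of y]
            by (intro fracs_least fracs_subfield) auto
          then show ?thesis using gen by auto
        qed
        ultimately show ?case using fracs_base[of "fixed H ?Ea \<sigma>a" y]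
          by (auto intro!: subfield_mult fracs_subfield)
      next
        case (add x y)
        have "(\<Sum>h\<in>carrier H. \<sigma> h (x + y)) = (\<Sum>h\<in>carrier H. \<sigma> h x) + (\<Sum>h\<in>carrier H. \<sigma> h y)"
          unfolding sum.distrib[symmetric] using add RE
          by (intro sum.cong refl) (subst subfield_hom_add[OF hom], auto)
        then show ?case using add by (auto intro: subfield_add fracs_subfield)
      qed
    qed
  qed
  then have "lin_fix F H (dsum n M triv) (a @ y) = fracs (lin_fix F H M a) y"
    using L2 L3 by simp
  moreover have "lin_fix F H (dsum n M M') (a @ w) = lin_fix F H (dsum n M triv) (a @ y)"
    using L1 L2 by simp
  ultimately show thesis
    by (intro that[of c d y] c d cd dc eq[unfolded \<sigma>a_def] y_def ind)
qed

section \<open>Saturated sublattices\<close>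

lemma bezout_family:
  fixes f :: "nat \<Rightarrow> int"
  shows "\<exists>h. (\<Sum>k<n. h k * f k) = Gcd (f ` {..<n})"
proof (induction n)
  case (Suc n)
  then obtain h where h: "(\<Sum>k<n. h k * f k) = Gcd (f ` {..<n})" by blast
  obtain u v where uv: "u * Gcd (f ` {..<n}) + v * f n = gcd (Gcd (f ` {..<n})) (f n)"
    using bezout_int by blast
  have "(\<Sum>k<n. (if k < n then u * h k else v) * f k) = u * (\<Sum>k<n. h k * f k)"
    by (simp add: sum_distrib_left mult.assoc)
  then have "(\<Sum>k<Suc n. (if k < n then u * h k else v) * f k) = u * (\<Sum>k<n. h k * f k) + v * f n"
    by simp
  also have "\<dots> = Gcd (f ` {..<Suc n})"
    using uv by (simp add: h lessThan_Suc gcd.commute)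
  finally show ?case by (rule exI[of _ "\<lambda>k. if k < n then u * h k else v"])
qed simp

text \<open>The columns of \<open>b\<close> span the saturation of the lattice spanned by the
  columns of \<open>A\<close>, and the left inverse \<open>e\<close> witnesses the saturation.
  Columns are added one at a time: the new one is made orthogonal to \<open>e\<close> and divided by
  the gcd of its entries.\<close>

lemma lattice_basis:
  fixes A :: "nat \<Rightarrow> nat \<Rightarrow> int"
  shows "\<exists>(r :: nat) b e. (\<forall>i<r. \<forall>j<r. (\<Sum>k<n. e i k * b k j) = of_bool (i = j)) \<and>
    (\<forall>q. (\<forall>j<r. (\<Sum>k<n. q k * b k j) = 0) \<longleftrightarrow> (\<forall>j<s. (\<Sum>k<n. q k * A k j) = 0))"
proof (induction s)
  case 0
  show ?case by (rule exI[of _ "0 :: nat"]) simp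
next
  case (Suc s)
  then obtain r :: nat and b e :: "nat \<Rightarrow> nat \<Rightarrow> int"
    where *: "(\<forall>i<r. \<forall>j<r. (\<Sum>k<n. e i k * b k j) = of_bool (i = j)) \<and>
      (\<forall>q. (\<forall>j<r. (\<Sum>k<n. q k * b k j) = 0) \<longleftrightarrow> (\<forall>j<s. (\<Sum>k<n. q k * A k j) = 0))" by (elim exE)
  have eb: "\<And>i j. i < r \<Longrightarrow> j < r \<Longrightarrow> (\<Sum>k<n. e i k * b k j) = of_bool (i = j)" using * by simp
  have R: "\<And>q. (\<forall>j<r. (\<Sum>k<n. q k * b k j) = 0) \<longleftrightarrow> (\<forall>j<s. (\<Sum>k<n. q k * A k j) = 0)" using * by simp
  \<comment> \<open>The component of the new column that \<open>e\<close> annihilates. On vectors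
    orthogonal to \<open>b\<close> it has the same value as the column itself.\<close>
  define f where "f k = A k s - (\<Sum>i<r. b k i * (\<Sum>l<n. e i l * A l s))" for k
  have ebA: "(\<Sum>k<n. e i k * (\<Sum>i'<r. b k i' * x i')) = x i" if i: "i < r" for i and x :: "nat \<Rightarrow> int"
  proof -
    have "(\<Sum>k<n. e i k * (\<Sum>i'<r. b k i' * x i')) = (\<Sum>i'<r. (\<Sum>k<n. e i k * b k i') * x i')"
      by (simp add: sum_distrib_left sum_distrib_right mult.assoc) (rule sum.swap)
    also have "\<dots> = (\<Sum>i'<r. of_bool (i = i') * x i')" using eb i by simp
    also have "\<dots> = x i" using i by (simp add: of_bool_def if_distrib[of "\<lambda>x. x * _"] cong: if_cong)
    finally show ?thesis .
  qed
  have ef: "(\<Sum>k<n. e i k * f k) = 0" if "i < r" for i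
    using ebA[OF that] by (simp add: f_def right_diff_distrib sum_subtractf)
  have qf: "(\<Sum>k<n. q k * f k) = (\<Sum>k<n. q k * A k s)" if q: "\<forall>j<r. (\<Sum>k<n. q k * b k j) = 0" for q
  proof -
    have "(\<Sum>k<n. q k * (\<Sum>i<r. b k i * x i)) = (\<Sum>i<r. (\<Sum>k<n. q k * b k i) * x i)" for x :: "nat \<Rightarrow> int"
      by (simp add: sum_distrib_left sum_distrib_right mult.assoc) (rule sum.swap)
    then show ?thesis using q by (simp add: f_def right_diff_distrib sum_subtractf)
  qed
  show ?case
  proof (cases "\<forall>k<n. f k = 0")
    case True
    then have "(\<Sum>k<n. q k * A k s) = 0" if "\<forall>j<r. (\<Sum>k<n. q k * b k j) = 0" for q
      using qf[OF that] by simp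
    then have "(\<forall>j<r. (\<Sum>k<n. q k * b k j) = 0) \<longleftrightarrow> (\<forall>j<Suc s. (\<Sum>k<n. q k * A k j) = 0)" for q
      using R by (auto simp: less_Suc_eq)
    then show ?thesis using eb by (intro exI[of _ r] exI[of _ b] exI[of _ e]) auto
  next
    case False
    define g where "g = Gcd (f ` {..<n})"
    have g0: "g \<noteq> 0" using False by (auto simp: g_def)
    define f' where "f' k = f k div g" for k
    have f': "f k = g * f' k" if "k < n" for k using that by (simp add: f'_def g_def)
    obtain h where "(\<Sum>k<n. h k * f k) = g" using bezout_family[of f n] by (auto simp: g_def)
    then have "g * (\<Sum>k<n. h k * f' k) = g" by (simp add: f' sum_distrib_left mult.left_commute)
    then have hf: "(\<Sum>k<n. h k * f' k) = 1" using g0 by simp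
    have "g * (\<Sum>k<n. e i k * f' k) = 0" if "i < r" for i
      using ef[OF that] by (simp add: f' sum_distrib_left mult.left_commute)
    then have ef': "(\<Sum>k<n. e i k * f' k) = 0" if "i < r" for i using g0 that by simp
    define b' where "b' k j = (if j < r then b k j else f' k)" for k j
    \<comment> \<open>The Bezout coefficients \<open>h\<close> give the value 1 on
      \<open>f'\<close>. The correction by the old rows makes the new row vanish on the columns of
      \<open>b\<close>, and it does not change that value because \<open>e\<close> annihilates
      \<open>f'\<close>.\<close>
    define e' where "e' i k = (if i < r then e i k else h k - (\<Sum>i<r. (\<Sum>l<n. h l * b l i) * e i k))" for i k
    have er: "(\<Sum>k<n. e' r k * x k) = (\<Sum>k<n. h k * x k) - (\<Sum>i<r. (\<Sum>l<n. h l * b l i) * (\<Sum>k<n. e i k * x k))"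
      for x :: "nat \<Rightarrow> int"
    proof -
      have "(\<Sum>k<n. (\<Sum>i<r. (\<Sum>l<n. h l * b l i) * e i k) * x k) = (\<Sum>i<r. (\<Sum>l<n. h l * b l i) * (\<Sum>k<n. e i k * x k))"
        unfolding sum_distrib_right sum_distrib_left[of _ "\<lambda>k. e _ k * x k"]
        by (subst sum.swap) (simp add: mult.assoc)
      then show ?thesis by (simp add: e'_def left_diff_distrib sum_subtractf)
    qed
    have eb': "(\<Sum>k<n. e' i k * b' k j) = of_bool (i = j)" if ij: "i < Suc r" "j < Suc r" for i j
    proof (cases "i < r")
      case True
      then show ?thesis using ij eb ef' by (auto simp: e'_def b'_def less_Suc_eq)
    next
      case False
      then have i: "i = r" using ij by simp
      show ?thesis
      proof (cases "j < r")
        case True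
        then have "(\<Sum>i<r. (\<Sum>l<n. h l * b l i) * (\<Sum>k<n. e i k * b k j)) = (\<Sum>l<n. h l * b l j)"
          using eb by (simp add: of_bool_def if_distrib[of "\<lambda>x. _ * x"] cong: if_cong)
        then show ?thesis using True i by (simp add: er b'_def)
      next
        case False
        then show ?thesis using ij i hf ef' by (simp add: er b'_def)
      qed
    qed
    have "(\<forall>j<Suc r. (\<Sum>k<n. q k * b' k j) = 0) \<longleftrightarrow> (\<forall>j<Suc s. (\<Sum>k<n. q k * A k j) = 0)" for q
    proof -
      have "(\<forall>j<Suc r. (\<Sum>k<n. q k * b' k j) = 0) \<longleftrightarrow> (\<forall>j<r. (\<Sum>k<n. q k * b k j) = 0) \<and> (\<Sum>k<n. q k * f' k) = 0"
        by (auto simp: b'_def less_Suc_eq)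
      also have "\<dots> \<longleftrightarrow> (\<forall>j<r. (\<Sum>k<n. q k * b k j) = 0) \<and> (\<Sum>k<n. q k * A k s) = 0"
      proof -
        have "(\<Sum>k<n. q k * f k) = g * (\<Sum>k<n. q k * f' k)"
          by (simp add: f' sum_distrib_left mult.left_commute)
        then show ?thesis using qf[of q] g0 by auto
      qed
      finally show ?thesis using R by (auto simp: less_Suc_eq)
    qed
    then show ?thesis using eb' by (intro exI[of _ "Suc r"] exI[of _ b'] exI[of _ e']) auto
  qed
qed

section \<open>Twisted tori and their torsors\<close>

text \<open>Descent: a family of conjugate polynomials has the same common zeros as the family of its
  averages, which have coefficients in the fixed field.\<close>

inductive_set conj_polys :: "('g, 'b) monoid_scheme \<Rightarrow> 'a :: field set \<Rightarrow> ('g \<Rightarrow> 'a \<Rightarrow> 'a) \<Rightarrow> nat \<Rightarrow>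
    ('g \<Rightarrow> 'a list \<Rightarrow> 'a) set" for H E \<sigma> N where
  gen: "a \<in> E \<Longrightarrow> Q \<in> polys (fixed H E \<sigma>) N \<Longrightarrow> (\<lambda>g u. \<sigma> g a * Q u) \<in> conj_polys H E \<sigma> N"
| add: "P \<in> conj_polys H E \<sigma> N \<Longrightarrow> Q \<in> conj_polys H E \<sigma> N \<Longrightarrow> (\<lambda>g u. P g u + Q g u) \<in> conj_polys H E \<sigma> N"

text \<open>The distinct conjugates of \<open>\<theta>\<close> make the action faithful, so
  \<open>E\<close> is a Galois extension of its fixed field with group \<open>H\<close>.\<close>

locale galois_action =
  fixes H :: "('g, 'b) monoid_scheme" and E :: "'a :: field_char_0 set" and \<sigma> :: "'g \<Rightarrow> 'a \<Rightarrow> 'a" and \<theta> :: 'a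
  assumes act: "field_action H E \<sigma>" and tE: "\<theta> \<in> E" and inj: "inj_on (\<lambda>g. \<sigma> g \<theta>) (carrier H)"
begin

abbreviation "K \<equiv> fixed H E \<sigma>"

sublocale H: group H using act by (simp add: field_action_def)

lemma fin: "finite (carrier H)" and hom: "h \<in> carrier H \<Longrightarrow> subfield_hom E (\<sigma> h)"
  and cl: "h \<in> carrier H \<Longrightarrow> x \<in> E \<Longrightarrow> \<sigma> h x \<in> E" and one: "x \<in> E \<Longrightarrow> \<sigma> \<one>\<^bsub>H\<^esub> x = x"
  and comp: "g \<in> carrier H \<Longrightarrow> h \<in> carrier H \<Longrightarrow> x \<in> E \<Longrightarrow> \<sigma> (g \<otimes>\<^bsub>H\<^esub> h) x = \<sigma> g (\<sigma> h x)"
  using act by (auto simp: field_action_def)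

lemma E: "is_subfield E"
  using hom[OF H.one_closed] by (rule subfield_hom_subfield)

lemma K: "is_subfield K" by (rule fixed_subfield[OF act])

lemma KE: "K \<subseteq> E" by (auto simp: fixed_def)

lemma conj_const: "a \<in> E \<Longrightarrow> (\<lambda>g u. \<sigma> g a) \<in> conj_polys H E \<sigma> N"
  using conj_polys.gen[of a E "\<lambda>_. 1" H \<sigma> N] K by (simp add: polys.const subfield_one)

text \<open>Nothing is known about \<open>\<sigma>\<close> outside the carrier, so families are
  compared on the carrier only.\<close>

definition conj_family :: "nat \<Rightarrow> ('g \<Rightarrow> 'a list \<Rightarrow> 'a) \<Rightarrow> bool" where
  "conj_family N P \<longleftrightarrow> (\<exists>Q \<in> conj_polys H E \<sigma> N. \<forall>g\<in>carrier H. \<forall>u. P g u = Q g u)"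

lemma conj_family_const: "a \<in> E \<Longrightarrow> conj_family N (\<lambda>g u. \<sigma> g a)"
  unfolding conj_family_def by (auto intro!: bexI[OF _ conj_const])

lemma conj_family_poly: "Q \<in> polys K N \<Longrightarrow> conj_family N (\<lambda>g. Q)"
  unfolding conj_family_def
  using conj_polys.gen[of 1 E Q H \<sigma> N] E subfield_hom_one[OF hom]
  by (intro bexI[of _ "\<lambda>g u. \<sigma> g 1 * Q u"]) (auto simp: subfield_one)

lemma conj_family_add: "conj_family N P \<Longrightarrow> conj_family N Q \<Longrightarrow> conj_family N (\<lambda>g u. P g u + Q g u)"
  unfolding conj_family_def by (metis (no_types, lifting) conj_polys.add)

lemma conj_family_gen_mult:
  assumes "Q \<in> conj_polys H E \<sigma> N" "a \<in> E" "p \<in> polys K N"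
  shows "conj_family N (\<lambda>g u. \<sigma> g a * p u * Q g u)"
  using assms(1)
proof induction
  case (gen a' q)
  show ?case unfolding conj_family_def
  proof (intro bexI ballI allI)
    show "(\<lambda>g u. \<sigma> g (a * a') * (p u * q u)) \<in> conj_polys H E \<sigma> N"
      using gen assms E by (intro conj_polys.gen polys.mult subfield_mult)
  qed (use gen assms in \<open>simp add: subfield_hom_mult[OF hom]\<close>)
next
  case (add P Q)
  show ?case using conj_family_add[OF add.IH] by (simp add: distrib_left)
qed

lemma conj_family_mult:
  assumes P: "conj_family N P" and Q: "conj_family N Q"
  shows "conj_family N (\<lambda>g u. P g u * Q g u)"
proof -
  obtain P' Q' where *: "P' \<in> conj_polys H E \<sigma> N" "\<forall>g\<in>carrier H. \<forall>u. P g u = P' g u"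
      "Q' \<in> conj_polys H E \<sigma> N" "\<forall>g\<in>carrier H. \<forall>u. Q g u = Q' g u"
    using P Q by (auto simp: conj_family_def)
  from *(1) have "conj_family N (\<lambda>g u. P' g u * Q' g u)"
  proof induction
    case (gen a q)
    show ?case by (rule conj_family_gen_mult[OF *(3) gen])
  next
    case (add P Q)
    show ?case using conj_family_add[OF add.IH] by (simp add: distrib_right)
  qed
  then show ?thesis using *(2,4) by (simp add: conj_family_def)
qed

lemma conj_family_power: "conj_family N P \<Longrightarrow> conj_family N (\<lambda>g u. P g u ^ k)"
  using conj_family_poly[of "\<lambda>_. 1"] K
  by (induction k) (auto intro: conj_family_mult polys.const subfield_one)

lemma conj_family_sum: "(\<And>i. i \<in> A \<Longrightarrow> conj_family N (P i)) \<Longrightarrow> conj_family N (\<lambda>g u. \<Sum>i\<in>A. P i g u)"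
  using conj_family_poly[of "\<lambda>_. 0"] K
  by (induction A rule: infinite_finite_induct) (auto intro: conj_family_add polys.const subfield_zero)

lemma conj_family_prod: "(\<And>i. i \<in> A \<Longrightarrow> conj_family N (P i)) \<Longrightarrow> conj_family N (\<lambda>g u. \<Prod>i\<in>A. P i g u)"
  using conj_family_poly[of "\<lambda>_. 1"] K
  by (induction A rule: infinite_finite_induct) (auto intro: conj_family_mult polys.const subfield_one)

lemma trace_in_K: "a \<in> E \<Longrightarrow> (\<Sum>g\<in>carrier H. \<sigma> g a) \<in> K"
  unfolding fixed_def
proof (intro CollectI conjI ballI)
  assume a: "a \<in> E"
  then show "(\<Sum>g\<in>carrier H. \<sigma> g a) \<in> E" using cl E by (intro subfield_sum)
  fix h assume h: "h \<in> carrier H"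
  have "\<sigma> h (\<Sum>g\<in>carrier H. \<sigma> g a) = (\<Sum>g\<in>carrier H. \<sigma> h (\<sigma> g a))"
    using cl a by (intro subfield_hom_sum[OF hom[OF h]])
  also have "\<dots> = (\<Sum>g\<in>carrier H. \<sigma> (h \<otimes>\<^bsub>H\<^esub> g) a)" using a h comp by simp
  also have "\<dots> = (\<Sum>g\<in>carrier H. \<sigma> g a)"
    using sum.reindex_bij_betw[OF H.bij_betw_mult_left[OF h], of "\<lambda>g. \<sigma> g a"] .
  finally show "\<sigma> h (\<Sum>g\<in>carrier H. \<sigma> g a) = (\<Sum>g\<in>carrier H. \<sigma> g a)" .
qed

text \<open>The coefficients of the average are traces of elements of \<open>E\<close>, multiplied
  by elements of \<open>K\<close>.\<close>

lemma conj_family_average: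
  assumes "conj_family N P" "b \<in> E"
  shows "(\<lambda>u. \<Sum>g\<in>carrier H. \<sigma> g b * P g u) \<in> polys K N"
proof -
  obtain Q where Q: "Q \<in> conj_polys H E \<sigma> N" "\<And>g u. g \<in> carrier H \<Longrightarrow> P g u = Q g u"
    using assms by (auto simp: conj_family_def)
  from Q(1) have "(\<lambda>u. \<Sum>g\<in>carrier H. \<sigma> g b * Q g u) \<in> polys K N"
  proof induction
    case (gen a q)
    have "(\<Sum>g\<in>carrier H. \<sigma> g b * (\<sigma> g a * q u)) = (\<Sum>g\<in>carrier H. \<sigma> g (b * a)) * q u" for u
      unfolding sum_distrib_right using gen assms
      by (intro sum.cong refl) (simp add: subfield_hom_mult[OF hom] mult.assoc)
    then show ?case using gen assms E by (simp add: polys.intros trace_in_K subfield_mult)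
  next
    case (add P Q)
    then show ?case using polys.add[OF add.IH] by (simp add: distrib_left sum.distrib)
  qed
  then show ?thesis using Q(2) by simp
qed

text \<open>Linear independence of the conjugations: \<open>b\<close> runs through the powers of
  \<open>\<theta>\<close>, and these equations are combined with the coefficients of a polynomial
  that vanishes at all conjugates of \<open>\<theta>\<close> except the one under \<open>h\<close>.
  This isolates \<open>x h\<close>.\<close>

lemma averages_zero:
  assumes "\<And>b. b \<in> E \<Longrightarrow> (\<Sum>g\<in>carrier H. \<sigma> g b * x g) = 0" and h: "h \<in> carrier H"
  shows "x h = 0"
proof -
  define q where "q = (\<Prod>g\<in>carrier H - {h}. [:- \<sigma> g \<theta>, 1:])"
  have q0: "poly q (\<sigma> g \<theta>) = 0" if "g \<in> carrier H" "g \<noteq> h" for g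
    unfolding q_def poly_prod using that fin by (auto simp: prod_zero_iff)
  have qh: "poly q (\<sigma> h \<theta>) \<noteq> 0"
    unfolding q_def poly_prod using fin inj h by (auto simp: prod_zero_iff inj_on_def)
  have "0 = (\<Sum>i\<le>degree q. coeff q i * (\<Sum>g\<in>carrier H. \<sigma> g (\<theta> ^ i) * x g))"
    using assms(1)[of "\<theta> ^ _"] tE E by (simp add: subfield_power)
  also have "\<dots> = (\<Sum>g\<in>carrier H. poly q (\<sigma> g \<theta>) * x g)"
    unfolding poly_altdef sum_distrib_left sum_distrib_right
    by (subst sum.swap) (simp add: subfield_hom_power[OF hom] tE mult.assoc)
  also have "\<dots> = (\<Sum>g\<in>{h}. poly q (\<sigma> g \<theta>) * x g)"
    using fin h q0 by (intro sum.mono_neutral_right) auto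
  finally show ?thesis using qh by simp
qed

lemma zclosed_conj_families:
  assumes FS: "\<And>P. P \<in> FS \<Longrightarrow> conj_family N P"
  shows "zclosed K N {u \<in> affine_space N. \<forall>P\<in>FS. \<forall>g\<in>carrier H. P g u = 0}"
  unfolding zclosed_def
proof (intro exI conjI)
  let ?S = "{(\<lambda>u. \<Sum>g\<in>carrier H. \<sigma> g b * P g u) |P b. P \<in> FS \<and> b \<in> E}"
  show "?S \<subseteq> polys K N" using FS conj_family_average by auto
  show "{u \<in> affine_space N. \<forall>P\<in>FS. \<forall>g\<in>carrier H. P g u = 0} = {u \<in> affine_space N. \<forall>p\<in>?S. p u = 0}"
  proof (intro Collect_cong conj_cong refl iffI ballI)
    fix u p assume "\<forall>P\<in>FS. \<forall>g\<in>carrier H. P g u = 0" "p \<in> ?S"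
    then show "p u = 0" by auto
  next
    fix u P g assume *: "\<forall>p\<in>?S. p u = 0" "P \<in> FS" "g \<in> carrier H"
    show "P g u = 0"
    proof (rule averages_zero[OF _ *(3), of "\<lambda>g. P g u"])
      fix b assume "b \<in> E"
      then have "(\<lambda>u. \<Sum>g\<in>carrier H. \<sigma> g b * P g u) \<in> ?S" using *(2) by blast
      from bspec[OF *(1) this] show "(\<Sum>g\<in>carrier H. \<sigma> g b * P g u) = 0" .
    qed
  qed
qed

text \<open>As \<open>\<sigma> h\<close> is a homomorphism on \<open>E\<close> only, the
  coefficients are tracked through the product together with their membership in
  \<open>E\<close>.\<close>

lemma hom_coeff_prod:
  assumes h: "h \<in> carrier H"
    and "\<And>i j. i \<in> A \<Longrightarrow> coeff (f i) j \<in> E" "\<And>i j. i \<in> A \<Longrightarrow> \<sigma> h (coeff (f i) j) = coeff (f' i) j"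
  shows "coeff (\<Prod>i\<in>A. f i) j \<in> E \<and> \<sigma> h (coeff (\<Prod>i\<in>A. f i) j) = coeff (\<Prod>i\<in>A. f' i) j"
  using assms(2,3)
proof (induction A arbitrary: j rule: infinite_finite_induct)
  case (insert a A)
  have in_E: "coeff (f a) i \<in> E" "coeff (\<Prod>i\<in>A. f i) i \<in> E" for i using insert by auto
  have "\<sigma> h (coeff (f a * (\<Prod>i\<in>A. f i)) j) = (\<Sum>i\<le>j. \<sigma> h (coeff (f a) i * coeff (\<Prod>i\<in>A. f i) (j - i)))"
    unfolding coeff_mult by (rule subfield_hom_sum[OF hom[OF h]]) (simp add: in_E E subfield_mult)
  also have "\<dots> = coeff (f' a * (\<Prod>i\<in>A. f' i)) j"
    unfolding coeff_mult using insert by (intro sum.cong refl) (simp add: subfield_hom_mult[OF hom[OF h]] in_E)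
  finally show ?case using insert(1,2) in_E E
    by (simp add: coeff_mult) (intro subfield_sum subfield_mult E in_E)
qed (use subfield_hom_one[OF hom[OF h]] subfield_hom_zero[OF hom[OF h]] E in \<open>auto simp: coeff_pCons subfield_intros split: nat.splits\<close>)

text \<open>The group permutes the polynomials \<open>X ^ N - \<sigma> h (z ^ N)\<close>, so their
  product has coefficients in \<open>K\<close>, and \<open>z\<close> is a root of the factor of the
  identity.\<close>

lemma root_algebraic:
  assumes z: "z ^ N \<in> E" and N: "N > 0"
  shows "z \<in> algebraic_closure_of K"
proof -
  define f where "f h = monom 1 N - [:\<sigma> h (z ^ N):]" for h
  define P where "P = (\<Prod>h\<in>carrier H. f h)"
  have cf: "coeff (f h) j = (if j = N then 1 else 0) - (if j = 0 then \<sigma> h (z ^ N) else 0)" for h j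
    by (auto simp: f_def coeff_pCons split: nat.splits)
  have "coeff P j \<in> K" for j
    unfolding fixed_def
  proof (intro CollectI conjI ballI)
    have fE: "coeff (f h) j \<in> E" if "h \<in> carrier H" for h j
      using E cl[OF that z] by (auto simp: cf intro!: subfield_intros)
    have sf: "\<sigma> g (coeff (f h) j) = coeff (f (g \<otimes>\<^bsub>H\<^esub> h)) j" if g: "g \<in> carrier H" and h: "h \<in> carrier H" for g h j
      using E cl[OF h z] by (auto simp: cf subfield_hom_diff[OF hom[OF g]] subfield_hom_one[OF hom[OF g]]
        subfield_hom_zero[OF hom[OF g]] subfield_one subfield_zero comp[OF g h z])
    show "coeff P j \<in> E"
      unfolding P_def using hom_coeff_prod[OF H.one_closed fE sf[OF H.one_closed], of "carrier H"] by simp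
    fix g assume g: "g \<in> carrier H"
    have "\<sigma> g (coeff P j) = coeff (\<Prod>h\<in>carrier H. f (g \<otimes>\<^bsub>H\<^esub> h)) j"
      unfolding P_def using hom_coeff_prod[OF g fE sf[OF g], of "carrier H"] by simp
    also have "(\<Prod>h\<in>carrier H. f (g \<otimes>\<^bsub>H\<^esub> h)) = P"
      unfolding P_def using prod.reindex_bij_betw[OF H.bij_betw_mult_left[OF g], of f] .
    finally show "\<sigma> g (coeff P j) = coeff P j" .
  qed
  moreover have "P \<noteq> 0"
  proof -
    have "coeff (f h) N = 1" for h using N by (simp add: cf)
    then have "f h \<noteq> 0" for h by (metis coeff_0 zero_neq_one)
    then show ?thesis using fin by (auto simp: P_def prod_zero_iff)
  qed
  moreover have "poly P z = 0"
  proof -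
    have "poly (f \<one>\<^bsub>H\<^esub>) z = 0" using z one by (simp add: f_def poly_monom)
    then show ?thesis using fin H.one_closed by (auto simp: P_def poly_prod prod_zero_iff)
  qed
  ultimately show ?thesis by (auto simp: algebraic_closure_of_def)
qed

lemma E_algebraic: "E \<subseteq> algebraic_closure_of K"
  using root_algebraic[of _ 1] by auto

end

section \<open>Monomials with integer exponents\<close>

lemma power_int_sum_exponents: "x \<noteq> 0 \<Longrightarrow> (\<Prod>k\<in>A. x powi f k) = x powi (\<Sum>k\<in>A. f k)"
  for x :: "'a :: field"
  by (induction A rule: infinite_finite_induct) (auto simp: power_int_add)

lemma prod_power_int: "(\<Prod>j\<in>A. y j) powi q = (\<Prod>j\<in>A. y j powi q)" for y :: "'b \<Rightarrow> 'a :: field"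
  by (induction A rule: infinite_finite_induct) (auto simp: power_int_mult_distrib)

text \<open>Composing monomial maps multiplies their exponent matrices.\<close>

lemma prod_power_int_matrix:
  fixes x :: "nat \<Rightarrow> 'a :: field"
  assumes "\<And>j. j < r \<Longrightarrow> x j \<noteq> 0"
  shows "(\<Prod>k<n. (\<Prod>j<r. x j powi B k j) powi q k) = (\<Prod>j<r. x j powi (\<Sum>k<n. B k j * q k))"
proof -
  have "(\<Prod>k<n. (\<Prod>j<r. x j powi B k j) powi q k) = (\<Prod>j<r. \<Prod>k<n. x j powi (B k j * q k))"
    by (simp add: prod_power_int power_int_mult) (rule prod.swap)
  also have "\<dots> = (\<Prod>j<r. x j powi (\<Sum>k<n. B k j * q k))"
    using assms by (intro prod.cong refl power_int_sum_exponents) auto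
  finally show ?thesis .
qed

text \<open>On a torus that is embedded by coordinates together with their inverses, this turns
  Laurent monomials into polynomials.\<close>

lemma power_int_split: "z * z' = 1 \<Longrightarrow> z powi q = z ^ nat q * z' ^ nat (- q)" for z :: "'a :: field"
  by (cases "q \<ge> 0") (auto simp: power_int_def field_simps power_mult_distrib[symmetric] dest: inverse_unique)

lemma fprodI: "x \<in> A \<Longrightarrow> y \<in> B \<Longrightarrow> x @ y \<in> fprod A B"
  and fprodE: "w \<in> fprod A B \<Longrightarrow> (\<And>x y. w = x @ y \<Longrightarrow> x \<in> A \<Longrightarrow> y \<in> B \<Longrightarrow> P) \<Longrightarrow> P"
  by (auto simp: fprod_def)

text \<open>The group permutes \<open>n\<close> multiplicative coordinates semilinearly, and the
  equivariant matrix \<open>c\<close> turns them into coordinates over \<open>K\<close>. The matrix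
  \<open>b\<close> holds the exponents of a monomial parametrization by \<open>r\<close> variables;
  its left inverse \<open>e\<close> makes it an isomorphism onto the torus cut out by the relations
  orthogonal to \<open>b\<close>. The assumption \<open>R_stable\<close> says that the group
  preserves these relations.\<close>

locale twisted_torus = galois_action +
  fixes n r :: nat and c d :: "nat \<Rightarrow> nat \<Rightarrow> 'c" and \<pi> :: "'a \<Rightarrow> nat \<Rightarrow> nat" and b e :: "nat \<Rightarrow> nat \<Rightarrow> int"
  assumes cE: "i < n \<Longrightarrow> j < n \<Longrightarrow> c i j \<in> E" and dE: "i < n \<Longrightarrow> j < n \<Longrightarrow> d i j \<in> E"
    and cd: "i < n \<Longrightarrow> j < n \<Longrightarrow> (\<Sum>k<n. c i k * d k j) = of_bool (i = j)"
    and dc: "i < n \<Longrightarrow> j < n \<Longrightarrow> (\<Sum>k<n. d i k * c k j) = of_bool (i = j)"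
    and perm: "g \<in> carrier H \<Longrightarrow> k < n \<Longrightarrow> \<pi> g k < n"
    and perm_comp: "g \<in> carrier H \<Longrightarrow> h \<in> carrier H \<Longrightarrow> k < n \<Longrightarrow> \<pi> (g \<otimes>\<^bsub>H\<^esub> h) k = \<pi> g (\<pi> h k)"
    and perm_one: "k < n \<Longrightarrow> \<pi> \<one>\<^bsub>H\<^esub> k = k"
    and c_equiv: "g \<in> carrier H \<Longrightarrow> i < n \<Longrightarrow> j < n \<Longrightarrow> \<sigma> g (c i j) = c i (\<pi> g j)"
    and eb: "i < r \<Longrightarrow> j < r \<Longrightarrow> (\<Sum>k<n. e i k * b k j) = of_bool (i = j)"
    and R_stable: "g \<in> carrier H \<Longrightarrow> (\<forall>j<r. (\<Sum>k<n. q k * b k j) = 0) \<Longrightarrow> (\<forall>j<r. (\<Sum>k<n. q (\<pi> g k) * b k j) = 0)"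
begin

definition rel :: "(nat \<Rightarrow> int) \<Rightarrow> bool" where
  "rel q \<longleftrightarrow> (\<forall>j<r. (\<Sum>k<n. q k * b k j) = 0)"

definition pw :: "(nat \<Rightarrow> 'c) \<Rightarrow> (nat \<Rightarrow> int) \<Rightarrow> 'c" where
  "pw \<zeta> q = (\<Prod>k<n. \<zeta> k powi q k)"

definition Z :: "'c list \<Rightarrow> nat \<Rightarrow> 'c" where
  "Z u k = (\<Sum>j<n. d k j * u ! j)"

definition Z' :: "'c list \<Rightarrow> nat \<Rightarrow> 'c" where
  "Z' u k = (\<Sum>j<n. d k j * u ! (n + j))"

text \<open>Inverse of the passage from a point to \<open>Z\<close> and \<open>Z'\<close>. Points
  are stored in the coordinates in which the equations have coefficients in
  \<open>K\<close>.\<close>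

definition enc :: "(nat \<Rightarrow> 'c) \<Rightarrow> (nat \<Rightarrow> 'c) \<Rightarrow> 'c list" where
  "enc \<zeta> \<xi> = map (\<lambda>i. \<Sum>j<n. c i j * \<zeta> j) [0..<n] @ map (\<lambda>i. \<Sum>j<n. c i j * \<xi> j) [0..<n]"

text \<open>In the coordinates \<open>\<zeta> = Z u\<close>, the variety \<open>Y \<tau>\<close> is the coset of \<open>\<tau>\<close> under the subtorus of
  \<open>\<G>\<^sub>m\<^sup>n\<close> that is cut out by the characters in \<open>rel\<close>; \<open>Z' u\<close> are the inverse coordinates.\<close>

definition Y :: "(nat \<Rightarrow> 'c) \<Rightarrow> 'c list set" where
  "Y \<tau> = {u. length u = 2 * n \<and> (\<forall>k<n. Z u k * Z' u k = 1) \<and> (\<forall>q. rel q \<longrightarrow> pw (Z u) q = pw \<tau> q)}"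

text \<open>The conditions under which the coset of \<open>\<tau>\<close> descends to
  \<open>K\<close>: the values of the relations are conjugated compatibly with the permutation. The
  condition on powers makes the coordinates of \<open>\<tau>\<close> algebraic over
  \<open>K\<close>.\<close>

definition equivariant :: "(nat \<Rightarrow> 'c) \<Rightarrow> bool" where
  "equivariant \<tau> \<longleftrightarrow> (\<forall>k<n. \<tau> k \<noteq> 0 \<and> (\<exists>N>0. \<tau> k ^ N \<in> E)) \<and>
     (\<forall>q. rel q \<longrightarrow> pw \<tau> q \<in> E \<and> (\<forall>g\<in>carrier H. \<sigma> g (pw \<tau> (\<lambda>k. q (\<pi> g k))) = pw \<tau> q))"

lemma rel_perm: "g \<in> carrier H \<Longrightarrow> rel q \<Longrightarrow> rel (\<lambda>k. q (\<pi> g k))"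
  using R_stable by (simp add: rel_def)

lemma bij_perm: "g \<in> carrier H \<Longrightarrow> bij_betw (\<pi> g) {..<n} {..<n}"
  by (rule bij_betwI[where g = "\<pi> (inv\<^bsub>H\<^esub> g)"]) (auto simp: perm perm_comp[symmetric] perm_one)

lemma length_enc [simp]: "length (enc \<zeta> \<xi>) = 2 * n"
  by (simp add: enc_def)

lemma Z_enc: "k < n \<Longrightarrow> Z (enc \<zeta> \<xi>) k = \<zeta> k" "k < n \<Longrightarrow> Z' (enc \<zeta> \<xi>) k = \<xi> k"
  using linear_change_of_basis[where w = "map \<zeta> [0..<n]" and c = c and d = d and i = k, OF dc]
    linear_change_of_basis[where w = "map \<xi> [0..<n]" and c = c and d = d and i = k, OF dc]
  by (simp_all add: Z_def Z'_def enc_def nth_append)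

lemma enc_Z: assumes "length u = 2 * n" shows "enc (Z u) (Z' u) = u"
proof -
  have 1: "(\<Sum>j<n. c i j * Z u j) = u ! i" if "i < n" for i
    using linear_change_of_basis[where w = "take n u" and c = d and d = c and i = i, OF cd] that assms
    by (simp add: Z_def)
  have 2: "(\<Sum>j<n. c i j * Z' u j) = u ! (n + i)" if "i < n" for i
    using linear_change_of_basis[where w = "drop n u" and c = d and d = c and i = i, OF cd] that assms
    by (simp add: Z'_def)
  show ?thesis
  proof (rule nth_equalityI)
    fix i assume "i < length (enc (Z u) (Z' u))"
    then show "enc (Z u) (Z' u) ! i = u ! i"
      using 1[of i] 2[of "i - n"] by (auto simp: enc_def nth_append)
  qed (use assms in simp)
qed

lemma enc_cong: "(\<And>k. k < n \<Longrightarrow> \<zeta> k = \<zeta>' k) \<Longrightarrow> (\<And>k. k < n \<Longrightarrow> \<xi> k = \<xi>' k) \<Longrightarrow> enc \<zeta> \<xi> = enc \<zeta>' \<xi>'"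
  by (simp add: enc_def)

lemma Z_eqI: "length u = 2 * n \<Longrightarrow> length v = 2 * n \<Longrightarrow> (\<And>k. k < n \<Longrightarrow> Z u k = Z v k) \<Longrightarrow>
    (\<And>k. k < n \<Longrightarrow> Z' u k = Z' v k) \<Longrightarrow> u = v"
  using enc_cong[of "Z u" "Z v" "Z' u" "Z' v"] by (simp add: enc_Z)

lemma pw_cong: "(\<And>k. k < n \<Longrightarrow> \<zeta> k = \<zeta>' k) \<Longrightarrow> pw \<zeta> q = pw \<zeta>' q"
  by (simp add: pw_def)

lemma pw_mult: "pw (\<lambda>k. \<zeta> k * \<xi> k) q = pw \<zeta> q * pw \<xi> q"
  by (simp add: pw_def power_int_mult_distrib prod.distrib)

lemma pw_inverse: "pw (\<lambda>k. inverse (\<zeta> k)) q = inverse (pw \<zeta> q)"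
  by (simp add: pw_def power_int_inverse prod_inversef[symmetric] o_def)

lemma equivariant_one: "equivariant (\<lambda>_. 1)"
  using E subfield_hom_one[OF hom] by (auto simp: equivariant_def pw_def subfield_one intro: exI[of _ 1])

text \<open>As \<open>\<sigma> g\<close> permutes the columns of \<open>c\<close>, uniqueness of the
  inverse matrix forces it to permute the rows of \<open>d\<close>.\<close>

lemma d_equiv:
  assumes g: "g \<in> carrier H" and k: "k < n" and j: "j < n"
  shows "\<sigma> g (d k j) = d (\<pi> g k) j"
proof -
  have 1: "(\<Sum>i<n. d (\<pi> g k) i * \<sigma> g (c i l)) = of_bool (k = l)" if l: "l < n" for l
  proof -
    have "(\<Sum>i<n. d (\<pi> g k) i * \<sigma> g (c i l)) = (\<Sum>i<n. d (\<pi> g k) i * c i (\<pi> g l))"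
      using g l by (intro sum.cong refl) (simp add: c_equiv)
    also have "\<dots> = of_bool (\<pi> g k = \<pi> g l)" using g k l by (intro dc perm)
    also have "\<pi> g k = \<pi> g l \<longleftrightarrow> k = l"
      using bij_perm[OF g] k l by (auto simp: bij_betw_def inj_on_def)
    finally show ?thesis .
  qed
  have "\<sigma> g (d k j) = (\<Sum>l<n. of_bool (k = l) * \<sigma> g (d l j))" using k by (simp only: sum_of_bool_mult)
  also have "\<dots> = (\<Sum>l<n. \<Sum>i<n. d (\<pi> g k) i * (\<sigma> g (c i l) * \<sigma> g (d l j)))"
    by (intro sum.cong refl) (simp add: sum_distrib_right mult.assoc flip: 1)
  also have "\<dots> = (\<Sum>i<n. d (\<pi> g k) i * (\<Sum>l<n. \<sigma> g (c i l) * \<sigma> g (d l j)))"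
    by (subst sum.swap) (simp add: sum_distrib_left)
  also have "\<dots> = (\<Sum>i<n. d (\<pi> g k) i * of_bool (i = j))"
  proof (intro sum.cong refl arg_cong2[of _ _ _ _ "(*)"])
    fix i assume i: "i \<in> {..<n}"
    have "(\<Sum>l<n. \<sigma> g (c i l) * \<sigma> g (d l j)) = (\<Sum>l<n. \<sigma> g (c i l * d l j))"
      using i j cE dE by (intro sum.cong refl) (simp add: subfield_hom_mult[OF hom[OF g]])
    also have "\<dots> = \<sigma> g (\<Sum>l<n. c i l * d l j)"
      using i j cE dE E by (intro subfield_hom_sum[OF hom[OF g], symmetric]) (simp add: subfield_mult)
    also have "\<dots> = of_bool (i = j)"
      using cd[of i j] i j by (simp add: subfield_hom_one[OF hom[OF g]] subfield_hom_zero[OF hom[OF g]] of_bool_def)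
    finally show "(\<Sum>l<n. \<sigma> g (c i l) * \<sigma> g (d l j)) = of_bool (i = j)" .
  qed
  also have "\<dots> = d (\<pi> g k) j" using j by (simp only: sum_of_bool_mult)
  finally show ?thesis .
qed

text \<open>Conjugating the coefficients of the linear forms \<open>Z\<close> and \<open>Z'\<close>
  amounts to permuting the forms.\<close>

lemma Z_conj: "g \<in> carrier H \<Longrightarrow> k < n \<Longrightarrow> (\<Sum>j<n. \<sigma> g (d k j) * u ! j) = Z u (\<pi> g k)"
  "g \<in> carrier H \<Longrightarrow> k < n \<Longrightarrow> (\<Sum>j<n. \<sigma> g (d k j) * u ! (n + j)) = Z' u (\<pi> g k)"
  by (simp_all add: Z_def Z'_def d_equiv)

text \<open>Each equation in the coordinates \<open>Z\<close> and \<open>Z'\<close> has coefficients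
  in \<open>E\<close>, and its conjugates are again equations of \<open>Y \<tau>\<close> because
  \<open>\<tau>\<close> is equivariant. So descent applies.\<close>

lemma zclosed_Y:
  assumes \<tau>: "equivariant \<tau>"
  shows "zclosed K (2 * n) (Y \<tau>)"
proof -
  let ?z = "\<lambda>k g u. \<Sum>j<n. \<sigma> g (d k j) * u ! j" and ?z' = "\<lambda>k g u. \<Sum>j<n. \<sigma> g (d k j) * u ! (n + j)"
  let ?P = "\<lambda>k g u. ?z k g u * ?z' k g u + \<sigma> g (- 1)"
  let ?Q = "\<lambda>q g u. (\<Prod>k<n. ?z k g u ^ nat (q k) * ?z' k g u ^ nat (- q k)) + \<sigma> g (- pw \<tau> q)"
  let ?FS = "{?P k |k. k < n} \<union> {?Q q |q. rel q}"
  have K1: "1 \<in> K" using K by (rule subfield_one)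
  have z: "conj_family (2 * n) (?z k)" "conj_family (2 * n) (?z' k)" if "k < n" for k
    using that dE by (auto intro!: conj_family_sum conj_family_mult conj_family_const conj_family_poly polys.coord)
  have pE: "pw \<tau> q \<in> E" if "rel q" for q using \<tau> that by (simp add: equivariant_def)
  have "conj_family (2 * n) P" if "P \<in> ?FS" for P
    using that z pE E by (auto intro!: conj_family_add conj_family_mult conj_family_prod conj_family_power
        conj_family_const simp: subfield_minus subfield_one)
  from zclosed_conj_families[OF this]
  have "zclosed K (2 * n) {u \<in> affine_space (2 * n). \<forall>P\<in>?FS. \<forall>g\<in>carrier H. P g u = 0}" .
  also have "{u \<in> affine_space (2 * n). \<forall>P\<in>?FS. \<forall>g\<in>carrier H. P g u = 0} = Y \<tau>"
  proof (intro equalityI subsetI)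
    fix u assume u: "u \<in> {u \<in> affine_space (2 * n). \<forall>P\<in>?FS. \<forall>g\<in>carrier H. P g u = 0}"
    have FS: "\<And>P g. P \<in> ?FS \<Longrightarrow> g \<in> carrier H \<Longrightarrow> P g u = 0" using u by simp
    have P: "?P k g u = 0" if "k < n" "g \<in> carrier H" for k g
      by (rule FS[of "?P k" g]) (use that in blast)+
    have Q: "?Q q g u = 0" if "rel q" "g \<in> carrier H" for q g
      by (rule FS[of "?Q q" g]) (use that in blast)+
    have zz: "Z u k * Z' u k = 1" if "k < n" for k
      using P[OF that H.one_closed] that E
      by (simp add: Z_conj[OF H.one_closed that] perm_one one subfield_minus subfield_one)
    have "pw (Z u) q = pw \<tau> q" if q: "rel q" for q
    proof -
      have "pw (Z u) q = (\<Prod>k<n. ?z k \<one>\<^bsub>H\<^esub> u ^ nat (q k) * ?z' k \<one>\<^bsub>H\<^esub> u ^ nat (- q k))"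
        unfolding pw_def
        by (intro prod.cong refl) (simp add: Z_conj[OF H.one_closed] perm_one power_int_split[OF zz])
      then show ?thesis using Q[OF q H.one_closed] pE[OF q] E by (simp add: one subfield_minus)
    qed
    then show "u \<in> Y \<tau>" using u zz by (simp add: Y_def affine_space_def)
  next
    fix u assume u: "u \<in> Y \<tau>"
    have zz: "Z u k * Z' u k = 1" if "k < n" for k using u that by (simp add: Y_def)
    have P: "?P k g u = 0" if "k < n" "g \<in> carrier H" for k g
      using that E by (simp add: Z_conj zz perm subfield_hom_minus[OF hom] subfield_hom_one[OF hom] subfield_one)
    have Q: "?Q q g u = 0" if q: "rel q" and g: "g \<in> carrier H" for q g
    proof -
      \<comment> \<open>The conjugate by \<open>g\<close> of the equation for \<open>q\<close> is
        the equation for \<open>q\<close> transported back along the permutation.\<close>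
      let ?q = "\<lambda>k. q (\<pi> (inv\<^bsub>H\<^esub> g) k)"
      have eqv: "\<sigma> g (pw \<tau> (\<lambda>k. p (\<pi> g k))) = pw \<tau> p" if "rel p" for p
        using \<tau> g that by (simp add: equivariant_def)
      have q': "rel ?q" using rel_perm[OF _ q] g by simp
      have qq: "?q (\<pi> g k) = q k" if "k < n" for k
        using that g by (simp add: perm_comp[symmetric] perm_one)
      have "(\<Prod>k<n. ?z k g u ^ nat (q k) * ?z' k g u ^ nat (- q k)) = (\<Prod>k<n. Z u (\<pi> g k) powi ?q (\<pi> g k))"
        using g by (intro prod.cong refl) (simp add: Z_conj power_int_split[OF zz] perm qq)
      also have "\<dots> = pw (Z u) ?q"
        unfolding pw_def using prod.reindex_bij_betw[OF bij_perm[OF g], of "\<lambda>k. Z u k powi ?q k"] .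
      also have "\<dots> = pw \<tau> ?q" using u q' by (simp add: Y_def)
      also have "\<dots> = \<sigma> g (pw \<tau> (\<lambda>k. ?q (\<pi> g k)))" by (rule eqv[OF q', symmetric])
      also have "pw \<tau> (\<lambda>k. ?q (\<pi> g k)) = pw \<tau> q"
        unfolding pw_def using qq by (intro prod.cong refl) simp
      finally show ?thesis using pE[OF q] by (simp add: subfield_hom_minus[OF hom[OF g]])
    qed
    show "u \<in> {u \<in> affine_space (2 * n). \<forall>P\<in>?FS. \<forall>g\<in>carrier H. P g u = 0}"
      using u P Q by (auto simp: Y_def affine_space_def)
  qed
  finally show ?thesis .
qed

text \<open>The structure constants of the coordinatewise multiplication of \<open>Z\<close>,
  expressed in the coordinates over \<open>K\<close>.\<close>

definition \<kappa> :: "nat \<Rightarrow> nat \<Rightarrow> nat \<Rightarrow> 'c" where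
  "\<kappa> i k l = (\<Sum>j<n. c i j * d j k * d j l)"

text \<open>Conjugation only permutes the summands.\<close>

lemma \<kappa>_in_K:
  assumes "i < n" "k < n" "l < n"
  shows "\<kappa> i k l \<in> K"
  unfolding fixed_def
proof (intro CollectI conjI ballI)
  show "\<kappa> i k l \<in> E" unfolding \<kappa>_def using assms cE dE E by (intro subfield_sum subfield_mult) auto
  fix g assume g: "g \<in> carrier H"
  have "\<sigma> g (\<kappa> i k l) = (\<Sum>j<n. \<sigma> g (c i j * d j k * d j l))"
    unfolding \<kappa>_def by (rule subfield_hom_sum[OF hom[OF g]]) (use assms cE dE E in \<open>auto intro!: subfield_mult\<close>)
  also have "\<dots> = (\<Sum>j<n. c i (\<pi> g j) * d (\<pi> g j) k * d (\<pi> g j) l)"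
    using assms cE dE E g
    by (intro sum.cong refl) (simp add: subfield_hom_mult[OF hom[OF g]] subfield_mult c_equiv d_equiv)
  also have "\<dots> = \<kappa> i k l"
    unfolding \<kappa>_def using sum.reindex_bij_betw[OF bij_perm[OF g], of "\<lambda>j. c i j * d j k * d j l"] .
  finally show "\<sigma> g (\<kappa> i k l) = \<kappa> i k l" .
qed

text \<open>The functions \<open>f\<close> and \<open>h\<close> say where the coordinates of the two
  factors sit in the list \<open>w\<close>, so that the same polynomials serve for the product and
  for the product with one factor inverted.\<close>

definition mulp :: "(nat \<Rightarrow> nat) \<Rightarrow> (nat \<Rightarrow> nat) \<Rightarrow> ('c list \<Rightarrow> 'c) list" where
  "mulp f h = map (\<lambda>i w. \<Sum>k<n. \<Sum>l<n. \<kappa> i k l * (w ! f k * w ! h l)) [0..<n] @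
     map (\<lambda>i w. \<Sum>k<n. \<Sum>l<n. \<kappa> i k l * (w ! f (n + k) * w ! h (n + l))) [0..<n]"

definition mul :: "'c list \<Rightarrow> 'c list \<Rightarrow> 'c list" where
  "mul u v = enc (\<lambda>k. Z u k * Z v k) (\<lambda>k. Z' u k * Z' v k)"

text \<open>The two halves of a point hold its coordinates and those of its inverse, so inversion
  exchanges them.\<close>

definition inv_pt :: "'c list \<Rightarrow> 'c list" where
  "inv_pt u = drop n u @ take n u"

lemma length_mul [simp]: "length (mul u v) = 2 * n"
  by (simp add: mul_def)

lemma Z_mul: "k < n \<Longrightarrow> Z (mul u v) k = Z u k * Z v k" "k < n \<Longrightarrow> Z' (mul u v) k = Z' u k * Z' v k"
  by (simp_all add: mul_def Z_enc)

lemma Z_inv_pt: "length u = 2 * n \<Longrightarrow> k < n \<Longrightarrow> Z (inv_pt u) k = Z' u k"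
  "length u = 2 * n \<Longrightarrow> k < n \<Longrightarrow> Z' (inv_pt u) k = Z u k"
  by (simp_all add: Z_def Z'_def inv_pt_def nth_append)

lemma mulp_polys:
  assumes "\<And>k. k < 2 * n \<Longrightarrow> f k < N" "\<And>k. k < 2 * n \<Longrightarrow> h k < N"
  shows "set (mulp f h) \<subseteq> polys K N"
  unfolding mulp_def using assms \<kappa>_in_K K
  by (auto intro!: polys_sum polys.intros simp: subfield_zero)

lemma mulp_eval:
  assumes "\<And>k. k < 2 * n \<Longrightarrow> w ! f k = u ! k" "\<And>k. k < 2 * n \<Longrightarrow> w ! h k = v ! k"
  shows "map (\<lambda>p. p w) (mulp f h) = mul u v"
proof -
  have *: "(\<Sum>j<n. c i j * ((\<Sum>k<n. d j k * x k) * (\<Sum>l<n. d j l * y l))) =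
      (\<Sum>k<n. \<Sum>l<n. \<kappa> i k l * (x k * y l))" for i and x y :: "nat \<Rightarrow> 'c"
  proof -
    have "(\<Sum>j<n. c i j * ((\<Sum>k<n. d j k * x k) * (\<Sum>l<n. d j l * y l))) =
        (\<Sum>j<n. \<Sum>k<n. \<Sum>l<n. c i j * d j k * d j l * (x k * y l))"
      unfolding sum_product unfolding sum_distrib_left by (intro sum.cong refl) (simp add: mult_ac)
    also have "\<dots> = (\<Sum>k<n. \<Sum>l<n. \<Sum>j<n. c i j * d j k * d j l * (x k * y l))"
      by (subst sum.swap) (intro sum.cong refl sum.swap)
    also have "\<dots> = (\<Sum>k<n. \<Sum>l<n. \<kappa> i k l * (x k * y l))"
      by (simp add: \<kappa>_def sum_distrib_right)
    finally show ?thesis .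
  qed
  show ?thesis
    using assms by (simp add: mulp_def mul_def enc_def Z_def Z'_def *)
qed

definition T :: "'c list monoid" where
  "T = \<lparr>carrier = Y (\<lambda>_. 1), monoid.mult = mul, monoid.one = enc (\<lambda>_. 1) (\<lambda>_. 1)\<rparr>"

lemma T_simps [simp]: "carrier T = Y (\<lambda>_. 1)" "u \<otimes>\<^bsub>T\<^esub> v = mul u v" "\<one>\<^bsub>T\<^esub> = enc (\<lambda>_. 1) (\<lambda>_. 1)"
  by (simp_all add: T_def)

lemma Y_D: "u \<in> Y \<tau> \<Longrightarrow> length u = 2 * n" "u \<in> Y \<tau> \<Longrightarrow> k < n \<Longrightarrow> Z u k * Z' u k = 1"
  "u \<in> Y \<tau> \<Longrightarrow> rel q \<Longrightarrow> pw (Z u) q = pw \<tau> q"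
  by (auto simp: Y_def)

lemma Y_enc: "(\<And>k. k < n \<Longrightarrow> \<zeta> k * \<xi> k = 1) \<Longrightarrow> (\<And>q. rel q \<Longrightarrow> pw \<zeta> q = pw \<tau> q) \<Longrightarrow> enc \<zeta> \<xi> \<in> Y \<tau>"
  using pw_cong[of "Z (enc \<zeta> \<xi>)" \<zeta>] by (simp add: Y_def Z_enc)

lemma mul_Y: "u \<in> Y \<tau> \<Longrightarrow> v \<in> Y \<tau>' \<Longrightarrow> mul u v \<in> Y (\<lambda>k. \<tau> k * \<tau>' k)"
  unfolding mul_def using Y_D(2)[of u \<tau>] Y_D(2)[of v \<tau>']
  by (intro Y_enc) (simp_all add: pw_mult Y_D(3) algebra_simps)

lemma inv_Y:
  assumes u: "u \<in> Y \<tau>"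
  shows "inv_pt u \<in> Y (\<lambda>k. inverse (\<tau> k))"
proof -
  have "Z' u k = inverse (Z u k)" if "k < n" for k
    using Y_D(2)[OF u that] by (metis inverse_unique)
  then have "pw (Z' u) q = inverse (pw (Z u) q)" for q
    unfolding pw_inverse[symmetric] by (intro pw_cong)
  moreover have "pw (Z (inv_pt u)) q = pw (Z' u) q" for q
    using Y_D(1)[OF u] by (intro pw_cong Z_inv_pt)
  ultimately show ?thesis using u
    by (auto simp: Y_def Z_inv_pt pw_inverse mult.commute) (simp add: inv_pt_def)
qed

lemma one_Y: "enc (\<lambda>_. 1) (\<lambda>_. 1) \<in> Y (\<lambda>_. 1)"
  by (rule Y_enc) simp_all

lemma T_group: "group T"
proof (rule groupI)
  show "x \<otimes>\<^bsub>T\<^esub> y \<in> carrier T" if "x \<in> carrier T" "y \<in> carrier T" for x y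
    using mul_Y[of x "\<lambda>_. 1" y "\<lambda>_. 1"] that by simp
  show "\<one>\<^bsub>T\<^esub> \<in> carrier T" using one_Y by simp
  show "x \<otimes>\<^bsub>T\<^esub> y \<otimes>\<^bsub>T\<^esub> z = x \<otimes>\<^bsub>T\<^esub> (y \<otimes>\<^bsub>T\<^esub> z)" for x y z
    unfolding T_simps by (rule Z_eqI) (simp_all add: Z_mul mult.assoc)
  show "\<one>\<^bsub>T\<^esub> \<otimes>\<^bsub>T\<^esub> x = x" if "x \<in> carrier T" for x
    unfolding T_simps by (rule Z_eqI) (use that Y_D(1) in \<open>auto simp: Z_mul Z_enc\<close>)
  show "\<exists>y\<in>carrier T. y \<otimes>\<^bsub>T\<^esub> x = \<one>\<^bsub>T\<^esub>" if x: "x \<in> carrier T" for x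
  proof (rule bexI[of _ "inv_pt x"])
    show "inv_pt x \<in> carrier T" using inv_Y[of x "\<lambda>_. 1"] x by simp
    show "inv_pt x \<otimes>\<^bsub>T\<^esub> x = \<one>\<^bsub>T\<^esub>"
      unfolding T_simps using Y_D(1,2)[of x "\<lambda>_. 1"] x
      by (intro Z_eqI) (simp_all add: Z_mul Z_enc Z_inv_pt mult.commute)
  qed
qed

lemma T_inv:
  assumes "x \<in> carrier T"
  shows "inv\<^bsub>T\<^esub> x = inv_pt x"
proof (rule group.inv_equality[OF T_group])
  show "inv_pt x \<otimes>\<^bsub>T\<^esub> x = \<one>\<^bsub>T\<^esub>"
    unfolding T_simps using Y_D(1,2)[of x "\<lambda>_. 1"] assms
    by (intro Z_eqI) (simp_all add: Z_mul Z_enc Z_inv_pt mult.commute)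
  show "inv_pt x \<in> carrier T" using inv_Y[of x "\<lambda>_. 1"] assms by simp
qed (rule assms)

lemma mul_morphism:
  "morphism K (2 * n + 2 * n) (fprod (Y (\<lambda>_. 1)) (Y \<tau>)) (2 * n) (Y \<tau>) (\<lambda>w. mul (take (2 * n) w) (drop (2 * n) w))"
  unfolding morphism_def
proof (intro conjI exI)
  show "length (mulp (\<lambda>k. k) (\<lambda>k. 2 * n + k)) = 2 * n" by (simp add: mulp_def)
  show "set (mulp (\<lambda>k. k) (\<lambda>k. 2 * n + k)) \<subseteq> polys K (2 * n + 2 * n)" by (rule mulp_polys) auto
  show "\<forall>x\<in>fprod (Y (\<lambda>_. 1)) (Y \<tau>). mul (take (2 * n) x) (drop (2 * n) x) = map (\<lambda>p. p x) (mulp (\<lambda>k. k) (\<lambda>k. 2 * n + k))"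
    by (intro ballI mulp_eval[symmetric]) (auto simp: fprod_def Y_D(1) nth_append)
  show "(\<lambda>w. mul (take (2 * n) w) (drop (2 * n) w)) ` fprod (Y (\<lambda>_. 1)) (Y \<tau>) \<subseteq> Y \<tau>"
    using mul_Y[of _ "\<lambda>_. 1" _ \<tau>] by (auto simp: fprod_def Y_D(1))
qed

lemma T_algebraic_group: "algebraic_group K (2 * n) T"
  unfolding algebraic_group_def
proof (intro conjI)
  show "zclosed K (2 * n) (carrier T)" using zclosed_Y[OF equivariant_one] by simp
  show "group T" by (rule T_group)
  \<comment> \<open>The coordinates of the identity are the row sums of \<open>c\<close>, which the
    group fixes.\<close>
  have "(\<Sum>j<n. c i j) \<in> K" if i: "i < n" for i
    unfolding fixed_def
  proof (intro CollectI conjI ballI)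
    show "(\<Sum>j<n. c i j) \<in> E" using cE i E by (intro subfield_sum) auto
    fix g assume g: "g \<in> carrier H"
    have "\<sigma> g (\<Sum>j<n. c i j) = (\<Sum>j<n. \<sigma> g (c i j))"
      by (rule subfield_hom_sum[OF hom[OF g]]) (use cE i in auto)
    also have "\<dots> = (\<Sum>j<n. c i (\<pi> g j))" using i g by (intro sum.cong refl) (simp add: c_equiv)
    finally have "\<sigma> g (\<Sum>j<n. c i j) = (\<Sum>j<n. c i (\<pi> g j))" .
    then show "\<sigma> g (\<Sum>j<n. c i j) = (\<Sum>j<n. c i j)"
      using sum.reindex_bij_betw[OF bij_perm[OF g], of "c i"] by simp
  qed
  then show "set \<one>\<^bsub>T\<^esub> \<subseteq> K" by (auto simp: enc_def)
  show "morphism K (2 * n + 2 * n) (fprod (carrier T) (carrier T)) (2 * n) (carrier T)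
     (\<lambda>w. take (2 * n) w \<otimes>\<^bsub>T\<^esub> drop (2 * n) w)"
    using mul_morphism[of "\<lambda>_. 1"] by simp
  show "morphism K (2 * n) (carrier T) (2 * n) (carrier T) (\<lambda>t. inv\<^bsub>T\<^esub> t)"
    unfolding morphism_def
  proof (intro conjI exI)
    let ?ps = "map (\<lambda>i w. w ! (n + i)) [0..<n] @ map (\<lambda>i w. w ! i) [0..<n]"
    show "length ?ps = 2 * n" by simp
    show "set ?ps \<subseteq> polys K (2 * n)" by (auto intro!: polys.coord)
    show "\<forall>x\<in>carrier T. inv\<^bsub>T\<^esub> x = map (\<lambda>p. p x) ?ps"
    proof
      fix x assume x: "x \<in> carrier T"
      then have "length x = 2 * n" using Y_D(1) by simp
      then show "inv\<^bsub>T\<^esub> x = map (\<lambda>p. p x) ?ps"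
        unfolding T_inv[OF x] by (auto simp: inv_pt_def nth_append intro!: nth_equalityI)
    qed
    show "(\<lambda>t. inv\<^bsub>T\<^esub> t) ` carrier T \<subseteq> carrier T" using group.inv_closed[OF T_group] by blast
  qed
qed

text \<open>The inverse of \<open>(t, y) \<mapsto> (t y, y)\<close> divides the first component by
  the second: the quotient of two points of \<open>Y \<tau>\<close> takes the value 1 on every
  relation, so it is a point of \<open>T\<close>.\<close>

lemma torsor_Y:
  assumes \<tau>: "equivariant \<tau>"
  shows "torsor K (2 * n) T (2 * n) (Y \<tau>) mul"
  unfolding torsor_def
proof (intro conjI ballI)
  let ?N = "2 * n"
  show "zclosed K ?N (Y \<tau>)" by (rule zclosed_Y[OF \<tau>])
  have "enc \<tau> (\<lambda>k. inverse (\<tau> k)) \<in> Y \<tau>"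
    by (rule Y_enc) (use \<tau> in \<open>auto simp: equivariant_def\<close>)
  then show "Y \<tau> \<noteq> {}" by blast
  show "mul \<one>\<^bsub>T\<^esub> y = y" if "y \<in> Y \<tau>" for y
    by (rule Z_eqI) (use that Y_D(1) in \<open>auto simp: Z_mul Z_enc\<close>)
  show "mul (s \<otimes>\<^bsub>T\<^esub> t) y = mul s (mul t y)" for s t y
    by (rule Z_eqI) (simp_all add: Z_mul mult.assoc)
  show "morphism K (?N + ?N) (fprod (carrier T) (Y \<tau>)) ?N (Y \<tau>) (\<lambda>w. mul (take ?N w) (drop ?N w))"
    using mul_morphism[of \<tau>] by simp
  let ?f = "\<lambda>w. mul (take ?N w) (drop ?N w) @ drop ?N w"
  let ?g = "\<lambda>w. mul (take ?N w) (inv_pt (drop ?N w)) @ drop ?N w"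
  let ?id = "map (\<lambda>i w. w ! (?N + i)) [0..<?N]"
  \<comment> \<open>Reads the second factor with its halves exchanged, that is, inverted.\<close>
  let ?h = "\<lambda>l. if l < n then ?N + (n + l) else ?N + (l - n)"
  have id: "set ?id \<subseteq> polys K (?N + ?N)" by (auto intro!: polys.coord)
  have id_eval: "map (\<lambda>p. p w) ?id = drop ?N w" if "length w = ?N + ?N" for w :: "'c list"
    using that by (auto intro!: nth_equalityI)
  show "isomorphism K (?N + ?N) (fprod (carrier T) (Y \<tau>)) (?N + ?N) (fprod (Y \<tau>) (Y \<tau>)) ?f"
    unfolding isomorphism_def
  proof (intro conjI exI ballI)
    show "morphism K (?N + ?N) (fprod (carrier T) (Y \<tau>)) (?N + ?N) (fprod (Y \<tau>) (Y \<tau>)) ?f"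
      unfolding morphism_def
    proof (intro conjI exI)
      let ?ps = "mulp (\<lambda>k. k) (\<lambda>k. ?N + k) @ ?id"
      show "length ?ps = ?N + ?N" by (simp add: mulp_def)
      show "set ?ps \<subseteq> polys K (?N + ?N)" using id mulp_polys[of "\<lambda>k. k" "?N + ?N" "\<lambda>k. ?N + k"] by auto
      show "\<forall>x\<in>fprod (carrier T) (Y \<tau>). ?f x = map (\<lambda>p. p x) ?ps"
      proof
        fix x assume "x \<in> fprod (carrier T) (Y \<tau>)"
        then have l: "length x = ?N + ?N" by (auto simp: fprod_def Y_D(1))
        have "map (\<lambda>p. p x) (mulp (\<lambda>k. k) (\<lambda>k. ?N + k)) = mul (take ?N x) (drop ?N x)"
          using l by (intro mulp_eval) auto
        then show "?f x = map (\<lambda>p. p x) ?ps" using id_eval[OF l] unfolding map_append by simp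
      qed
      show "?f ` fprod (carrier T) (Y \<tau>) \<subseteq> fprod (Y \<tau>) (Y \<tau>)"
        using mul_Y[of _ "\<lambda>_. 1" _ \<tau>] by (auto elim!: fprodE intro!: fprodI simp: Y_D(1))
    qed
    show "morphism K (?N + ?N) (fprod (Y \<tau>) (Y \<tau>)) (?N + ?N) (fprod (carrier T) (Y \<tau>)) ?g"
      unfolding morphism_def
    proof (intro conjI exI)
      let ?ps = "mulp (\<lambda>k. k) ?h @ ?id"
      show "length ?ps = ?N + ?N" by (simp add: mulp_def)
      show "set ?ps \<subseteq> polys K (?N + ?N)" using id mulp_polys[of "\<lambda>k. k" "?N + ?N" ?h] by auto
      show "\<forall>x\<in>fprod (Y \<tau>) (Y \<tau>). ?g x = map (\<lambda>p. p x) ?ps"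
      proof
        fix x assume "x \<in> fprod (Y \<tau>) (Y \<tau>)"
        then have l: "length x = ?N + ?N" by (auto simp: fprod_def Y_D(1))
        have "map (\<lambda>p. p x) (mulp (\<lambda>k. k) ?h) = mul (take ?N x) (inv_pt (drop ?N x))"
          using l by (intro mulp_eval) (auto simp: inv_pt_def nth_append)
        then show "?g x = map (\<lambda>p. p x) ?ps" using id_eval[OF l] unfolding map_append by simp
      qed
      show "?g ` fprod (Y \<tau>) (Y \<tau>) \<subseteq> fprod (carrier T) (Y \<tau>)"
      proof -
        have "mul x (inv_pt y) \<in> Y (\<lambda>_. 1)" if "x \<in> Y \<tau>" "y \<in> Y \<tau>" for x y
        proof -
          have "mul x (inv_pt y) \<in> Y (\<lambda>k. \<tau> k * inverse (\<tau> k))" by (rule mul_Y[OF that(1) inv_Y[OF that(2)]])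
          moreover have "pw (\<lambda>k. \<tau> k * inverse (\<tau> k)) q = pw (\<lambda>_. 1) q" for q
            using \<tau> by (intro pw_cong) (simp add: equivariant_def)
          ultimately show ?thesis by (simp add: Y_def)
        qed
        then show ?thesis by (auto elim!: fprodE intro!: fprodI simp: Y_D(1))
      qed
    qed
    fix w assume "w \<in> fprod (carrier T) (Y \<tau>)"
    then obtain x y where w: "w = x @ y" "x \<in> Y (\<lambda>_. 1)" "y \<in> Y \<tau>" by (auto simp: fprod_def)
    have "mul (mul x y) (inv_pt y) = x"
      by (rule Z_eqI) (use w Y_D(1)[OF w(2)] Y_D(1,2)[OF w(3)] in \<open>auto simp: Z_mul Z_inv_pt mult.commute mult.left_commute\<close>)
    then show "?g (?f w) = w" using w Y_D(1)[OF w(2)] by simp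
  next
    fix w assume "w \<in> fprod (Y \<tau>) (Y \<tau>)"
    then obtain x y where w: "w = x @ y" "x \<in> Y \<tau>" "y \<in> Y \<tau>" by (auto simp: fprod_def)
    have "mul (mul x (inv_pt y)) y = x"
      by (rule Z_eqI) (use w Y_D(1)[OF w(2)] Y_D(1,2)[OF w(3)] in \<open>auto simp: Z_mul Z_inv_pt mult.commute mult.left_commute\<close>)
    then show "?f (?g w) = w" using w Y_D(1)[OF w(2)] by simp
  qed
qed

end

section \<open>Splitting of the torsor over the algebraic closure\<close>

lemma prod_indep_index: "i < n \<Longrightarrow> (\<Prod>j<n. f j) = f i * (\<Prod>j\<in>{..<n} - {i}. f j)"
  for f :: "nat \<Rightarrow> 'a :: comm_monoid_mult"
  by (rule prod.remove) auto

context twisted_torus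
begin

text \<open>Recovers the parameters of a point of the coset by monomials with exponents
  \<open>e\<close>; the parametrization itself is \<open>bwd\<close>, with exponents
  \<open>b\<close>.\<close>

definition fwd :: "(nat \<Rightarrow> 'c) \<Rightarrow> 'c list \<Rightarrow> 'c list" where
  "fwd \<tau> u = map (\<lambda>i. \<Prod>k<n. (Z u k / \<tau> k) powi e i k) [0..<r] @ map (\<lambda>i. \<Prod>k<n. (Z u k / \<tau> k) powi (- e i k)) [0..<r]"

definition bwd :: "(nat \<Rightarrow> 'c) \<Rightarrow> 'c list \<Rightarrow> 'c list" where
  "bwd \<tau> x = enc (\<lambda>k. \<tau> k * (\<Prod>i<r. x ! i powi b k i)) (\<lambda>k. inverse (\<tau> k) * (\<Prod>i<r. x ! i powi (- b k i)))"

lemma Gm_power_nth: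
  assumes "x \<in> carrier (Gm_power r)" "i < r"
  shows "x ! i * x ! (r + i) = 1" "x ! i \<noteq> 0" "x ! (r + i) = inverse (x ! i)"
proof -
  show 1: "x ! i * x ! (r + i) = 1" using assms by (simp add: Gm_power_def)
  then show "x ! i \<noteq> 0" by auto
  show "x ! (r + i) = inverse (x ! i)" using inverse_unique[OF 1] by simp
qed

lemma fwd_Gm:
  assumes \<tau>: "equivariant \<tau>" and u: "u \<in> Y \<tau>"
  shows "fwd \<tau> u \<in> carrier (Gm_power r)"
proof -
  have "Z u k / \<tau> k \<noteq> 0" if "k < n" for k
    using \<tau> Y_D(2)[OF u that] that by (auto simp: equivariant_def)
  then have "(\<Prod>k<n. (Z u k / \<tau> k) powi e i k) * (\<Prod>k<n. (Z u k / \<tau> k) powi (- e i k)) = 1" for i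
    by (simp add: power_int_minus flip: prod.distrib)
  then show ?thesis by (simp add: Gm_power_def fwd_def nth_append)
qed

lemma pw_monomials:
  assumes x: "\<And>i. i < r \<Longrightarrow> x i \<noteq> 0" and q: "rel q"
  shows "pw (\<lambda>k. \<Prod>i<r. x i powi b k i) q = 1"
proof -
  have "pw (\<lambda>k. \<Prod>i<r. x i powi b k i) q = (\<Prod>i<r. x i powi (\<Sum>k<n. b k i * q k))"
    unfolding pw_def by (rule prod_power_int_matrix) (rule x)
  also have "\<dots> = 1" using q by (intro prod.neutral) (simp add: rel_def mult.commute)
  finally show ?thesis .
qed

lemma bwd_Y:
  assumes \<tau>: "equivariant \<tau>" and x: "x \<in> carrier (Gm_power r)"
  shows "bwd \<tau> x \<in> Y \<tau>"
  unfolding bwd_def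
proof (rule Y_enc)
  fix k assume k: "k < n"
  have "(\<Prod>i<r. x ! i powi b k i) * (\<Prod>i<r. x ! i powi (- b k i)) = 1"
    using Gm_power_nth[OF x] by (simp add: power_int_minus flip: prod.distrib)
  then show "\<tau> k * (\<Prod>i<r. x ! i powi b k i) * (inverse (\<tau> k) * (\<Prod>i<r. x ! i powi (- b k i))) = 1"
    using \<tau> k by (simp add: equivariant_def field_simps)
next
  fix q assume "rel q"
  then show "pw (\<lambda>k. \<tau> k * (\<Prod>i<r. x ! i powi b k i)) q = pw \<tau> q"
    using pw_monomials[of "\<lambda>i. x ! i" q] Gm_power_nth[OF x] by (simp add: pw_mult)
qed

lemma fwd_bwd:
  assumes \<tau>: "equivariant \<tau>" and x: "x \<in> carrier (Gm_power r)"
  shows "fwd \<tau> (bwd \<tau> x) = x"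
proof -
  have Zb: "Z (bwd \<tau> x) k / \<tau> k = (\<Prod>j<r. x ! j powi b k j)" if "k < n" for k
    using that \<tau> by (simp add: bwd_def Z_enc equivariant_def)
  have *: "(\<Prod>k<n. (Z (bwd \<tau> x) k / \<tau> k) powi (s * e i k)) = x ! i powi s" if i: "i < r" for i s
  proof -
    have "(\<Prod>k<n. (Z (bwd \<tau> x) k / \<tau> k) powi (s * e i k)) = (\<Prod>k<n. (\<Prod>j<r. x ! j powi b k j) powi (s * e i k))"
      by (intro prod.cong refl) (simp add: Zb)
    also have "\<dots> = (\<Prod>j<r. x ! j powi (\<Sum>k<n. b k j * (s * e i k)))"
      by (rule prod_power_int_matrix) (rule Gm_power_nth[OF x])
    also have "\<dots> = (\<Prod>j<r. if j = i then x ! i powi s else 1)"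
    proof (intro prod.cong refl)
      fix j assume "j \<in> {..<r}"
      then have "(\<Sum>k<n. e i k * b k j) = of_bool (i = j)" using i eb by simp
      moreover have "(\<Sum>k<n. b k j * (s * e i k)) = s * (\<Sum>k<n. e i k * b k j)"
        by (simp add: sum_distrib_left mult_ac)
      ultimately show "x ! j powi (\<Sum>k<n. b k j * (s * e i k)) = (if j = i then x ! i powi s else 1)" by auto
    qed
    also have "\<dots> = x ! i powi s" using i by simp
    finally show ?thesis .
  qed
  show ?thesis
  proof (rule nth_equalityI)
    show "length (fwd \<tau> (bwd \<tau> x)) = length x" using x by (simp add: fwd_def Gm_power_def)
    fix i assume "i < length (fwd \<tau> (bwd \<tau> x))"
    then have i: "i < 2 * r" by (simp add: fwd_def)
    show "fwd \<tau> (bwd \<tau> x) ! i = x ! i"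
    proof (cases "i < r")
      case True
      then show ?thesis using *[of i 1] by (simp add: fwd_def nth_append)
    next
      case False
      then have "i - r < r" "r + (i - r) = i" using i by auto
      then show ?thesis using *[of "i - r" "- 1"] Gm_power_nth(3)[OF x, of "i - r"] False
        by (simp add: fwd_def nth_append power_int_minus)
    qed
  qed
qed

text \<open>Here the relations are used. The product of \<open>e\<close> and \<open>b\<close> is the
  identity, but that of \<open>b\<close> and \<open>e\<close> is so only up to relations, and on a
  point of \<open>Y \<tau>\<close> divided by \<open>\<tau>\<close> every relation has the value
  1.\<close>

lemma bwd_fwd:
  assumes \<tau>: "equivariant \<tau>" and u: "u \<in> Y \<tau>"
  shows "bwd \<tau> (fwd \<tau> u) = u"
proof -
  define \<xi> where "\<xi> k = Z u k / \<tau> k" for k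
  have nz: "\<xi> k \<noteq> 0" if "k < n" for k
    using \<tau> Y_D(2)[OF u that] that by (auto simp: equivariant_def \<xi>_def)
  have fw: "fwd \<tau> u ! i = (\<Prod>l<n. \<xi> l powi e i l)" if "i < r" for i
    using that by (simp add: fwd_def nth_append \<xi>_def)
  have main: "(\<Prod>i<r. (\<Prod>l<n. \<xi> l powi e i l) powi b k i) = \<xi> k" if k: "k < n" for k
  proof -
    define q where "q l = of_bool (k = l) - (\<Sum>i<r. e i l * b k i)" for l
    have "(\<Sum>l<n. q l * b l j) = 0" if j: "j < r" for j
    proof -
      have "(\<Sum>l<n. (\<Sum>i<r. e i l * b k i) * b l j) = (\<Sum>i<r. (\<Sum>l<n. e i l * b l j) * b k i)"
        unfolding sum_distrib_right by (subst sum.swap) (intro sum.cong refl, simp add: mult_ac)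
      also have "\<dots> = (\<Sum>i<r. of_bool (i = j) * b k i)" using eb j by simp
      also have "\<dots> = b k j" using j by (simp add: of_bool_def if_distrib[of "\<lambda>x. x * _"] cong: if_cong)
      finally show ?thesis
        using k by (simp add: q_def left_diff_distrib sum_subtractf of_bool_def if_distrib[of "\<lambda>x. x * _"] cong: if_cong)
    qed
    then have q: "rel q" by (simp add: rel_def)
    have "pw \<xi> q = pw (Z u) q * inverse (pw \<tau> q)"
      unfolding pw_inverse[symmetric] pw_mult[symmetric] by (intro pw_cong) (simp add: \<xi>_def divide_inverse)
    also have "\<dots> = 1"
    proof -
      have "pw \<tau> q \<noteq> 0" using \<tau> by (auto simp: pw_def equivariant_def prod_zero_iff)
      then show ?thesis using Y_D(3)[OF u q] by simp
    qed
    finally have 1: "(\<Prod>l<n. \<xi> l powi (of_bool (k = l) - (\<Sum>i<r. e i l * b k i))) = 1" by (simp add: pw_def q_def)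
    have 2: "(\<Prod>l<n. \<xi> l powi (of_bool (k = l) - (\<Sum>i<r. e i l * b k i))) =
        (\<Prod>l<n. \<xi> l powi of_bool (k = l)) / (\<Prod>l<n. \<xi> l powi (\<Sum>i<r. e i l * b k i))"
      unfolding prod_dividef[symmetric] using nz by (intro prod.cong refl) (simp add: power_int_diff)
    have 3: "(\<Prod>l<n. \<xi> l powi of_bool (k = l)) = \<xi> k"
      using k by (simp add: of_bool_def if_distrib[of "\<lambda>x. _ powi x"] cong: if_cong)
    have 4: "(\<Prod>i<r. (\<Prod>l<n. \<xi> l powi e i l) powi b k i) = (\<Prod>l<n. \<xi> l powi (\<Sum>i<r. e i l * b k i))"
      by (rule prod_power_int_matrix) (rule nz)
    have "\<xi> k / (\<Prod>l<n. \<xi> l powi (\<Sum>i<r. e i l * b k i)) = 1" using 1 unfolding 2 3 .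
    then show ?thesis unfolding 4 by (simp only: divide_eq_1_iff)
  qed
  show ?thesis
  proof (rule Z_eqI)
    fix k assume k: "k < n"
    have "(\<Prod>i<r. fwd \<tau> u ! i powi b k i) = \<xi> k"
      using main[OF k] by (simp add: fw cong: prod.cong_simp)
    then show 1: "Z (bwd \<tau> (fwd \<tau> u)) k = Z u k"
      using k \<tau> by (simp add: bwd_def Z_enc \<xi>_def equivariant_def)
    have "Z (bwd \<tau> (fwd \<tau> u)) k * Z' (bwd \<tau> (fwd \<tau> u)) k = 1"
      using Y_D(2)[OF bwd_Y[OF \<tau> fwd_Gm[OF \<tau> u]] k] .
    then have "Z u k * Z' (bwd \<tau> (fwd \<tau> u)) k = Z u k * Z' u k" using 1 Y_D(2)[OF u k] by simp
    moreover have "Z u k \<noteq> 0" using Y_D(2)[OF u k] by auto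
    ultimately show "Z' (bwd \<tau> (fwd \<tau> u)) k = Z' u k" by (metis mult_left_cancel)
  qed (use Y_D(1)[OF u] in \<open>simp_all add: bwd_def\<close>)
qed

text \<open>Negative exponents are moved to the inverse coordinates \<open>x ! (r + l)\<close>,
  which makes \<open>bwd\<close> polynomial.\<close>

definition bwdp :: "(nat \<Rightarrow> 'c) \<Rightarrow> nat \<Rightarrow> 'c list \<Rightarrow> 'c" where
  "bwdp \<tau> i x = (if i < n
     then \<Sum>j<n. c i j * (\<tau> j * (\<Prod>l<r. x ! l ^ nat (b j l) * x ! (r + l) ^ nat (- b j l)))
     else \<Sum>j<n. c (i - n) j * (inverse (\<tau> j) * (\<Prod>l<r. x ! l ^ nat (- b j l) * x ! (r + l) ^ nat (b j l))))"

lemma bwdp_polys: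
  assumes "i < 2 * n" "\<And>i j. i < n \<Longrightarrow> j < n \<Longrightarrow> c i j \<in> L" "\<And>j. j < n \<Longrightarrow> \<tau> j \<in> L" "\<And>j. j < n \<Longrightarrow> inverse (\<tau> j) \<in> L"
    "0 \<in> L" "1 \<in> L"
  shows "bwdp \<tau> i \<in> polys L (2 * r)"
proof (cases "i < n")
  case True
  then have "bwdp \<tau> i = (\<lambda>x. \<Sum>j<n. c i j * (\<tau> j * (\<Prod>l<r. x ! l ^ nat (b j l) * x ! (r + l) ^ nat (- b j l))))"
    by (auto simp: bwdp_def)
  then show ?thesis using assms True
    by (auto intro!: polys_sum polys.mult polys.const polys_prod polys_power polys.coord)
next
  case False
  then have "bwdp \<tau> i = (\<lambda>x. \<Sum>j<n. c (i - n) j * (inverse (\<tau> j) * (\<Prod>l<r. x ! l ^ nat (- b j l) * x ! (r + l) ^ nat (b j l))))"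
    by (auto simp: bwdp_def)
  then show ?thesis using assms False
    by (auto intro!: polys_sum polys.mult polys.const polys_prod polys_power polys.coord)
qed

lemma bwdp_eval:
  assumes x: "x \<in> carrier (Gm_power r)"
  shows "map (\<lambda>i. bwdp \<tau> i x) [0..<2 * n] = bwd \<tau> x"
proof (rule nth_equalityI)
  have 1: "x ! l powi q = x ! l ^ nat q * x ! (r + l) ^ nat (- q)" if "l < r" for l q
    by (rule power_int_split) (rule Gm_power_nth(1)[OF x that])
  fix i assume "i < length (map (\<lambda>i. bwdp \<tau> i x) [0..<2 * n])"
  then show "map (\<lambda>i. bwdp \<tau> i x) [0..<2 * n] ! i = bwd \<tau> x ! i"
    by (auto simp: bwdp_def bwd_def enc_def nth_append 1 intro!: sum.cong prod.cong)
qed (simp add: bwd_def)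

text \<open>The constants in \<open>fwd\<close> and \<open>bwd\<close> come from \<open>c\<close>,
  \<open>d\<close>, \<open>\<tau>\<close> and its inverse, all of them algebraic over
  \<open>K\<close>. Hence the torsor splits over the algebraic closure.\<close>

lemma Y_isomorphism:
  assumes \<tau>: "equivariant \<tau>"
  shows "isomorphism (algebraic_closure_of K) (2 * n) (Y \<tau>) (2 * r) (carrier (Gm_power r)) (fwd \<tau>)"
  unfolding isomorphism_def
proof (intro conjI exI ballI)
  let ?L = "algebraic_closure_of K"
  have L: "x \<in> E \<Longrightarrow> x \<in> ?L" for x using E_algebraic by blast
  have L01: "0 \<in> ?L" "1 \<in> ?L" using L E by (auto simp: subfield_zero subfield_one)
  have cL: "c i j \<in> ?L" "d i j \<in> ?L" if "i < n" "j < n" for i j using L cE dE that by auto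
  have \<tau>L: "\<tau> k \<in> ?L" "inverse (\<tau> k) \<in> ?L" if k: "k < n" for k
  proof -
    obtain N where N: "N > 0" "\<tau> k ^ N \<in> E" using \<tau> k by (auto simp: equivariant_def)
    then show "\<tau> k \<in> ?L" using root_algebraic by blast
    have "inverse (\<tau> k) ^ N \<in> E" using N E by (simp add: power_inverse subfield_inverse)
    then show "inverse (\<tau> k) \<in> ?L" using N root_algebraic by blast
  qed
  have Zp: "(\<lambda>u. Z u k) \<in> polys ?L (2 * n)" "(\<lambda>u. Z' u k) \<in> polys ?L (2 * n)" if "k < n" for k
    unfolding Z_def Z'_def using that cL L01 by (auto intro!: polys_sum polys.intros)
  show "morphism ?L (2 * n) (Y \<tau>) (2 * r) (carrier (Gm_power r)) (fwd \<tau>)"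
    unfolding morphism_def
  proof (intro conjI exI)
    let ?p = "\<lambda>s i u. \<Prod>k<n. (Z u k * inverse (\<tau> k)) ^ nat (s * e i k) * (Z' u k * \<tau> k) ^ nat (- (s * e i k))"
    let ?ps = "map (?p 1) [0..<r] @ map (?p (- 1)) [0..<r]"
    show "length ?ps = 2 * r" by simp
    have pp: "?p s i \<in> polys ?L (2 * n)" for s i
      using Zp \<tau>L L01 by (auto intro!: polys_prod polys.mult polys_power polys.const)
    show "set ?ps \<subseteq> polys ?L (2 * n)" using pp[of 1] pp[of "- 1"] by auto
    show "\<forall>u\<in>Y \<tau>. fwd \<tau> u = map (\<lambda>p. p u) ?ps"
    proof
      fix u assume u: "u \<in> Y \<tau>"
      have *: "(Z u k / \<tau> k) powi q = (Z u k * inverse (\<tau> k)) ^ nat q * (Z' u k * \<tau> k) ^ nat (- q)" if "k < n" for k q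
        unfolding divide_inverse using \<tau> Y_D(2)[OF u that] that
        by (intro power_int_split) (simp add: equivariant_def field_simps)
      show "fwd \<tau> u = map (\<lambda>p. p u) ?ps"
        by (simp add: fwd_def * cong: prod.cong_simp)
    qed
    show "fwd \<tau> ` Y \<tau> \<subseteq> carrier (Gm_power r)" using fwd_Gm[OF \<tau>] by blast
  qed
  show "morphism ?L (2 * r) (carrier (Gm_power r)) (2 * n) (Y \<tau>) (bwd \<tau>)"
    unfolding morphism_def
  proof (intro conjI exI)
    show "length (map (bwdp \<tau>) [0..<2 * n]) = 2 * n" by simp
    show "set (map (bwdp \<tau>) [0..<2 * n]) \<subseteq> polys ?L (2 * r)"
      using cL \<tau>L L01 by (auto intro!: bwdp_polys)
    show "\<forall>x\<in>carrier (Gm_power r). bwd \<tau> x = map (\<lambda>p. p x) (map (bwdp \<tau>) [0..<2 * n])"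
      using bwdp_eval[symmetric] by (simp add: o_def)
    show "bwd \<tau> ` carrier (Gm_power r) \<subseteq> Y \<tau>" using bwd_Y[OF \<tau>] by blast
  qed
qed (use bwd_fwd[OF \<tau>] fwd_bwd[OF \<tau>] in auto)

lemma torus_T: "torus K (2 * n) T"
  unfolding torus_def
proof (intro conjI exI bexI)
  show "algebraic_group K (2 * n) T" by (rule T_algebraic_group)
  show "isomorphism (algebraic_closure_of K) (2 * n) (carrier T) (2 * r) (carrier (Gm_power r)) (fwd (\<lambda>_. 1))"
    using Y_isomorphism[OF equivariant_one] by simp
  show "fwd (\<lambda>_. 1) \<in> hom T (Gm_power r)"
  proof (rule homI)
    show "fwd (\<lambda>_. 1) x \<in> carrier (Gm_power r)" if "x \<in> carrier T" for x
      using fwd_Gm[OF equivariant_one] that by simp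
    fix x y
    have "fwd (\<lambda>_. 1) (mul x y) = map2 (*) (fwd (\<lambda>_. 1) x) (fwd (\<lambda>_. 1) y)"
      by (rule nth_equalityI)
        (auto simp: fwd_def nth_append Z_mul power_int_mult_distrib prod.distrib)
    then show "fwd (\<lambda>_. 1) (x \<otimes>\<^bsub>T\<^esub> y) = fwd (\<lambda>_. 1) x \<otimes>\<^bsub>Gm_power r\<^esub> fwd (\<lambda>_. 1) y"
      by (simp add: Gm_power_def)
  qed
qed

end

text \<open>Pulled back to a split torus, a polynomial becomes a polynomial in the parameters and
  their inverses, and a power of the product of all parameters clears the latter.\<close>

lemma Gm_clear:
  fixes p :: "'a :: field list \<Rightarrow> 'a"
  assumes p: "p \<in> polys L l" and q: "\<And>i. i < l \<Longrightarrow> q i \<in> polys L (2 * d)" and L: "1 \<in> L"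
  obtains Q N where "Q \<in> polys L d" "\<And>s. length s = d \<Longrightarrow> (\<Prod>i<d. s ! i) \<noteq> 0 \<Longrightarrow>
    p (map (\<lambda>i. q i (s @ map inverse s)) [0..<l]) * (\<Prod>i<d. s ! i) ^ N = Q s"
proof -
  \<comment> \<open>Both a parameter and its inverse are written as fractions with the product of
    all parameters as denominator.\<close>
  let ?a = "\<lambda>i x. if i < d then x ! i * (\<Prod>j<d. x ! j) else \<Prod>j\<in>{..<d} - {i - d}. x ! j"
  have P: "(\<lambda>x. p (map (\<lambda>i. q i x) [0..<l])) \<in> polys L (2 * d)" by (rule polys_compose[OF p q])
  have a: "?a i \<in> polys L d" if "i < 2 * d" for i
    using that L by (cases "i < d") (auto intro!: polys_prod polys.intros)
  have b: "(\<lambda>x. \<Prod>j<d. x ! j) \<in> polys L d" using L by (intro polys_prod polys.coord) auto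
  obtain Q N where Q: "Q \<in> polys L d" "\<And>x. (\<Prod>j<d. x ! j) \<noteq> 0 \<Longrightarrow>
      (\<lambda>x. p (map (\<lambda>i. q i x) [0..<l])) (map (\<lambda>i. ?a i x / (\<Prod>j<d. x ! j)) [0..<2 * d]) * (\<Prod>j<d. x ! j) ^ N = Q x"
    using polys_clear[where a = ?a, OF P a b L] by blast
  have eq: "map (\<lambda>i. ?a i s / (\<Prod>j<d. s ! j)) [0..<2 * d] = s @ map inverse s"
    if "length s = d" "(\<Prod>i<d. s ! i) \<noteq> 0" for s :: "'a list"
  proof (rule nth_equalityI)
    fix i assume "i < length (map (\<lambda>i. ?a i s / (\<Prod>j<d. s ! j)) [0..<2 * d])"
    then have i: "i < 2 * d" by simp
    show "map (\<lambda>i. ?a i s / (\<Prod>j<d. s ! j)) [0..<2 * d] ! i = (s @ map inverse s) ! i"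
    proof (cases "i < d")
      case True
      have "s ! i * x / x = s ! i" if "x \<noteq> 0" for x :: 'a
        unfolding nonzero_divide_eq_eq[OF that] ..
      from this[OF that(2)] show ?thesis using that(1) i True by (simp add: nth_append)
    next
      case False
      then have id: "i - d < d" using i by simp
      have "s ! (i - d) \<noteq> 0" using that id by (auto simp: prod_zero_iff)
      then show ?thesis using that(1) i id False
        unfolding prod_indep_index[OF id, of "\<lambda>j. s ! j"] using that(2) prod_indep_index[OF id, of "\<lambda>j. s ! j"]
        by (simp add: nth_append field_simps)
    qed
  qed (use that in simp)
  show thesis
  proof (rule that[OF Q(1)])
    fix s :: "'a list" assume s: "length s = d" "(\<Prod>i<d. s ! i) \<noteq> 0"
    show "p (map (\<lambda>i. q i (s @ map inverse s)) [0..<l]) * (\<Prod>i<d. s ! i) ^ N = Q s"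
      using Q(2)[OF s(2)] unfolding eq[OF s] .
  qed
qed

lemma zclosed_zeros: "p \<in> polys F n \<Longrightarrow> zclosed F n {x \<in> affine_space n. p x = 0}"
  unfolding zclosed_def by (intro exI[of _ "{p}"]) auto

text \<open>\<open>Y\<close> inherits both properties from the open part of affine space where no
  coordinate vanishes. For \<open>l = 0\<close> the map into \<open>Y\<close> has no denominators
  that could exclude the coordinate hyperplanes, whence the condition \<open>l0\<close>.\<close>

lemma torus_geometry:
  fixes f :: "'a :: field_char_0 list \<Rightarrow> 'a list"
  assumes iso: "isomorphism L l Y (2 * d) (carrier (Gm_power d)) f" and L: "1 \<in> L"
    and Y: "Y \<subseteq> affine_space l" and l0: "l = 0 \<Longrightarrow> d = 0"
  shows "irreducible_over L l Y" "rational_over L l Y"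
proof -
  let ?G = "carrier (Gm_power d) :: 'a list set"
  let ?pr = "\<lambda>s :: 'a list. \<Prod>i<d. s ! i"
  let ?i = "\<lambda>s :: 'a list. s @ map inverse s"
  obtain g ps qs where ps: "length ps = 2 * d" "set ps \<subseteq> polys L l" "\<And>x. x \<in> Y \<Longrightarrow> f x = map (\<lambda>p. p x) ps"
      "f ` Y \<subseteq> ?G"
    and qs: "length qs = l" "set qs \<subseteq> polys L (2 * d)" "\<And>x. x \<in> ?G \<Longrightarrow> g x = map (\<lambda>p. p x) qs" "g ` ?G \<subseteq> Y"
    and gf: "\<And>x. x \<in> Y \<Longrightarrow> g (f x) = x" and fg: "\<And>y. y \<in> ?G \<Longrightarrow> f (g y) = y"
    using iso unfolding isomorphism_def morphism_def by metis
  have iG: "?i s \<in> ?G" if "length s = d" "?pr s \<noteq> 0" for s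
    using that by (auto simp: Gm_power_def nth_append prod_zero_iff)
  have Gi: "x = ?i (take d x)" "length (take d x) = d" "?pr (take d x) \<noteq> 0" if x: "x \<in> ?G" for x
  proof -
    have *: "length x = 2 * d" "\<And>i. i < d \<Longrightarrow> x ! i * x ! (d + i) = 1" using x by (auto simp: Gm_power_def)
    then show "length (take d x) = d" by simp
    have "x ! i \<noteq> 0" if "i < d" for i using *(2)[OF that] by auto
    then show "?pr (take d x) \<noteq> 0" by (auto simp: prod_zero_iff)
    show "x = ?i (take d x)"
    proof (rule nth_equalityI)
      fix i assume "i < length x"
      then show "x ! i = ?i (take d x) ! i"
        using * inverse_unique[OF *(2)[of "i - d"]] by (auto simp: nth_append)
    qed (use * in simp)
  qed
  have gi: "g (?i s) = map (\<lambda>i. (qs ! i) (?i s)) [0..<l]" if "length s = d" "?pr s \<noteq> 0" for s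
    using qs(3)[OF iG[OF that]] qs(1) by (auto intro: nth_equalityI)
  have qsp: "i < l \<Longrightarrow> qs ! i \<in> polys L (2 * d)" for i using qs by auto
  have prp: "?pr \<in> polys L d" using L by (intro polys_prod polys.coord) auto
  let ?ones = "replicate d 1 :: 'a list"
  have ones: "?ones \<in> affine_space d" "?pr ?ones \<noteq> 0" by (auto simp: affine_space_def)
  have Y_ne: "g (?i ?ones) \<in> Y" using qs(4) iG[of ?ones] ones by (auto simp: affine_space_def)
  \<comment> \<open>Two polynomials that do not vanish on all of \<open>Y\<close> pull back to
    nonzero polynomials on affine space, and these have a common nonzero without zero
    coordinates.\<close>
  have common: "\<exists>s. length s = d \<and> ?pr s \<noteq> 0 \<and> p (g (?i s)) \<noteq> 0 \<and> q (g (?i s)) \<noteq> 0"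
    if p: "p \<in> polys L l" "u \<in> Y" "p u \<noteq> 0" and q: "q \<in> polys L l" "v \<in> Y" "q v \<noteq> 0" for p q u v
  proof -
    have ex: "\<exists>Q \<in> polys L d. (\<forall>s. length s = d \<longrightarrow> ?pr s \<noteq> 0 \<longrightarrow> (p (g (?i s)) = 0 \<longleftrightarrow> Q s = 0)) \<and>
        (\<exists>s. length s = d \<and> ?pr s \<noteq> 0 \<and> Q s \<noteq> 0)" if p: "p \<in> polys L l" "u \<in> Y" "p u \<noteq> 0" for p u
    proof -
      obtain Q N where Q: "Q \<in> polys L d" "\<And>s. length s = d \<Longrightarrow> ?pr s \<noteq> 0 \<Longrightarrow>
          p (map (\<lambda>i. (qs ! i) (?i s)) [0..<l]) * ?pr s ^ N = Q s"
        by (rule Gm_clear[where q = "\<lambda>i. qs ! i", OF p(1) qsp L], assumption, rule that)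
      then have Q2: "p (g (?i s)) = 0 \<longleftrightarrow> Q s = 0" if "length s = d" "?pr s \<noteq> 0" for s
        using that gi[OF that] by (metis mult_eq_0_iff power_not_zero)
      let ?s = "take d (f u)"
      have fu: "f u \<in> ?G" using ps(4) p by blast
      have "g (?i ?s) = u" using Gi(1)[OF fu] gf[OF p(2)] by simp
      then have "Q ?s \<noteq> 0" using Q2[OF Gi(2,3)[OF fu]] p by simp
      then show ?thesis using Q(1) Q2 Gi(2,3)[OF fu] by blast
    qed
    obtain P s where P: "P \<in> polys L d" "\<And>s. length s = d \<Longrightarrow> ?pr s \<noteq> 0 \<Longrightarrow> (p (g (?i s)) = 0 \<longleftrightarrow> P s = 0)"
        "length s = d" "?pr s \<noteq> 0" "P s \<noteq> 0" using ex[OF p] by blast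
    obtain Q t where Q: "Q \<in> polys L d" "\<And>s. length s = d \<Longrightarrow> ?pr s \<noteq> 0 \<Longrightarrow> (q (g (?i s)) = 0 \<longleftrightarrow> Q s = 0)"
        "length t = d" "?pr t \<noteq> 0" "Q t \<noteq> 0" using ex[OF q] by blast
    have "\<exists>w\<in>affine_space d. P w * ?pr w \<noteq> 0 \<and> Q w \<noteq> 0"
      by (rule polys_common_nonzero[where p = "\<lambda>w. P w * ?pr w", OF polys.mult[OF P(1) prp] Q(1), where u = s and v = t])
        (use P Q in \<open>auto simp: affine_space_def\<close>)
    then obtain w where "length w = d" "P w * ?pr w \<noteq> 0" "Q w \<noteq> 0" by (auto simp: affine_space_def)
    then show ?thesis using P(2) Q(2) by (intro exI[of _ w]) auto
  qed
  show "irreducible_over L l Y"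
    unfolding irreducible_over_def
  proof (intro conjI allI impI)
    show "Y \<subseteq> affine_space l" by (rule Y)
    show "Y \<noteq> {}" using Y_ne by blast
    fix A B assume A: "zclosed L l A" and B: "zclosed L l B" and YAB: "Y \<subseteq> A \<union> B"
    show "Y \<subseteq> A \<or> Y \<subseteq> B"
    proof (rule ccontr)
      assume "\<not> ?thesis"
      then obtain u v where uv: "u \<in> Y" "u \<notin> A" "v \<in> Y" "v \<notin> B" by blast
      obtain S where S: "S \<subseteq> polys L l" "A = {x \<in> affine_space l. \<forall>p\<in>S. p x = 0}"
        using A by (auto simp: zclosed_def)
      obtain S' where S': "S' \<subseteq> polys L l" "B = {x \<in> affine_space l. \<forall>p\<in>S'. p x = 0}"
        using B by (auto simp: zclosed_def)
      obtain p where p: "p \<in> S" "p u \<noteq> 0" using uv S Y by auto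
      obtain q where q: "q \<in> S'" "q v \<noteq> 0" using uv S' Y by auto
      obtain s where "length s = d" "?pr s \<noteq> 0" "p (g (?i s)) \<noteq> 0" "q (g (?i s)) \<noteq> 0"
        using common[of p u q v] p q S S' uv by blast
      moreover have "g (?i s) \<in> Y" using qs(4) iG calculation by blast
      ultimately show False using YAB p q S S' by blast
    qed
  qed
  have "\<forall>i. \<exists>Q N. i < l \<longrightarrow> Q \<in> polys L d \<and> (\<forall>s. length s = d \<longrightarrow> ?pr s \<noteq> 0 \<longrightarrow> (qs ! i) (?i s) * ?pr s ^ N = Q s)"
  proof (intro allI)
    fix i
    show "\<exists>Q N. i < l \<longrightarrow> Q \<in> polys L d \<and> (\<forall>s. length s = d \<longrightarrow> ?pr s \<noteq> 0 \<longrightarrow> (qs ! i) (?i s) * ?pr s ^ N = Q s)"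
    proof (cases "i < l")
      case True
      obtain Q N where "Q \<in> polys L d" "\<And>s. length s = d \<Longrightarrow> ?pr s \<noteq> 0 \<Longrightarrow>
          map (\<lambda>i. (qs ! i) (?i s)) [0..<l] ! i * ?pr s ^ N = Q s"
        by (rule Gm_clear[where q = "\<lambda>i. qs ! i", OF polys.coord[OF True] qsp L], assumption, rule that)
      then show ?thesis using True by (intro exI[of _ Q] exI[of _ N]) simp
    qed simp
  qed
  then obtain Q N where Q: "\<And>i. i < l \<Longrightarrow> Q i \<in> polys L d"
    "\<And>i s. i < l \<Longrightarrow> length s = d \<Longrightarrow> ?pr s \<noteq> 0 \<Longrightarrow> (qs ! i) (?i s) * ?pr s ^ N i = Q i s" by metis
  define F where "F = map (\<lambda>p. (p, \<lambda>_ :: 'a list. 1 :: 'a)) (take d ps)"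
  \<comment> \<open>The factor \<open>?pr\<close> in numerator and denominator puts the coordinate
    hyperplanes outside the domain even where the map itself would extend.\<close>
  define G where "G = map (\<lambda>i. (\<lambda>s. Q i s * ?pr s, \<lambda>s. ?pr s ^ Suc (N i))) [0..<l]"
  have F_dom: "rdom F Y = Y" by (auto simp: rdom_def F_def)
  have F_eval: "reval F x = take d (f x)" if "x \<in> Y" for x
    using ps(3)[OF that] by (simp add: reval_def F_def take_map o_def)
  have F_len: "length F = d" using ps by (simp add: F_def)
  have G_nz: "?pr s \<noteq> 0" if "s \<in> rdom G (affine_space d)" for s
  proof (cases "l = 0")
    case False
    then show ?thesis using that by (auto simp: rdom_def G_def)
  qed (use l0 in simp)
  have G_eval: "reval G s = g (?i s)" if "length s = d" "?pr s \<noteq> 0" for s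
  proof -
    have "Q i s * ?pr s / ?pr s ^ Suc (N i) = (qs ! i) (?i s)" if "i < l" for i
      using Q(2)[OF that \<open>length s = d\<close> \<open>?pr s \<noteq> 0\<close>] \<open>?pr s \<noteq> 0\<close> by (simp add: field_simps)
    then show ?thesis unfolding gi[OF that] by (auto simp: reval_def G_def)
  qed
  have G_dom: "s \<in> rdom G (affine_space d)" if "length s = d" "?pr s \<noteq> 0" for s
    using that by (auto simp: rdom_def G_def affine_space_def)
  have Fp: "\<forall>(p, q)\<in>set F. p \<in> polys L l \<and> q \<in> polys L l \<and> (\<exists>x\<in>Y. q x \<noteq> 0)"
    using ps(2) Y_ne L by (auto simp: F_def intro: polys.const dest: in_set_takeD)
  have Gp: "\<forall>(p, q)\<in>set G. p \<in> polys L d \<and> q \<in> polys L d \<and> (\<exists>x\<in>affine_space d. q x \<noteq> 0)"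
    using Q(1) prp L ones by (auto simp: G_def intro!: polys.mult polys_power bexI[of _ ?ones])
  have "dominant_map L l Y d (affine_space d) F"
    unfolding dominant_map_def rational_map_def
  proof (intro conjI allI impI)
    show "length F = d" by (rule F_len)
    show "\<forall>(p, q)\<in>set F. p \<in> polys L l \<and> q \<in> polys L l \<and> (\<exists>x\<in>Y. q x \<noteq> 0)" by (rule Fp)
    show "reval F ` rdom F Y \<subseteq> affine_space d" by (auto simp: reval_def affine_space_def F_len)
    fix A assume A: "zclosed L d A" and sub: "reval F ` rdom F Y \<subseteq> A"
    obtain S where S: "S \<subseteq> polys L d" "A = {x \<in> affine_space d. \<forall>p\<in>S. p x = 0}"
      using A by (auto simp: zclosed_def)
    show "affine_space d \<subseteq> A"
    proof (rule ccontr)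
      assume "\<not> affine_space d \<subseteq> A"
      then obtain v p where vp: "v \<in> affine_space d" "p \<in> S" "p v \<noteq> 0" using S by blast
      then obtain w where w: "w \<in> affine_space d" "p w \<noteq> 0" "?pr w \<noteq> 0"
        using polys_common_nonzero[where p = p, OF _ prp vp(1) vp(3) ones] S by blast
      then have wl: "length w = d" by (simp add: affine_space_def)
      have "g (?i w) \<in> Y" using qs(4) iG[OF wl w(3)] by blast
      then have "reval F (g (?i w)) \<in> A" using sub F_dom by blast
      moreover have "reval F (g (?i w)) = w"
        using F_eval[OF \<open>g (?i w) \<in> Y\<close>] fg[OF iG[OF wl w(3)]] wl by simp
      ultimately show False using vp w S by auto
    qed
  qed
  moreover have "dominant_map L d (affine_space d) l Y G"
    unfolding dominant_map_def rational_map_def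
  proof (intro conjI allI impI)
    show "length G = l" by (simp add: G_def)
    show "\<forall>(p, q)\<in>set G. p \<in> polys L d \<and> q \<in> polys L d \<and> (\<exists>x\<in>affine_space d. q x \<noteq> 0)" by (rule Gp)
    show "reval G ` rdom G (affine_space d) \<subseteq> Y"
    proof (rule image_subsetI)
      fix s assume s: "s \<in> rdom G (affine_space d)"
      then have "length s = d" by (simp add: rdom_def affine_space_def)
      then show "reval G s \<in> Y" using G_eval G_nz[OF s] qs(4) iG by auto
    qed
    fix A assume A: "zclosed L l A" and sub: "reval G ` rdom G (affine_space d) \<subseteq> A"
    show "Y \<subseteq> A"
    proof
      fix y assume y: "y \<in> Y"
      then have fy: "f y \<in> ?G" using ps(4) by blast
      have "reval G (take d (f y)) \<in> A" using sub G_dom[OF Gi(2,3)[OF fy]] by blast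
      then show "y \<in> A" using G_eval[OF Gi(2,3)[OF fy]] Gi(1)[OF fy] gf[OF y] by simp
    qed
  qed
  moreover have "reval G (reval F x) = x" if "x \<in> rdom F Y" for x
  proof -
    have x: "x \<in> Y" "f x \<in> ?G" using that F_dom ps(4) by auto
    show ?thesis using F_eval[OF x(1)] G_eval[OF Gi(2,3)[OF x(2)]] Gi(1)[OF x(2)] gf[OF x(1)] by simp
  qed
  moreover have "reval F (reval G y) = y" if y: "y \<in> rdom G (affine_space d)" for y
  proof -
    have l: "length y = d" using y by (simp add: rdom_def affine_space_def)
    have "g (?i y) \<in> Y" using qs(4) iG[OF l G_nz[OF y]] by blast
    then show ?thesis using G_eval[OF l G_nz[OF y]] F_eval fg[OF iG[OF l G_nz[OF y]]] l by simp
  qed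
  ultimately show "rational_over L l Y" unfolding rational_over_def birational_def by blast
qed

section \<open>Towers of torus torsors\<close>

text \<open>A tower expressed by function fields alone: over \<open>K\<close> there is a torus
  torsor with generic point \<open>y\<close>, and the tower goes on with \<open>K(y)\<close>. The
  splitting over the algebraic closure is recorded because it yields geometric rationality and
  irreducibility of the fibres.\<close>

inductive torsor_tower :: "'a :: field set \<Rightarrow> 'a set \<Rightarrow> bool" for k :: "'a set" where
  base: "indep k t \<Longrightarrow> torsor_tower k (fracs k t)"
| step: "torus K m T \<Longrightarrow> torsor K m T l Y act \<Longrightarrow>
    isomorphism (algebraic_closure_of K) l Y (2 * d) (carrier (Gm_power d)) f \<Longrightarrow> (l = 0 \<Longrightarrow> d = 0) \<Longrightarrow>
    generic_point K l Y y \<Longrightarrow> torsor_tower k (fracs K y) \<Longrightarrow> torsor_tower k K"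

text \<open>Parameters that are independent over a field \<open>L\<close> containing
  \<open>E\<close> and \<open>\<tau>\<close> give a generic point: an equation at that point is an
  identity in the parameters, and the parametrization reaches all of
  \<open>Y \<tau>\<close>.\<close>

lemma (in twisted_torus) torsor_tower_step:
  assumes \<tau>: "equivariant \<tau>" and L: "is_subfield L" "E \<subseteq> L" "\<And>k. k < n \<Longrightarrow> \<tau> k \<in> L"
    and s: "indep L s" "length s = r" and tower: "torsor_tower F (fracs K (bwd \<tau> (s @ map inverse s)))"
  shows "torsor_tower F K"
proof (rule torsor_tower.step[OF torus_T torsor_Y[OF \<tau>] Y_isomorphism[OF \<tau>] _ _ tower])
  \<comment> \<open>For \<open>n = 0\<close> the matrix \<open>b\<close> has a left inverse only if
    it has no columns.\<close>
  show "r = 0" if "2 * n = 0"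
  proof (rule ccontr)
    assume "r \<noteq> 0"
    then show False using eb[of 0 0] that by simp
  qed
  let ?pr = "\<lambda>s :: 'c list. \<Prod>i<r. s ! i"
  let ?i = "\<lambda>s :: 'c list. s @ map inverse s"
  have L1: "1 \<in> L" "0 \<in> L" using L by (auto simp: subfield_one subfield_zero)
  have iG: "?i s \<in> carrier (Gm_power r)" if "length s = r" "?pr s \<noteq> 0" for s
    using that by (auto simp: Gm_power_def nth_append prod_zero_iff)
  have prp: "?pr \<in> polys L r" using L1 by (intro polys_prod polys.coord) auto
  have prs: "?pr s \<noteq> 0"
  proof
    assume "?pr s = 0"
    then have "?pr (replicate r 1) = 0" by (rule indepD[OF s(1) prp s(2)[symmetric]]) simp
    then show False by simp
  qed
  have bp: "i < 2 * n \<Longrightarrow> bwdp \<tau> i \<in> polys L (2 * r)" for i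
    using L L1 cE by (intro bwdp_polys) (auto intro: subfield_inverse)
  show "generic_point K (2 * n) (Y \<tau>) (bwd \<tau> (?i s))"
    unfolding generic_point_def
  proof (intro conjI allI impI subsetI)
    show "bwd \<tau> (?i s) \<in> Y \<tau>" by (rule bwd_Y[OF \<tau> iG[OF s(2) prs]])
    fix A u assume A: "zclosed K (2 * n) A" "bwd \<tau> (?i s) \<in> A" and u: "u \<in> Y \<tau>"
    obtain S where S: "S \<subseteq> polys K (2 * n)" "A = {x \<in> affine_space (2 * n). \<forall>p\<in>S. p x = 0}"
      using A(1) by (auto simp: zclosed_def)
    have "p u = 0" if pS: "p \<in> S" for p
    proof -
      have pL: "p \<in> polys L (2 * n)" using S pS KE L(2) by (blast intro: polys_mono)
      obtain Q N where Q: "Q \<in> polys L r" "\<And>s. length s = r \<Longrightarrow> ?pr s \<noteq> 0 \<Longrightarrow>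
          p (map (\<lambda>i. bwdp \<tau> i (?i s)) [0..<2 * n]) * ?pr s ^ N = Q s"
        by (rule Gm_clear[where q = "bwdp \<tau>", OF pL bp L1(1)], assumption, rule that)
      have Q': "p (bwd \<tau> (?i s)) * ?pr s ^ N = Q s" if "length s = r" "?pr s \<noteq> 0" for s
        using Q(2)[OF that] bwdp_eval[OF iG[OF that]] by simp
      have "p (bwd \<tau> (?i s)) = 0" using A(2) S pS by blast
      then have Q0: "Q s = 0" using Q'[OF s(2) prs] by simp
      let ?x = "fwd \<tau> u"
      have x: "?x \<in> carrier (Gm_power r)" by (rule fwd_Gm[OF \<tau> u])
      have lx: "length ?x = 2 * r" using x by (simp add: Gm_power_def)
      have xi: "?x = ?i (take r ?x)"
      proof (rule nth_equalityI)
        fix i assume "i < length ?x"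
        then show "?x ! i = ?i (take r ?x) ! i"
          using lx Gm_power_nth(3)[OF x, of "i - r"] by (auto simp: nth_append)
      qed (use lx in simp)
      have px: "?pr (take r ?x) \<noteq> 0" using Gm_power_nth(2)[OF x] by (auto simp: prod_zero_iff)
      have "Q (take r ?x) = 0" by (rule indepD[OF s(1) Q(1) s(2)[symmetric] Q0]) (simp add: lx)
      then have "p (bwd \<tau> (?i (take r ?x))) = 0" using Q'[of "take r ?x"] px lx by auto
      then show ?thesis using xi bwd_fwd[OF \<tau> u] by simp
    qed
    then show "u \<in> A" using S Y_D(1)[OF u] by (simp add: affine_space_def)
  qed
qed

section \<open>Rational maps between varieties with given generic points\<close>

lemma polys_shift:
  assumes "p \<in> polys F m"
  shows "(\<lambda>v. p (map (\<lambda>j. v ! (n + j)) [0..<m])) \<in> polys F (n + m)"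
  by (rule polys_compose[OF assms]) (auto intro: polys.coord)

lemma shift_eval: "length a = n \<Longrightarrow> length v = m \<Longrightarrow> map (\<lambda>j. (a @ v) ! (n + j)) [0..<m] = v"
  by (auto simp: nth_append intro: nth_equalityI)

lemma zclosed_affine: "1 \<in> F \<Longrightarrow> zclosed F n (affine_space n)" "1 \<in> F \<Longrightarrow> zclosed F n {}"
  unfolding zclosed_def
  by (rule exI[of _ "{}"], simp) (rule exI[of _ "{\<lambda>_. 1}"], auto intro: polys.intros)

lemma generic_irreducible: "W \<subseteq> affine_space n \<Longrightarrow> generic_point F n W x \<Longrightarrow> irreducible_over F n W"
  unfolding generic_point_def irreducible_over_def by blast

lemma generic_zero:
  assumes "generic_point F n W x" "p \<in> polys F n" "p x = 0" "v \<in> W" "W \<subseteq> affine_space n"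
  shows "p v = 0"
proof -
  have "x \<in> {x \<in> affine_space n. p x = 0}" using assms by (auto simp: generic_point_def)
  then have "W \<subseteq> {x \<in> affine_space n. p x = 0}"
    using assms(1) zclosed_zeros[OF assms(2)] unfolding generic_point_def by blast
  then show ?thesis using assms by blast
qed

lemma affine_generic: "1 \<in> F \<Longrightarrow> indep F t \<Longrightarrow> length t = d \<Longrightarrow> generic_point F d (affine_space d) t"
  unfolding generic_point_def zclosed_def by (auto simp: affine_space_def dest: indepD)

text \<open>The coordinates of \<open>y\<close>, written as fractions in \<open>x\<close>, define
  the map. A polynomial that separates \<open>y\<close> from \<open>B\<close> enters the
  denominators, so that the image avoids \<open>B\<close> on the whole domain.\<close>

lemma rational_map_exists:
  assumes k: "is_subfield k" and W: "W \<subseteq> affine_space n" "generic_point k n W x"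
    and Y: "zclosed k m A" "zclosed k m B" "Y = A - B" and y: "generic_point k m Y y"
    and yx: "set y \<subseteq> fracs k x"
  shows "\<exists>f. dominant_map k n W m Y f \<and> x \<in> rdom f W \<and> reval f x = y"
proof -
  obtain S where S: "S \<subseteq> polys k m" "A = {x \<in> affine_space m. \<forall>p\<in>S. p x = 0}"
    using Y(1) by (auto simp: zclosed_def)
  obtain S' where S': "S' \<subseteq> polys k m" "B = {x \<in> affine_space m. \<forall>p\<in>S'. p x = 0}"
    using Y(2) by (auto simp: zclosed_def)
  have yY: "y \<in> Y" and ly: "length y = m" and xW: "x \<in> W" and lx: "length x = n"
    using y W Y S by (auto simp: generic_point_def affine_space_def)
  have k1: "1 \<in> k" using k by (rule subfield_one)
  obtain a q where aq: "\<And>i. i < m \<Longrightarrow> a i \<in> polys k n" "q \<in> polys k n" "q x \<noteq> 0"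
      "\<And>i. i < m \<Longrightarrow> y ! i = a i x / q x"
    using fracs_common[OF k, of m "\<lambda>i. y ! i" x] yx ly lx by force
  have yeq: "map (\<lambda>i. a i x / q x) [0..<m] = y" using aq(4) ly by (auto intro: nth_equalityI)
  obtain p0 where p0: "p0 \<in> S'" "p0 y \<noteq> 0" using yY Y S S' ly by (auto simp: affine_space_def)
  obtain Q0 N0 where Q0: "Q0 \<in> polys k n"
      "\<And>x. q x \<noteq> 0 \<Longrightarrow> p0 (map (\<lambda>i. a i x / q x) [0..<m]) * q x ^ N0 = Q0 x"
    using polys_clear[where a = a, OF _ aq(1,2) k1, of p0 m] p0 S' by blast
  have Q0x: "Q0 x \<noteq> 0" using Q0(2)[OF aq(3)] yeq p0 aq(3) by auto
  define f where "f = map (\<lambda>i. (\<lambda>v. a i v * Q0 v, \<lambda>v. q v * Q0 v)) [0..<m]"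
  have xdom: "x \<in> rdom f W" using xW aq(3) Q0x by (auto simp: rdom_def f_def)
  have fx: "reval f x = y" unfolding yeq[symmetric] using Q0x by (simp add: reval_def f_def)
  have fv: "reval f v = map (\<lambda>i. a i v / q v) [0..<m]" "q v \<noteq> 0" "Q0 v \<noteq> 0" if "v \<in> rdom f W" "m > 0" for v
    using that by (auto simp: rdom_def f_def reval_def)
  have im: "reval f v \<in> Y" if v: "v \<in> rdom f W" for v
  proof (cases "m = 0")
    case True
    then show ?thesis using yY ly by (simp add: f_def reval_def)
  next
    case False
    then have fv: "reval f v = map (\<lambda>i. a i v / q v) [0..<m]" "q v \<noteq> 0" "Q0 v \<noteq> 0"
      using fv[OF v] by auto
    have vW: "v \<in> W" using v by (simp add: rdom_def)
    have "p (reval f v) = 0" if p: "p \<in> S" for p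
    proof -
      obtain P N where P: "P \<in> polys k n"
        "\<And>x. q x \<noteq> 0 \<Longrightarrow> p (map (\<lambda>i. a i x / q x) [0..<m]) * q x ^ N = P x"
        using polys_clear[where a = a, OF _ aq(1,2) k1, of p m] p S by blast
      have "p y = 0" using yY Y S p by auto
      then have "P x = 0" using P(2)[OF aq(3)] yeq by simp
      then have "P v = 0" using generic_zero[OF W(2) P(1) _ vW W(1)] by simp
      then show ?thesis using P(2)[OF fv(2)] fv by simp
    qed
    moreover have "p0 (reval f v) \<noteq> 0" using Q0(2)[OF fv(2)] fv by auto
    moreover have "length (reval f v) = m" using fv by simp
    ultimately show ?thesis using Y(3) S S' p0 by (auto simp: affine_space_def)
  qed
  have "rational_map k n W m Y f"
    unfolding rational_map_def
  proof (intro conjI)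
    show "length f = m" by (simp add: f_def)
    show "\<forall>(p, q)\<in>set f. p \<in> polys k n \<and> q \<in> polys k n \<and> (\<exists>x\<in>W. q x \<noteq> 0)"
      using aq Q0 Q0x xW by (auto simp: f_def intro!: polys.mult)
    show "reval f ` rdom f W \<subseteq> Y" using im by blast
  qed
  moreover have "Y \<subseteq> A'" if "zclosed k m A'" "reval f ` rdom f W \<subseteq> A'" for A'
  proof -
    have "y \<in> A'" using that(2) xdom fx by blast
    then show ?thesis using y that(1) by (simp add: generic_point_def)
  qed
  ultimately have "dominant_map k n W m Y f" by (simp add: dominant_map_def)
  then show ?thesis using xdom fx by blast
qed

text \<open>A polynomial identity between the generic point and its image under a rational map
  specializes to all points where the map is defined.\<close>

lemma graph_specialize:
  assumes k: "is_subfield k" and W: "W \<subseteq> affine_space n" "generic_point k n W x"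
    and f: "rational_map k n W m Y f" and x: "x \<in> rdom f W"
    and P: "P \<in> polys k (n + m)" "P (x @ reval f x) = 0" and v: "v \<in> rdom f W"
  shows "P (v @ reval f v) = 0"
proof -
  have k1: "1 \<in> k" using k by (rule subfield_one)
  have lf: "length f = m" and fp: "\<And>i. i < m \<Longrightarrow> fst (f ! i) \<in> polys k n \<and> snd (f ! i) \<in> polys k n"
    using f by (auto simp: rational_map_def case_prod_unfold)
  \<comment> \<open>A common denominator for all coordinates of the graph; on \<open>W\<close> it is
    nonzero exactly where the map is defined.\<close>
  let ?b = "\<lambda>v. \<Prod>i<m. snd (f ! i) v"
  let ?a = "\<lambda>i v. if i < n then v ! i * ?b v else fst (f ! (i - n)) v * (\<Prod>j\<in>{..<m} - {i - n}. snd (f ! j) v)"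
  have b: "?b \<in> polys k n" using fp k1 by (intro polys_prod) auto
  have a: "?a i \<in> polys k n" if "i < n + m" for i
    using that fp k1 b by (cases "i < n") (auto intro!: polys.mult polys_prod polys.coord)
  obtain Q N where Q: "Q \<in> polys k n"
      "\<And>v. ?b v \<noteq> 0 \<Longrightarrow> P (map (\<lambda>i. ?a i v / ?b v) [0..<n + m]) * ?b v ^ N = Q v"
    using polys_clear[where a = ?a, OF P(1) a b k1] by blast
  have bnz: "?b v \<noteq> 0" if "v \<in> rdom f W" for v
  proof -
    have "snd (f ! i) v \<noteq> 0" if "i < m" for i
      using \<open>v \<in> rdom f W\<close> that lf by (auto simp: rdom_def case_prod_unfold)
    then show ?thesis by (auto simp: prod_zero_iff)
  qed
  have eq: "map (\<lambda>i. ?a i v / ?b v) [0..<n + m] = v @ reval f v" if v: "v \<in> rdom f W" for v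
  proof (rule nth_equalityI)
    have lv: "length v = n" using v W by (auto simp: rdom_def affine_space_def)
    show "length (map (\<lambda>i. ?a i v / ?b v) [0..<n + m]) = length (v @ reval f v)"
      using lv lf by (simp add: reval_def)
    fix i assume "i < length (map (\<lambda>i. ?a i v / ?b v) [0..<n + m])"
    then have i: "i < n + m" by simp
    show "map (\<lambda>i. ?a i v / ?b v) [0..<n + m] ! i = (v @ reval f v) ! i"
    proof (cases "i < n")
      case True
      then have "map (\<lambda>i. ?a i v / ?b v) [0..<n + m] ! i = v ! i * ?b v / ?b v" using i by simp
      also have "\<dots> = v ! i" unfolding nonzero_divide_eq_eq[OF bnz[OF v]] ..
      finally show ?thesis using True lv by (simp add: nth_append)
    next
      case False
      then have im: "i - n < m" using i by simp
      let ?c = "\<Prod>j\<in>{..<m} - {i - n}. snd (f ! j) v"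
      have b2: "?b v = snd (f ! (i - n)) v * ?c" by (rule prod_indep_index[OF im])
      have c0: "?c \<noteq> 0" "snd (f ! (i - n)) v \<noteq> 0" using bnz[OF v] unfolding b2 by auto
      have "map (\<lambda>i. ?a i v / ?b v) [0..<n + m] ! i = fst (f ! (i - n)) v * ?c / ?b v" using False i by simp
      also have "\<dots> = fst (f ! (i - n)) v / snd (f ! (i - n)) v"
        unfolding b2 using c0 mult_divide_mult_cancel_right[OF c0(1)] by blast
      finally show ?thesis using False lv im lf by (simp add: nth_append reval_def case_prod_unfold)
    qed
  qed
  have "Q x = 0" using Q(2)[OF bnz[OF x]] eq[OF x] P(2) by simp
  then have "Q v = 0" using generic_zero[OF W(2) Q(1) _ _ W(1)] v by (simp add: rdom_def)
  then show ?thesis using Q(2)[OF bnz[OF v]] eq[OF v] bnz[OF v] by simp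
qed

lemma birational_inverse:
  assumes k: "is_subfield k" and W: "W \<subseteq> affine_space n" "generic_point k n W x"
    and Y: "Y \<subseteq> affine_space m"
    and f: "rational_map k n W m Y f" "x \<in> rdom f W" and g: "rational_map k m Y n W g" "reval f x \<in> rdom g Y"
    and gfx: "reval g (reval f x) = x" and v: "v \<in> rdom f W" "reval f v \<in> rdom g Y"
  shows "reval g (reval f v) = v"
proof (rule nth_equalityI)
  have lg: "length g = n" and gp: "\<And>i. i < n \<Longrightarrow> fst (g ! i) \<in> polys k m \<and> snd (g ! i) \<in> polys k m"
    using g(1) by (auto simp: rational_map_def case_prod_unfold)
  have lv: "length v = n" using v W by (auto simp: rdom_def affine_space_def)
  show "length (reval g (reval f v)) = length v" using lg lv by (simp add: reval_def)
  fix i assume "i < length (reval g (reval f v))"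
  then have i: "i < n" using lg by (simp add: reval_def)
  let ?s = "\<lambda>w. map (\<lambda>j. w ! (n + j)) [0..<m]"
  \<comment> \<open>The identity for the \<open>i\<close>-th coordinate with its denominator
    cleared, as a polynomial on the graph of \<open>f\<close>.\<close>
  let ?P = "\<lambda>w. fst (g ! i) (?s w) - w ! i * snd (g ! i) (?s w)"
  have m1: "- 1 \<in> k" using k by (auto intro: subfield_intros)
  have P: "?P \<in> polys k (n + m)"
    using gp[OF i] i by (intro polys_diff m1 polys.mult polys.coord polys_shift) auto
  have sn: "snd (g ! i) w \<noteq> 0" if "w \<in> rdom g Y" for w
    using that i lg by (auto simp: rdom_def case_prod_unfold)
  have eval: "?P (u @ reval f u) = 0 \<longleftrightarrow> reval g (reval f u) ! i = u ! i"
    if "u \<in> rdom f W" "reval f u \<in> rdom g Y" for u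
  proof -
    have l: "length u = n" "length (reval f u) = m"
      using that W Y by (auto simp: rdom_def affine_space_def)
    have 1: "?P (u @ reval f u) = fst (g ! i) (reval f u) - u ! i * snd (g ! i) (reval f u)"
      unfolding shift_eval[OF l] using i l by (simp add: nth_append)
    have 2: "reval g (reval f u) ! i = fst (g ! i) (reval f u) / snd (g ! i) (reval f u)"
      using i lg by (simp add: reval_def case_prod_unfold)
    show ?thesis unfolding 1 2 nonzero_divide_eq_eq[OF sn[OF that(2)]] by simp
  qed
  have "?P (x @ reval f x) = 0" using eval[OF f(2) g(2)] gfx by simp
  then have "?P (v @ reval f v) = 0" by (rule graph_specialize[OF k W f P _ v(1)])
  then show "reval g (reval f v) ! i = v ! i" using eval[OF v] by blast
qed

text \<open>Each generic point is a rational function of the other. The two maps obtained in this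
  way are inverse to each other at the generic points, hence wherever the compositions are
  defined.\<close>

lemma birational_if_same_field:
  assumes k: "is_subfield k"
    and W: "zclosed k n A" "zclosed k n B" "W = A - B" "generic_point k n W x"
    and Y: "zclosed k m A'" "zclosed k m B'" "Y = A' - B'" "generic_point k m Y y"
    and eq: "fracs k x = fracs k y"
  shows "birational k n W m Y"
proof -
  have Wa: "W \<subseteq> affine_space n" and Ya: "Y \<subseteq> affine_space m"
    using W(1,3) Y(1,3) by (auto simp: zclosed_def)
  obtain f where f: "dominant_map k n W m Y f" "x \<in> rdom f W" "reval f x = y"
    using rational_map_exists[OF k Wa W(4) Y(1-4)] eq fracs_gens[of y k] by auto
  obtain g where g: "dominant_map k m Y n W g" "y \<in> rdom g Y" "reval g y = x"
    using rational_map_exists[OF k Ya Y(4) W(1-4)] eq fracs_gens[of x k] by auto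
  have fr: "rational_map k n W m Y f" and gr: "rational_map k m Y n W g"
    using f g by (simp_all add: dominant_map_def)
  have "reval g (reval f v) = v" if "v \<in> rdom f W" "reval f v \<in> rdom g Y" for v
    by (rule birational_inverse[OF k Wa W(4) Ya fr f(2) gr _ _ that]) (use f g in auto)
  moreover have "reval f (reval g v) = v" if "v \<in> rdom g Y" "reval g v \<in> rdom f W" for v
    by (rule birational_inverse[OF k Ya Y(4) Wa gr g(2) fr _ _ that]) (use f g in auto)
  ultimately show ?thesis using f(1) g(1) unfolding birational_def by blast
qed

text \<open>A fibre of a coordinate projection is a copy of \<open>Y\<close> with constant first
  coordinates. Closed sets restrict to closed sets of \<open>Y\<close> because these constants lie
  in \<open>L\<close>.\<close>

lemma irreducible_shift:
  assumes Y: "irreducible_over L l Y" and x: "length x = n" "set x \<subseteq> L"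
  shows "irreducible_over L (n + l) ((@) x ` Y)"
  unfolding irreducible_over_def
proof (intro conjI allI impI)
  have Ya: "Y \<subseteq> affine_space l" "Y \<noteq> {}" using Y by (auto simp: irreducible_over_def)
  then show "(@) x ` Y \<subseteq> affine_space (n + l)" "(@) x ` Y \<noteq> {}" using x by (auto simp: affine_space_def)
  have sect: "zclosed L l {v \<in> affine_space l. x @ v \<in> A}" if A: "zclosed L (n + l) A" for A
  proof -
    obtain S where S: "S \<subseteq> polys L (n + l)" "A = {x \<in> affine_space (n + l). \<forall>p\<in>S. p x = 0}"
      using A by (auto simp: zclosed_def)
    have "\<forall>P\<in>S. \<exists>p \<in> polys L l. \<forall>v. length v = l \<longrightarrow> P (x @ v) = p v"
      using S polys_specialize_left_const[OF _ x] by blast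
    then obtain h where h: "\<And>P. P \<in> S \<Longrightarrow> h P \<in> polys L l" "\<And>P v. P \<in> S \<Longrightarrow> length v = l \<Longrightarrow> P (x @ v) = h P v"
      by metis
    show ?thesis unfolding zclosed_def
      by (rule exI[of _ "h ` S"]) (use h S x in \<open>auto simp: affine_space_def\<close>)
  qed
  fix A B assume AB: "zclosed L (n + l) A" "zclosed L (n + l) B" "(@) x ` Y \<subseteq> A \<union> B"
  then have "Y \<subseteq> {v \<in> affine_space l. x @ v \<in> A} \<union> {v \<in> affine_space l. x @ v \<in> B}" using Ya by blast
  then have "Y \<subseteq> {v \<in> affine_space l. x @ v \<in> A} \<or> Y \<subseteq> {v \<in> affine_space l. x @ v \<in> B}"
    using Y sect[OF AB(1)] sect[OF AB(2)] unfolding irreducible_over_def by blast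
  then show "(@) x ` Y \<subseteq> A \<or> (@) x ` Y \<subseteq> B" by blast
qed

text \<open>The coordinates \<open>x\<close> are forgotten in one direction and inserted as
  constants in the other.\<close>

lemma birational_shift:
  assumes b: "birational L l Y m D" and x: "length x = n" "set x \<subseteq> L" and Y: "Y \<subseteq> affine_space l" and L: "1 \<in> L"
    and ne: "D \<noteq> {}"
  shows "birational L (n + l) ((@) x ` Y) m D"
proof -
  obtain f g where f: "dominant_map L l Y m D f" and g: "dominant_map L m D l Y g"
    and gf: "\<forall>v \<in> rdom f Y. reval f v \<in> rdom g D \<longrightarrow> reval g (reval f v) = v"
    and fg: "\<forall>y \<in> rdom g D. reval g y \<in> rdom f Y \<longrightarrow> reval f (reval g y) = y"
    using b unfolding birational_def by blast
  let ?s = "\<lambda>w. map (\<lambda>j. w ! (n + j)) [0..<l]"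
  define F where "F = map (\<lambda>(p, q). (\<lambda>w. p (?s w), \<lambda>w. q (?s w))) f"
  define G where "G = map (\<lambda>i. (\<lambda>_. x ! i, \<lambda>_. 1)) [0..<n] @ g"
  have s: "?s (x @ v) = v" if "v \<in> Y" for v
    using that Y x by (intro shift_eval) (auto simp: affine_space_def)
  have Fe: "reval F (x @ v) = reval f v" if "v \<in> Y" for v
    using s[OF that] by (simp add: reval_def F_def case_prod_unfold)
  have Fd: "rdom F ((@) x ` Y) = (@) x ` rdom f Y"
    using s by (auto simp: rdom_def F_def case_prod_unfold)
  have Ge: "reval G v = x @ reval g v" for v
  proof -
    have "map (\<lambda>i. x ! i) [0..<n] = x" using x by (metis map_nth)
    then show ?thesis by (simp add: reval_def G_def o_def)
  qed
  have Gd: "rdom G D = rdom g D" by (auto simp: rdom_def G_def)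
  have fY: "v \<in> rdom f Y \<Longrightarrow> v \<in> Y" for v by (simp add: rdom_def)
  have gY: "v \<in> rdom g D \<Longrightarrow> reval g v \<in> Y" for v
    using g by (auto simp: dominant_map_def rational_map_def)
  have "dominant_map L (n + l) ((@) x ` Y) m D F"
    unfolding dominant_map_def rational_map_def
  proof (intro conjI allI impI)
    show "length F = m" using f by (simp add: F_def dominant_map_def rational_map_def)
    show "\<forall>(p, q)\<in>set F. p \<in> polys L (n + l) \<and> q \<in> polys L (n + l) \<and> (\<exists>x\<in>(@) x ` Y. q x \<noteq> 0)"
      using f s by (fastforce simp: F_def dominant_map_def rational_map_def intro!: polys_shift)
    show "reval F ` rdom F ((@) x ` Y) \<subseteq> D"
      using f unfolding Fd dominant_map_def rational_map_def by (auto simp: Fe[OF fY])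
    fix A assume "zclosed L m A" "reval F ` rdom F ((@) x ` Y) \<subseteq> A"
    moreover have "reval F ` rdom F ((@) x ` Y) = reval f ` rdom f Y"
      unfolding Fd by (auto simp: Fe[OF fY] image_image)
    ultimately show "D \<subseteq> A" using f by (simp add: dominant_map_def)
  qed
  moreover have "dominant_map L m D (n + l) ((@) x ` Y) G"
    unfolding dominant_map_def rational_map_def
  proof (intro conjI allI impI)
    show "length G = n + l" using g by (simp add: G_def dominant_map_def rational_map_def)
    show "\<forall>(p, q)\<in>set G. p \<in> polys L m \<and> q \<in> polys L m \<and> (\<exists>x\<in>D. q x \<noteq> 0)"
      using g x ne L unfolding dominant_map_def rational_map_def
      by (auto simp: G_def intro!: polys.const)
    show "reval G ` rdom G D \<subseteq> (@) x ` Y" unfolding Gd using gY by (auto simp: Ge)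
    fix A assume A: "zclosed L (n + l) A" "reval G ` rdom G D \<subseteq> A"
    obtain S where S: "S \<subseteq> polys L (n + l)" "A = {x \<in> affine_space (n + l). \<forall>p\<in>S. p x = 0}"
      using A(1) by (auto simp: zclosed_def)
    have "\<forall>P\<in>S. \<exists>p \<in> polys L l. \<forall>v. length v = l \<longrightarrow> P (x @ v) = p v"
      using S polys_specialize_left_const[OF _ x] by blast
    then obtain h where h: "\<And>P. P \<in> S \<Longrightarrow> h P \<in> polys L l" "\<And>P v. P \<in> S \<Longrightarrow> length v = l \<Longrightarrow> P (x @ v) = h P v"
      by metis
    have "zclosed L l {v \<in> affine_space l. \<forall>p\<in>h ` S. p v = 0}"
      unfolding zclosed_def by (rule exI[of _ "h ` S"]) (use h in auto)
    moreover have "reval g ` rdom g D \<subseteq> {v \<in> affine_space l. \<forall>p\<in>h ` S. p v = 0}"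
    proof (rule image_subsetI)
      fix v assume v: "v \<in> rdom g D"
      then have "x @ reval g v \<in> A" using A(2) Ge Gd by auto
      then show "reval g v \<in> {v \<in> affine_space l. \<forall>p\<in>h ` S. p v = 0}"
        using gY[OF v] Y S h by (auto simp: affine_space_def)
    qed
    ultimately have "Y \<subseteq> {v \<in> affine_space l. \<forall>p\<in>h ` S. p v = 0}" using g by (simp add: dominant_map_def)
    then show "(@) x ` Y \<subseteq> A" using S h x Y by (auto simp: affine_space_def)
  qed
  moreover have "\<forall>v \<in> rdom F ((@) x ` Y). reval F v \<in> rdom G D \<longrightarrow> reval G (reval F v) = v"
    unfolding Fd Gd using gf by (auto simp: Fe[OF fY] Ge)
  moreover have "\<forall>v \<in> rdom G D. reval G v \<in> rdom F ((@) x ` Y) \<longrightarrow> reval F (reval G v) = v"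
    unfolding Fd Gd using fg by (auto simp: Fe[OF gY] Ge)
  ultimately show ?thesis unfolding birational_def by blast
qed

lemma birational_refl:
  assumes "Y \<subseteq> affine_space l" "Y \<noteq> {}" "1 \<in> L"
  shows "birational L l Y l Y"
proof -
  define f where "f = map (\<lambda>i. (\<lambda>v :: 'a :: field list. v ! i, \<lambda>_ :: 'a list. 1 :: 'a)) [0..<l]"
  have d: "rdom f Y = Y" by (auto simp: rdom_def f_def)
  have e: "reval f v = v" if "v \<in> Y" for v
    using that assms by (auto simp: reval_def f_def affine_space_def intro!: nth_equalityI)
  have "dominant_map L l Y l Y f"
    unfolding dominant_map_def rational_map_def d
    using assms e by (auto simp: f_def intro: polys.intros)
  then show ?thesis unfolding birational_def using d e by (intro exI[of _ f]) auto
qed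

text \<open>The next variety is the locus of \<open>x @ y\<close> over \<open>k\<close>, up to a
  closed subset, and the map is the projection to the first coordinates. Over the generic point
  \<open>x\<close>, equations over \<open>k\<close> and equations over \<open>k(x)\<close> are
  interchangeable, so the fibre is a copy of \<open>Y\<close>.\<close>

lemma tower_step:
  fixes k :: "'a :: field_char_0 set"
  assumes k: "is_subfield k" and W: "variety k n W" "generic_point k n W x"
    and t: "torus (fracs k x) m T" "torsor (fracs k x) m T l Y act"
    and iso: "isomorphism (algebraic_closure_of (fracs k x)) l Y (2 * d) (carrier (Gm_power d)) f"
    and l0: "l = 0 \<Longrightarrow> d = 0" and y: "generic_point (fracs k x) l Y y"
    and tower: "\<And>W'. variety k (n + l) W' \<Longrightarrow> generic_point k (n + l) W' (x @ y) \<Longrightarrow> toric_rational_tower k (n + l) W'"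
  shows "toric_rational_tower k n W"
proof -
  let ?K = "fracs k x"
  have K: "is_subfield ?K" by (rule fracs_subfield)
  have k01: "1 \<in> k" "0 \<in> k" using k by (auto intro: subfield_intros)
  obtain A B where AB: "zclosed k n A" "zclosed k n B" "W = A - B" using W by (auto simp: variety_def)
  obtain S where S: "S \<subseteq> polys k n" "A = {x \<in> affine_space n. \<forall>p\<in>S. p x = 0}"
    using AB(1) by (auto simp: zclosed_def)
  obtain S' where S': "S' \<subseteq> polys k n" "B = {x \<in> affine_space n. \<forall>p\<in>S'. p x = 0}"
    using AB(2) by (auto simp: zclosed_def)
  have xW: "x \<in> W" and lx: "length x = n" using W AB S by (auto simp: generic_point_def affine_space_def)
  have yY: "y \<in> Y" using y by (simp add: generic_point_def)
  obtain SY where SY: "SY \<subseteq> polys ?K l" "Y = {x \<in> affine_space l. \<forall>p\<in>SY. p x = 0}"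
    using t(2)[unfolded torsor_def, THEN conjunct1] unfolding zclosed_def by blast
  have Ya: "Y \<subseteq> affine_space l" using SY by auto
  have ly: "length y = l" using yY Ya by (auto simp: affine_space_def)
  \<comment> \<open>\<open>W\<close> is only locally closed; removing the zeros of \<open>b\<close>
    makes the projection land in \<open>W\<close>.\<close>
  obtain b where b: "b \<in> S'" "b x \<noteq> 0" using xW AB S S' lx by (auto simp: affine_space_def)
  have bp: "b \<in> polys k n" "b \<in> polys k (n + l)" using b S' polys_mono[of b k n k "n + l"] by auto
  let ?C = "{v \<in> affine_space (n + l). \<forall>P\<in>{P \<in> polys k (n + l). P (x @ y) = 0}. P v = 0}"
  define W' where "W' = ?C - {v \<in> affine_space (n + l). b v = 0}"
  have W'_zc: "zclosed k (n + l) ?C" "zclosed k (n + l) {v \<in> affine_space (n + l). b v = 0}"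
    unfolding zclosed_def
    by (rule exI[of _ "{P \<in> polys k (n + l). P (x @ y) = 0}"], blast) (rule exI[of _ "{b}"], use bp in auto)
  have W'_gen: "generic_point k (n + l) W' (x @ y)"
    unfolding generic_point_def
  proof (intro conjI allI impI)
    show "x @ y \<in> W'" using lx ly b polys_append[OF bp(1) lx] by (simp add: W'_def affine_space_def)
    fix A' assume A': "zclosed k (n + l) A'" "x @ y \<in> A'"
    obtain S0 where S0: "S0 \<subseteq> polys k (n + l)" "A' = {x \<in> affine_space (n + l). \<forall>p\<in>S0. p x = 0}"
      using A' by (auto simp: zclosed_def)
    then show "W' \<subseteq> A'" using A'(2) by (auto simp: W'_def)
  qed
  have W'_aff: "W' \<subseteq> affine_space (n + l)" by (auto simp: W'_def)
  have W'_var: "variety k (n + l) W'"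
    unfolding variety_def using W'_zc generic_irreducible[OF W'_aff W'_gen] W'_def by blast
  have take_W: "take n v \<in> W" if v: "v \<in> W'" for v
  proof -
    have l: "length v = n + l" using v W'_aff by (auto simp: affine_space_def)
    have "p (take n v) = 0" if "p \<in> S" for p
    proof -
      have p: "p \<in> polys k n" "p x = 0" using that S xW AB by auto
      then have "p \<in> polys k (n + l)" "p (x @ y) = 0"
        using polys_mono[of p k n k "n + l"] polys_append[OF p(1) lx] by auto
      then show ?thesis using v polys_take[OF p(1)] by (auto simp: W'_def)
    qed
    moreover have "b (take n v) \<noteq> 0" using v polys_take[OF bp(1)] by (auto simp: W'_def)
    ultimately show ?thesis using AB S S' b l by (auto simp: affine_space_def)
  qed
  define \<pi> where "\<pi> = map (\<lambda>i. (\<lambda>v :: 'a list. v ! i, \<lambda>_ :: 'a list. 1 :: 'a)) [0..<n]"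
  have \<pi>_dom: "rdom \<pi> W' = W'" by (auto simp: rdom_def \<pi>_def)
  have \<pi>_eval: "reval \<pi> v = take n v" if "v \<in> W'" for v
    using that W'_aff by (auto simp: reval_def \<pi>_def affine_space_def intro!: nth_equalityI)
  have \<pi>_dominant: "dominant_map k (n + l) W' n W \<pi>"
    unfolding dominant_map_def rational_map_def \<pi>_dom
  proof (intro conjI allI impI)
    show "length \<pi> = n" by (simp add: \<pi>_def)
    show "\<forall>(p, q)\<in>set \<pi>. p \<in> polys k (n + l) \<and> q \<in> polys k (n + l) \<and> (\<exists>x\<in>W'. q x \<noteq> 0)"
      using W'_gen k01 by (auto simp: \<pi>_def generic_point_def intro!: polys.intros)
    show "reval \<pi> ` W' \<subseteq> W" using \<pi>_eval take_W by auto
    fix A' assume A': "zclosed k n A'" "reval \<pi> ` W' \<subseteq> A'"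
    have "x @ y \<in> W'" using W'_gen by (simp add: generic_point_def)
    then have "x \<in> A'" using A'(2) \<pi>_eval[of "x @ y"] lx by force
    then show "W \<subseteq> A'" using W A' by (simp add: generic_point_def)
  qed
  have fib: "fibre \<pi> W' x = (@) x ` Y"
  proof (intro equalityI subsetI)
    fix v assume "v \<in> fibre \<pi> W' x"
    then have v: "v \<in> W'" "take n v = x" using \<pi>_dom \<pi>_eval by (auto simp: fibre_def)
    define u where "u = drop n v"
    have vu: "v = x @ u" using v(2) append_take_drop_id[of n v] by (simp add: u_def)
    have lu: "length u = l" using v W'_aff by (auto simp: affine_space_def u_def)
    have "p u = 0" if p: "p \<in> SY" for p
    proof -
      obtain P q where P: "P \<in> polys k (n + l)" "q \<in> polys k n" "q x \<noteq> 0"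
          "\<forall>v. length v = l \<longrightarrow> P (x @ v) = q x * p v"
        using fracs_polys_clear[OF k _ lx[symmetric], of p l] p SY by blast
      have "p y = 0" using yY SY p by auto
      then have "P (x @ y) = 0" using P(4) ly by simp
      then have "P (x @ u) = 0" using v vu P(1) by (auto simp: W'_def)
      then show ?thesis using P lu by simp
    qed
    then show "v \<in> (@) x ` Y" using SY lu vu by (auto simp: affine_space_def)
  next
    fix v assume "v \<in> (@) x ` Y"
    then obtain u where u: "u \<in> Y" "v = x @ u" by blast
    have lu: "length u = l" using u Ya by (auto simp: affine_space_def)
    have "P v = 0" if P: "P \<in> polys k (n + l)" "P (x @ y) = 0" for P
    proof -
      obtain p where p: "p \<in> polys ?K l" "\<forall>v. length v = l \<longrightarrow> P (x @ v) = p v"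
        using polys_specialize_left[OF P(1) lx] by blast
      then have "p y = 0" using P ly by simp
      then have "p u = 0" by (rule generic_zero[OF y p(1) _ u(1) Ya])
      then show ?thesis using p lu u by simp
    qed
    then have "v \<in> W'" using u lu lx b polys_append[OF bp(1) lx] by (simp add: W'_def affine_space_def)
    then show "v \<in> fibre \<pi> W' x" using \<pi>_dom \<pi>_eval u lx by (simp add: fibre_def)
  qed
  let ?L = "algebraic_closure_of ?K"
  have KL: "?K \<subseteq> ?L"
  proof
    fix c assume "c \<in> ?K"
    then show "c \<in> ?L"
      using K by (auto simp: algebraic_closure_of_def subfield_intros coeff_pCons split: nat.splits
          intro!: exI[of _ "[:- c, 1:]"])
  qed
  have K1: "1 \<in> ?K" using K by (rule subfield_one)
  have L1: "1 \<in> ?L" using K1 KL by blast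
  have xK: "set x \<subseteq> ?K" by (rule fracs_gens)
  have geo: "irreducible_over ?L l Y" "rational_over ?L l Y"
    using torus_geometry[OF iso L1 Ya l0] by blast+
  have Z1: "geom_irreducible ?K (n + l) (fibre \<pi> W' x)"
    unfolding geom_irreducible_def fib using irreducible_shift[OF geo(1) lx] xK KL by blast
  have Z2: "geom_rational ?K (n + l) (fibre \<pi> W' x)"
  proof -
    obtain d' where "birational ?L l Y d' (affine_space d')" using geo(2) by (auto simp: rational_over_def)
    moreover have "affine_space d' \<noteq> ({} :: 'a list set)"
      by (auto simp: affine_space_def intro: exI[of _ "replicate d' 0"])
    ultimately have "birational ?L (n + l) ((@) x ` Y) d' (affine_space d')"
      using xK KL by (intro birational_shift[OF _ lx _ Ya L1]) auto
    then show ?thesis unfolding geom_rational_def rational_over_def fib by blast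
  qed
  have "birational ?K l Y l Y" by (rule birational_refl[OF Ya _ K1]) (use yY in blast)
  then have "birational ?K (n + l) (fibre \<pi> W' x) l Y"
    unfolding fib by (rule birational_shift[OF _ lx xK Ya K1]) (use yY in blast)
  then have Z3: "birational_to_torus_torsor ?K (n + l) (fibre \<pi> W' x)"
    using t unfolding birational_to_torus_torsor_def by blast
  obtain N D V pr where tw: "D 0 = n + l" "V 0 = W'" "\<forall>i\<le>N. variety k (D i) (V i)"
      "rational_over k (D N) (V N)" "\<forall>i\<in>{1..N::nat}.
           dominant_map k (D i) (V i) (D (i - 1)) (V (i - 1)) (pr i) \<and>
           (\<exists>y. generic_point k (D (i - 1)) (V (i - 1)) y \<and>
              (let K = field_adjoin k (set y); Z = fibre (pr i) (V i) y in
                 geom_rational K (D i) Z \<and> geom_irreducible K (D i) Z \<and>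
                 birational_to_torus_torsor K (D i) Z))"
    using tower[OF W'_var W'_gen] unfolding toric_rational_tower_def by blast
  \<comment> \<open>The given tower is prolonged at its lower end, so all indices shift by
    one.\<close>
  let ?D = "case_nat n D" and ?V = "case_nat W V" and ?pr = "\<lambda>i. if i = 1 then \<pi> else pr (i - 1)"
  show ?thesis
    unfolding toric_rational_tower_def
  proof (rule exI[of _ "Suc N"], rule exI[of _ ?D], rule exI[of _ ?V], rule exI[of _ ?pr], intro conjI ballI allI impI)
    show "?D 0 = n" "?V 0 = W" by simp_all
    show "variety k (?D i) (?V i)" if "i \<le> Suc N" for i
      using that W tw(3) by (cases i) auto
    show "rational_over k (?D (Suc N)) (?V (Suc N))" using tw(4) by simp
    fix i assume i: "i \<in> {1..Suc N}"
    show "dominant_map k (?D i) (?V i) (?D (i - 1)) (?V (i - 1)) (?pr i)"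
    proof (cases "i = 1")
      case True
      then show ?thesis using \<pi>_dominant tw(1,2) by simp
    next
      case False
      then obtain j where j: "i = Suc (Suc j)" using i by (cases i; cases "i - 1") auto
      then have "Suc j \<in> {1..N}" using i by simp
      from bspec[OF tw(5) this] show ?thesis using j by simp
    qed
    show "\<exists>y. generic_point k (?D (i - 1)) (?V (i - 1)) y \<and>
              (let K = field_adjoin k (set y); Z = fibre (?pr i) (?V i) y in
                 geom_rational K (?D i) Z \<and> geom_irreducible K (?D i) Z \<and>
                 birational_to_torus_torsor K (?D i) Z)"
    proof (cases "i = 1")
      case True
      then show ?thesis using W Z1 Z2 Z3 tw(1,2)
        by (intro exI[of _ x]) (simp add: Let_def flip: fracs_def)
    next
      case False
      then obtain j where j: "i = Suc (Suc j)" using i by (cases i; cases "i - 1") auto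
      then have "Suc j \<in> {1..N}" using i by simp
      from bspec[OF tw(5) this] show ?thesis using j by simp
    qed
  qed
qed

text \<open>The induction is over all models of the field at once, since each step constructs its
  own next variety. At the top the field is purely transcendental, so that model is birational to
  affine space.\<close>

theorem torsor_tower_toric_rational_tower:
  fixes k :: "'a :: field_char_0 set"
  assumes k: "is_subfield k" and "torsor_tower k K"
    and "variety k n W" "generic_point k n W x" "fracs k x = K"
  shows "toric_rational_tower k n W"
  using assms(2-5)
proof (induction arbitrary: n W x rule: torsor_tower.induct)
  case (base t)
  obtain A B where AB: "zclosed k n A" "zclosed k n B" "W = A - B" using base by (auto simp: variety_def)
  have k1: "1 \<in> k" using k by (rule subfield_one)
  have "birational k n W (length t) (affine_space (length t))"
    by (rule birational_if_same_field[OF k AB base(3) zclosed_affine(1)[OF k1] zclosed_affine(2)[OF k1] _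
          affine_generic[OF k1 base(1) refl] base(4)]) simp
  then have "rational_over k n W" unfolding rational_over_def by blast
  then show ?case using base(2) unfolding toric_rational_tower_def
    by (intro exI[of _ 0] exI[of _ "\<lambda>_. n"] exI[of _ "\<lambda>_. W"]) auto
next
  case (step K m T l Y act d f y)
  have Kx: "K = fracs k x" using step.prems(3) by simp
  note hyps = step.hyps[unfolded Kx]
  show ?case
  proof (rule tower_step[OF k step.prems(1,2) hyps(1-5)])
    fix W' assume "variety k (n + l) W'" "generic_point k (n + l) W' (x @ y)"
    then show "toric_rational_tower k (n + l) W'"
      using step.IH fracs_append[of k x y] step.prems(3) by simp
  qed
qed

section \<open>Roots of unity and characters\<close>

lemma nth_root_exists:
  fixes x :: "'a :: alg_closed_field"
  assumes "n > 0"
  shows "\<exists>y. y ^ n = x"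
proof -
  have "coeff (monom 1 n - [:x:]) n = 1" using assms by (auto simp: coeff_pCons split: nat.splits)
  then have "degree (monom 1 n - [:x:]) \<ge> n" by (intro le_degree) auto
  then have "degree (monom 1 n - [:x:]) > 0" using assms by linarith
  from alg_closed_imp_poly_has_root[OF this] show ?thesis by (auto simp: poly_monom)
qed

definition primitive_root :: "nat \<Rightarrow> 'a :: field \<Rightarrow> bool" where
  "primitive_root N \<zeta> \<longleftrightarrow> (\<forall>i. \<zeta> ^ i = 1 \<longleftrightarrow> N dvd i)"

text \<open>A root of \<open>1 + X + ... + X ^ (p - 1)\<close> is taken. It is not 1, because the
  value there is \<open>p\<close>, which is nonzero in characteristic zero.\<close>

lemma exists_prime_root_of_unity:
  assumes p: "prime (p :: nat)"
  shows "\<exists>\<epsilon> :: 'a :: {alg_closed_field, field_char_0}. \<epsilon> \<noteq> 1 \<and> \<epsilon> ^ p = 1"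
proof -
  define P :: "'a poly" where "P = (\<Sum>i<p. monom 1 i)"
  have "coeff P (p - 1) = 1"
    using prime_gt_1_nat[OF p] by (simp add: P_def coeff_sum if_distrib cong: if_cong)
  then have "degree P \<ge> p - 1" by (intro le_degree) auto
  then have "degree P > 0" using prime_gt_1_nat[OF p] by linarith
  from alg_closed_imp_poly_has_root[OF this] obtain \<epsilon> where \<epsilon>: "poly P \<epsilon> = 0" by blast
  then have s: "(\<Sum>i<p. \<epsilon> ^ i) = 0" by (simp add: P_def poly_sum poly_monom)
  have "\<epsilon> \<noteq> 1"
  proof
    assume "\<epsilon> = 1"
    then show False using s prime_gt_0_nat[OF p] by simp
  qed
  moreover have "\<epsilon> ^ p - 1 = (\<epsilon> - 1) * (\<Sum>i<p. \<epsilon> ^ i)" by (rule power_diff_1_eq)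
  ultimately show ?thesis using s by auto
qed

text \<open>The order grows by one prime factor at a time. If \<open>p\<close> divides
  \<open>m\<close>, a \<open>p\<close>-th root of a primitive root works; otherwise a primitive root
  is multiplied by a root of unity of order \<open>p\<close>.\<close>

lemma exists_primitive_root:
  assumes "N > 0"
  shows "\<exists>\<zeta> :: 'a :: {alg_closed_field, field_char_0}. primitive_root N \<zeta>"
  using assms
proof (induction N rule: prime_divisors_induct)
  case (unit m)
  then show ?case by (intro exI[of _ 1]) (auto simp: primitive_root_def)
next
  case (factor p m)
  then have p: "prime p" and m: "m > 0" by auto
  then obtain \<zeta> :: 'a where \<zeta>: "\<And>i. \<zeta> ^ i = 1 \<longleftrightarrow> m dvd i" using factor by (auto simp: primitive_root_def)
  show ?case
  proof (cases "p dvd m")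
    case True
    obtain \<eta> where \<eta>: "\<eta> ^ p = \<zeta>" using nth_root_exists[of p \<zeta>] prime_gt_0_nat[OF p] by blast
    have "\<eta> ^ i = 1 \<longleftrightarrow> p * m dvd i" for i
    proof
      assume 1: "\<eta> ^ i = 1"
      have "\<zeta> ^ i = (\<eta> ^ i) ^ p" unfolding \<eta>[symmetric] by (simp add: power_mult[symmetric] mult.commute)
      then have "m dvd i" using 1 \<zeta> by simp
      then obtain i' where i': "i = p * i'" using True by (metis dvd_trans dvdE)
      then have "\<zeta> ^ i' = 1" using 1 \<eta> by (simp add: power_mult)
      then show "p * m dvd i" using \<zeta> i' by simp
    next
      assume "p * m dvd i"
      then obtain j where "i = p * m * j" by (rule dvdE)
      then have "i = p * (m * j)" by (simp add: mult.assoc)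
      then have "\<eta> ^ i = \<zeta> ^ (m * j)" using \<eta> by (simp add: power_mult)
      then show "\<eta> ^ i = 1" using \<zeta> by simp
    qed
    then show ?thesis by (auto simp: primitive_root_def)
  next
    case False
    then have cop: "coprime p m" using p by (simp add: prime_imp_coprime)
    obtain \<epsilon> :: 'a where \<epsilon>: "\<epsilon> \<noteq> 1" "\<epsilon> ^ p = 1" using exists_prime_root_of_unity[OF p] by blast
    have \<epsilon>_dvd: "p dvd j" if "\<epsilon> ^ j = 1" for j
    proof (rule ccontr)
      assume nd: "\<not> p dvd j"
      then have "j \<noteq> 0" by (metis dvd_0_right)
      moreover have "gcd j p = 1" using nd p by (metis coprime_imp_gcd_eq_1 gcd.commute prime_imp_coprime)
      ultimately obtain x y where xy: "j * x = p * y + 1" using bezout_nat[of j p] by auto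
      have "\<epsilon> ^ (j * x) = 1" using that by (simp add: power_mult)
      moreover have "\<epsilon> ^ (p * y + 1) = \<epsilon>" using \<epsilon> by (simp add: power_mult power_add)
      ultimately show False using xy \<epsilon> by simp
    qed
    have "(\<zeta> * \<epsilon>) ^ i = 1 \<longleftrightarrow> p * m dvd i" for i
    proof
      assume 1: "(\<zeta> * \<epsilon>) ^ i = 1"
      have "1 = ((\<zeta> * \<epsilon>) ^ i) ^ p" using 1 by simp
      also have "\<dots> = \<zeta> ^ (i * p) * (\<epsilon> ^ p) ^ i" by (simp add: power_mult_distrib power_mult[symmetric] mult.commute)
      finally have "m dvd i * p" using \<epsilon> \<zeta> by simp
      then have mi: "m dvd i" using cop by (simp add: coprime_dvd_mult_left_iff coprime_commute)
      have "1 = ((\<zeta> * \<epsilon>) ^ i) ^ m" using 1 by simp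
      also have "\<dots> = (\<zeta> ^ m) ^ i * \<epsilon> ^ (i * m)" by (simp add: power_mult_distrib power_mult[symmetric] mult.commute)
      also have "\<zeta> ^ m = 1" using \<zeta> by simp
      finally have "\<epsilon> ^ (i * m) = 1" by simp
      then have "p dvd i" using \<epsilon>_dvd[of "i * m"] cop by (simp add: coprime_dvd_mult_left_iff)
      then show "p * m dvd i" using mi cop by (simp add: divides_mult)
    next
      assume "p * m dvd i"
      then obtain j where j: "i = p * m * j" by blast
      have "\<zeta> ^ i = 1" using \<zeta> j by simp
      moreover have "\<epsilon> ^ i = 1" unfolding j mult.assoc using \<epsilon> by (simp add: power_mult)
      ultimately show "(\<zeta> * \<epsilon>) ^ i = 1" by (simp add: power_mult_distrib)
    qed
    then show ?thesis by (auto simp: primitive_root_def)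
  qed
qed simp

text \<open>The powers of \<open>\<zeta>\<close> are already \<open>N\<close> distinct roots of
  \<open>X ^ N - 1\<close>, so there are no others.\<close>

lemma root_of_unity_power:
  fixes \<zeta> :: "'a :: field"
  assumes \<zeta>: "primitive_root N \<zeta>" and N: "N > 0" and z: "z ^ N = 1"
  shows "\<exists>l<N. z = \<zeta> ^ l"
proof -
  let ?P = "monom 1 N - [:1 :: 'a:]"
  have c: "coeff ?P N = 1" using N by (auto simp: coeff_pCons split: nat.splits)
  then have P0: "?P \<noteq> 0" by (metis coeff_0 zero_neq_one)
  have deg: "degree ?P \<le> N" by (intro degree_diff_le) (auto simp: degree_monom_le)
  have inj: "inj_on (\<lambda>l. \<zeta> ^ l) {..<N}"
  proof (rule linorder_inj_onI)
    fix i j assume ij: "i < j" "i \<in> {..<N}" "j \<in> {..<N}"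
    have "\<zeta> ^ N = 1" using \<zeta> by (simp add: primitive_root_def)
    then have z0: "\<zeta> \<noteq> 0" using N by (metis power_eq_0_iff zero_neq_one)
    have "\<zeta> ^ (j - i) \<noteq> 1" using \<zeta> ij by (auto simp: primitive_root_def dest: dvd_imp_le)
    moreover have "\<zeta> ^ j = \<zeta> ^ i * \<zeta> ^ (j - i)" using ij by (simp flip: power_add)
    ultimately show "\<zeta> ^ i \<noteq> \<zeta> ^ j" using z0 by auto
  qed auto
  have sub: "(\<lambda>l. \<zeta> ^ l) ` {..<N} \<subseteq> {x. poly ?P x = 0}"
    using \<zeta> by (auto simp: primitive_root_def poly_monom simp flip: power_mult)
  have "card {x. poly ?P x = 0} \<le> N" using card_poly_roots_bound[OF P0] deg by linarith
  then have "(\<lambda>l. \<zeta> ^ l) ` {..<N} = {x. poly ?P x = 0}"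
    using sub card_image[OF inj] poly_roots_finite[OF P0] by (intro card_seteq) auto
  moreover have "z \<in> {x. poly ?P x = 0}" using z by (simp add: poly_monom)
  ultimately show ?thesis by blast
qed

lemma sum_periodic:
  fixes h :: "nat \<Rightarrow> 'a :: comm_monoid_add"
  assumes "h N = h 0"
  shows "(\<Sum>i<N. h (Suc i)) = (\<Sum>i<N. h i)"
proof (cases N)
  case (Suc M)
  have "(\<Sum>i<N. h (Suc i)) = (\<Sum>i<M. h (Suc i)) + h N" using Suc by simp
  also have "\<dots> = (\<Sum>i<Suc M. h i)" unfolding sum.lessThan_Suc_shift by (simp add: assms add.commute)
  finally show ?thesis using Suc by simp
qed simp

text \<open>On the functions on the group with vanishing averages along the cosets of \<open>\<langle>a\<rangle>\<close>, the
  commuting translations have a common eigenvector; its eigenvalues form a character, which is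
  nontrivial at \<open>a\<close>.\<close>

lemma character_separates:
  fixes \<zeta> :: "'k :: field_char_0"
  assumes G: "comm_group G" and fin: "finite (carrier G)" and N: "N = card (carrier G)"
    and \<zeta>: "primitive_root N \<zeta>" and a: "a \<in> carrier G" "a \<noteq> \<one>\<^bsub>G\<^esub>"
  shows "\<exists>l. (\<forall>b\<in>carrier G. l b < N) \<and> (\<forall>b\<in>carrier G. \<forall>c\<in>carrier G. (l b + l c) mod N = l (b \<otimes>\<^bsub>G\<^esub> c)) \<and> l a \<noteq> 0"
proof -
  interpret comm_group G by (rule G)
  have N0: "N > 0" using N fin by (auto simp: card_gt_0_iff)
  have pN: "b [^]\<^bsub>G\<^esub> N = \<one>\<^bsub>G\<^esub>" if "b \<in> carrier G" for b using pow_order_eq_1[OF that] N by (simp add: Coset.order_def)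
  have sh: "(x \<otimes>\<^bsub>G\<^esub> b) \<otimes>\<^bsub>G\<^esub> b [^]\<^bsub>G\<^esub> i = x \<otimes>\<^bsub>G\<^esub> b [^]\<^bsub>G\<^esub> Suc i" if "x \<in> carrier G" "b \<in> carrier G" for x b and i :: nat
    using that by (simp add: m_assoc m_comm m_lcomm)
  define good where "good f \<longleftrightarrow> (\<exists>x\<in>carrier G. f x \<noteq> 0) \<and> (\<forall>x\<in>carrier G. (\<Sum>i<N. f (x \<otimes>\<^bsub>G\<^esub> a [^]\<^bsub>G\<^esub> i)) = 0)"
    for f :: "'a \<Rightarrow> 'k"
  have ex: "\<exists>f. good f \<and> (\<forall>b\<in>S. \<exists>z. \<forall>x\<in>carrier G. f (x \<otimes>\<^bsub>G\<^esub> b) = z * f x)"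
    if "finite S" "S \<subseteq> carrier G" for S
    using that
  proof (induction S rule: finite_induct)
    case empty
    \<comment> \<open>The difference of a function and its translate by \<open>a\<close> has
      vanishing averages; starting from the indicator of the identity makes it nonzero.\<close>
    define h :: "'a \<Rightarrow> 'k" where "h x = of_bool (x = \<one>\<^bsub>G\<^esub>)" for x
    define f where "f x = h x - h (x \<otimes>\<^bsub>G\<^esub> a)" for x
    have "f \<one>\<^bsub>G\<^esub> \<noteq> 0" using a by (simp add: f_def h_def)
    moreover have "(\<Sum>i<N. f (x \<otimes>\<^bsub>G\<^esub> a [^]\<^bsub>G\<^esub> i)) = 0" if x: "x \<in> carrier G" for x
    proof -
      have "f (x \<otimes>\<^bsub>G\<^esub> a [^]\<^bsub>G\<^esub> i) = h (x \<otimes>\<^bsub>G\<^esub> a [^]\<^bsub>G\<^esub> i) - h (x \<otimes>\<^bsub>G\<^esub> a [^]\<^bsub>G\<^esub> Suc i)" for i :: nat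
        using x a by (simp add: f_def m_assoc)
      then show ?thesis using sum_periodic[of "\<lambda>i. h (x \<otimes>\<^bsub>G\<^esub> a [^]\<^bsub>G\<^esub> i)" N] pN[OF a(1)]
        by (simp add: sum_subtractf)
    qed
    ultimately show ?case by (intro exI[of _ f]) (auto simp: good_def)
  next
    case (insert b S)
    then have b: "b \<in> carrier G" and S: "S \<subseteq> carrier G" by auto
    obtain f where f: "good f" "\<forall>b\<in>S. \<exists>z. \<forall>x\<in>carrier G. f (x \<otimes>\<^bsub>G\<^esub> b) = z * f x" using insert by auto
    \<comment> \<open>Up to a scalar, \<open>P j\<close> is the projection to the eigenspace of the
      translation by \<open>b\<close> whose eigenvalue is the inverse of \<open>\<zeta> ^ j\<close>.
      Translations commute, so the properties already achieved persist.\<close>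
    define P where "P j x = (\<Sum>i<N. \<zeta> ^ (i * j) * f (x \<otimes>\<^bsub>G\<^esub> b [^]\<^bsub>G\<^esub> i))" for j x
    have Pb: "\<zeta> ^ j * P j (x \<otimes>\<^bsub>G\<^esub> b) = P j x" if x: "x \<in> carrier G" for j x
    proof -
      have "\<zeta> ^ j * P j (x \<otimes>\<^bsub>G\<^esub> b) = (\<Sum>i<N. \<zeta> ^ (Suc i * j) * f (x \<otimes>\<^bsub>G\<^esub> b [^]\<^bsub>G\<^esub> Suc i))"
        unfolding P_def sum_distrib_left using x b by (simp only: sh) (simp add: power_add mult.assoc)
      also have "\<dots> = P j x" unfolding P_def
        by (rule sum_periodic) (use pN[OF b] \<zeta> in \<open>simp add: primitive_root_def\<close>)
      finally show ?thesis .
    qed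
    have z0: "\<zeta> \<noteq> 0" using \<zeta> N0 unfolding primitive_root_def by (metis dvd_refl power_eq_0_iff zero_neq_one)
    have eig_b: "P j (x \<otimes>\<^bsub>G\<^esub> b) = inverse (\<zeta> ^ j) * P j x" if "x \<in> carrier G" for j x
      using Pb[OF that, of j] z0 by (simp add: field_simps)
    have lin: "P j (x \<otimes>\<^bsub>G\<^esub> c) = (\<Sum>i<N. \<zeta> ^ (i * j) * f ((x \<otimes>\<^bsub>G\<^esub> b [^]\<^bsub>G\<^esub> i) \<otimes>\<^bsub>G\<^esub> c))"
      if "x \<in> carrier G" "c \<in> carrier G" for j x c
      unfolding P_def using that b by (intro sum.cong refl) (simp add: m_assoc m_comm[of c])
    have eig_S: "\<exists>z. \<forall>x\<in>carrier G. P j (x \<otimes>\<^bsub>G\<^esub> c) = z * P j x" if c: "c \<in> S" for j c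
    proof -
      obtain z where z: "\<forall>x\<in>carrier G. f (x \<otimes>\<^bsub>G\<^esub> c) = z * f x" using f(2) c by blast
      have "P j (x \<otimes>\<^bsub>G\<^esub> c) = z * P j x" if "x \<in> carrier G" for x
        using lin[OF that, of c j] c S z that b by (auto simp: P_def sum_distrib_left mult_ac)
      then show ?thesis by blast
    qed
    have avg: "(\<Sum>i<N. P j (x \<otimes>\<^bsub>G\<^esub> a [^]\<^bsub>G\<^esub> i)) = 0" if x: "x \<in> carrier G" for j x
    proof -
      have "(\<Sum>i<N. P j (x \<otimes>\<^bsub>G\<^esub> a [^]\<^bsub>G\<^esub> i)) =
          (\<Sum>i<N. \<Sum>i'<N. \<zeta> ^ (i' * j) * f ((x \<otimes>\<^bsub>G\<^esub> b [^]\<^bsub>G\<^esub> i') \<otimes>\<^bsub>G\<^esub> a [^]\<^bsub>G\<^esub> i))"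
        using lin[OF x] a by simp
      also have "\<dots> = (\<Sum>i'<N. \<zeta> ^ (i' * j) * (\<Sum>i<N. f ((x \<otimes>\<^bsub>G\<^esub> b [^]\<^bsub>G\<^esub> i') \<otimes>\<^bsub>G\<^esub> a [^]\<^bsub>G\<^esub> i)))"
        by (subst sum.swap) (simp add: sum_distrib_left)
      also have "\<dots> = 0" using f(1) x b by (intro sum.neutral) (simp add: good_def)
      finally show ?thesis .
    qed
    \<comment> \<open>The projections add up to a nonzero multiple of \<open>f\<close>, so one of
      them is nonzero.\<close>
    have "(\<Sum>j<N. P j x) = of_nat N * f x" if x: "x \<in> carrier G" for x
    proof -
      have orth: "(\<Sum>j<N. \<zeta> ^ (i * j)) = (if i = 0 then of_nat N else 0)" if i: "i < N" for i
      proof (cases "i = 0")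
        case False
        have "(\<zeta> ^ i) ^ N - 1 = (\<zeta> ^ i - 1) * (\<Sum>j<N. (\<zeta> ^ i) ^ j)" by (rule power_diff_1_eq)
        moreover have "(\<zeta> ^ i) ^ N = 1" using \<zeta> by (simp add: primitive_root_def flip: power_mult)
        moreover have "\<zeta> ^ i \<noteq> 1" using \<zeta> i False by (auto simp: primitive_root_def dest: dvd_imp_le)
        ultimately show ?thesis using False by (simp add: power_mult)
      qed simp
      have "(\<Sum>j<N. P j x) = (\<Sum>i<N. (\<Sum>j<N. \<zeta> ^ (i * j)) * f (x \<otimes>\<^bsub>G\<^esub> b [^]\<^bsub>G\<^esub> i))"
        unfolding P_def sum_distrib_right by (rule sum.swap)
      also have "\<dots> = (\<Sum>i<N. (if i = 0 then of_nat N else 0) * f (x \<otimes>\<^bsub>G\<^esub> b [^]\<^bsub>G\<^esub> i))"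
        using orth by simp
      also have "\<dots> = of_nat N * f x"
        using N0 x by (simp add: if_distrib[of "\<lambda>x. x * _"] cong: if_cong)
      finally show ?thesis .
    qed
    moreover obtain x where x: "x \<in> carrier G" "f x \<noteq> 0" using f(1) by (auto simp: good_def)
    ultimately have "(\<Sum>j<N. P j x) \<noteq> 0" using N0 by simp
    then obtain j where "P j x \<noteq> 0" by (meson sum.neutral)
    then have "good (P j)" using x avg by (auto simp: good_def)
    then show ?case using eig_b eig_S by (intro exI[of _ "P j"]) auto
  qed
  obtain f where f: "good f" "\<forall>b\<in>carrier G. \<exists>z. \<forall>x\<in>carrier G. f (x \<otimes>\<^bsub>G\<^esub> b) = z * f x"
    using ex[OF fin order_refl] by blast
  then obtain \<chi> where \<chi>: "\<And>b x. b \<in> carrier G \<Longrightarrow> x \<in> carrier G \<Longrightarrow> f (x \<otimes>\<^bsub>G\<^esub> b) = \<chi> b * f x" by metis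
  obtain x0 where x0: "x0 \<in> carrier G" "f x0 \<noteq> 0" using f(1) by (auto simp: good_def)
  have mult: "\<chi> (b \<otimes>\<^bsub>G\<^esub> c) = \<chi> b * \<chi> c" if "b \<in> carrier G" "c \<in> carrier G" for b c
  proof -
    have "\<chi> (b \<otimes>\<^bsub>G\<^esub> c) * f x0 = f ((x0 \<otimes>\<^bsub>G\<^esub> b) \<otimes>\<^bsub>G\<^esub> c)" using that x0 \<chi> by (simp add: m_assoc)
    also have "\<dots> = \<chi> b * \<chi> c * f x0" using that x0 \<chi> by simp
    finally show ?thesis using x0 by simp
  qed
  have one: "\<chi> \<one>\<^bsub>G\<^esub> = 1" using \<chi>[of "\<one>\<^bsub>G\<^esub>" x0] x0 by simp
  have pow: "\<chi> (b [^]\<^bsub>G\<^esub> i) = \<chi> b ^ i" if "b \<in> carrier G" for b and i :: nat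
    using that by (induction i) (auto simp: one mult)
  have "\<exists>l<N. \<chi> b = \<zeta> ^ l" if "b \<in> carrier G" for b
    by (rule root_of_unity_power[OF \<zeta> N0]) (use pow[OF that, of N] pN[OF that] one in simp)
  then obtain l where l: "\<And>b. b \<in> carrier G \<Longrightarrow> l b < N" "\<And>b. b \<in> carrier G \<Longrightarrow> \<chi> b = \<zeta> ^ l b" by metis
  have zmod: "\<zeta> ^ i = \<zeta> ^ (i mod N)" for i
  proof -
    have "\<zeta> ^ i = \<zeta> ^ (N * (i div N) + i mod N)" by simp
    also have "\<dots> = \<zeta> ^ (i mod N)" using \<zeta> by (simp only: power_add) (simp add: primitive_root_def)
    finally show ?thesis .
  qed
  have zinj: "i = j" if "i < N" "j < N" "\<zeta> ^ i = \<zeta> ^ j" for i j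
  proof -
    have "i \<le> j \<Longrightarrow> i = j" if "i < N" "j < N" "\<zeta> ^ i = \<zeta> ^ j" for i j
    proof (rule ccontr)
      assume le: "i \<le> j" and ne: "i \<noteq> j"
      have "\<zeta> ^ j = \<zeta> ^ i * \<zeta> ^ (j - i)" using le by (simp flip: power_add)
      moreover have "\<zeta> \<noteq> 0" using \<zeta> N0 unfolding primitive_root_def by (metis dvd_refl power_eq_0_iff zero_neq_one)
      ultimately have "\<zeta> ^ (j - i) = 1" using that by simp
      then show False using \<zeta> that le ne by (auto simp: primitive_root_def dest: dvd_imp_le)
    qed
    from this[of i j] this[of j i] show ?thesis using that by (cases "i \<le> j") auto
  qed
  have "(l b + l c) mod N = l (b \<otimes>\<^bsub>G\<^esub> c)" if "b \<in> carrier G" "c \<in> carrier G" for b c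
  proof (rule zinj)
    show "\<zeta> ^ ((l b + l c) mod N) = \<zeta> ^ l (b \<otimes>\<^bsub>G\<^esub> c)"
      using that l mult by (simp add: power_add flip: zmod)
  qed (use that l N0 in auto)
  \<comment> \<open>With eigenvalue 1 at \<open>a\<close>, the average at \<open>x0\<close> would be
    a nonzero multiple of \<open>f x0\<close>.\<close>
  moreover have "l a \<noteq> 0"
  proof
    assume "l a = 0"
    then have "\<chi> a = 1" using l a by simp
    then have "(\<Sum>i<N. f (x0 \<otimes>\<^bsub>G\<^esub> a [^]\<^bsub>G\<^esub> i)) = of_nat N * f x0"
      using \<chi> x0 a pow by simp
    then show False using f(1) x0 N0 by (auto simp: good_def)
  qed
  ultimately show ?thesis using l by blast
qed

section \<open>Split extensions with abelian kernel\<close>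

locale split_extension =
  fixes B :: "('b, 'm) monoid_scheme" and Q :: "('q, 'n) monoid_scheme" and p :: "'b \<Rightarrow> 'q" and s :: "'q \<Rightarrow> 'b"
  assumes B: "group B" "finite (carrier B)" and Q: "group Q"
    and p: "p \<in> hom B Q" and s: "s \<in> hom Q B" and ps: "q \<in> carrier Q \<Longrightarrow> p (s q) = q"
    and comm: "a \<in> carrier B \<Longrightarrow> a' \<in> carrier B \<Longrightarrow> p a = \<one>\<^bsub>Q\<^esub> \<Longrightarrow> p a' = \<one>\<^bsub>Q\<^esub> \<Longrightarrow> a \<otimes>\<^bsub>B\<^esub> a' = a' \<otimes>\<^bsub>B\<^esub> a"
begin

sublocale B: group B by (rule B)
sublocale Q: group Q by (rule Q)
sublocale ph: group_hom B Q p by unfold_locales (rule p)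
sublocale sh: group_hom Q B s by unfold_locales (rule s)

definition ker :: "'b set" where
  "ker = {a \<in> carrier B. p a = \<one>\<^bsub>Q\<^esub>}"

lemma ker_subgroup: "subgroup ker B"
  using ph.subgroup_kernel by (simp add: ker_def kernel_def)

lemma ker_D: "a \<in> ker \<Longrightarrow> a \<in> carrier B" "a \<in> ker \<Longrightarrow> p a = \<one>\<^bsub>Q\<^esub>"
  by (auto simp: ker_def)

lemma finite_Q: "finite (carrier Q)"
proof -
  have "carrier Q \<subseteq> p ` carrier B"
  proof
    fix q assume q: "q \<in> carrier Q"
    show "q \<in> p ` carrier B" by (rule image_eqI[of _ _ "s q"]) (use q ps in auto)
  qed
  then show ?thesis using B(2) finite_surj by blast
qed

definition act :: "'q \<Rightarrow> 'b \<Rightarrow> 'b" where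
  "act q a = s q \<otimes>\<^bsub>B\<^esub> a \<otimes>\<^bsub>B\<^esub> inv\<^bsub>B\<^esub> (s q)"

lemma act_ker: "q \<in> carrier Q \<Longrightarrow> a \<in> ker \<Longrightarrow> act q a \<in> ker"
  by (simp add: ker_def act_def ps)

lemma act_act: "q \<in> carrier Q \<Longrightarrow> q' \<in> carrier Q \<Longrightarrow> a \<in> carrier B \<Longrightarrow> act q (act q' a) = act (q \<otimes>\<^bsub>Q\<^esub> q') a"
  by (simp add: act_def B.m_assoc B.inv_mult_group)

lemma act_one: "a \<in> carrier B \<Longrightarrow> act \<one>\<^bsub>Q\<^esub> a = a"
  by (simp add: act_def)

lemma act_mult: "q \<in> carrier Q \<Longrightarrow> a \<in> carrier B \<Longrightarrow> a' \<in> carrier B \<Longrightarrow> act q (a \<otimes>\<^bsub>B\<^esub> a') = act q a \<otimes>\<^bsub>B\<^esub> act q a'"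
proof -
  assume *: "q \<in> carrier Q" "a \<in> carrier B" "a' \<in> carrier B"
  then have "inv\<^bsub>B\<^esub> (s q) \<otimes>\<^bsub>B\<^esub> (s q \<otimes>\<^bsub>B\<^esub> (a' \<otimes>\<^bsub>B\<^esub> inv\<^bsub>B\<^esub> (s q))) = a' \<otimes>\<^bsub>B\<^esub> inv\<^bsub>B\<^esub> (s q)"
    by (simp add: B.m_assoc[symmetric])
  then show ?thesis using * by (simp add: act_def B.m_assoc)
qed

definition kpart :: "'b \<Rightarrow> 'b" where
  "kpart g = g \<otimes>\<^bsub>B\<^esub> inv\<^bsub>B\<^esub> (s (p g))"

lemma kpart_ker: "g \<in> carrier B \<Longrightarrow> kpart g \<in> ker"
  by (simp add: ker_def kpart_def ps)

text \<open>The kernel part is a crossed homomorphism; this is what makes the monomial matrices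
  \<open>Mw\<close> multiplicative.\<close>

lemma kpart_mult:
  assumes "g \<in> carrier B" "h \<in> carrier B"
  shows "kpart (g \<otimes>\<^bsub>B\<^esub> h) = kpart g \<otimes>\<^bsub>B\<^esub> act (p g) (kpart h)"
proof -
  have "inv\<^bsub>B\<^esub> (s (p g)) \<otimes>\<^bsub>B\<^esub> (s (p g) \<otimes>\<^bsub>B\<^esub> x) = x" if "x \<in> carrier B" for x
    using that assms by (simp add: B.m_assoc[symmetric])
  then show ?thesis using assms
    by (simp add: kpart_def act_def B.m_assoc B.inv_mult_group)
qed

lemma kpart_s: "q \<in> carrier Q \<Longrightarrow> kpart (s q) = \<one>\<^bsub>B\<^esub>"
  by (simp add: kpart_def ps)

lemma kpart_of_ker: "a \<in> ker \<Longrightarrow> kpart a = a"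
  by (simp add: kpart_def ker_def)

definition N :: nat where "N = card ker"

text \<open>Characters of the kernel written additively: the value is the exponent of a primitive
  root of unity of order \<open>N\<close>. Extensionality makes the set finite.\<close>

definition chars :: "('b \<Rightarrow> nat) set" where
  "chars = {l \<in> ker \<rightarrow>\<^sub>E {..<N}. \<forall>b\<in>ker. \<forall>c\<in>ker. (l b + l c) mod N = l (b \<otimes>\<^bsub>B\<^esub> c)}"

text \<open>The inverse makes a character keep its value when it is moved together with its
  argument.\<close>

definition char_act :: "'q \<Rightarrow> ('b \<Rightarrow> nat) \<Rightarrow> 'b \<Rightarrow> nat" where
  "char_act q l = (\<lambda>a\<in>ker. l (act (inv\<^bsub>Q\<^esub> q) a))"

lemma finite_ker: "finite ker" using B(2) by (auto simp: ker_def)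

lemma N_pos: "N > 0"
  using finite_ker subgroup.one_closed[OF ker_subgroup] by (auto simp: N_def card_gt_0_iff)

lemma finite_chars: "finite chars"
  by (rule finite_subset[of _ "ker \<rightarrow>\<^sub>E {..<N}"]) (auto simp: chars_def finite_ker intro!: finite_PiE)

lemma char_act_chars: "q \<in> carrier Q \<Longrightarrow> l \<in> chars \<Longrightarrow> char_act q l \<in> chars"
  unfolding chars_def char_act_def
  using act_ker[of "inv\<^bsub>Q\<^esub> q"] subgroup.m_closed[OF ker_subgroup]
  by (auto simp: PiE_def Pi_def act_mult ker_D)

lemma char_act_act: "q \<in> carrier Q \<Longrightarrow> q' \<in> carrier Q \<Longrightarrow> char_act q (char_act q' l) = char_act (q \<otimes>\<^bsub>Q\<^esub> q') l"
  unfolding char_act_def by (rule restrict_ext) (auto simp: act_ker act_act ker_D Q.inv_mult_group)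

lemma char_act_one: "l \<in> chars \<Longrightarrow> char_act \<one>\<^bsub>Q\<^esub> l = l"
  unfolding char_act_def chars_def by (auto simp: act_one ker_D PiE_def extensional_def restrict_def)

lemma char_act_apply: "q \<in> carrier Q \<Longrightarrow> a \<in> ker \<Longrightarrow> char_act q l (act q a) = l a"
  by (simp add: char_act_def act_ker act_act act_one ker_D)

text \<open>Characters and kernel elements are numbered because coordinates are indexed by natural
  numbers; \<open>\<pi>x\<close> and \<open>\<pi>a\<close> express the action of \<open>Q\<close> on
  these numbers.\<close>

definition nx :: nat where "nx = card chars"
definition na :: nat where "na = card ker"
definition lx :: "nat \<Rightarrow> 'b \<Rightarrow> nat" where "lx = (SOME h. bij_betw h {..<nx} chars)"
definition ea :: "nat \<Rightarrow> 'b" where "ea = (SOME h. bij_betw h {..<na} ker)"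
definition \<pi>x :: "'q \<Rightarrow> nat \<Rightarrow> nat" where "\<pi>x q i = inv_into {..<nx} lx (char_act q (lx i))"
definition \<pi>a :: "'q \<Rightarrow> nat \<Rightarrow> nat" where "\<pi>a q i = inv_into {..<na} ea (act q (ea i))"

lemma bij_lx: "bij_betw lx {..<nx} chars"
  unfolding lx_def nx_def
  unfolding lessThan_atLeast0 by (rule someI_ex[OF ex_bij_betw_nat_finite[OF finite_chars]])

lemma bij_ea: "bij_betw ea {..<na} ker"
  unfolding ea_def na_def
  unfolding lessThan_atLeast0 by (rule someI_ex[OF ex_bij_betw_nat_finite[OF finite_ker]])

lemma lx_chars: "i < nx \<Longrightarrow> lx i \<in> chars"
  and ea_ker: "i < na \<Longrightarrow> ea i \<in> ker"
  using bij_betwE[OF bij_lx] bij_betwE[OF bij_ea] by auto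

lemma \<pi>x: "q \<in> carrier Q \<Longrightarrow> i < nx \<Longrightarrow> \<pi>x q i < nx" "q \<in> carrier Q \<Longrightarrow> i < nx \<Longrightarrow> lx (\<pi>x q i) = char_act q (lx i)"
proof -
  assume *: "q \<in> carrier Q" "i < nx"
  then have "char_act q (lx i) \<in> lx ` {..<nx}"
    using char_act_chars lx_chars bij_lx by (auto simp: bij_betw_def)
  then show "\<pi>x q i < nx" "lx (\<pi>x q i) = char_act q (lx i)"
    using inv_into_into[of _ lx "{..<nx}"] f_inv_into_f[of _ lx "{..<nx}"] by (auto simp: \<pi>x_def)
qed

lemma \<pi>a: "q \<in> carrier Q \<Longrightarrow> i < na \<Longrightarrow> \<pi>a q i < na" "q \<in> carrier Q \<Longrightarrow> i < na \<Longrightarrow> ea (\<pi>a q i) = act q (ea i)"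
proof -
  assume *: "q \<in> carrier Q" "i < na"
  then have "act q (ea i) \<in> ea ` {..<na}"
    using act_ker ea_ker bij_ea by (auto simp: bij_betw_def)
  then show "\<pi>a q i < na" "ea (\<pi>a q i) = act q (ea i)"
    using inv_into_into[of _ ea "{..<na}"] f_inv_into_f[of _ ea "{..<na}"] by (auto simp: \<pi>a_def)
qed

lemma lx_eqI: "i < nx \<Longrightarrow> j < nx \<Longrightarrow> lx i = lx j \<Longrightarrow> i = j"
  using bij_lx by (auto simp: bij_betw_def inj_on_def)

lemma ea_eqI: "i < na \<Longrightarrow> j < na \<Longrightarrow> ea i = ea j \<Longrightarrow> i = j"
  using bij_ea by (auto simp: bij_betw_def inj_on_def)

lemma ea_onto:
  assumes "a \<in> ker"
  shows "\<exists>i<na. ea i = a"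
proof -
  have "a \<in> ea ` {..<na}" using assms bij_betw_imp_surj_on[OF bij_ea] by simp
  then show ?thesis by auto
qed

text \<open>The first \<open>nx\<close> indices belong to the characters, the following
  \<open>na\<close> to the elements of the kernel.\<close>

definition \<pi>J :: "'q \<Rightarrow> nat \<Rightarrow> nat" where
  "\<pi>J q i = (if i < nx then \<pi>x q i else nx + \<pi>a q (i - nx))"

lemma \<pi>J_less: "q \<in> carrier Q \<Longrightarrow> i < nx + na \<Longrightarrow> \<pi>J q i < nx + na"
  using \<pi>x(1)[of q i] \<pi>a(1)[of q "i - nx"] by (auto simp: \<pi>J_def)

lemma \<pi>x_comp: "g \<in> carrier Q \<Longrightarrow> h \<in> carrier Q \<Longrightarrow> i < nx \<Longrightarrow> \<pi>x (g \<otimes>\<^bsub>Q\<^esub> h) i = \<pi>x g (\<pi>x h i)"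
  by (rule lx_eqI) (simp_all add: \<pi>x char_act_act)

lemma \<pi>J_comp:
  assumes "g \<in> carrier Q" "h \<in> carrier Q" "i < nx + na"
  shows "\<pi>J (g \<otimes>\<^bsub>Q\<^esub> h) i = \<pi>J g (\<pi>J h i)"
proof (cases "i < nx")
  case True
  then show ?thesis using assms \<pi>x by (simp add: \<pi>J_def \<pi>x_comp)
next
  case False
  have "\<pi>a (g \<otimes>\<^bsub>Q\<^esub> h) (i - nx) = \<pi>a g (\<pi>a h (i - nx))"
    by (rule ea_eqI) (use assms False in \<open>simp_all add: \<pi>a act_act ker_D ea_ker\<close>)
  then show ?thesis using False by (simp add: \<pi>J_def)
qed

lemma \<pi>x_one: "i < nx \<Longrightarrow> \<pi>x \<one>\<^bsub>Q\<^esub> i = i"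
  by (rule lx_eqI) (simp_all add: \<pi>x char_act_one lx_chars)

lemma \<pi>J_one:
  assumes "i < nx + na"
  shows "\<pi>J \<one>\<^bsub>Q\<^esub> i = i"
proof (cases "i < nx")
  case True
  then show ?thesis by (simp add: \<pi>J_def \<pi>x_one)
next
  case False
  have "\<pi>a \<one>\<^bsub>Q\<^esub> (i - nx) = i - nx"
    by (rule ea_eqI) (use assms False in \<open>simp_all add: \<pi>a act_one ker_D ea_ker\<close>)
  then show ?thesis using False by (simp add: \<pi>J_def)
qed

lemma lx_mult: "i < nx \<Longrightarrow> a \<in> ker \<Longrightarrow> a' \<in> ker \<Longrightarrow> (lx i a + lx i a') mod N = lx i (a \<otimes>\<^bsub>B\<^esub> a')"
  using lx_chars[of i] by (simp add: chars_def)

lemma lx_one: "i < nx \<Longrightarrow> lx i \<one>\<^bsub>B\<^esub> = 0"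
proof -
  assume i: "i < nx"
  have 1: "\<one>\<^bsub>B\<^esub> \<in> ker" by (rule subgroup.one_closed[OF ker_subgroup])
  have "lx i \<one>\<^bsub>B\<^esub> < N" using lx_chars[OF i] 1 by (auto simp: chars_def PiE_def Pi_def)
  moreover have "(lx i \<one>\<^bsub>B\<^esub> + lx i \<one>\<^bsub>B\<^esub>) mod N = lx i \<one>\<^bsub>B\<^esub>" using lx_mult[OF i 1 1] by simp
  ultimately show ?thesis by (cases "lx i \<one>\<^bsub>B\<^esub> + lx i \<one>\<^bsub>B\<^esub> < N") (auto simp: le_mod_geq not_less)
qed

lemma separating:
  fixes \<zeta> :: "'k :: field_char_0"
  assumes \<zeta>: "primitive_root N \<zeta>" and a: "a \<in> ker" "a \<noteq> \<one>\<^bsub>B\<^esub>"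
  shows "\<exists>i<nx. \<not> N dvd lx i a"
proof -
  let ?G = "B\<lparr>carrier := ker\<rparr>"
  have G: "group ?G" by (rule B.subgroup_imp_group[OF ker_subgroup])
  have "comm_group ?G"
    by (rule group.group_comm_groupI[OF G]) (use comm in \<open>auto simp: ker_def\<close>)
  from character_separates[OF this, of N \<zeta> a] obtain l where
    l: "\<forall>b\<in>ker. l b < N" "\<forall>b\<in>ker. \<forall>c\<in>ker. (l b + l c) mod N = l (b \<otimes>\<^bsub>B\<^esub> c)" "l a \<noteq> 0"
    using finite_ker \<zeta> a by (auto simp: N_def)
  have "restrict l ker \<in> chars"
    unfolding chars_def using l subgroup.m_closed[OF ker_subgroup] by auto
  then have "restrict l ker \<in> lx ` {..<nx}" using bij_betw_imp_surj_on[OF bij_lx] by simp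
  then obtain i where "i < nx" "lx i = restrict l ker" by force
  then show ?thesis using l a by (intro exI[of _ i]) (auto dest: nat_dvd_not_less)
qed

end

section \<open>Descending along a split extension\<close>

lemma primitive_root_mod: "primitive_root N \<zeta> \<Longrightarrow> \<zeta> ^ (i mod N) = \<zeta> ^ i" for \<zeta> :: "'a :: field"
proof -
  assume \<zeta>: "primitive_root N \<zeta>"
  have "\<zeta> ^ i = \<zeta> ^ (N * (i div N) + i mod N)" by simp
  also have "\<dots> = \<zeta> ^ (i mod N)" using \<zeta> by (simp only: power_add) (simp add: primitive_root_def)
  finally show ?thesis ..
qed

text \<open>The identity at \<open>a\<close> holds for all vectors, in particular for the unit
  vectors.\<close>

lemma indep_linear_eq:
  fixes a :: "'a :: field list"
  assumes F: "is_subfield F" and ia: "indep F a" and m: "\<And>j. j < length a \<Longrightarrow> m j \<in> F"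
    and i: "i < length a" and eq: "(\<Sum>j<length a. m j * a ! j) = a ! i" and j: "j < length a"
  shows "m j = of_bool (i = j)"
proof -
  let ?p = "\<lambda>v. (\<Sum>j<length a. m j * v ! j) - v ! i"
  have m1: "- 1 \<in> F" "0 \<in> F" using F by (auto intro: subfield_intros)
  have p: "?p \<in> polys F (length a)" using m i m1
    by (intro polys_diff polys_sum polys.mult polys.const polys.coord) auto
  have "?p a = 0" using eq by simp
  then have "?p (map (\<lambda>k. of_bool (k = j)) [0..<length a]) = 0"
    by (rule indepD[OF ia p refl]) simp
  then show ?thesis using i j by (simp add: sum_of_bool_mult)
qed

lemma dsum_triv_triv: "dsum (n + m) (dsum n M triv) triv = dsum n M triv"
  by (intro ext) (auto simp: dsum_def triv_def)

text \<open>\<open>x\<close> carries the representation of \<open>Q\<close>, \<open>w\<close> holds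
  one variable for each character, \<open>t\<close> spare variables that are fixed by the groups,
  and \<open>u\<close> the parameters of the torus. The column of \<open>A\<close> for a kernel
  element expresses that a monomial in \<open>w\<close> is fixed by it: the exponent of the root of
  unity has to be \<open>N\<close> times the extra coordinate.\<close>

locale kummer_step = split_extension B Q p s
  for B :: "('b, 'm) monoid_scheme" and Q :: "('q, 'n) monoid_scheme" and p :: "'b \<Rightarrow> 'q" and s :: "'q \<Rightarrow> 'b" +
  fixes F :: "'a :: {field_char_0, alg_closed_field} set" and \<zeta> :: 'a and n r :: nat
    and M0 :: "'q \<Rightarrow> nat \<Rightarrow> nat \<Rightarrow> 'a" and x w t u :: "'a list" and b e :: "nat \<Rightarrow> nat \<Rightarrow> int" and A :: "nat \<Rightarrow> nat \<Rightarrow> int"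
  assumes F: "is_subfield F" and \<zeta>F: "\<zeta> \<in> F" and \<zeta>: "primitive_root N \<zeta>"
    and M0: "lin_rep F Q n M0"
    and faithful0: "q \<in> carrier Q \<Longrightarrow> q \<noteq> \<one>\<^bsub>Q\<^esub> \<Longrightarrow> \<exists>i<n. \<exists>j<n. M0 q i j \<noteq> of_bool (i = j)"
    and len_x: "length x = n" and len_w: "length w = nx" and len_u: "length u = r"
    and A_def: "A k a = (if k < nx then - int (lx k (ea a)) else int N * of_bool (k - nx = a))"
    and eb: "i < r \<Longrightarrow> j < r \<Longrightarrow> (\<Sum>k<nx + na. e i k * b k j) = of_bool (i = j)"
    and rel: "(\<forall>j<r. (\<Sum>k<nx + na. f k * b k j) = 0) \<longleftrightarrow> (\<forall>j<na. (\<Sum>k<nx + na. f k * A k j) = 0)"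
    and indep: "indep F (x @ w @ t @ u)"
begin

definition J :: nat where "J = nx + na"

text \<open>A monomial matrix: \<open>Q\<close> permutes the variables through the section, and the
  kernel acts on each variable by its character.\<close>

definition Mw :: "'b \<Rightarrow> nat \<Rightarrow> nat \<Rightarrow> 'a" where
  "Mw g i j = of_bool (j = \<pi>x (p g) i) * \<zeta> ^ lx j (kpart g)"

definition MB :: "'b \<Rightarrow> nat \<Rightarrow> nat \<Rightarrow> 'a" where
  "MB = dsum n (\<lambda>g. M0 (p g)) Mw"

definition MJ :: "'q \<Rightarrow> nat \<Rightarrow> nat \<Rightarrow> 'a" where
  "MJ q i j = of_bool (j = \<pi>J q i)"

text \<open>The permutations compose because \<open>\<pi>x\<close> is an action. The roots of unity
  do because the kernel part is a crossed homomorphism and characters are moved along with their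
  arguments.\<close>

lemma lin_rep_Mw: "lin_rep F B nx Mw"
  unfolding lin_rep_def
proof (intro conjI ballI allI impI)
  show "Mw g i j \<in> F" for g i j using F \<zeta>F by (auto simp: Mw_def intro!: subfield_intros)
  show "Mw \<one>\<^bsub>B\<^esub> i j = of_bool (i = j)" if "i < nx" "j < nx" for i j
    using that by (auto simp: Mw_def \<pi>x_one lx_one kpart_def)
  fix g h i j assume *: "g \<in> carrier B" "h \<in> carrier B" "i < nx" "j < nx"
  let ?l = "\<pi>x (p h) i"
  have l: "?l < nx" using * by (simp add: \<pi>x)
  have "(\<Sum>l<nx. Mw h i l * Mw g l j) = (\<Sum>l<nx. of_bool (?l = l) * (\<zeta> ^ lx l (kpart h) * Mw g l j))"
    by (intro sum.cong refl) (auto simp: Mw_def)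
  also have "\<dots> = \<zeta> ^ lx ?l (kpart h) * Mw g ?l j" by (simp only: sum_of_bool_mult(1)[OF l])
  also have "\<dots> = Mw (g \<otimes>\<^bsub>B\<^esub> h) i j"
  proof (cases "j = \<pi>x (p g) ?l")
    case True
    have "lx j (act (p g) (kpart h)) = lx ?l (kpart h)"
      using True * l by (simp add: \<pi>x char_act_apply kpart_ker)
    moreover have "lx j (kpart (g \<otimes>\<^bsub>B\<^esub> h)) = (lx j (kpart g) + lx j (act (p g) (kpart h))) mod N"
      using * by (simp add: kpart_mult lx_mult kpart_ker act_ker)
    moreover have "j = \<pi>x (p (g \<otimes>\<^bsub>B\<^esub> h)) i" using True * by (simp add: \<pi>x_comp)
    ultimately show ?thesis using True
      by (simp add: Mw_def primitive_root_mod[OF \<zeta>] power_add)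
  next
    case False
    moreover have "j \<noteq> \<pi>x (p (g \<otimes>\<^bsub>B\<^esub> h)) i" using False * by (simp add: \<pi>x_comp)
    ultimately show ?thesis by (simp add: Mw_def)
  qed
  finally show "Mw (g \<otimes>\<^bsub>B\<^esub> h) i j = (\<Sum>l<nx. Mw h i l * Mw g l j)" ..
qed

lemma lin_rep_M0p: "lin_rep F B n (\<lambda>g. M0 (p g))"
  using M0 by (auto simp: lin_rep_def)

lemma lin_rep_MB: "lin_rep F B (n + nx) MB"
  unfolding MB_def by (rule lin_rep_dsum[OF F lin_rep_M0p lin_rep_Mw])

text \<open>An element outside the kernel is detected by the representation of \<open>Q\<close>, an
  element of the kernel by a character, since the characters separate points.\<close>

lemma faithful_MB:
  assumes g: "g \<in> carrier B" "g \<noteq> \<one>\<^bsub>B\<^esub>"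
  shows "\<exists>i<n + nx. \<exists>j<n + nx. MB g i j \<noteq> of_bool (i = j)"
proof (cases "p g = \<one>\<^bsub>Q\<^esub>")
  case False
  then obtain i j where "i < n" "j < n" "M0 (p g) i j \<noteq> of_bool (i = j)"
    using faithful0[of "p g"] g by auto
  then show ?thesis by (intro exI[of _ i] exI[of _ j] conjI) (auto simp: MB_def dsum_def)
next
  case True
  then have "g \<in> ker" using g by (simp add: ker_def)
  from separating[OF \<zeta> this g(2)] obtain i where i: "i < nx" "\<not> N dvd lx i g" by blast
  then have "Mw g i i \<noteq> 1"
    using True \<pi>x_one \<zeta> kpart_of_ker[OF \<open>g \<in> ker\<close>] by (simp add: Mw_def primitive_root_def)
  then show ?thesis using i by (intro exI[of _ "n + i"] conjI) (auto simp: MB_def dsum_def)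
qed

section \<open>The Galois extension fixed by the abelian kernel\<close>

abbreviation "z \<equiv> x @ w @ t"
abbreviation "E0 \<equiv> fracs F z"

definition \<sigma> :: "'b \<Rightarrow> 'a \<Rightarrow> 'a" where
  "\<sigma> g = subst_map F z (mact (length z) (dsum (n + nx) MB triv) g z)"

lemma mact_z: "mact (length z) (dsum (n + nx) MB triv) g z = mact n (\<lambda>g. M0 (p g)) g x @ mact nx Mw g w @ t"
  using mact_dsum[of "x @ w" "n + nx" t "length t" MB triv g] mact_dsum[OF len_x len_w, of "\<lambda>g. M0 (p g)" Mw g]
  by (simp add: len_x len_w mact_triv MB_def add.assoc)

lemma indep_z: "indep F z"
  using indep_appendD1[of F z u] indep by simp

lemma rep_z: "lin_rep F B (length z) (dsum (n + nx) MB triv)"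
  using lin_rep_dsum[OF F lin_rep_MB lin_rep_triv[OF F], of "length t"] by (simp add: len_x len_w add.assoc)

lemma \<sigma>_fun: "(\<lambda>g. subst_map F z (mact (length z) (dsum (n + nx) MB triv) g z)) = \<sigma>"
  unfolding \<sigma>_def ..

lemma \<sigma>_alt: "\<sigma> g = subst_map F z (mact n (\<lambda>g. M0 (p g)) g x @ mact nx Mw g w @ t)"
  unfolding \<sigma>_def mact_z ..

lemma action_\<sigma>: "field_action B E0 \<sigma>"
  and \<sigma>_const: "g \<in> carrier B \<Longrightarrow> c \<in> F \<Longrightarrow> \<sigma> g c = c"
  using lin_action(1,2)[OF F B rep_z indep_z] unfolding \<sigma>_def by blast+

lemma \<sigma>_hom: "g \<in> carrier B \<Longrightarrow> subfield_hom E0 (\<sigma> g)"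
  and \<sigma>_cl: "g \<in> carrier B \<Longrightarrow> c \<in> E0 \<Longrightarrow> \<sigma> g c \<in> E0"
  and \<sigma>_comp: "g \<in> carrier B \<Longrightarrow> h \<in> carrier B \<Longrightarrow> c \<in> E0 \<Longrightarrow> \<sigma> (g \<otimes>\<^bsub>B\<^esub> h) c = \<sigma> g (\<sigma> h c)"
  and \<sigma>_one: "c \<in> E0 \<Longrightarrow> \<sigma> \<one>\<^bsub>B\<^esub> c = c"
  using action_\<sigma> by (auto simp: field_action_def)

lemma eqv_z: "g \<in> carrier B \<Longrightarrow> eqv F z (mact n (\<lambda>g. M0 (p g)) g x @ mact nx Mw g w @ t)"
  using indep_mact[OF F B(1) rep_z indep_z, of g] indep_z
  unfolding mact_z by (auto simp: len_x len_w intro!: indep_eqv)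

lemma \<sigma>_x: "g \<in> carrier B \<Longrightarrow> i < n \<Longrightarrow> \<sigma> g (x ! i) = (\<Sum>j<n. M0 (p g) i j * x ! j)"
  using subst_map_nth[OF F eqv_z, of g i] by (simp add: \<sigma>_alt nth_append len_x nth_mact)

lemma \<sigma>_t: "g \<in> carrier B \<Longrightarrow> i < length t \<Longrightarrow> \<sigma> g (t ! i) = t ! i"
  using subst_map_nth[OF F eqv_z, of g "n + nx + i"] by (simp add: \<sigma>_alt nth_append len_x len_w)

lemma \<sigma>_w: "g \<in> carrier B \<Longrightarrow> i < nx \<Longrightarrow> \<sigma> g (w ! i) = \<zeta> ^ lx (\<pi>x (p g) i) (kpart g) * w ! \<pi>x (p g) i"
proof -
  assume *: "g \<in> carrier B" "i < nx"
  have "\<sigma> g (w ! i) = mact nx Mw g w ! i"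
    using * subst_map_nth[OF F eqv_z, of g "n + i"] by (simp add: \<sigma>_alt nth_append len_x len_w)
  also have "\<dots> = (\<Sum>j<nx. of_bool (\<pi>x (p g) i = j) * (\<zeta> ^ lx j (kpart g) * w ! j))"
    unfolding nth_mact[OF *(2)] by (intro sum.cong refl) (auto simp: Mw_def)
  also have "\<dots> = \<zeta> ^ lx (\<pi>x (p g) i) (kpart g) * w ! \<pi>x (p g) i"
    by (rule sum_of_bool_mult) (simp add: * \<pi>x)
  finally show ?thesis .
qed

lemma w_E0: "i < nx \<Longrightarrow> w ! i \<in> E0" and x_E0: "i < n \<Longrightarrow> x ! i \<in> E0"
  using fracs_gens[of z F] len_w len_x by auto

lemma w_nonzero: "i < nx \<Longrightarrow> w ! i \<noteq> 0"
proof
  assume i: "i < nx" and 0: "w ! i = 0"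
  have p: "(\<lambda>v. v ! (n + i)) \<in> polys F (length z)" using i len_x len_w by (intro polys.coord) simp
  have "(\<lambda>v. v ! (n + i)) (replicate (length z) 1) = (0 :: 'a)"
    by (rule indepD[OF indep_z p refl]) (use 0 i len_x len_w in \<open>simp_all add: nth_append\<close>)
  then show False using i len_x len_w by simp
qed

abbreviation "a \<equiv> x @ t"
abbreviation "E1 \<equiv> fracs F a"
abbreviation "M1 \<equiv> dsum n M0 triv"

lemma E1_E0: "E1 \<subseteq> E0"
  using fracs_gens[of z F] by (intro fracs_least fracs_subfield fracs_base) auto

lemma rep_M1: "lin_rep F Q (n + length t) M1"
  by (rule lin_rep_dsum[OF F M0 lin_rep_triv[OF F]])

lemma indep_twu: "indep F (x @ w @ t @ u @ v) \<Longrightarrow> indep F (a @ w @ u @ v)"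
proof -
  assume i: "indep F (x @ w @ t @ u @ v)"
  have "indep (fracs F x) (t @ w @ u @ v)" using indep_swap[OF indep_appendD2[OF F i]] .
  then have "indep F (x @ t @ w @ u @ v)" by (rule indep_appendI[OF F indep_appendD1[OF i]])
  then show ?thesis by simp
qed

lemma indep_a: "indep F a"
  using indep_appendD1[OF indep_twu[of "[]"]] indep by simp

definition \<sigma>1 :: "'q \<Rightarrow> 'a \<Rightarrow> 'a" where
  "\<sigma>1 q = subst_map F a (mact (n + length t) M1 q a)"

lemma action_\<sigma>1: "field_action Q E1 \<sigma>1"
proof -
  have "lin_rep F Q (length a) M1" using rep_M1 len_x by simp
  from lin_action(1)[OF F Q finite_Q this indep_a] show ?thesis
    by (simp add: \<sigma>1_def[abs_def] len_x)
qed

lemma mact_a: "mact (n + length t) M1 q a = mact n M0 q x @ t"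
  using mact_dsum[OF len_x refl, of t M0 triv q] by (simp add: mact_triv)

lemma eqv_a: "q \<in> carrier Q \<Longrightarrow> eqv F a (mact n M0 q x @ t)"
  using indep_mact[OF F Q _ indep_a, of M1 q] rep_M1 len_x indep_a
  by (auto simp: mact_a intro!: indep_eqv)

text \<open>\<open>B\<close> acts on \<open>x\<close> through \<open>Q\<close> and trivially on
  \<open>t\<close>.\<close>

lemma \<sigma>_\<sigma>1:
  assumes g: "g \<in> carrier B" and c: "c \<in> E1"
  shows "\<sigma> g c = \<sigma>1 (p g) c"
  unfolding \<sigma>1_def mact_a
proof (rule subst_map_unique[OF F eqv_a _ _ _ c])
  show "p g \<in> carrier Q" using g by simp
  show "subfield_hom E1 (\<sigma> g)" by (rule subfield_hom_mono[OF \<sigma>_hom[OF g] fracs_subfield E1_E0])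
  show "\<sigma> g (a ! i) = (mact n M0 (p g) x @ t) ! i" if i: "i < length a" for i
  proof (cases "i < n")
    case True
    then show ?thesis using \<sigma>_x[OF g] len_x by (simp add: nth_append nth_mact)
  next
    case False
    then show ?thesis using \<sigma>_t[OF g, of "i - n"] i len_x by (simp add: nth_append)
  qed
qed (rule \<sigma>_const[OF g])

text \<open>The Galois extension \<open>E\<close> of the field of invariants consists of the elements fixed by the
  abelian kernel; its group is \<open>Q\<close>, acting through the section.\<close>

abbreviation "Bker \<equiv> B\<lparr>carrier := ker\<rparr>"

definition E :: "'a set" where "E = fixed Bker E0 \<sigma>"

definition \<sigma>Q :: "'q \<Rightarrow> 'a \<Rightarrow> 'a" where "\<sigma>Q q = \<sigma> (s q)"

lemma E_D: "c \<in> E \<Longrightarrow> c \<in> E0" "c \<in> E \<Longrightarrow> k \<in> ker \<Longrightarrow> \<sigma> k c = c"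
  by (auto simp: E_def fixed_def)

lemma E_I: "c \<in> E0 \<Longrightarrow> (\<And>k. k \<in> ker \<Longrightarrow> \<sigma> k c = c) \<Longrightarrow> c \<in> E"
  by (auto simp: E_def fixed_def)

lemma E_subfield: "is_subfield E"
proof -
  have "field_action Bker E0 \<sigma>"
    unfolding field_action_def using B.subgroup_imp_group[OF ker_subgroup] finite_ker \<sigma>_hom \<sigma>_cl \<sigma>_comp \<sigma>_one
    by (simp add: ker_D)
  then show ?thesis unfolding E_def by (rule fixed_subfield)
qed

lemma E1_E: "E1 \<subseteq> E"
proof
  fix c assume c: "c \<in> E1"
  have "\<sigma> k c = c" if "k \<in> ker" for k
    using \<sigma>_\<sigma>1[OF ker_D(1)[OF that] c] ker_D(2)[OF that] action_\<sigma>1 c by (simp add: field_action_def)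
  then show "c \<in> E" using c E1_E0 by (intro E_I) auto
qed

text \<open>The section is a homomorphism, so it turns the action of \<open>B\<close> into one of
  \<open>Q\<close>. An element of the kernel can be moved past \<open>s q\<close> at the cost of a
  conjugation within the kernel, so \<open>E\<close> is preserved.\<close>

lemma action_\<sigma>Q: "field_action Q E \<sigma>Q"
  unfolding field_action_def
proof (intro conjI ballI)
  show "group Q" "finite (carrier Q)" by (rule Q, rule finite_Q)
  have EE0: "E \<subseteq> E0" using E_D by blast
  show "subfield_hom E (\<sigma>Q q)" if "q \<in> carrier Q" for q
    unfolding \<sigma>Q_def using that by (intro subfield_hom_mono[OF \<sigma>_hom E_subfield EE0]) simp
  show "\<sigma>Q q c \<in> E" if q: "q \<in> carrier Q" and c: "c \<in> E" for q c
    unfolding \<sigma>Q_def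
  proof (rule E_I)
    show "\<sigma> (s q) c \<in> E0" using q E_D(1)[OF c] by (intro \<sigma>_cl) auto
    fix k assume k: "k \<in> ker"
    let ?k = "act (inv\<^bsub>Q\<^esub> q) k"
    have k': "?k \<in> ker" using act_ker[of "inv\<^bsub>Q\<^esub> q" k] q k by simp
    have "k \<otimes>\<^bsub>B\<^esub> s q = s q \<otimes>\<^bsub>B\<^esub> ?k"
      using q ker_D(1)[OF k] by (simp add: act_def B.m_assoc[symmetric])
    then have "\<sigma> k (\<sigma> (s q) c) = \<sigma> (s q) (\<sigma> ?k c)"
      using q ker_D(1)[OF k] ker_D(1)[OF k'] E_D(1)[OF c] by (simp flip: \<sigma>_comp)
    then show "\<sigma> k (\<sigma> (s q) c) = \<sigma> (s q) c" using E_D(2)[OF c k'] by simp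
  qed
  show "\<sigma>Q (g \<otimes>\<^bsub>Q\<^esub> h) c = \<sigma>Q g (\<sigma>Q h c)" if "g \<in> carrier Q" "h \<in> carrier Q" "c \<in> E" for g h c
    using that E_D(1) by (simp add: \<sigma>Q_def \<sigma>_comp)
  show "\<sigma>Q \<one>\<^bsub>Q\<^esub> c = c" if "c \<in> E" for c
    using that E_D(1) by (simp add: \<sigma>Q_def \<sigma>_one)
qed

text \<open>Every element of \<open>B\<close> is the product of its kernel part and an element in
  the image of the section.\<close>

lemma fixed_E: "fixed Q E \<sigma>Q = lin_fix F B (dsum (n + nx) MB triv) z"
proof -
  have "fixed Q E \<sigma>Q = fixed B E0 \<sigma>"
  proof (intro equalityI subsetI)
    fix c assume c: "c \<in> fixed Q E \<sigma>Q"
    then have cE: "c \<in> E" by (simp add: fixed_def)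
    have "\<sigma> g c = c" if g: "g \<in> carrier B" for g
    proof -
      have "g = kpart g \<otimes>\<^bsub>B\<^esub> s (p g)" using g by (simp add: kpart_def B.m_assoc)
      then have "\<sigma> g c = \<sigma> (kpart g) (\<sigma> (s (p g)) c)"
        using g E_D(1)[OF cE] ker_D(1)[OF kpart_ker[OF g]] by (metis \<sigma>_comp ph.hom_closed sh.hom_closed)
      also have "\<sigma> (s (p g)) c = c" using c g by (simp add: fixed_def \<sigma>Q_def)
      finally show ?thesis using E_D(2)[OF cE kpart_ker[OF g]] by simp
    qed
    then show "c \<in> fixed B E0 \<sigma>" using E_D(1)[OF cE] by (simp add: fixed_def)
  next
    fix c assume "c \<in> fixed B E0 \<sigma>"
    then have c: "c \<in> E0" "\<And>g. g \<in> carrier B \<Longrightarrow> \<sigma> g c = c" by (auto simp: fixed_def)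
    then have "c \<in> E" by (intro E_I) (auto simp: ker_D)
    then show "c \<in> fixed Q E \<sigma>Q" using c(2) by (simp add: fixed_def \<sigma>Q_def)
  qed
  then show ?thesis unfolding lin_fix_def \<sigma>_fun .
qed

text \<open>The coordinates \<open>x\<close> lie in \<open>E\<close>, and \<open>Q\<close> acts
  faithfully on them because they are independent.\<close>

lemma exists_theta: "\<exists>\<theta>\<in>E. inj_on (\<lambda>q. \<sigma>Q q \<theta>) (carrier Q)"
proof (rule exists_distinct_conjugates[OF action_\<sigma>Q])
  show "set x \<subseteq> E" using fracs_gens[of a F] E1_E by auto
  fix q assume q: "q \<in> carrier Q" "q \<noteq> \<one>\<^bsub>Q\<^esub>"
  show "\<exists>i<length x. \<sigma>Q q (x ! i) \<noteq> x ! i"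
  proof (rule ccontr)
    assume "\<not> ?thesis"
    then have fixd: "(\<Sum>j<length x. M0 q i j * x ! j) = x ! i" if "i < length x" for i
      using that \<sigma>_x[of "s q" i] q ps len_x by (simp add: \<sigma>Q_def)
    obtain i j where ij: "i < n" "j < n" "M0 q i j \<noteq> of_bool (i = j)" using faithful0[OF q] by blast
    have "M0 q i j = of_bool (i = j)"
      by (rule indep_linear_eq[OF F indep_appendD1[OF indep_z] _ _ fixd])
        (use ij M0 q len_x in \<open>auto simp: lin_rep_def\<close>)
    then show False using ij by simp
  qed
qed

text \<open>The base point of the coset. The value 1 in the coordinates of the kernel elements makes
  every relation take the value of its monomial in \<open>w\<close>.\<close>

definition \<tau> :: "nat \<Rightarrow> 'a" where
  "\<tau> j = (if j < nx then w ! j else 1)"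

text \<open>The generic point of the coset of \<open>\<tau>\<close> in multiplicative coordinates,
  with the variables \<open>u\<close> as parameters.\<close>

definition zl :: "'a list" where
  "zl = map (\<lambda>j. \<tau> j * (\<Prod>i<r. u ! i powi b j i)) [0..<J]"

text \<open>The relations are the exponents of the monomials in \<open>w\<close> that the kernel
  fixes; the entries from \<open>nx\<close> on are the quotients by \<open>N\<close> and thus
  determined by the others.\<close>

lemma relA_iff: "(\<forall>j<na. (\<Sum>k<nx + na. q k * A k j) = 0) \<longleftrightarrow>
    (\<forall>j<na. int N * q (nx + j) = (\<Sum>k<nx. q k * int (lx k (ea j))))"
proof -
  have "(\<Sum>k<nx + na. q k * A k j) = int N * q (nx + j) - (\<Sum>k<nx. q k * int (lx k (ea j)))" if j: "j < na" for j
  proof -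
    have "(\<Sum>k<na. q (nx + k) * A (nx + k) j) = (\<Sum>k<na. (int N * q (nx + k)) * of_bool (k = j))"
      by (intro sum.cong refl) (simp add: A_def)
    also have "\<dots> = int N * q (nx + j)" using j by (simp add: of_bool_def if_distrib[of "\<lambda>x. _ * x"] cong: if_cong)
    finally show ?thesis unfolding sum_lessThan_add by (simp add: A_def sum_negf)
  qed
  then show ?thesis by auto
qed

lemma bij_perm_of:
  assumes "\<And>q i. q \<in> carrier Q \<Longrightarrow> i < m \<Longrightarrow> f q i < m" "\<And>q q' i. q \<in> carrier Q \<Longrightarrow> q' \<in> carrier Q \<Longrightarrow> i < m \<Longrightarrow> f (q \<otimes>\<^bsub>Q\<^esub> q') i = f q (f q' i)"
    "\<And>i. i < m \<Longrightarrow> f \<one>\<^bsub>Q\<^esub> i = i" "q \<in> carrier Q"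
  shows "bij_betw (f q) {..<m} {..<m}"
  by (rule bij_betwI[where g = "f (inv\<^bsub>Q\<^esub> q)"]) (use assms in \<open>auto simp: assms(2)[symmetric]\<close>)

lemma bij_\<pi>x: "q \<in> carrier Q \<Longrightarrow> bij_betw (\<pi>x q) {..<nx} {..<nx}"
  by (rule bij_perm_of) (auto simp: \<pi>x(1) \<pi>x_comp \<pi>x_one)

lemma bij_\<pi>J: "q \<in> carrier Q \<Longrightarrow> bij_betw (\<pi>J q) {..<J} {..<J}"
  unfolding J_def by (rule bij_perm_of) (auto simp: \<pi>J_less \<pi>J_comp \<pi>J_one)

text \<open>Moving a character and a kernel element together does not change the value, so the sum
  is merely reindexed.\<close>

lemma relA_stable:
  assumes g: "g \<in> carrier Q" and q: "\<forall>j<na. int N * q (nx + j) = (\<Sum>k<nx. q k * int (lx k (ea j)))"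
  shows "\<forall>j<na. int N * q (\<pi>J g (nx + j)) = (\<Sum>k<nx. q (\<pi>J g k) * int (lx k (ea j)))"
proof (intro allI impI)
  fix j assume j: "j < na"
  have "(\<Sum>k<nx. q (\<pi>J g k) * int (lx k (ea j))) = (\<Sum>k<nx. q (\<pi>x g k) * int (lx (\<pi>x g k) (ea (\<pi>a g j))))"
    using g j by (intro sum.cong refl) (simp add: \<pi>J_def \<pi>x \<pi>a char_act_apply ea_ker)
  also have "\<dots> = (\<Sum>k<nx. q k * int (lx k (ea (\<pi>a g j))))"
    using sum.reindex_bij_betw[OF bij_\<pi>x[OF g], of "\<lambda>k. q k * int (lx k (ea (\<pi>a g j)))"] .
  also have "\<dots> = int N * q (nx + \<pi>a g j)" using q \<pi>a(1)[OF g j] by simp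
  finally show "int N * q (\<pi>J g (nx + j)) = (\<Sum>k<nx. q (\<pi>J g k) * int (lx k (ea j)))" by (simp add: \<pi>J_def)
qed

text \<open>The product of \<open>b\<close> and \<open>e\<close> acts as the identity on the columns
  of \<open>A\<close>: the rows of the difference are orthogonal to \<open>b\<close>, hence to
  \<open>A\<close>.\<close>

lemma beA:
  assumes j: "j < J" and k: "k < na"
  shows "(\<Sum>i<r. (\<Sum>l<J. A l k * e i l) * b j i) = A j k"
proof -
  define q where "q l = of_bool (j = l) - (\<Sum>i<r. e i l * b j i)" for l
  have "(\<Sum>l<J. q l * b l i) = 0" if i: "i < r" for i
  proof -
    have "(\<Sum>l<J. (\<Sum>i'<r. e i' l * b j i') * b l i) = (\<Sum>i'<r. (\<Sum>l<J. e i' l * b l i) * b j i')"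
      unfolding sum_distrib_right by (subst sum.swap) (intro sum.cong refl, simp add: mult_ac)
    also have "\<dots> = (\<Sum>i'<r. of_bool (i' = i) * b j i')" using eb i by (simp add: J_def)
    also have "\<dots> = b j i" using i by (simp add: of_bool_def if_distrib[of "\<lambda>x. x * _"] cong: if_cong)
    finally show ?thesis using j
      by (simp add: q_def left_diff_distrib sum_subtractf of_bool_def if_distrib[of "\<lambda>x. x * _"] cong: if_cong)
  qed
  then have "(\<Sum>l<J. q l * A l k) = 0" using rel[of q] k by (simp add: J_def)
  moreover have "(\<Sum>l<J. (\<Sum>i<r. e i l * b j i) * A l k) = (\<Sum>i<r. (\<Sum>l<J. A l k * e i l) * b j i)"
    unfolding sum_distrib_right by (subst sum.swap) (intro sum.cong refl, simp add: mult_ac)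
  ultimately show ?thesis using j
    by (simp add: q_def left_diff_distrib sum_subtractf of_bool_def if_distrib[of "\<lambda>x. x * _"] cong: if_cong)
qed

text \<open>\<open>N\<close>-th roots of the coordinates from \<open>nx\<close> on determine
  \<open>u'\<close>, because \<open>A\<close> is \<open>N\<close> times the identity on these rows.
  The remaining coordinates are then corrected by \<open>w'\<close>.\<close>

lemma solve_monomials:
  assumes \<xi>: "\<And>j. j < J \<Longrightarrow> \<xi> j \<noteq> 0"
  shows "\<exists>w' u'. (\<forall>i<r. u' i \<noteq> 0) \<and> (\<forall>j<J. (if j < nx then w' j else 1) * (\<Prod>i<r. u' i powi b j i) = (\<xi> j :: 'a))"
proof -
  have "\<forall>k. \<exists>y. y ^ N = \<xi> (nx + k)" using nth_root_exists[OF N_pos] by blast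
  then obtain v where v: "\<And>k. v k ^ N = \<xi> (nx + k)" by metis
  have v0: "v k \<noteq> 0" if "k < na" for k
    using v[of k] \<xi>[of "nx + k"] that N_pos by (auto simp: J_def power_0_left)
  define u' where "u' i = (\<Prod>k<na. v k powi (\<Sum>l<J. A l k * e i l))" for i
  have u0: "u' i \<noteq> 0" for i using v0 by (auto simp: u'_def prod_zero_iff)
  have U: "(\<Prod>i<r. u' i powi b j i) = (\<Prod>k<na. v k powi A j k)" if j: "j < J" for j
  proof -
    have "(\<Prod>i<r. u' i powi b j i) = (\<Prod>k<na. v k powi (\<Sum>i<r. (\<Sum>l<J. A l k * e i l) * b j i))"
      unfolding u'_def by (rule prod_power_int_matrix) (rule v0)
    also have "\<dots> = (\<Prod>k<na. v k powi A j k)" by (intro prod.cong refl) (simp add: beA[OF j])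
    finally show ?thesis .
  qed
  have V0: "(\<Prod>k<na. v k powi A j k) \<noteq> 0" for j using v0 by (auto simp: prod_zero_iff)
  have Vj: "(\<Prod>k<na. v k powi A j k) = \<xi> j" if j: "j < J" "\<not> j < nx" for j
  proof -
    have "(\<Prod>k<na. v k powi A j k) = (\<Prod>k<na. if k = j - nx then \<xi> j else 1)"
      using j v by (intro prod.cong refl) (auto simp: A_def)
    also have "\<dots> = \<xi> j" using j by (simp add: J_def)
    finally show ?thesis .
  qed
  show ?thesis
    by (intro exI[of _ "\<lambda>j. \<xi> j / (\<Prod>k<na. v k powi A j k)"] exI[of _ u'] conjI allI impI)
      (use u0 V0 Vj U in auto)
qed

text \<open>The monomial map from \<open>w\<close> and \<open>u\<close> to \<open>zl\<close> reaches
  all points without zero coordinates, so it takes independent variables to independent ones.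
  Because of negative exponents and the missing points, \<open>indep_transform\<close> does not
  apply directly.\<close>

lemma indep_zl:
  assumes i: "indep F (x @ w @ t @ u @ v)"
  shows "indep F (a @ zl @ v)"
proof (rule indep_appendI[OF F indep_a])
  let ?m = "length v"
  have ind: "indep E1 (w @ u @ v)" by (rule indep_appendD2[OF F indep_twu[OF i]])
  have k01: "1 \<in> E1" "0 \<in> E1" using fracs_subfield by (auto intro: subfield_intros)
  \<comment> \<open>Adding \<open>Bd\<close> makes all exponents nonnegative, at the cost of the
    common denominator \<open>cb\<close>.\<close>
  define Bd where "Bd = (\<Sum>j<J. \<Sum>i<r. nat \<bar>b j i\<bar>)"
  have Bd: "int Bd + b j i \<ge> 0" if "j < J" "i < r" for j i
  proof -
    have "nat \<bar>b j i\<bar> \<le> (\<Sum>i<r. nat \<bar>b j i\<bar>)" using that by (intro member_le_sum) auto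
    also have "\<dots> \<le> Bd" unfolding Bd_def using that by (intro member_le_sum[of j]) auto
    finally show ?thesis by linarith
  qed
  define cb where "cb \<omega> = (\<Prod>i<r. \<omega> ! (nx + i)) ^ Bd" for \<omega> :: "'a list"
  define ca where "ca j \<omega> = (if j < J then (if j < nx then \<omega> ! j else 1) * (\<Prod>i<r. \<omega> ! (nx + i) ^ nat (int Bd + b j i))
     else \<omega> ! (nx + r + (j - J)) * cb \<omega>)" for j and \<omega> :: "'a list"
  let ?L = "nx + r + ?m"
  have cbp: "cb \<in> polys E1 ?L" unfolding cb_def using k01 by (intro polys_power polys_prod polys.coord) auto
  have cap: "ca j \<in> polys E1 ?L" if "j < J + ?m" for j
  proof (cases "j < J")
    case True
    then have "ca j = (\<lambda>\<omega>. (if j < nx then \<omega> ! j else 1) * (\<Prod>i<r. \<omega> ! (nx + i) ^ nat (int Bd + b j i)))"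
      by (simp add: ca_def fun_eq_iff)
    moreover have "(\<lambda>\<omega>. if j < nx then \<omega> ! j else 1) \<in> polys E1 ?L"
      using k01 by (cases "j < nx") (auto intro: polys.intros)
    ultimately show ?thesis using k01 by (auto intro!: polys.mult polys_prod polys_power polys.coord)
  next
    case False
    then have "ca j = (\<lambda>\<omega>. \<omega> ! (nx + r + (j - J)) * cb \<omega>)" by (simp add: ca_def fun_eq_iff)
    then show ?thesis using that False cbp by (auto intro!: polys.mult polys.coord)
  qed
  have eval: "map (\<lambda>j. ca j \<omega> / cb \<omega>) [0..<J + ?m] =
      map (\<lambda>j. (if j < nx then \<omega> ! j else 1) * (\<Prod>i<r. \<omega> ! (nx + i) powi b j i)) [0..<J] @ drop (nx + r) \<omega>"
    if \<omega>: "length \<omega> = ?L" "\<And>i. i < r \<Longrightarrow> \<omega> ! (nx + i) \<noteq> 0" for \<omega> :: "'a list"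
  proof (rule nth_equalityI)
    have cb0: "cb \<omega> \<noteq> 0" using \<omega>(2) by (auto simp: cb_def prod_zero_iff)
    fix j assume "j < length (map (\<lambda>j. ca j \<omega> / cb \<omega>) [0..<J + ?m])"
    then have j: "j < J + ?m" by simp
    show "map (\<lambda>j. ca j \<omega> / cb \<omega>) [0..<J + ?m] ! j =
      (map (\<lambda>j. (if j < nx then \<omega> ! j else 1) * (\<Prod>i<r. \<omega> ! (nx + i) powi b j i)) [0..<J] @ drop (nx + r) \<omega>) ! j"
    proof (cases "j < J")
      case True
      have "(\<Prod>i<r. \<omega> ! (nx + i) ^ nat (int Bd + b j i)) = (\<Prod>i<r. \<omega> ! (nx + i) powi (b j i + int Bd))"
        using True Bd by (intro prod.cong refl) (simp add: power_int_def add.commute)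
      also have "\<dots> = (\<Prod>i<r. \<omega> ! (nx + i) powi b j i * \<omega> ! (nx + i) ^ Bd)"
        using \<omega>(2) by (intro prod.cong refl) (simp add: power_int_add)
      also have "\<dots> = (\<Prod>i<r. \<omega> ! (nx + i) powi b j i) * cb \<omega>"
        by (simp add: prod.distrib cb_def prod_power_distrib)
      finally have "ca j \<omega> = ((if j < nx then \<omega> ! j else 1) * (\<Prod>i<r. \<omega> ! (nx + i) powi b j i)) * cb \<omega>"
        using True by (simp add: ca_def)
      then have "ca j \<omega> / cb \<omega> = (if j < nx then \<omega> ! j else 1) * (\<Prod>i<r. \<omega> ! (nx + i) powi b j i)"
        using nonzero_divide_eq_eq[OF cb0] by blast
      then show ?thesis using True by (simp add: nth_append)
    next
      case False
      have "ca j \<omega> = \<omega> ! (nx + r + (j - J)) * cb \<omega>" using False by (simp add: ca_def)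
      then have "ca j \<omega> / cb \<omega> = \<omega> ! (nx + r + (j - J))" using nonzero_divide_eq_eq[OF cb0] by blast
      then show ?thesis using False j \<omega>(1) by (simp add: nth_append)
    qed
  qed (use \<omega> in simp)
  show "indep E1 (zl @ v)"
    unfolding indep_def
  proof (intro ballI impI)
    fix P and v0 :: "'a list"
    assume P: "P \<in> polys E1 (length (zl @ v))" "P (zl @ v) = 0" and v0: "v0 \<in> affine_space (length (zl @ v))"
    have lz: "length (zl @ v) = J + ?m" by (simp add: zl_def)
    have P': "P \<in> polys E1 (J + ?m)" using P lz by simp
    obtain G M where G: "G \<in> polys E1 ?L" "\<And>\<omega>. cb \<omega> \<noteq> 0 \<Longrightarrow> P (map (\<lambda>j. ca j \<omega> / cb \<omega>) [0..<J + ?m]) * cb \<omega> ^ M = G \<omega>"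
      using polys_clear[where a = ca, OF P' cap cbp k01(1)] by blast
    let ?\<omega> = "w @ u @ v"
    have l\<omega>: "length ?\<omega> = ?L" using len_w len_u by simp
    have u0: "u ! i \<noteq> 0" if i: "i < r" for i
    proof
      assume 0: "u ! i = 0"
      have pc: "(\<lambda>v. v ! (nx + i)) \<in> polys E1 (length ?\<omega>)" using i l\<omega> by (intro polys.coord) simp
      have "(\<lambda>v. v ! (nx + i)) (replicate (length ?\<omega>) 1) = (0 :: 'a)"
        by (rule indepD[OF ind pc refl]) (use 0 i len_w len_u in \<open>simp_all add: nth_append\<close>)
      then show False using i l\<omega> by simp
    qed
    have "map (\<lambda>j. ca j ?\<omega> / cb ?\<omega>) [0..<J + ?m] = zl @ v"
      using eval[OF l\<omega>] u0 len_w len_u by (auto simp: nth_append zl_def \<tau>_def intro!: prod.cong)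
    moreover have "cb ?\<omega> \<noteq> 0" using u0 len_w len_u by (auto simp: cb_def nth_append prod_zero_iff)
    ultimately have "G ?\<omega> = 0" using G(2)[of ?\<omega>] P(2) by simp
    then have G0: "G \<omega> = 0" if "length \<omega> = ?L" for \<omega> by (rule indepD[OF ind G(1) l\<omega>[symmetric]]) (rule that)
    show "P v0 = 0"
    proof (rule ccontr)
      assume "P v0 \<noteq> 0"
      \<comment> \<open>Only points without zero coordinates are values of the monomial map, so the
        nonzero of \<open>P\<close> is moved to such a point.\<close>
      have prp: "(\<lambda>\<xi>. \<Prod>j<J. \<xi> ! j) \<in> polys E1 (J + ?m)" using k01 by (intro polys_prod polys.coord) auto
      obtain \<xi> where \<xi>: "length \<xi> = J + ?m" "P \<xi> \<noteq> 0" "(\<Prod>j<J. \<xi> ! j) \<noteq> 0"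
        using polys_common_nonzero[where u = v0 and v = "replicate (J + ?m) 1", OF P' prp] v0 lz \<open>P v0 \<noteq> 0\<close>
        by (auto simp: affine_space_def)
      obtain w' u' where wu: "\<And>i. i < r \<Longrightarrow> u' i \<noteq> 0"
          "\<And>j. j < J \<Longrightarrow> (if j < nx then w' j else 1) * (\<Prod>i<r. u' i powi b j i) = \<xi> ! j"
        using solve_monomials[of "\<lambda>j. \<xi> ! j"] \<xi>(3) by (auto simp: prod_zero_iff)
      let ?\<omega> = "map w' [0..<nx] @ map u' [0..<r] @ drop J \<xi>"
      have l: "length ?\<omega> = ?L" using \<xi> by simp
      have nz: "?\<omega> ! (nx + i) \<noteq> 0" if "i < r" for i using that wu by (simp add: nth_append)
      have wu3: "(if j < nx then ?\<omega> ! j else 1) * (\<Prod>i<r. ?\<omega> ! (nx + i) powi b j i) = \<xi> ! j" if "j < J" for j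
      proof -
        have "(\<Prod>i<r. ?\<omega> ! (nx + i) powi b j i) = (\<Prod>i<r. u' i powi b j i)"
          by (intro prod.cong refl) (simp add: nth_append)
        then show ?thesis using wu(2)[OF that] by (simp add: nth_append split: if_splits)
      qed
      have "map (\<lambda>j. ca j ?\<omega> / cb ?\<omega>) [0..<J + ?m] =
          map (\<lambda>j. (if j < nx then ?\<omega> ! j else 1) * (\<Prod>i<r. ?\<omega> ! (nx + i) powi b j i)) [0..<J] @ drop (nx + r) ?\<omega>"
        by (rule eval[OF l nz])
      also have "\<dots> = map (\<lambda>j. \<xi> ! j) [0..<J] @ drop J \<xi>" using wu3 by simp
      also have "\<dots> = \<xi>" using \<xi>(1) by (auto intro!: nth_equalityI simp: nth_append)
      finally have "map (\<lambda>j. ca j ?\<omega> / cb ?\<omega>) [0..<J + ?m] = \<xi>" .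
      moreover have "cb ?\<omega> \<noteq> 0" using nz unfolding cb_def by (auto simp: prod_zero_iff)
      ultimately have "P \<xi> = 0" using G(2)[of ?\<omega>] G0[OF l] by simp
      then show False using \<xi> by simp
    qed
  qed
qed

end

section \<open>The function field of the torsor\<close>

lemma (in group) bij_betw_mult_right: "g \<in> carrier G \<Longrightarrow> bij_betw (\<lambda>h. h \<otimes> g) (carrier G) (carrier G)"
  by (rule bij_betwI[where g = "\<lambda>h. h \<otimes> inv g"]) (auto simp: m_assoc)

context kummer_step
begin

lemma lin_rep_MJ: "lin_rep F Q J MJ"
  unfolding lin_rep_def
proof (intro conjI ballI allI impI)
  show "MJ g i j \<in> F" for g i j using F by (simp add: MJ_def subfield_one subfield_zero)
  show "MJ \<one>\<^bsub>Q\<^esub> i j = of_bool (i = j)" if "i < J" "j < J" for i j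
    using that by (auto simp: MJ_def \<pi>J_one J_def)
  fix g h i j assume *: "g \<in> carrier Q" "h \<in> carrier Q" "i < J" "j < J"
  have "(\<Sum>l<J. MJ h i l * MJ g l j) = (\<Sum>l<J. of_bool (\<pi>J h i = l) * MJ g l j)"
    by (intro sum.cong refl) (auto simp: MJ_def)
  also have "\<dots> = MJ g (\<pi>J h i) j" by (rule sum_of_bool_mult(1)) (use * \<pi>J_less in \<open>simp add: J_def\<close>)
  also have "\<dots> = MJ (g \<otimes>\<^bsub>Q\<^esub> h) i j" using * by (simp add: MJ_def \<pi>J_comp J_def)
  finally show "MJ (g \<otimes>\<^bsub>Q\<^esub> h) i j = (\<Sum>l<J. MJ h i l * MJ g l j)" ..
qed

lemma u_nonzero: "i < r \<Longrightarrow> u ! i \<noteq> 0"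
proof
  assume i: "i < r" and 0: "u ! i = 0"
  have ind: "indep E0 u" using indep_appendD2[OF F, of z u] indep by simp
  have pc: "(\<lambda>v. v ! i) \<in> polys E0 (length u)" using i len_u by (intro polys.coord) simp
  have "(\<lambda>v. v ! i) (replicate (length u) 1) = (0 :: 'a)"
    by (rule indepD[OF ind pc refl]) (use 0 in simp_all)
  then show False using i len_u by simp
qed

lemma \<zeta>_nonzero: "\<zeta> \<noteq> 0"
  using \<zeta> N_pos unfolding primitive_root_def by (metis dvd_refl power_eq_0_iff zero_neq_one)

lemma \<zeta>_N: "\<zeta> ^ N = 1"
  using \<zeta> by (simp add: primitive_root_def)

lemma \<sigma>_\<zeta>: "g \<in> carrier B \<Longrightarrow> \<sigma> g (\<zeta> ^ k) = \<zeta> ^ k"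
  using F \<zeta>F by (intro \<sigma>_const) (auto intro: subfield_power)

lemma \<sigma>_ker_w: "k \<in> ker \<Longrightarrow> j < nx \<Longrightarrow> \<sigma> k (w ! j) = \<zeta> ^ lx j k * w ! j"
  by (simp add: \<sigma>_w ker_D \<pi>x_one kpart_of_ker)

lemma \<sigma>_s_w: "q \<in> carrier Q \<Longrightarrow> j < nx \<Longrightarrow> \<sigma> (s q) (w ! j) = w ! \<pi>x q j"
  using lx_one[OF \<pi>x(1), of q j] by (simp add: \<sigma>_w ps kpart_s)

text \<open>The total exponent of \<open>\<zeta>\<close> is \<open>N\<close> times the extra
  coordinate of the relation at \<open>k\<close>.\<close>

lemma \<zeta>_kernel_monomial:
  assumes "\<forall>j<na. int N * q (nx + j) = (\<Sum>k<nx. q k * int (lx k (ea j)))" and k: "k \<in> ker"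
  shows "(\<Prod>j<nx. (\<zeta> ^ lx j k) powi q j) = 1"
proof -
  obtain i where i: "i < na" "ea i = k" using ea_onto[OF k] by blast
  have "(\<Prod>j<nx. (\<zeta> ^ lx j k) powi q j) = (\<Prod>j<nx. \<zeta> powi (q j * int (lx j k)))"
    by (intro prod.cong refl) (simp only: mult.commute[of "q _"] power_int_mult power_int_of_nat)
  also have "\<dots> = \<zeta> powi (\<Sum>j<nx. q j * int (lx j k))" by (rule power_int_sum_exponents[OF \<zeta>_nonzero])
  also have "(\<Sum>j<nx. q j * int (lx j k)) = int N * q (nx + i)" using assms(1) i by simp
  also have "\<zeta> powi (int N * q (nx + i)) = (\<zeta> ^ N) powi q (nx + i)" by (simp add: power_int_mult)
  also have "\<zeta> ^ N = 1" by (rule \<zeta>_N)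
  finally show ?thesis by simp
qed

lemma prod_\<tau>: "(\<Prod>j<J. \<tau> j powi q j) = (\<Prod>j<nx. w ! j powi q j)"
proof -
  have "(\<Prod>j<J. \<tau> j powi q j) = (\<Prod>j<nx. \<tau> j powi q j)"
    by (rule prod.mono_neutral_right) (auto simp: \<tau>_def J_def)
  then show ?thesis by (simp add: \<tau>_def)
qed

definition wmonos :: "'a set" where
  "wmonos = range (\<lambda>m :: nat \<Rightarrow> nat. \<Prod>j<nx. w ! j ^ m j)"

lemma mono_E0: "(\<Prod>j<nx. w ! j ^ m j) \<in> E0"
  by (intro subfield_prod subfield_power fracs_subfield) (simp add: w_E0)

lemma \<sigma>_mono:
  assumes g: "g \<in> carrier B"
  shows "\<sigma> g (\<Prod>j<nx. w ! j ^ m j) =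
    (\<Prod>j<nx. (\<zeta> ^ lx (\<pi>x (p g) j) (kpart g)) ^ m j) * (\<Prod>j<nx. w ! \<pi>x (p g) j ^ m j)"
proof -
  have "\<sigma> g (\<Prod>j<nx. w ! j ^ m j) = (\<Prod>j<nx. \<sigma> g (w ! j ^ m j))"
    by (rule subfield_hom_prod[OF \<sigma>_hom[OF g]]) (simp add: w_E0 subfield_power fracs_subfield)
  also have "\<dots> = (\<Prod>j<nx. (\<zeta> ^ lx (\<pi>x (p g) j) (kpart g) * w ! \<pi>x (p g) j) ^ m j)"
    using g by (intro prod.cong refl) (simp add: subfield_hom_power[OF \<sigma>_hom[OF g]] w_E0 \<sigma>_w)
  finally show ?thesis by (simp add: power_mult_distrib prod.distrib)
qed

lemma perm_mono:
  assumes q: "q \<in> carrier Q"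
  shows "(\<Prod>j<nx. w ! \<pi>x q j ^ m j) = (\<Prod>j<nx. w ! j ^ m (\<pi>x (inv\<^bsub>Q\<^esub> q) j))"
proof -
  have "(\<Prod>j<nx. w ! \<pi>x q j ^ m j) = (\<Prod>j<nx. w ! \<pi>x q j ^ m (\<pi>x (inv\<^bsub>Q\<^esub> q) (\<pi>x q j)))"
    using q by (intro prod.cong refl) (simp add: \<pi>x_one flip: \<pi>x_comp)
  also have "\<dots> = (\<Prod>j<nx. w ! j ^ m (\<pi>x (inv\<^bsub>Q\<^esub> q) j))"
    using prod.reindex_bij_betw[OF bij_\<pi>x[OF q], of "\<lambda>j. w ! j ^ m (\<pi>x (inv\<^bsub>Q\<^esub> q) j)"] .
  finally show ?thesis .
qed

text \<open>The torsor with generic point \<open>zl\<close> has as function field \<open>Dy\<close>,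
  the \<open>Q\<close>-invariants of \<open>F(x, t, zl)\<close>. The essential point is that
  \<open>Dy\<close> contains the invariants of \<open>B\<close>. These come from sums over
  \<open>B\<close> of conjugates of an element of \<open>F(x, t)\<close> times a monomial in
  \<open>w\<close>; such a sum vanishes unless the kernel fixes the monomial, and then the monomial
  can be written in \<open>zl\<close>.\<close>

theorem descend:
  assumes ext: "\<And>m. indep F (x @ w @ t @ u @ map f [0..<m])"
    and tower: "\<And>y. (\<And>m. indep F (x @ t @ y @ map f [0..<m])) \<Longrightarrow> torsor_tower F (lin_fix F Q (dsum n M0 triv) (x @ t @ y))"
  shows "torsor_tower F (lin_fix F B (dsum (n + nx) MB triv) z)"
proof -
  have len_a: "length a = n + length t" by (simp add: len_x)
  have len_zl: "length zl = J" by (simp add: zl_def)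
  have ind_az: "indep F (a @ zl)" using indep_zl[of "[]"] indep by simp
  have faithful1: "\<exists>i<n + length t. \<exists>j<n + length t. M1 g i j \<noteq> of_bool (i = j)"
    if g: "g \<in> carrier Q" "g \<noteq> \<one>\<^bsub>Q\<^esub>" for g
  proof -
    obtain i j where "i < n" "j < n" "M0 g i j \<noteq> of_bool (i = j)" using faithful0[OF g] by blast
    then show ?thesis by (intro exI[of _ i] exI[of _ j] conjI) (auto simp: dsum_def)
  qed
  \<comment> \<open>The no-name lemma for the permutation representation on \<open>zl\<close> yields
    at once the twisting matrix \<open>c\<close> of the torus and the invariant coordinates
    \<open>y\<close>.\<close>
  obtain c d y where c: "\<And>i j. i < J \<Longrightarrow> j < J \<Longrightarrow> c i j \<in> E1" and d: "\<And>i j. i < J \<Longrightarrow> j < J \<Longrightarrow> d i j \<in> E1"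
    and cd: "\<And>i j. i < J \<Longrightarrow> j < J \<Longrightarrow> (\<Sum>k<J. c i k * d k j) = of_bool (i = j)"
    and dc: "\<And>i j. i < J \<Longrightarrow> j < J \<Longrightarrow> (\<Sum>k<J. d i k * c k j) = of_bool (i = j)"
    and ceq: "\<And>g i l. g \<in> carrier Q \<Longrightarrow> i < J \<Longrightarrow> l < J \<Longrightarrow> (\<Sum>j<J. subst_map F a (mact (n + length t) M1 g a) (c i j) * MJ g j l) = c i l"
    and y: "y = map (\<lambda>i. \<Sum>j<J. c i j * zl ! j) [0..<J]"
    and ind_y: "\<And>v. indep F (a @ zl @ v) \<Longrightarrow> indep F (a @ y @ v)"
    and L1: "lin_fix F Q (dsum (n + length t) M1 MJ) (a @ zl) = lin_fix F Q (dsum (n + length t) M1 triv) (a @ y)"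
    and L2: "lin_fix F Q (dsum (n + length t) M1 triv) (a @ y) = fracs (lin_fix F Q M1 a) y"
    by (rule no_name[OF F Q finite_Q rep_M1 lin_rep_MJ ind_az len_a len_zl faithful1],
        assumption, assumption, rule that, assumption+)
  note ceq = ceq[folded \<sigma>1_def]
  define Dy where "Dy = lin_fix F Q (dsum n M0 triv) (x @ t @ y)"
  have Dy_tower: "torsor_tower F Dy"
    unfolding Dy_def
  proof (rule tower)
    show "indep F (x @ t @ y @ map f [0..<m])" for m using ind_y[OF indep_zl[OF ext]] by simp
  qed
  have Dy_y: "Dy = fracs (lin_fix F Q M1 a) y"
    unfolding Dy_def using L2 by (simp add: dsum_triv_triv)
  define Dz where "Dz = fracs F (a @ zl)"
  \<comment> \<open>The action of \<open>Q\<close> on \<open>F(x, t, zl)\<close> that permutes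
    \<open>zl\<close>. It is no restriction of \<open>\<sigma>\<close>, which acts on
    \<open>F(x, w, t)\<close> only, but the two are compatible on \<open>F(x, t)\<close> and on the
    monomials fixed by the kernel.\<close>
  define \<tau>2 where "\<tau>2 q = subst_map F (a @ zl) (mact n M0 q x @ t @ mact J MJ q zl)" for q
  have mact_az: "mact (length (a @ zl)) (dsum (n + length t) M1 MJ) q (a @ zl) = mact n M0 q x @ t @ mact J MJ q zl" for q
    using mact_dsum[OF len_a len_zl, of M1 MJ q] mact_a[of q] by (simp add: len_x len_zl add.assoc)
  have rep_az: "lin_rep F Q (length (a @ zl)) (dsum (n + length t) M1 MJ)"
    using lin_rep_dsum[OF F rep_M1 lin_rep_MJ] by (simp add: len_x len_zl add.assoc)
  have act2: "field_action Q Dz \<tau>2"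
    using lin_action(1)[OF F Q finite_Q rep_az ind_az] unfolding mact_az Dz_def \<tau>2_def by simp
  have Dy_fix: "Dy = fixed Q Dz \<tau>2"
    unfolding Dy_def using L1 dsum_triv_triv[of n "length t" M0]
    unfolding lin_fix_def[of F Q "dsum (n + length t) M1 MJ"] mact_az Dz_def \<tau>2_def by simp
  have Dz_sub: "is_subfield Dz" unfolding Dz_def by (rule fracs_subfield)
  have E1_Dz: "E1 \<subseteq> Dz" unfolding Dz_def by (rule fracs_mono_append)
  have \<tau>2_hom: "q \<in> carrier Q \<Longrightarrow> subfield_hom Dz (\<tau>2 q)" and \<tau>2_cl: "q \<in> carrier Q \<Longrightarrow> v \<in> Dz \<Longrightarrow> \<tau>2 q v \<in> Dz"
    and \<tau>2_comp: "q \<in> carrier Q \<Longrightarrow> q' \<in> carrier Q \<Longrightarrow> v \<in> Dz \<Longrightarrow> \<tau>2 (q \<otimes>\<^bsub>Q\<^esub> q') v = \<tau>2 q (\<tau>2 q' v)" for q q' v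
    using act2 by (auto simp: field_action_def)
  have eqv2: "eqv F (a @ zl) (mact n M0 q x @ t @ mact J MJ q zl)" if q: "q \<in> carrier Q" for q
    using indep_mact[OF F Q rep_az ind_az q] ind_az unfolding mact_az
    by (intro indep_eqv) (simp_all add: len_x len_zl)
  have \<tau>2_\<sigma>1: "\<tau>2 q v = \<sigma>1 q v" if q: "q \<in> carrier Q" and v: "v \<in> E1" for q v
  proof -
    have e: "eqv F (a @ zl) ((mact n M0 q x @ t) @ mact J MJ q zl)" using eqv2[OF q] by simp
    have "subst_map F (a @ zl) ((mact n M0 q x @ t) @ mact J MJ q zl) v = subst_map F a (mact n M0 q x @ t) v"
      by (rule subst_map_append[OF F e _ v]) (simp add: len_x)
    then show ?thesis unfolding \<tau>2_def \<sigma>1_def mact_a by simp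
  qed
  have MJ_sum: "(\<Sum>l<J. MJ q j l * f l) = f (\<pi>J q j)" if q: "q \<in> carrier Q" and j: "j < J" for q j and f :: "nat \<Rightarrow> 'a"
  proof -
    have "(\<Sum>l<J. MJ q j l * f l) = (\<Sum>l<J. of_bool (\<pi>J q j = l) * f l)"
      by (intro sum.cong refl) (auto simp: MJ_def)
    also have "\<dots> = f (\<pi>J q j)" by (rule sum_of_bool_mult(1)) (use \<pi>J_less[OF q] j in \<open>simp add: J_def\<close>)
    finally show ?thesis .
  qed
  have \<tau>2_zl: "\<tau>2 q (zl ! j) = zl ! \<pi>J q j" if q: "q \<in> carrier Q" and j: "j < J" for q j
  proof -
    have "\<tau>2 q (zl ! j) = mact J MJ q zl ! j"
      using subst_map_nth[OF F eqv2[OF q], of "n + length t + j"] j len_zl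
      by (simp add: \<tau>2_def nth_append len_x)
    then show ?thesis using MJ_sum[OF q j, of "\<lambda>l. zl ! l"] j by (simp add: nth_mact)
  qed
  \<comment> \<open>Against a permutation matrix, equivariance means that conjugation permutes the
    columns of \<open>c\<close>.\<close>
  have c_equiv: "\<sigma>1 g (c i j) = c i (\<pi>J g j)" if g: "g \<in> carrier Q" and ij: "i < J" "j < J" for g i j
  proof -
    have pj: "\<pi>J g j < J" using \<pi>J_less[OF g] ij by (simp add: J_def)
    have "c i (\<pi>J g j) = (\<Sum>j'<J. \<sigma>1 g (c i j') * MJ g j' (\<pi>J g j))" using ceq[OF g ij(1) pj] ..
    also have "\<dots> = (\<Sum>j'<J. \<sigma>1 g (c i j') * of_bool (j' = j))"
      using bij_\<pi>J[OF g] ij by (intro sum.cong refl) (auto simp: MJ_def bij_betw_def inj_on_def)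
    also have "\<dots> = \<sigma>1 g (c i j)" by (rule sum_of_bool_mult(2)[OF ij(2)])
    finally show ?thesis ..
  qed
  have c_equivQ: "\<sigma>Q g (c i j) = c i (\<pi>J g j)" if "g \<in> carrier Q" "i < J" "j < J" for g i j
    using \<sigma>_\<sigma>1[OF _ c[OF that(2,3)], of "s g"] c_equiv[OF that] that ps by (simp add: \<sigma>Q_def)
  obtain \<theta> where \<theta>: "\<theta> \<in> E" "inj_on (\<lambda>q. \<sigma>Q q \<theta>) (carrier Q)" using exists_theta by blast
  have cE: "c i j \<in> E" "d i j \<in> E" if "i < J" "j < J" for i j using c d that E1_E by auto
  interpret tt: twisted_torus Q E \<sigma>Q \<theta> J r c d \<pi>J b e
  proof unfold_locales
    show "field_action Q E \<sigma>Q" by (rule action_\<sigma>Q)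
    show "\<forall>j<r. (\<Sum>k<J. q (\<pi>J g k) * b k j) = 0" if "g \<in> carrier Q" "\<forall>j<r. (\<Sum>k<J. q k * b k j) = 0" for g q
      using that relA_stable[OF that(1), of q] rel[of q] rel[of "\<lambda>k. q (\<pi>J g k)"]
        relA_iff[of q] relA_iff[of "\<lambda>k. q (\<pi>J g k)"] by (simp add: J_def)
  qed (use \<theta> cE cd dc \<pi>J_less \<pi>J_comp \<pi>J_one c_equivQ eb in \<open>simp_all add: J_def\<close>)
  have relA: "(\<forall>j<na. int N * q (nx + j) = (\<Sum>k<nx. q k * int (lx k (ea j))))" if "tt.rel q" for q
    using that[unfolded tt.rel_def, unfolded J_def] rel[of q] relA_iff[of q] by simp
  have \<tau>_equiv: "tt.equivariant \<tau>"
    unfolding tt.equivariant_def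
  proof (intro conjI allI impI ballI)
    show "\<tau> j \<noteq> 0" if "j < J" for j using w_nonzero by (simp add: \<tau>_def)
    show "\<exists>N>0. \<tau> j ^ N \<in> E" if j: "j < J" for j
    proof (cases "j < nx")
      case True
      \<comment> \<open>The kernel multiplies \<open>w ! j\<close> by roots of unity whose
        \<open>N\<close>-th power is 1.\<close>
      have "w ! j ^ N \<in> E"
      proof (rule E_I)
        show "w ! j ^ N \<in> E0" using True by (simp add: w_E0 subfield_power fracs_subfield)
        fix k assume k: "k \<in> ker"
        have "\<sigma> k (w ! j ^ N) = (\<zeta> ^ lx j k * w ! j) ^ N"
          using True k by (simp add: subfield_hom_power[OF \<sigma>_hom] ker_D w_E0 \<sigma>_ker_w)
        also have "\<dots> = (\<zeta> ^ N) ^ lx j k * w ! j ^ N"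
          by (simp add: power_mult_distrib mult.commute flip: power_mult)
        finally show "\<sigma> k (w ! j ^ N) = w ! j ^ N" by (simp add: \<zeta>_N)
      qed
      then show ?thesis using N_pos True by (auto simp: \<tau>_def)
    next
      case False
      then show ?thesis using E_subfield by (intro exI[of _ 1]) (simp add: \<tau>_def subfield_one)
    qed
  next
    fix q assume q: "tt.rel q"
    have pwE0: "(\<Prod>j<nx. w ! j powi f j) \<in> E0" for f :: "nat \<Rightarrow> int"
      by (intro subfield_prod subfield_powi fracs_subfield) (simp add: w_E0)
    have \<sigma>_pw: "\<sigma> g (\<Prod>j<nx. w ! j powi f j) = (\<Prod>j<nx. \<sigma> g (w ! j) powi f j)" if g: "g \<in> carrier B" for g and f :: "nat \<Rightarrow> int"
    proof -
      have "\<sigma> g (\<Prod>j<nx. w ! j powi f j) = (\<Prod>j<nx. \<sigma> g (w ! j powi f j))"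
        by (rule subfield_hom_prod[OF \<sigma>_hom[OF g]]) (simp add: w_E0 subfield_powi fracs_subfield)
      then show ?thesis by (simp add: subfield_hom_powi[OF \<sigma>_hom[OF g]] w_E0)
    qed
    show "tt.pw \<tau> q \<in> E"
      unfolding tt.pw_def prod_\<tau>
    proof (rule E_I[OF pwE0])
      fix k assume k: "k \<in> ker"
      have "\<sigma> k (\<Prod>j<nx. w ! j powi q j) = (\<Prod>j<nx. (\<zeta> ^ lx j k * w ! j) powi q j)"
        using k by (simp add: \<sigma>_pw ker_D \<sigma>_ker_w)
      also have "\<dots> = (\<Prod>j<nx. (\<zeta> ^ lx j k) powi q j) * (\<Prod>j<nx. w ! j powi q j)"
        by (simp add: power_int_mult_distrib prod.distrib)
      finally show "\<sigma> k (\<Prod>j<nx. w ! j powi q j) = (\<Prod>j<nx. w ! j powi q j)"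
        using \<zeta>_kernel_monomial[OF relA[OF q] k] by simp
    qed
    fix g assume g: "g \<in> carrier Q"
    \<comment> \<open>Along the section no roots of unity occur, so the values of the relations are
      permuted exactly.\<close>
    have "\<sigma>Q g (tt.pw \<tau> (\<lambda>k. q (\<pi>J g k))) = (\<Prod>j<nx. \<sigma> (s g) (w ! j) powi q (\<pi>J g j))"
      unfolding tt.pw_def prod_\<tau> \<sigma>Q_def using g by (simp add: \<sigma>_pw)
    also have "\<dots> = (\<Prod>j<nx. w ! \<pi>x g j powi q (\<pi>x g j))"
      using g by (intro prod.cong refl) (simp add: \<sigma>_s_w \<pi>J_def)
    also have "\<dots> = (\<Prod>j<nx. w ! j powi q j)"
      using prod.reindex_bij_betw[OF bij_\<pi>x[OF g], of "\<lambda>j. w ! j powi q j"] .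
    finally show "\<sigma>Q g (tt.pw \<tau> (\<lambda>k. q (\<pi>J g k))) = tt.pw \<tau> q" unfolding tt.pw_def prod_\<tau> .
  qed
  have zl_nz: "zl ! j \<noteq> 0" if "j < J" for j
    using that u_nonzero w_nonzero by (auto simp: zl_def \<tau>_def prod_zero_iff)
  have pw_zl: "tt.pw (\<lambda>j. zl ! j) q = (\<Prod>j<nx. w ! j powi q j)" if q: "tt.rel q" for q
  proof -
    have "tt.pw (\<lambda>j. zl ! j) q = tt.pw (\<lambda>j. \<tau> j * (\<Prod>i<r. u ! i powi b j i)) q"
      by (rule tt.pw_cong) (simp add: zl_def)
    also have "\<dots> = tt.pw \<tau> q" using tt.pw_monomials[of "\<lambda>i. u ! i" q] u_nonzero q by (simp add: tt.pw_mult)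
    finally show ?thesis unfolding tt.pw_def prod_\<tau> .
  qed
  \<comment> \<open>The second half of the generic point: the inverses of \<open>zl\<close> in the
    coordinates given by \<open>c\<close>.\<close>
  define y2 where "y2 = map (\<lambda>i. \<Sum>j<J. c i j * inverse (zl ! j)) [0..<J]"
  have bwd: "tt.bwd \<tau> (u @ map inverse u) = y @ y2"
  proof -
    have 1: "(\<Prod>i<r. (u @ map inverse u) ! i powi f i) = (\<Prod>i<r. u ! i powi f i)" for f :: "nat \<Rightarrow> int"
      by (intro prod.cong refl) (simp add: nth_append len_u)
    have 2: "inverse (\<tau> k) * (\<Prod>i<r. u ! i powi (- b k i)) = inverse (\<tau> k * (\<Prod>i<r. u ! i powi b k i))" for k
      by (simp add: power_int_minus prod_inversef[symmetric] o_def)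
    have "tt.bwd \<tau> (u @ map inverse u) = tt.enc (\<lambda>k. zl ! k) (\<lambda>k. inverse (zl ! k))"
      unfolding tt.bwd_def 1 2 by (rule tt.enc_cong) (simp_all add: zl_def)
    then show ?thesis by (simp add: tt.enc_def y y2_def)
  qed
  have zlDz: "zl ! j \<in> Dz" if "j < J" for j
    using that len_zl fracs_gens[of "a @ zl" F] by (auto simp: Dz_def)
  have y2_Dy: "set y2 \<subseteq> Dy"
  proof
    fix v assume "v \<in> set y2"
    then obtain i where i: "i < J" "v = (\<Sum>j<J. c i j * inverse (zl ! j))" by (auto simp: y2_def)
    have cz: "c i j * inverse (zl ! j) \<in> Dz" "c i j \<in> Dz" "inverse (zl ! j) \<in> Dz" if "j < J" for j
      using c[OF i(1) that] E1_Dz zlDz[OF that] Dz_sub by (auto intro!: subfield_mult subfield_inverse)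
    have "\<tau>2 q v = v" if q: "q \<in> carrier Q" for q
    proof -
      have "\<tau>2 q v = (\<Sum>j<J. \<tau>2 q (c i j * inverse (zl ! j)))"
        unfolding i(2) by (rule subfield_hom_sum[OF \<tau>2_hom[OF q]]) (simp add: cz)
      also have "\<dots> = (\<Sum>j<J. c i (\<pi>J q j) * inverse (zl ! \<pi>J q j))"
        using cz zlDz c[OF i(1)] i(1) q
        by (intro sum.cong refl) (simp add: subfield_hom_mult[OF \<tau>2_hom[OF q]] subfield_hom_inverse[OF \<tau>2_hom[OF q]]
            \<tau>2_\<sigma>1 c_equiv \<tau>2_zl)
      also have "\<dots> = v"
        unfolding i(2) using sum.reindex_bij_betw[OF bij_\<pi>J[OF q], of "\<lambda>j. c i j * inverse (zl ! j)"] .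
      finally show ?thesis .
    qed
    moreover have "v \<in> Dz" unfolding i(2) using cz Dz_sub by (intro subfield_sum) auto
    ultimately show "v \<in> Dy" unfolding Dy_fix by (simp add: fixed_def)
  qed
  have Dy_sub: "is_subfield Dy" unfolding Dy_fix by (rule fixed_subfield[OF act2])
  have K_Dy: "fixed Q E \<sigma>Q \<subseteq> Dy"
  proof -
    have K_eq: "fixed Q E \<sigma>Q = fixed B E0 \<sigma>" unfolding fixed_E lin_fix_def \<sigma>_fun ..
    let ?R = "prodspan E1 wmonos"
    have wmonosE0: "\<mu> \<in> E0" if "\<mu> \<in> wmonos" for \<mu> using that mono_E0 by (auto simp: wmonos_def)
    have RE: "?R \<subseteq> E0"
    proof
      fix v assume "v \<in> ?R"
      then show "v \<in> E0"
        by induction (use E1_E0 wmonosE0 in \<open>auto intro!: subfield_mult subfield_add fracs_subfield\<close>)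
    qed
    have E1m: "v * v' \<in> E1" if "v \<in> E1" "v' \<in> E1" for v v' using that by (intro subfield_mult fracs_subfield)
    have E11: "1 \<in> E1" by (intro subfield_one fracs_subfield)
    have wmonosm: "\<mu> * \<mu>' \<in> wmonos" if mm: "\<mu> \<in> wmonos" "\<mu>' \<in> wmonos" for \<mu> \<mu>'
    proof -
      obtain m m' where "\<mu> = (\<Prod>j<nx. w ! j ^ m j)" "\<mu>' = (\<Prod>j<nx. w ! j ^ m' j)"
        using mm by (auto simp: wmonos_def)
      then have "\<mu> * \<mu>' = (\<Prod>j<nx. w ! j ^ (m j + m' j))" by (simp add: power_add prod.distrib)
      then show ?thesis unfolding wmonos_def by (rule image_eqI[of _ _ "\<lambda>j. m j + m' j"]) simp
    qed
    have wmonos1: "1 \<in> wmonos" unfolding wmonos_def by (rule image_eqI[of _ _ "\<lambda>_. 0"]) auto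
    have w_monos: "w ! i \<in> wmonos" if "i < nx" for i
      unfolding wmonos_def
    proof (rule image_eqI[of _ _ "\<lambda>j. of_bool (j = i)"])
      have "(\<Prod>j<nx. w ! j ^ of_bool (j = i)) = (\<Prod>j<nx. if j = i then w ! j else 1)"
        by (intro prod.cong refl) auto
      then show "w ! i = (\<Prod>j<nx. w ! j ^ of_bool (j = i))" using that by simp
    qed simp
    have \<zeta>E1: "\<zeta> ^ k \<in> E1" for k using F \<zeta>F fracs_base[of F a] by (auto intro: subfield_power)
    have avg_gen: "(\<Sum>g\<in>carrier B. \<sigma> g (v * (\<Prod>j<nx. w ! j ^ m j))) \<in> Dy" if v: "v \<in> E1" for v m
    proof (cases "\<exists>k\<in>ker. \<not> N dvd (\<Sum>j<nx. m j * lx j k)")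
      case True
      then obtain k where k: "k \<in> ker" "\<not> N dvd (\<Sum>j<nx. m j * lx j k)" by blast
      let ?\<mu> = "\<Prod>j<nx. w ! j ^ m j" and ?\<chi> = "\<zeta> ^ (\<Sum>j<nx. m j * lx j k)"
      have vE0: "v \<in> E0" using v E1_E0 by auto
      have kB: "k \<in> carrier B" using k ker_D by blast
      have "(\<Prod>j<nx. (\<zeta> ^ lx j k) ^ m j) = ?\<chi>"
        by (simp add: power_sum mult.commute flip: power_mult)
      then have \<sigma>\<mu>: "\<sigma> k ?\<mu> = ?\<chi> * ?\<mu>"
        using \<sigma>_mono[OF kB, of m] k(1) by (simp add: ker_D \<pi>x_one kpart_of_ker)
      have \<sigma>v: "\<sigma> k v = v" using E_D(2)[of v k] v E1_E k(1) by blast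
      have \<chi>E0: "?\<chi> \<in> E0" using \<zeta>E1 E1_E0 by blast
      let ?S = "\<Sum>g\<in>carrier B. \<sigma> g (v * ?\<mu>)"
      \<comment> \<open>Translating the sum by \<open>k\<close> multiplies it by a root of unity
        other than 1.\<close>
      have "?S = (\<Sum>g\<in>carrier B. \<sigma> (g \<otimes>\<^bsub>B\<^esub> k) (v * ?\<mu>))"
        using sum.reindex_bij_betw[OF B.bij_betw_mult_right[OF kB], of "\<lambda>g. \<sigma> g (v * ?\<mu>)"] by simp
      also have "\<dots> = (\<Sum>g\<in>carrier B. ?\<chi> * \<sigma> g (v * ?\<mu>))"
      proof (intro sum.cong refl)
        fix g assume g: "g \<in> carrier B"
        have v\<mu>: "v * ?\<mu> \<in> E0" using vE0 mono_E0 by (intro subfield_mult fracs_subfield)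
        have "\<sigma> (g \<otimes>\<^bsub>B\<^esub> k) (v * ?\<mu>) = \<sigma> g (\<sigma> k v * \<sigma> k ?\<mu>)"
          using g kB v\<mu> vE0 mono_E0 by (simp add: \<sigma>_comp subfield_hom_mult[OF \<sigma>_hom[OF kB]])
        also have "\<sigma> k v * \<sigma> k ?\<mu> = ?\<chi> * (v * ?\<mu>)" by (simp add: \<sigma>\<mu> \<sigma>v mult_ac)
        also have "\<sigma> g (?\<chi> * (v * ?\<mu>)) = ?\<chi> * \<sigma> g (v * ?\<mu>)"
          using subfield_hom_mult[OF \<sigma>_hom[OF g] \<chi>E0 v\<mu>] \<sigma>_\<zeta>[OF g] by simp
        finally show "\<sigma> (g \<otimes>\<^bsub>B\<^esub> k) (v * ?\<mu>) = ?\<chi> * \<sigma> g (v * ?\<mu>)" .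
      qed
      also have "\<dots> = ?\<chi> * ?S" by (simp add: sum_distrib_left)
      finally have "(?\<chi> - 1) * ?S = 0" by (simp add: left_diff_distrib)
      moreover have "?\<chi> \<noteq> 1" using \<zeta> k(2) by (simp add: primitive_root_def)
      ultimately have "?S = 0" by simp
      then show ?thesis using Dy_sub by (simp add: subfield_zero)
    next
      case False
      then have dv: "N dvd (\<Sum>j<nx. m j * lx j k)" if "k \<in> ker" for k using that by blast
      let ?\<mu> = "\<Prod>j<nx. w ! j ^ m j"
      \<comment> \<open>Divisibility by \<open>N\<close> extends the exponents of the monomial to a
        relation, and on relations the monomials in \<open>w\<close> and in \<open>zl\<close> have
        the same value.\<close>
      define q where "q k = (if k < nx then int (m k) else int ((\<Sum>j<nx. m j * lx j (ea (k - nx))) div N))" for k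
      have "int N * q (nx + j) = (\<Sum>k<nx. q k * int (lx k (ea j)))" if j: "j < na" for j
      proof -
        have "N * ((\<Sum>k<nx. m k * lx k (ea j)) div N) = (\<Sum>k<nx. m k * lx k (ea j))"
          using dv[OF ea_ker[OF j]] by simp
        then show ?thesis by (simp add: q_def flip: of_nat_mult of_nat_sum)
      qed
      then have q: "tt.rel q" unfolding tt.rel_def unfolding J_def using rel[of q] relA_iff[of q] by simp
      have \<mu>_pw: "?\<mu> = tt.pw (\<lambda>j. zl ! j) q" unfolding pw_zl[OF q] by (simp add: q_def)
      have \<mu>Dz: "?\<mu> \<in> Dz"
        unfolding \<mu>_pw tt.pw_def using zlDz Dz_sub by (intro subfield_prod subfield_powi) auto
      \<comment> \<open>Both actions permute the variables of the monomial in the same way, and the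
        root of unity contributed by \<open>g\<close> is 1 because the kernel fixes the
        monomial.\<close>
      have same: "\<sigma> g (v * ?\<mu>) = \<tau>2 (p g) (v * ?\<mu>)" if g: "g \<in> carrier B" for g
      proof -
        let ?q = "p g"
        have qQ: "?q \<in> carrier Q" using g by simp
        let ?k = "act (inv\<^bsub>Q\<^esub> ?q) (kpart g)"
        have k: "?k \<in> ker" using act_ker kpart_ker[OF g] qQ by simp
        have kp: "act ?q ?k = kpart g" using kpart_ker[OF g] qQ by (simp add: act_act act_one ker_D)
        have "lx (\<pi>x ?q j) (kpart g) = lx j ?k" if "j < nx" for j
          using char_act_apply[OF qQ k, of "lx j"] kp that qQ by (simp add: \<pi>x)
        then have "(\<Prod>j<nx. (\<zeta> ^ lx (\<pi>x ?q j) (kpart g)) ^ m j) = \<zeta> ^ (\<Sum>j<nx. m j * lx j ?k)"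
          by (simp add: power_sum mult.commute flip: power_mult)
        also have "\<dots> = 1" using dv[OF k] \<zeta> by (simp add: primitive_root_def)
        finally have \<sigma>\<mu>: "\<sigma> g ?\<mu> = (\<Prod>j<nx. w ! \<pi>x ?q j ^ m j)" using \<sigma>_mono[OF g, of m] by simp
        let ?q' = "\<lambda>j. q (\<pi>J (inv\<^bsub>Q\<^esub> ?q) j)"
        have q': "tt.rel ?q'" using tt.rel_perm[OF _ q, of "inv\<^bsub>Q\<^esub> ?q"] qQ by simp
        have qback: "?q' (\<pi>J ?q j) = q j" if "j < J" for j
          using that qQ \<pi>J_comp[of "inv\<^bsub>Q\<^esub> ?q" ?q j] \<pi>J_one[of j] by (simp add: J_def)
        have "\<tau>2 ?q ?\<mu> = (\<Prod>j<J. \<tau>2 ?q (zl ! j powi q j))"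
          unfolding \<mu>_pw tt.pw_def using zlDz Dz_sub
          by (intro subfield_hom_prod[OF \<tau>2_hom[OF qQ]]) (simp add: subfield_powi)
        also have "\<dots> = (\<Prod>j<J. zl ! \<pi>J ?q j powi ?q' (\<pi>J ?q j))"
          using zlDz by (intro prod.cong refl) (simp add: subfield_hom_powi[OF \<tau>2_hom[OF qQ]] \<tau>2_zl[OF qQ] qback)
        also have "\<dots> = tt.pw (\<lambda>j. zl ! j) ?q'"
          unfolding tt.pw_def using prod.reindex_bij_betw[OF bij_\<pi>J[OF qQ], of "\<lambda>j. zl ! j powi ?q' j"] .
        also have "\<dots> = (\<Prod>j<nx. w ! j powi ?q' j)" by (rule pw_zl[OF q'])
        also have "\<dots> = (\<Prod>j<nx. w ! \<pi>x ?q j powi ?q' (\<pi>x ?q j))"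
          using prod.reindex_bij_betw[OF bij_\<pi>x[OF qQ], of "\<lambda>j. w ! j powi ?q' j"] by simp
        also have "\<dots> = (\<Prod>j<nx. w ! \<pi>x ?q j ^ m j)"
        proof (intro prod.cong refl)
          fix j assume j: "j \<in> {..<nx}"
          then have "?q' (\<pi>x ?q j) = q j" using qback[of j] by (simp add: \<pi>J_def J_def)
          then show "w ! \<pi>x ?q j powi ?q' (\<pi>x ?q j) = w ! \<pi>x ?q j ^ m j" using j by (simp add: q_def)
        qed
        finally have \<tau>\<mu>: "\<tau>2 ?q ?\<mu> = \<sigma> g ?\<mu>" using \<sigma>\<mu> by simp
        have "\<sigma> g (v * ?\<mu>) = \<sigma> g v * \<sigma> g ?\<mu>"
          using v E1_E0 mono_E0 by (intro subfield_hom_mult[OF \<sigma>_hom[OF g]]) auto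
        also have "\<dots> = \<tau>2 ?q v * \<tau>2 ?q ?\<mu>" using \<sigma>_\<sigma>1[OF g v] \<tau>2_\<sigma>1[OF qQ v] \<tau>\<mu> by simp
        also have "\<dots> = \<tau>2 ?q (v * ?\<mu>)"
          using v E1_Dz \<mu>Dz by (intro subfield_hom_mult[OF \<tau>2_hom[OF qQ], symmetric]) auto
        finally show ?thesis .
      qed
      let ?e = "v * ?\<mu>"
      have eDz: "?e \<in> Dz" using v E1_Dz \<mu>Dz Dz_sub by (intro subfield_mult) auto
      have S: "(\<Sum>g\<in>carrier B. \<sigma> g ?e) = (\<Sum>g\<in>carrier B. \<tau>2 (p g) ?e)" using same by simp
      show ?thesis
        unfolding Dy_fix fixed_def
      proof (intro CollectI conjI ballI)
        show "(\<Sum>g\<in>carrier B. \<sigma> g ?e) \<in> Dz"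
          unfolding S using \<tau>2_cl eDz Dz_sub by (intro subfield_sum) auto
        fix h assume h: "h \<in> carrier Q"
        have "\<tau>2 h (\<Sum>g\<in>carrier B. \<sigma> g ?e) = (\<Sum>g\<in>carrier B. \<tau>2 h (\<tau>2 (p g) ?e))"
          unfolding S by (rule subfield_hom_sum[OF \<tau>2_hom[OF h]]) (use \<tau>2_cl eDz in simp)
        also have "\<dots> = (\<Sum>g\<in>carrier B. \<tau>2 (p (s h \<otimes>\<^bsub>B\<^esub> g)) ?e)"
          using h eDz ps by (intro sum.cong refl) (simp add: \<tau>2_comp)
        also have "\<dots> = (\<Sum>g\<in>carrier B. \<tau>2 (p g) ?e)"
          using sum.reindex_bij_betw[OF B.bij_betw_mult_left[OF sh.hom_closed[OF h]], of "\<lambda>g. \<tau>2 (p g) ?e"] .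
        finally show "\<tau>2 h (\<Sum>g\<in>carrier B. \<sigma> g ?e) = (\<Sum>g\<in>carrier B. \<sigma> g ?e)" unfolding S .
      qed
    qed
    show ?thesis
      unfolding K_eq
    proof (rule fixed_subset_if_averages[OF action_\<sigma> RE])
      show "v * v' \<in> ?R" if "v \<in> ?R" "v' \<in> ?R" for v v' by (rule prodspan_mult[OF E1m wmonosm that])
      show "1 \<in> ?R" using prodspan.gen[OF E11 wmonos1] by simp
      show "\<sigma> h v \<in> ?R" if h: "h \<in> carrier B" and v: "v \<in> ?R" for h v
        using v
      proof induction
        case (gen c \<mu>)
        obtain m where \<mu>: "\<mu> = (\<Prod>j<nx. w ! j ^ m j)" using gen(2) by (auto simp: wmonos_def)
        let ?C = "\<Prod>j<nx. (\<zeta> ^ lx (\<pi>x (p h) j) (kpart h)) ^ m j"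
        have "\<sigma> h (c * \<mu>) = \<sigma> h c * \<sigma> h \<mu>"
          using gen E1_E0 wmonosE0 by (intro subfield_hom_mult[OF \<sigma>_hom[OF h]]) auto
        also have "\<dots> = (\<sigma>1 (p h) c * ?C) * (\<Prod>j<nx. w ! j ^ m (\<pi>x (inv\<^bsub>Q\<^esub> (p h)) j))"
          using \<sigma>_\<sigma>1[OF h gen(1)] \<sigma>_mono[OF h, of m] perm_mono[of "p h" m] h by (simp add: \<mu>)
        finally show ?case
        proof (rule ssubst, intro prodspan.gen)
          have "\<sigma>1 (p h) c \<in> E1" using action_\<sigma>1 gen(1) h by (simp add: field_action_def)
          moreover have "?C \<in> E1" using \<zeta>E1[of 1] by (intro subfield_prod subfield_power fracs_subfield) auto
          ultimately show "\<sigma>1 (p h) c * ?C \<in> E1" by (rule E1m)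
          show "(\<Prod>j<nx. w ! j ^ m (\<pi>x (inv\<^bsub>Q\<^esub> (p h)) j)) \<in> wmonos" by (auto simp: wmonos_def)
        qed
      next
        case (add v v')
        then show ?case using RE by (subst subfield_hom_add[OF \<sigma>_hom[OF h]]) (auto intro: prodspan.add)
      qed
      show "\<exists>v\<in>?R. \<exists>v'\<in>?R. v' \<noteq> 0 \<and> e = v / v'" if e: "e \<in> E0" for e
      proof -
        have in_R: "P z \<in> ?R" if P: "P \<in> polys F (length z)" for P
        proof (rule prodspan_polys[OF P E1m E11 fracs_base wmonosm wmonos1])
          fix i assume i: "i < length z"
          show "z ! i \<in> E1 \<union> wmonos"
          proof (cases "i < n \<or> n + nx \<le> i")
            case True
            then have "z ! i \<in> set a" using i len_x len_w by (auto simp: nth_append)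
            then show ?thesis using fracs_gens[of a F] by blast
          next
            case False
            then show ?thesis using w_monos[of "i - n"] len_x len_w by (auto simp: nth_append)
          qed
        qed
        obtain P P' where "P \<in> polys F (length z)" "P' \<in> polys F (length z)" "P' z \<noteq> 0" "e = P z / P' z"
          using e unfolding fracs_eq[OF F] by blast
        then show ?thesis using in_R by blast
      qed
      show "is_subfield Dy" by (rule Dy_sub)
      show "(\<Sum>h\<in>carrier B. \<sigma> h v) \<in> Dy" if "v \<in> ?R" for v
        using that
      proof induction
        case (gen c \<mu>)
        then show ?case using avg_gen[OF gen(1)] by (auto simp: wmonos_def)
      next
        case (add v v')
        have "(\<Sum>h\<in>carrier B. \<sigma> h (v + v')) = (\<Sum>h\<in>carrier B. \<sigma> h v) + (\<Sum>h\<in>carrier B. \<sigma> h v')"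
          unfolding sum.distrib[symmetric] using add RE
          by (intro sum.cong refl) (subst subfield_hom_add[OF \<sigma>_hom], auto)
        then show ?case using add Dy_sub by (simp add: subfield_add)
      qed
    qed
  qed
  \<comment> \<open>\<open>Dy\<close> is generated by \<open>y\<close> over the
    \<open>Q\<close>-invariants of \<open>F(x, t)\<close>, which are also fixed by \<open>B\<close>.
    So adjoining the generic point to the base field of the torsor gives exactly
    \<open>Dy\<close>.\<close>
  have "fracs (fixed Q E \<sigma>Q) (y @ y2) = Dy"
  proof (rule equalityI)
    have "set y \<subseteq> Dy" unfolding Dy_y by (rule fracs_gens)
    then show "fracs (fixed Q E \<sigma>Q) (y @ y2) \<subseteq> Dy"
      using K_Dy y2_Dy by (intro fracs_least Dy_sub) auto
    have "lin_fix F Q M1 a \<subseteq> fixed Q E \<sigma>Q"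
    proof
      fix v assume "v \<in> lin_fix F Q M1 a"
      then have v: "v \<in> E1" "\<And>q. q \<in> carrier Q \<Longrightarrow> \<sigma>1 q v = v"
        unfolding lin_fix_def fixed_def \<sigma>1_def len_a by auto
      have "\<sigma>Q q v = v" if "q \<in> carrier Q" for q
        using \<sigma>_\<sigma>1[OF sh.hom_closed[OF that] v(1)] ps[OF that] v(2)[OF that] by (simp add: \<sigma>Q_def)
      then show "v \<in> fixed Q E \<sigma>Q" using v(1) E1_E by (auto simp: fixed_def)
    qed
    then show "Dy \<subseteq> fracs (fixed Q E \<sigma>Q) (y @ y2)"
      unfolding Dy_y using fracs_base[of "fixed Q E \<sigma>Q" "y @ y2"] fracs_gens[of "y @ y2" "fixed Q E \<sigma>Q"]
      by (intro fracs_least fracs_subfield) auto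
  qed
  then have bwd_tower: "torsor_tower F (fracs tt.K (tt.bwd \<tau> (u @ map inverse u)))" using Dy_tower bwd by simp
  have "torsor_tower F tt.K"
  proof (rule tt.torsor_tower_step[OF \<tau>_equiv fracs_subfield _ _ _ len_u bwd_tower])
    show "E \<subseteq> E0" using E_D(1) by blast
    show "\<tau> k \<in> E0" for k using w_E0 by (simp add: \<tau>_def subfield_one fracs_subfield)
    show "indep E0 u" using indep_appendD2[OF F, of z u] indep by simp
  qed
  then show ?thesis unfolding fixed_E .
qed

end

section \<open>Groups with a linear representation whose invariants admit a tower\<close>

text \<open>Each step of the tower consumes fresh variables, so a whole sequence of them is kept in
  reserve.\<close>

definition extendable :: "'a :: field set \<Rightarrow> 'a list \<Rightarrow> bool" where
  "extendable F z \<longleftrightarrow> (\<exists>f. \<forall>m. indep F (z @ map f [0..<m]))"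

text \<open>The tower is demanded for all lists \<open>t\<close> of additional invariant variables,
  because the step from \<open>Q\<close> to an extension passes its own new variables on to the
  tower of \<open>Q\<close>.\<close>

definition has_tower_rep :: "'a :: field set \<Rightarrow> ('g, 'b) monoid_scheme \<Rightarrow> bool" where
  "has_tower_rep F Q \<longleftrightarrow> (\<exists>n M. lin_rep F Q n M \<and>
     (\<forall>q\<in>carrier Q. q \<noteq> \<one>\<^bsub>Q\<^esub> \<longrightarrow> (\<exists>i<n. \<exists>j<n. M q i j \<noteq> of_bool (i = j))) \<and>
     (\<forall>x t. length x = n \<longrightarrow> extendable F (x @ t) \<longrightarrow> torsor_tower F (lin_fix F Q (dsum n M triv) (x @ t))))"

lemma extendableD: "extendable F z \<Longrightarrow> indep F z"
  unfolding extendable_def by (metis append_Nil2 list.simps(8) upt_0)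

lemma extendableE:
  assumes "extendable F z"
  obtains u f where "length u = r" "\<And>m. indep F (z @ u @ map f [0..<m])"
proof -
  obtain f where f: "\<And>m. indep F (z @ map f [0..<m])" using assms by (auto simp: extendable_def)
  have "map f [0..<r + m] = map f [0..<r] @ map (\<lambda>i. f (r + i)) [0..<m]" for m
    by (rule nth_equalityI) (auto simp: nth_append)
  then show ?thesis using f[of "r + _"] by (intro that[of "map f [0..<r]" "\<lambda>i. f (r + i)"]) simp_all
qed

text \<open>The zero-dimensional representation is faithful, and all of \<open>F(t)\<close> is
  invariant.\<close>

lemma has_tower_rep_trivial:
  assumes F: "is_subfield F" and Q: "group Q" and Q1: "carrier Q = {\<one>\<^bsub>Q\<^esub>}"
  shows "has_tower_rep F Q"
  unfolding has_tower_rep_def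
proof (intro exI conjI allI impI)
  have rep: "lin_rep F Q (0 + length t) (dsum 0 triv triv)" for t
    by (intro lin_rep_dsum lin_rep_triv F)
  show "lin_rep F Q 0 triv" by (rule lin_rep_triv[OF F])
  show "\<forall>q\<in>carrier Q. q \<noteq> \<one>\<^bsub>Q\<^esub> \<longrightarrow> (\<exists>i<0. \<exists>j<0. triv q i j \<noteq> of_bool (i = j))" using Q1 by simp
  fix x t :: "'a list" assume x: "length x = 0" and t: "extendable F (x @ t)"
  have it: "indep F t" using extendableD[OF t] x by simp
  have "field_action Q (fracs F t) (\<lambda>g. subst_map F t (mact (length t) (dsum 0 triv triv) g t))"
    by (rule lin_action(1)[OF F Q _ _ it]) (use Q1 rep[of t] in simp_all)
  then have "lin_fix F Q (dsum 0 triv triv) t = fracs F t"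
    using Q1 by (auto simp: lin_fix_def fixed_def field_action_def)
  then show "torsor_tower F (lin_fix F Q (dsum 0 triv triv) (x @ t))"
    using x torsor_tower.base[OF it] by simp
qed

lemma has_tower_rep_split_extension:
  fixes F :: "'a :: {field_char_0, alg_closed_field} set"
  assumes sp: "split_extension B Q p s" and F: "is_subfield F"
    and roots: "\<And>N. N > 0 \<Longrightarrow> \<exists>\<zeta>\<in>F. primitive_root N \<zeta>" and inf: "extendable F []"
    and tower: "has_tower_rep F Q"
  shows "has_tower_rep F B"
proof -
  interpret split_extension B Q p s by (rule sp)
  obtain n M0 where M0: "lin_rep F Q n M0"
    "\<forall>q\<in>carrier Q. q \<noteq> \<one>\<^bsub>Q\<^esub> \<longrightarrow> (\<exists>i<n. \<exists>j<n. M0 q i j \<noteq> of_bool (i = j))"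
    and tw: "\<And>x t. length x = n \<Longrightarrow> extendable F (x @ t) \<Longrightarrow> torsor_tower F (lin_fix F Q (dsum n M0 triv) (x @ t))"
    using tower unfolding has_tower_rep_def by blast
  obtain \<zeta> where \<zeta>: "\<zeta> \<in> F" "primitive_root N \<zeta>" using roots[OF N_pos] by blast
  define A where "A k a = (if k < nx then - int (lx k (ea a)) else int N * of_bool (k - nx = a))" for k a
  obtain r :: nat and b e :: "nat \<Rightarrow> nat \<Rightarrow> int"
    where be: "(\<forall>i<r. \<forall>j<r. (\<Sum>k<nx + na. e i k * b k j) = of_bool (i = j)) \<and>
      (\<forall>q. (\<forall>j<r. (\<Sum>k<nx + na. q k * b k j) = 0) \<longleftrightarrow> (\<forall>j<na. (\<Sum>k<nx + na. q k * A k j) = 0))"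
    using lattice_basis[where n = "nx + na" and s = na and A = A] by (elim exE)
  define M where "M = dsum n (\<lambda>g. M0 (p g)) (\<lambda>g i j. of_bool (j = \<pi>x (p g) i) * \<zeta> ^ lx j (kpart g))"
  have step: "kummer_step B Q p s F \<zeta> n r M0 x w t u b e A"
    if "length x = n" "length w = nx" "length u = r" "indep F (x @ w @ t @ u)" for x w t u
  proof unfold_locales
    show "\<exists>i<n. \<exists>j<n. M0 q i j \<noteq> of_bool (i = j)" if "q \<in> carrier Q" "q \<noteq> \<one>\<^bsub>Q\<^esub>" for q
      using M0(2) that by blast
  qed (use that F \<zeta> M0(1) A_def be in auto)
  have M: "kummer_step.MB B Q p s \<zeta> n M0 = M" if "kummer_step B Q p s F \<zeta> n r M0 x w t u b e A" for x w t u
    unfolding M_def kummer_step.MB_def[OF that] kummer_step.Mw_def[OF that, abs_def] ..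
  \<comment> \<open>Any independent point gives an instance of the locale, from which the facts
    about the matrices are read off; they do not depend on the point.\<close>
  obtain v f where v: "length v = n + nx + r" and "\<And>m. indep F ([] @ v @ map f [0..<m])"
    using extendableE[OF inf] by metis
  from this(2)[of 0] have iv: "indep F v" by simp
  have v': "kummer_step B Q p s F \<zeta> n r M0 (take n v) (take nx (drop n v)) [] (drop (n + nx) v) b e A"
    by (rule step) (use v iv in \<open>simp_all flip: append_assoc take_add\<close>)
  show ?thesis
    unfolding has_tower_rep_def
  proof (rule exI, rule exI, intro conjI ballI impI allI)
    show "lin_rep F B (n + nx) M" using kummer_step.lin_rep_MB[OF v'] by (simp add: M[OF v'])
    show "\<exists>i<n + nx. \<exists>j<n + nx. M g i j \<noteq> of_bool (i = j)" if "g \<in> carrier B" "g \<noteq> \<one>\<^bsub>B\<^esub>" for g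
      using kummer_step.faithful_MB[OF v' that] by (simp add: M[OF v'])
    fix z t :: "'a list" assume z: "length z = n + nx" and ext: "extendable F (z @ t)"
    define x w where "x = take n z" and "w = drop n z"
    have zxw: "z = x @ w" "length x = n" "length w = nx" using z by (simp_all add: x_def w_def)
    obtain u f where u: "length u = r" "\<And>m. indep F ((z @ t) @ u @ map f [0..<m])"
      using extendableE[OF ext] by metis
    have iu: "indep F (x @ w @ t @ u @ map f [0..<m])" for m using u(2)[of m] zxw(1) by simp
    have ks: "kummer_step B Q p s F \<zeta> n r M0 x w t u b e A"
      by (rule step) (use zxw u iu[of 0] in auto)
    have "torsor_tower F (lin_fix F B (dsum (n + nx) M triv) (x @ w @ t))"
      unfolding M[OF ks, symmetric]
      by (rule kummer_step.descend[OF ks iu], rule tw) (use zxw in \<open>auto simp: extendable_def\<close>)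
    then show "torsor_tower F (lin_fix F B (dsum (n + nx) M triv) (z @ t))" using zxw(1) by simp
  qed
qed

section \<open>Quotients along the filtration\<close>

lemma natural_proj_rcoset:
  assumes G: "group G" and N: "subgroup N G" and H: "subgroup H G" "H \<subseteq> N" and g: "g \<in> carrier G"
  shows "natural_proj G N (H #>\<^bsub>G\<^esub> g) = N #>\<^bsub>G\<^esub> g"
proof -
  interpret group G by (rule G)
  have NH: "N \<subseteq> carrier G" "H \<subseteq> carrier G" using N H(1) by (auto dest: subgroup.subset)
  have "N <#>\<^bsub>G\<^esub> H = N"
  proof
    show "N <#>\<^bsub>G\<^esub> H \<subseteq> N" using H(2) N by (auto simp: set_mult_def intro: subgroup.m_closed)
    show "N \<subseteq> N <#>\<^bsub>G\<^esub> H"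
    proof
      fix x assume "x \<in> N"
      then show "x \<in> N <#>\<^bsub>G\<^esub> H"
        using subgroup.one_closed[OF H(1)] NH(1) unfolding set_mult_def
        by (intro UN_I[of x] UN_I[of "\<one>\<^bsub>G\<^esub>"]) auto
    qed
  qed
  then show ?thesis unfolding natural_proj_def using setmult_rcos_assoc[OF NH g] by simp
qed

lemma split_extension_Mod:
  assumes G: "group G" "finite (carrier G)" and N: "N \<lhd> G" and H: "H \<lhd> G" "H \<subseteq> N"
    and comm: "comm_group ((G Mod H)\<lparr>carrier := kernel (G Mod H) (G Mod N) (natural_proj G N)\<rparr>)"
    and s: "s \<in> hom (G Mod N) (G Mod H)" "\<And>C. C \<in> carrier (G Mod N) \<Longrightarrow> natural_proj G N (s C) = C"
  shows "split_extension (G Mod H) (G Mod N) (natural_proj G N) s"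
proof (rule split_extension.intro)
  interpret group G by (rule G(1))
  interpret N: normal N G by (rule N)
  interpret H: normal H G by (rule H(1))
  have proj: "natural_proj G N (H #>\<^bsub>G\<^esub> g) = N #>\<^bsub>G\<^esub> g" if "g \<in> carrier G" for g
    by (rule natural_proj_rcoset[OF G(1) N.subgroup_axioms H.subgroup_axioms H(2) that])
  show "group (G Mod H)" by (rule H.factorgroup_is_group)
  show "group (G Mod N)" by (rule N.factorgroup_is_group)
  show "finite (carrier (G Mod H))" using G(2) by (simp add: carrier_FactGroup)
  show "natural_proj G N \<in> hom (G Mod H) (G Mod N)"
  proof (rule homI)
    show "natural_proj G N x \<in> carrier (G Mod N)" if "x \<in> carrier (G Mod H)" for x
      using that by (auto simp: carrier_FactGroup proj)
    fix x y assume "x \<in> carrier (G Mod H)" "y \<in> carrier (G Mod H)"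
    then obtain g h where "g \<in> carrier G" "h \<in> carrier G" "x = H #>\<^bsub>G\<^esub> g" "y = H #>\<^bsub>G\<^esub> h"
      by (auto simp: carrier_FactGroup)
    then show "natural_proj G N (x \<otimes>\<^bsub>G Mod H\<^esub> y) = natural_proj G N x \<otimes>\<^bsub>G Mod N\<^esub> natural_proj G N y"
      by (simp add: H.rcos_sum N.rcos_sum proj)
  qed
  show "s \<in> hom (G Mod N) (G Mod H)" by (rule s(1))
  show "natural_proj G N (s q) = q" if "q \<in> carrier (G Mod N)" for q by (rule s(2)[OF that])
  show "a \<otimes>\<^bsub>G Mod H\<^esub> a' = a' \<otimes>\<^bsub>G Mod H\<^esub> a"
    if "a \<in> carrier (G Mod H)" "a' \<in> carrier (G Mod H)"
      "natural_proj G N a = \<one>\<^bsub>G Mod N\<^esub>" "natural_proj G N a' = \<one>\<^bsub>G Mod N\<^esub>" for a a'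
    using comm_groupE(4)[OF comm, of a a'] that by (simp add: kernel_def)
qed

text \<open>The last quotient is taken modulo the trivial subgroup, and its elements are singletons.
  One more extension, with trivial kernel, leads back from there to \<open>G\<close> itself.\<close>

lemma split_extension_Mod_one:
  assumes G: "group G" "finite (carrier G)"
  shows "split_extension G (G Mod {\<one>\<^bsub>G\<^esub>}) (\<lambda>g. {\<one>\<^bsub>G\<^esub>} #>\<^bsub>G\<^esub> g) the_elem"
proof (rule split_extension.intro)
  interpret group G by (rule G(1))
  interpret N: normal "{\<one>\<^bsub>G\<^esub>}" G by (rule one_is_normal)
  have e: "{\<one>\<^bsub>G\<^esub>} #>\<^bsub>G\<^esub> g = {g}" if "g \<in> carrier G" for g using that by (auto simp: r_coset_def)
  show "group G" "finite (carrier G)" by (rule G)+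
  show "group (G Mod {\<one>\<^bsub>G\<^esub>})" by (rule N.factorgroup_is_group)
  show "(\<lambda>g. {\<one>\<^bsub>G\<^esub>} #>\<^bsub>G\<^esub> g) \<in> hom G (G Mod {\<one>\<^bsub>G\<^esub>})" by (rule N.r_coset_hom_Mod)
  show "the_elem \<in> hom (G Mod {\<one>\<^bsub>G\<^esub>}) G"
    by (rule homI) (auto simp: carrier_FactGroup e set_mult_def)
  show "{\<one>\<^bsub>G\<^esub>} #>\<^bsub>G\<^esub> the_elem q = q" if "q \<in> carrier (G Mod {\<one>\<^bsub>G\<^esub>})" for q
    using that by (auto simp: carrier_FactGroup e)
  show "a \<otimes>\<^bsub>G\<^esub> a' = a' \<otimes>\<^bsub>G\<^esub> a"
    if "a \<in> carrier G" "a' \<in> carrier G" "{\<one>\<^bsub>G\<^esub>} #>\<^bsub>G\<^esub> a = \<one>\<^bsub>G Mod {\<one>\<^bsub>G\<^esub>}\<^esub>" "{\<one>\<^bsub>G\<^esub>} #>\<^bsub>G\<^esub> a' = \<one>\<^bsub>G Mod {\<one>\<^bsub>G\<^esub>}\<^esub>" for a a'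
    using that by (simp add: e)
qed

text \<open>Induction along the filtration, starting from the trivial group
  \<open>G Mod H 0\<close>; every step is a split extension with abelian kernel.\<close>

theorem has_tower_rep_special_solvable:
  fixes F :: "'a :: {field_char_0, alg_closed_field} set"
  assumes G: "special_solvable G" and F: "is_subfield F"
    and roots: "\<And>N. N > 0 \<Longrightarrow> \<exists>\<zeta>\<in>F. primitive_root N \<zeta>" and inf: "extendable F []"
  shows "has_tower_rep F G"
proof -
  obtain r H where grp: "group G" "finite (carrier G)" and H0: "H 0 = carrier G" and Hr: "H r = {\<one>\<^bsub>G\<^esub>}"
    and H: "\<And>i. i < r \<Longrightarrow> H (Suc i) \<subset> H i \<and> H i \<lhd> G \<and>
      comm_group ((G Mod H (Suc i)) \<lparr>carrier := kernel (G Mod H (Suc i)) (G Mod H i) (natural_proj G (H i))\<rparr>) \<and>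
      (\<exists>s \<in> hom (G Mod H i) (G Mod H (Suc i)). \<forall>C \<in> carrier (G Mod H i). natural_proj G (H i) (s C) = C)"
    using G unfolding special_solvable_def by blast
  interpret group G by (rule grp)
  have normal: "H i \<lhd> G" if "i \<le> r" for i
    using that H[of i] Hr one_is_normal by (cases "i = r") auto
  have "has_tower_rep F (G Mod H i)" if "i \<le> r" for i
    using that
  proof (induction i)
    case 0
    interpret N: normal "H 0" G by (rule normal) simp
    have "H 0 #>\<^bsub>G\<^esub> g = H 0" if "g \<in> carrier G" for g
      using N.rcos_const[OF is_group, of g] that H0 by simp
    then have "carrier (G Mod H 0) = {\<one>\<^bsub>G Mod H 0\<^esub>}" by (auto simp: carrier_FactGroup)
    then show ?case by (rule has_tower_rep_trivial[OF F N.factorgroup_is_group])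
  next
    case (Suc i)
    then have i: "i < r" by simp
    obtain s where s: "s \<in> hom (G Mod H i) (G Mod H (Suc i))"
      "\<And>C. C \<in> carrier (G Mod H i) \<Longrightarrow> natural_proj G (H i) (s C) = C" using H[OF i] by blast
    have "split_extension (G Mod H (Suc i)) (G Mod H i) (natural_proj G (H i)) s"
      by (rule split_extension_Mod[OF grp normal normal _ _ s]) (use i H[OF i] in auto)
    then show ?case
      by (rule has_tower_rep_split_extension[OF _ F roots inf]) (use Suc in auto)
  qed
  from this[of r] show ?thesis
    by (intro has_tower_rep_split_extension[OF split_extension_Mod_one[OF grp] F roots inf]) (simp_all add: Hr)
qed

section \<open>Independent variables in the universal domain\<close>

definition monomial_value :: "(nat \<Rightarrow> 'k udom) \<Rightarrow> (nat \<Rightarrow>\<^sub>0 nat) \<Rightarrow> 'k :: field udom" where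
  "monomial_value v m = (\<Prod>i\<in>Poly_Mapping.keys m. v i ^ Poly_Mapping.lookup m i)"

text \<open>Independence speaks of polynomial functions, whereas the universal domain is built from
  formal polynomials; evaluation connects the two.\<close>

definition poly_value :: "(nat \<Rightarrow> 'k udom) \<Rightarrow> ((nat \<Rightarrow>\<^sub>0 nat) \<Rightarrow>\<^sub>0 'k) \<Rightarrow> 'k :: field udom" where
  "poly_value v P = (\<Sum>m\<in>Poly_Mapping.keys P. udom_of (Poly_Mapping.lookup P m) * monomial_value v m)"

definition std_var :: "nat \<Rightarrow> 'k :: field udom" where
  "std_var i = to_ac (to_fract (Poly_Mapping.single (Poly_Mapping.single i 1) 1))"

lemma monomial_value_superset:
  assumes "finite A" "Poly_Mapping.keys m \<subseteq> A"
  shows "monomial_value v m = (\<Prod>i\<in>A. v i ^ Poly_Mapping.lookup m i)"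
  unfolding monomial_value_def using assms
  by (intro prod.mono_neutral_left) (auto simp: in_keys_iff)

lemma monomial_value_add: "monomial_value v (m + m') = monomial_value v m * monomial_value v m'"
proof -
  let ?A = "Poly_Mapping.keys m \<union> Poly_Mapping.keys m'"
  have "monomial_value v (m + m') = (\<Prod>i\<in>?A. v i ^ Poly_Mapping.lookup (m + m') i)"
    by (rule monomial_value_superset) (use keys_add[of m m'] in auto)
  also have "\<dots> = (\<Prod>i\<in>?A. v i ^ Poly_Mapping.lookup m i) * (\<Prod>i\<in>?A. v i ^ Poly_Mapping.lookup m' i)"
    by (simp add: lookup_add power_add prod.distrib)
  also have "\<dots> = monomial_value v m * monomial_value v m'" by (simp add: monomial_value_superset[of ?A])
  finally show ?thesis .
qed

lemma poly_value_add: "poly_value v (P + Q) = poly_value v P + poly_value v Q"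
  unfolding poly_value_def by (rule setsum_keys_plus_distrib) (simp_all add: udom_of_hom distrib_right)

lemma poly_value_single: "poly_value v (Poly_Mapping.single m c) = udom_of c * monomial_value v m"
  by (simp add: poly_value_def udom_of_hom)

lemma poly_mapping_single_induct:
  assumes "P 0" "\<And>f m c. P f \<Longrightarrow> P (f + Poly_Mapping.single m c)"
  shows "P (f :: 'a \<Rightarrow>\<^sub>0 'b :: comm_monoid_add)"
proof (induction f rule: update_induct)
  case const
  show ?case by (rule assms(1))
next
  case (update f a b)
  have "Poly_Mapping.update a b f = f + Poly_Mapping.single a b"
    using update(1) by (intro poly_mapping_eqI) (auto simp: lookup_update lookup_add lookup_single in_keys_iff)
  then show ?case using assms(2) update by simp
qed

lemma poly_value_mult: "poly_value v (P * Q) = poly_value v P * poly_value v Q"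
proof (induction P rule: poly_mapping_single_induct)
  case 1
  show ?case by (simp add: poly_value_def)
next
  case (2 P m c)
  have "poly_value v (Poly_Mapping.single m c * Q) = poly_value v (Poly_Mapping.single m c) * poly_value v Q"
  proof (induction Q rule: poly_mapping_single_induct)
    case 1
    show ?case by (simp add: poly_value_def)
  next
    case (2 Q m' c')
    then show ?case
      by (simp add: distrib_left poly_value_add mult_single poly_value_single udom_of_hom monomial_value_add mult_ac)
  qed
  with 2 show ?case by (simp add: distrib_right poly_value_add)
qed

text \<open>Every polynomial function over the ground field is the evaluation of a formal
  polynomial, whose value at the standard variables is that polynomial itself. So if this value is
  zero, the function vanishes everywhere.\<close>

lemma polys_std_var:
  fixes p :: "'k :: field udom list \<Rightarrow> 'k udom"
  assumes "p \<in> polys ground n"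
  shows "\<exists>P. p (map std_var [0..<n]) = to_ac (to_fract P) \<and> (\<forall>v. p (map v [0..<n]) = poly_value v P)"
  using assms
proof induction
  case (const c)
  then obtain c' where "c = udom_of c'" by (auto simp: ground_def)
  then show ?case
    by (intro exI[of _ "Poly_Mapping.single 0 c'"]) (simp add: poly_value_single monomial_value_def udom_of_def)
next
  case (coord i)
  then show ?case
    by (intro exI[of _ "Poly_Mapping.single (Poly_Mapping.single i 1) 1"])
      (simp add: std_var_def poly_value_single monomial_value_def udom_of_hom)
next
  case (add p q)
  then obtain P Q where "p (map std_var [0..<n]) = to_ac (to_fract P)" "\<forall>v. p (map v [0..<n]) = poly_value v P"
    "q (map std_var [0..<n]) = to_ac (to_fract Q)" "\<forall>v. q (map v [0..<n]) = poly_value v Q" by blast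
  then show ?case by (intro exI[of _ "P + Q"]) (simp add: poly_value_add)
next
  case (mult p q)
  then obtain P Q where "p (map std_var [0..<n]) = to_ac (to_fract P)" "\<forall>v. p (map v [0..<n]) = poly_value v P"
    "q (map std_var [0..<n]) = to_ac (to_fract Q)" "\<forall>v. q (map v [0..<n]) = poly_value v Q" by blast
  then show ?case by (intro exI[of _ "P * Q"]) (simp add: poly_value_mult)
qed

lemma indep_std_var: "indep (ground :: 'k :: field udom set) (map std_var [0..<n])"
  unfolding indep_def
proof (intro ballI impI)
  fix p :: "'k udom list \<Rightarrow> 'k udom" and u :: "'k udom list"
  assume p: "p \<in> polys ground (length (map std_var [0..<n] :: 'k udom list))" "p (map std_var [0..<n]) = 0"
    and u: "u \<in> affine_space (length (map std_var [0..<n] :: 'k udom list))"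
  obtain P where P: "p (map std_var [0..<n]) = to_ac (to_fract P)" "\<forall>v. p (map v [0..<n]) = poly_value v P"
    using polys_std_var[of p n] p(1) by auto
  then have "P = 0" using p(2) by simp
  moreover have "map (\<lambda>i. u ! i) [0..<n] = u" using u by (auto simp: affine_space_def intro: nth_equalityI)
  ultimately show "p u = 0" using P(2)[rule_format, of "\<lambda>i. u ! i"] by (simp add: poly_value_def)
qed

lemma indep_std_var_append:
  "indep (ground :: 'k :: field udom set) (map std_var [0..<n] @ map (\<lambda>i. std_var (n + i)) [0..<m])"
proof -
  have "map std_var [0..<n + m] = map std_var [0..<n] @ map (\<lambda>i. std_var (n + i) :: 'k udom) [0..<m]"
    by (rule nth_equalityI) (auto simp: nth_append)
  then show ?thesis by (metis indep_std_var)
qed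

lemma ground_primitive_root:
  assumes "N > 0"
  shows "\<exists>\<zeta>\<in>(ground :: 'k :: {alg_closed_field, field_char_0} udom set). primitive_root N \<zeta>"
proof -
  obtain \<xi> :: 'k where \<xi>: "primitive_root N \<xi>" using exists_primitive_root[OF assms] by blast
  have "udom_of \<xi> ^ i = udom_of (\<xi> ^ i)" for i by (induction i) (simp_all add: udom_of_hom)
  then have "primitive_root N (udom_of \<xi>)"
    using \<xi> udom_of_eq_iff[of _ "1 :: 'k"] by (simp add: primitive_root_def udom_of_hom(2))
  then show ?thesis by (auto simp: ground_def)
qed

section \<open>Invariants of linear representations\<close>

text \<open>A purely transcendental extension is the function field of a split torus.\<close>

lemma torsor_tower_purely_transcendental:
  fixes K :: "'a :: field_char_0 set"
  assumes K: "is_subfield K" and y: "indep K y" and tower: "torsor_tower F (fracs K y)"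
  shows "torsor_tower F K"
proof -
  \<comment> \<open>With the trivial group and identity matrices as data, the twisted torus is the
    split torus of dimension \<open>length y\<close>, and only the zero relation is imposed.\<close>
  define H :: "unit monoid" where "H = \<lparr>carrier = {()}, monoid.mult = (\<lambda>_ _. ()), one = ()\<rparr>"
  have H: "group H" by (rule groupI) (auto simp: H_def)
  interpret tt: twisted_torus H K "\<lambda>_ x. x" 1 "length y" "length y" "\<lambda>i j. of_bool (i = j)" "\<lambda>i j. of_bool (i = j)"
    "\<lambda>_ k. k" "\<lambda>i j. of_bool (i = j)" "\<lambda>i j. of_bool (i = j)"
  proof unfold_locales
    show "field_action H K (\<lambda>_ x. x)"
      using H K by (auto simp: field_action_def subfield_hom_def H_def subfield_one)
  qed (use K in \<open>auto simp: subfield_one subfield_zero H_def inj_on_def sum_of_bool_mult\<close>)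
  have K_eq: "tt.K = K" by (auto simp: fixed_def)
  have b: "(\<Prod>i<length y. (y @ map inverse y) ! i powi (s * of_bool (k = i))) = y ! k powi s" if "k < length y" for k s
  proof -
    have "(\<Prod>i<length y. (y @ map inverse y) ! i powi (s * of_bool (k = i))) =
        (\<Prod>i<length y. if k = i then y ! i powi s else 1)"
      by (intro prod.cong refl) (auto simp: nth_append)
    then show ?thesis using that by simp
  qed
  have pick: "(\<Sum>j<length y. of_bool (i = j) * f j) = f i" if "i < length y" for i and f :: "nat \<Rightarrow> 'a"
    using that by (simp add: sum_of_bool_mult)
  have "tt.bwd (\<lambda>_. 1) (y @ map inverse y) = y @ map inverse y"
    unfolding tt.bwd_def tt.enc_def
    by (rule nth_equalityI)
      (use b[of _ 1] b[of _ "- 1"] in \<open>auto simp: pick nth_append power_int_minus\<close>)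
  moreover have "fracs K (y @ map inverse y) = fracs K y"
    using fracs_gens[of y K]
    by (intro equalityI fracs_least fracs_subfield fracs_base)
      (auto intro: subfield_inverse[OF fracs_subfield] simp: subset_iff fracs_gens[THEN subsetD])
  ultimately have tw: "torsor_tower F (fracs tt.K (tt.bwd (\<lambda>_. 1) (y @ map inverse y)))" using tower K_eq by simp
  have "torsor_tower F tt.K"
    by (rule tt.torsor_tower_step[OF tt.equivariant_one K subset_refl _ y refl tw]) (simp add: K subfield_one)
  then show ?thesis by (simp add: K_eq)
qed

text \<open>Invariance of a fraction is a polynomial identity at \<open>z\<close>, hence an identity
  everywhere. The condition on the two polynomials then no longer involves the coordinates of
  \<open>z\<close>.\<close>

lemma lin_fix_eq:
  fixes F :: "'a :: field set"
  assumes F: "is_subfield F" and H: "group H" and M: "lin_rep F H (length z) M" and i: "indep F z"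
  shows "lin_fix F H M z = {P z / Q z |P Q. P \<in> polys F (length z) \<and> Q \<in> polys F (length z) \<and> Q z \<noteq> 0 \<and>
    (\<forall>g\<in>carrier H. \<forall>v. length v = length z \<longrightarrow>
       P (mact (length z) M g v) * Q v = P v * Q (mact (length z) M g v))}" (is "_ = ?R")
proof -
  let ?n = "length z"
  have eqv: "eqv F z (mact ?n M g z)" if "g \<in> carrier H" for g
    using indep_mact[OF F H M i that] i by (intro indep_eqv) auto
  have key: "subst_map F z (mact ?n M g z) (P z / Q z) = P z / Q z \<longleftrightarrow>
      (\<forall>v. length v = ?n \<longrightarrow> P (mact ?n M g v) * Q v = P v * Q (mact ?n M g v))"
    if g: "g \<in> carrier H" and P: "P \<in> polys F ?n" and Q: "Q \<in> polys F ?n" "Q z \<noteq> 0" for g P Q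
  proof -
    have Qg: "Q (mact ?n M g z) \<noteq> 0" using eqv[OF g] Q by (auto simp: eqv_def)
    have mg: "(\<lambda>v. \<Sum>j<?n. M g i j * v ! j) \<in> polys F ?n" if "i < ?n" for i
      using M g that F unfolding lin_rep_def by (intro polys_sum polys.intros) (auto simp: subfield_zero)
    have comp: "(\<lambda>v. P' (mact ?n M g v)) \<in> polys F ?n" if "P' \<in> polys F ?n" for P'
      unfolding mact_def by (rule polys_compose[OF that mg])
    have R: "(\<lambda>v. P (mact ?n M g v) * Q v - P v * Q (mact ?n M g v)) \<in> polys F ?n" (is "?R \<in> _")
      using P Q comp F by (intro polys_diff polys.mult) (auto simp: subfield_one subfield_minus)
    have "subst_map F z (mact ?n M g z) (P z / Q z) = P z / Q z \<longleftrightarrow>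
        P (mact ?n M g z) * Q z = P z * Q (mact ?n M g z)"
      using subst_map_frac[OF F eqv[OF g] P Q] Q(2) Qg by (simp add: frac_eq_eq)
    also have "\<dots> \<longleftrightarrow> (\<forall>v. length v = ?n \<longrightarrow> P (mact ?n M g v) * Q v = P v * Q (mact ?n M g v))"
      using indepD[OF i R refl] by auto
    finally show ?thesis .
  qed
  show ?thesis
    unfolding lin_fix_def fixed_def fracs_eq[OF F] using key by blast
qed

lemma image_Collect2:
  assumes "\<And>P Q. C P Q \<Longrightarrow> h (f P Q) = g P Q"
  shows "h ` {f P Q |P Q. C P Q} = {g P Q |P Q. C P Q}"
proof (intro equalityI subsetI)
  fix y assume "y \<in> {g P Q |P Q. C P Q}"
  then obtain P Q where PQ: "C P Q" "y = g P Q" by blast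
  then show "y \<in> h ` {f P Q |P Q. C P Q}" using assms[OF PQ(1)] by (intro image_eqI[of _ _ "f P Q"]) auto
qed (use assms in blast)

text \<open>The pairs of polynomials that describe invariant fractions are the same for all
  independent points of the same length.\<close>

lemma subst_map_lin_fix:
  fixes F :: "'a :: field set"
  assumes F: "is_subfield F" and H: "group H" and M: "lin_rep F H (length z) M" and i: "indep F z"
    and z': "indep F z'" "length z' = length z"
  shows "subst_map F z z' ` lin_fix F H M z = lin_fix F H M z'"
proof -
  let ?C = "\<lambda>P Q. P \<in> polys F (length z) \<and> Q \<in> polys F (length z) \<and>
    (\<forall>g\<in>carrier H. \<forall>v. length v = length z \<longrightarrow>
       P (mact (length z) M g v) * Q v = P v * Q (mact (length z) M g v))"
  have e: "eqv F z z'" using i z' by (auto intro: indep_eqv)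
  have Q: "Q z' \<noteq> 0 \<longleftrightarrow> Q z \<noteq> 0" if "?C P Q" for P Q using e that by (auto simp: eqv_def)
  have "lin_fix F H M z = {P z / Q z |P Q. ?C P Q \<and> Q z \<noteq> 0}"
    unfolding lin_fix_eq[OF F H M i] by (intro Collect_cong ex_cong1) (simp only: conj_ac)
  moreover have "lin_fix F H M z' = {P z' / Q z' |P Q. ?C P Q \<and> Q z' \<noteq> 0}"
    unfolding lin_fix_eq[OF F H M[folded z'(2)] z'(1)] unfolding z'(2)
    by (intro Collect_cong ex_cong1) (simp only: conj_ac)
  moreover have "{P z' / Q z' |P Q. ?C P Q \<and> Q z' \<noteq> 0} = {P z' / Q z' |P Q. ?C P Q \<and> Q z \<noteq> 0}"
    using Q by (intro Collect_cong ex_cong1) (metis (no_types, lifting))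
  moreover have "subst_map F z z' ` {P z / Q z |P Q. ?C P Q \<and> Q z \<noteq> 0} = {P z' / Q z' |P Q. ?C P Q \<and> Q z \<noteq> 0}"
    by (rule image_Collect2) (use subst_map_frac[OF F e] in blast)
  ultimately show ?thesis by (simp only:)
qed

text \<open>Both sides are the invariants of the same action on the same field; only the order of
  the coordinates differs.\<close>

lemma lin_fix_swap:
  fixes F :: "'a :: field_char_0 set"
  assumes F: "is_subfield F" and H: "group H" "finite (carrier H)"
    and M: "lin_rep F H n M" "length a = n" and M': "lin_rep F H m M'" "length b = m" and i: "indep F (a @ b)"
  shows "lin_fix F H (dsum n M M') (a @ b) = lin_fix F H (dsum m M' M) (b @ a)"
proof -
  have j: "indep F (b @ a)" using indep_swap[of F a b "[]"] i by simp
  have fr: "fracs F (a @ b) = fracs F (b @ a)" by (simp add: fracs_def Un_commute)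
  define \<sigma> where "\<sigma> g = subst_map F (a @ b) (mact n M g a @ mact m M' g b)" for g
  have \<sigma>: "\<sigma> g = subst_map F (a @ b) (mact (length (a @ b)) (dsum n M M') g (a @ b))" for g
    using mact_dsum[OF M(2) M'(2), of M M' g] M(2) M'(2) by (simp add: \<sigma>_def)
  have act: "field_action H (fracs F (a @ b)) \<sigma>"
    and const: "\<And>g c. g \<in> carrier H \<Longrightarrow> c \<in> F \<Longrightarrow> \<sigma> g c = c"
    using lin_action(1,2)[OF F H _ i, of "dsum n M M'"] lin_rep_dsum[OF F M(1) M'(1)] M(2) M'(2)
    by (simp_all add: \<sigma>[abs_def])
  have eqv1: "eqv F (a @ b) (mact n M g a @ mact m M' g b)" if "g \<in> carrier H" for g
    using indep_mact[OF F H(1) _ i that, of "dsum n M M'"] lin_rep_dsum[OF F M(1) M'(1)] i M(2) M'(2)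
    by (auto simp: mact_dsum[OF M(2) M'(2)] intro!: indep_eqv)
  have eqv2: "eqv F (b @ a) (mact m M' g b @ mact n M g a)" if "g \<in> carrier H" for g
    using indep_mact[OF F H(1) _ j that, of "dsum m M' M"] lin_rep_dsum[OF F M'(1) M(1)] j M(2) M'(2)
    by (auto simp: mact_dsum[OF M'(2) M(2)] intro!: indep_eqv)
  have "\<sigma> g x = subst_map F (b @ a) (mact m M' g b @ mact n M g a) x"
    if g: "g \<in> carrier H" and x: "x \<in> fracs F (b @ a)" for g x
  proof (rule subst_map_unique[OF F eqv2[OF g] _ const[OF g] _ x])
    show "subfield_hom (fracs F (b @ a)) (\<sigma> g)" using act g fr by (simp add: field_action_def)
    fix i assume i: "i < length (b @ a)"
    show "\<sigma> g ((b @ a) ! i) = (mact m M' g b @ mact n M g a) ! i"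
    proof (cases "i < m")
      case True
      then show ?thesis
        using subst_map_nth[OF F eqv1[OF g], of "n + i"] M(2) M'(2) by (simp add: \<sigma>_def nth_append)
    next
      case False
      then have "i - m < n" using i M(2) M'(2) by simp
      with False show ?thesis
        using subst_map_nth[OF F eqv1[OF g], of "i - m"] M(2) M'(2) by (simp add: \<sigma>_def nth_append)
    qed
  qed
  then show ?thesis
    unfolding lin_fix_def \<sigma>[symmetric] fixed_def fr using mact_dsum[OF M'(2) M(2), of M' M] M(2) M'(2)
    by auto
qed

section \<open>Generic points of a linear representation\<close>

locale linear_coordinates = finite_dimensional_vector_space scale Basis
  for scale :: "'k :: field_char_0 \<Rightarrow> 'v :: ab_group_add \<Rightarrow> 'v" and Basis +
  fixes bs :: "'v list" and \<phi> :: "('v \<Rightarrow> 'k) \<Rightarrow> 'k udom"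
  assumes bs: "distinct bs" "set bs = Basis" and \<phi>: "generic_embedding scale \<phi>"
begin

definition d :: nat where "d = length bs"

definition co :: "nat \<Rightarrow> 'v \<Rightarrow> 'k" where "co i v = representation Basis v (bs ! i)"

definition pt :: "'v \<Rightarrow> 'k udom list" where "pt v = map (\<lambda>i. udom_of (co i v)) [0..<d]"

text \<open>The coordinates of the generic point for which the embedding \<open>\<phi>\<close>
  stands.\<close>

definition gen :: "'k udom list" where "gen = map (\<lambda>i. \<phi> (co i)) [0..<d]"

lemma length_pt [simp]: "length (pt v) = d" and length_gen [simp]: "length gen = d"
  by (simp_all add: pt_def gen_def)

lemma linear_co: "Vector_Spaces.linear scale (*) (co i)"
  unfolding co_def by (rule linear_representation[OF independent_Basis span_Basis])

lemma \<phi>_const: "\<phi> (\<lambda>_. c) = udom_of c"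
  and \<phi>_add: "p \<in> poly_functions scale \<Longrightarrow> q \<in> poly_functions scale \<Longrightarrow> \<phi> (\<lambda>v. p v + q v) = \<phi> p + \<phi> q"
  and \<phi>_mult: "p \<in> poly_functions scale \<Longrightarrow> q \<in> poly_functions scale \<Longrightarrow> \<phi> (\<lambda>v. p v * q v) = \<phi> p * \<phi> q"
  and \<phi>_inj: "p \<in> poly_functions scale \<Longrightarrow> q \<in> poly_functions scale \<Longrightarrow> \<phi> p = \<phi> q \<Longrightarrow> p = q"
  using \<phi> by (auto simp: generic_embedding_def dest: inj_onD)

lemma sum_co: "(\<Sum>i<d. scale (co i v) (bs ! i)) = v"
proof -
  have "(\<Sum>i<d. scale (co i v) (bs ! i)) = (\<Sum>b\<in>Basis. scale (representation Basis v b) b)"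
    unfolding co_def
    by (rule sum.reindex_bij_betw) (use bs bij_betw_nth[OF bs(1) refl refl] in \<open>simp add: d_def\<close>)
  also have "\<dots> = v"
    by (rule sum_representation_eq) (simp_all add: independent_Basis span_Basis finite_Basis)
  finally show ?thesis .
qed

lemma linear_sum_co: "Vector_Spaces.linear scale s l \<Longrightarrow> l v = (\<Sum>i<d. s (co i v) (l (bs ! i)))"
proof -
  assume l: "Vector_Spaces.linear scale s l"
  interpret l: Vector_Spaces.linear scale s l by (rule l)
  show ?thesis using arg_cong[OF sum_co[of v], of l] by (simp add: l.sum l.scale)
qed

lemma co_basis: "i < d \<Longrightarrow> j < d \<Longrightarrow> co i (bs ! j) = of_bool (i = j)"
  using bs independent_Basis
  by (auto simp: co_def representation_basis d_def nth_eq_iff_index_eq)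

lemma ex_point:
  assumes "length c = d"
  shows "\<exists>v. pt v = map udom_of c"
proof
  have "co i (\<Sum>j<d. scale (c ! j) (bs ! j)) = c ! i" if "i < d" for i
  proof -
    interpret l: Vector_Spaces.linear scale "(*)" "co i" by (rule linear_co)
    show ?thesis using that by (simp add: l.sum l.scale co_basis sum_of_bool_mult)
  qed
  then show "pt (\<Sum>j<d. scale (c ! j) (bs ! j)) = map udom_of c"
    using assms by (intro nth_equalityI) (simp_all add: pt_def)
qed

text \<open>The points with natural coordinates are among the points of the space, and they suffice
  to detect a nonzero polynomial.\<close>

lemma polys_zero_on_points:
  assumes P: "P \<in> polys ground d" and 0: "\<And>v. P (pt v) = 0" and u: "length u = d"
  shows "P u = 0"
proof (rule ccontr)
  assume "P u \<noteq> 0"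
  then obtain w :: "nat list" where w: "length w = d" "P (map of_nat w) \<noteq> 0"
    using polys_nonzero_nat[OF P] u by (auto simp: affine_space_def)
  have "of_nat m = udom_of (of_nat m :: 'k)" for m by (induction m) (simp_all add: udom_of_hom)
  then have "map of_nat w = map udom_of (map of_nat w :: 'k list)" by simp
  then show False using ex_point[of "map of_nat w"] w 0 by (metis length_map)
qed

text \<open>The dictionary between polynomial functions on the abstract space and polynomials on
  affine space over the universal domain. Both values are recorded: the field is described at the
  generic point, the invariance at the points of the space.\<close>

definition repr :: "('v \<Rightarrow> 'k) \<Rightarrow> ('k udom list \<Rightarrow> 'k udom) \<Rightarrow> bool" where
  "repr p P \<longleftrightarrow> p \<in> poly_functions scale \<and> P \<in> polys ground d \<and> \<phi> p = P gen \<and> (\<forall>v. udom_of (p v) = P (pt v))"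

lemma repr_intros:
  "repr (\<lambda>_. c) (\<lambda>_. udom_of c)"
  "i < d \<Longrightarrow> repr (co i) (\<lambda>u. u ! i)"
  "repr p P \<Longrightarrow> repr q Q \<Longrightarrow> repr (\<lambda>v. p v + q v) (\<lambda>u. P u + Q u)"
  "repr p P \<Longrightarrow> repr q Q \<Longrightarrow> repr (\<lambda>v. p v * q v) (\<lambda>u. P u * Q u)"
  by (auto simp: repr_def \<phi>_const \<phi>_add \<phi>_mult udom_of_hom ground_def gen_def pt_def
      intro: polys.intros poly_functions.intros linear_co)

lemma repr_sum: "(\<And>i. i < (m :: nat) \<Longrightarrow> repr (p i) (P i)) \<Longrightarrow> repr (\<lambda>v. \<Sum>i<m. p i v) (\<lambda>u. \<Sum>i<m. P i u)"
proof (induction m)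
  case 0
  show ?case using repr_intros(1)[of 0] by (simp add: udom_of_hom)
next
  case (Suc m)
  then show ?case using repr_intros(3)[of "\<lambda>v. \<Sum>i<m. p i v" _ "p m"] by simp
qed

lemma ex_repr_polys: "P \<in> polys ground d \<Longrightarrow> \<exists>p. repr p P"
proof (induction rule: polys.induct)
  case (const c)
  then show ?case using repr_intros(1) by (auto simp: ground_def)
qed (use repr_intros in blast)+

lemma ex_repr_poly_functions: "p \<in> poly_functions scale \<Longrightarrow> \<exists>P. repr p P"
proof (induction rule: poly_functions.induct)
  case (linear l)
  have "repr (\<lambda>v. \<Sum>i<d. co i v * l (bs ! i)) (\<lambda>u. \<Sum>i<d. u ! i * udom_of (l (bs ! i)))"
    by (intro repr_sum repr_intros)
  then show ?case using linear_sum_co[OF linear] by (metis (no_types, lifting) ext)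
qed (use repr_intros in blast)+

lemma repr_zero_iff:
  assumes "repr p P"
  shows "P gen = 0 \<longleftrightarrow> p = (\<lambda>_. 0)"
proof -
  have "P gen = \<phi> p" "p \<in> poly_functions scale" using assms by (auto simp: repr_def)
  moreover have "\<phi> (\<lambda>_. 0) = 0" using \<phi>_const[of 0] by (simp add: udom_of_hom)
  ultimately show ?thesis using \<phi>_inj[OF _ poly_functions.const] by metis
qed

lemma indep_gen: "indep ground gen"
  unfolding indep_def affine_space_def
proof (intro ballI impI, elim CollectE)
  fix P and u :: "'k udom list" assume P: "P \<in> polys ground (length gen)" "P gen = 0" and u: "length u = length gen"
  obtain p where p: "repr p P" using ex_repr_polys P(1) by auto
  have "P (pt v) = 0" for v
    using repr_zero_iff[OF p] P(2) p by (metis repr_def udom_of_hom(1))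
  then show "P u = 0" using polys_zero_on_points P(1) u by simp
qed

end

locale generic_representation = linear_coordinates scale Basis bs \<phi> + faithful_action G UNIV \<rho>
  for scale :: "'k :: field_char_0 \<Rightarrow> 'v :: ab_group_add \<Rightarrow> 'v" and Basis and bs :: "'v list" and \<phi>
    and G :: "('g, 'b) monoid_scheme" and \<rho> :: "'g \<Rightarrow> 'v \<Rightarrow> 'v" +
  assumes linear_\<rho>: "g \<in> carrier G \<Longrightarrow> Vector_Spaces.linear scale scale (\<rho> g)"
begin

sublocale grp: group G
  using group_hom by (simp add: group_hom_def)

text \<open>The inverse makes this compatible with the convention for the order of multiplication in \<open>lin_rep\<close>.\<close>

definition mat :: "'g \<Rightarrow> nat \<Rightarrow> nat \<Rightarrow> 'k udom" where
  "mat g i j = udom_of (co i (\<rho> (inv\<^bsub>G\<^esub> g) (bs ! j)))"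

lemma udom_of_sum: "udom_of (\<Sum>i<(m :: nat). f i) = (\<Sum>i<m. udom_of (f i))"
  by (induction m) (simp_all add: udom_of_hom)

lemma co_\<rho>: "g \<in> carrier G \<Longrightarrow> co i (\<rho> g v) = (\<Sum>j<d. co i (\<rho> g (bs ! j)) * co j v)"
proof -
  assume g: "g \<in> carrier G"
  interpret l: Vector_Spaces.linear scale "(*)" "co i" by (rule linear_co)
  show ?thesis by (subst linear_sum_co[OF linear_\<rho>[OF g]]) (simp add: l.sum l.scale mult.commute)
qed

lemma \<rho>_one: "\<rho> \<one>\<^bsub>G\<^esub> v = v"
  by (metis UNIV_I id_eq_one restrict_apply')

lemma lin_rep_mat: "lin_rep ground G d mat"
  unfolding lin_rep_def
proof (intro conjI ballI allI impI)
  show "mat g i j \<in> ground" for g i j by (simp add: mat_def ground_def)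
  show "mat \<one>\<^bsub>G\<^esub> i j = of_bool (i = j)" if "i < d" "j < d" for i j
    using that by (simp add: mat_def \<rho>_one co_basis udom_of_hom)
  fix g h i j assume gh: "g \<in> carrier G" "h \<in> carrier G" and "i < d" "j < d"
  have "mat (g \<otimes>\<^bsub>G\<^esub> h) i j = udom_of (co i (\<rho> (inv\<^bsub>G\<^esub> h) (\<rho> (inv\<^bsub>G\<^esub> g) (bs ! j))))"
    using gh composition_rule[of _ "inv\<^bsub>G\<^esub> h" "inv\<^bsub>G\<^esub> g"] by (simp add: mat_def grp.inv_mult_group)
  also have "\<dots> = (\<Sum>l<d. mat h i l * mat g l j)"
    using gh by (subst co_\<rho>) (simp_all add: udom_of_sum udom_of_hom mat_def)
  finally show "mat (g \<otimes>\<^bsub>G\<^esub> h) i j = (\<Sum>l<d. mat h i l * mat g l j)" .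
qed

lemma mact_pt: "g \<in> carrier G \<Longrightarrow> mact d mat g (pt v) = pt (\<rho> (inv\<^bsub>G\<^esub> g) v)"
  by (rule nth_equalityI) (simp_all add: nth_mact pt_def co_\<rho>[of _ _ v] udom_of_sum udom_of_hom mat_def)

lemma mat_faithful:
  assumes g: "g \<in> carrier G" "g \<noteq> \<one>\<^bsub>G\<^esub>"
  shows "\<exists>i<d. \<exists>j<d. mat g i j \<noteq> of_bool (i = j)"
proof (rule ccontr)
  assume *: "\<not> ?thesis"
  have g': "inv\<^bsub>G\<^esub> g \<in> carrier G" using g by simp
  have "udom_of (co i (\<rho> (inv\<^bsub>G\<^esub> g) (bs ! j))) = udom_of (of_bool (i = j))" if "i < d" "j < d" for i j
    using * that by (auto simp: mat_def udom_of_hom)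
  then have "co i (\<rho> (inv\<^bsub>G\<^esub> g) (bs ! j)) = of_bool (i = j)" if "i < d" "j < d" for i j
    using that by simp
  then have "co i (\<rho> (inv\<^bsub>G\<^esub> g) v) = co i v" if "i < d" for i v
    using that by (simp add: co_\<rho>[OF g', of i v] sum_of_bool_mult)
  then have "\<rho> (inv\<^bsub>G\<^esub> g) v = \<rho> \<one>\<^bsub>G\<^esub> v" for v
    using sum_co[of "\<rho> (inv\<^bsub>G\<^esub> g) v"] sum_co[of v] by (simp add: \<rho>_one)
  then have "inv\<^bsub>G\<^esub> g = \<one>\<^bsub>G\<^esub>" using inj_onD[OF faithful _ g' grp.one_closed] by blast
  then show False using g by (metis grp.inv_inv grp.inv_one)
qed

text \<open>The points of the space are Zariski dense in affine space over the universal domain, so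
  invariance on them is the same as the polynomial identity in \<open>lin_fix_eq\<close>.\<close>

lemma invariant_field_eq: "invariant_field scale G \<rho> \<phi> = lin_fix ground G mat gen"
proof -
  have k: "is_subfield (ground :: 'k udom set)" by (rule ground_subfield)
  have inv: "(\<forall>g\<in>carrier G. \<forall>v. p (\<rho> g v) * q v = p v * q (\<rho> g v)) \<longleftrightarrow>
      (\<forall>g\<in>carrier G. \<forall>v. length v = d \<longrightarrow> P (mact d mat g v) * Q v = P v * Q (mact d mat g v))"
    if p: "repr p P" and q: "repr q Q" for p q P Q
  proof -
    have "(\<forall>v. p (\<rho> (inv\<^bsub>G\<^esub> g) v) * q v = p v * q (\<rho> (inv\<^bsub>G\<^esub> g) v)) \<longleftrightarrow>
      (\<forall>v. length v = d \<longrightarrow> P (mact d mat g v) * Q v = P v * Q (mact d mat g v))"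
      if g: "g \<in> carrier G" for g
    proof -
      let ?R = "\<lambda>v. P (mact d mat g v) * Q v - P v * Q (mact d mat g v)"
      have mg: "(\<lambda>v. \<Sum>j<d. mat g i j * v ! j) \<in> polys ground d" if "i < d" for i
        using lin_rep_mat g that k unfolding lin_rep_def
        by (intro polys_sum polys.intros) (auto simp: subfield_zero)
      have comp: "(\<lambda>v. P' (mact d mat g v)) \<in> polys ground d" if "P' \<in> polys ground d" for P'
        unfolding mact_def by (rule polys_compose[OF that mg])
      have R: "?R \<in> polys ground d"
        using p q comp k unfolding repr_def
        by (intro polys_diff polys.mult) (auto simp: subfield_one subfield_minus)
      have "p (\<rho> (inv\<^bsub>G\<^esub> g) v) * q v = p v * q (\<rho> (inv\<^bsub>G\<^esub> g) v) \<longleftrightarrow> ?R (pt v) = 0" for v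
        using p q udom_of_eq_iff[of "p (\<rho> (inv\<^bsub>G\<^esub> g) v) * q v" "p v * q (\<rho> (inv\<^bsub>G\<^esub> g) v)"]
        by (simp add: repr_def mact_pt[OF g] udom_of_hom)
      then show ?thesis using polys_zero_on_points[OF R] by auto
    qed
    \<comment> \<open>The inverse in \<open>mat\<close> is harmless, as \<open>g\<close> runs
      through the whole group.\<close>
    moreover have "(\<forall>g\<in>carrier G. \<forall>v. p (\<rho> g v) * q v = p v * q (\<rho> g v)) \<longleftrightarrow>
        (\<forall>g\<in>carrier G. \<forall>v. p (\<rho> (inv\<^bsub>G\<^esub> g) v) * q v = p v * q (\<rho> (inv\<^bsub>G\<^esub> g) v))"
      by (metis grp.inv_closed grp.inv_inv)
    ultimately show ?thesis by blast
  qed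
  have eq: "lin_fix ground G mat gen = {P gen / Q gen |P Q. P \<in> polys ground d \<and> Q \<in> polys ground d \<and> Q gen \<noteq> 0 \<and>
    (\<forall>g\<in>carrier G. \<forall>v. length v = d \<longrightarrow> P (mact d mat g v) * Q v = P v * Q (mact d mat g v))}"
    using lin_fix_eq[OF ground_subfield grp.is_group _ indep_gen, of mat] lin_rep_mat by simp
  show ?thesis
  proof (rule equalityI; rule subsetI)
    fix e assume "e \<in> invariant_field scale G \<rho> \<phi>"
    then obtain p q where e: "e = \<phi> p / \<phi> q" "p \<in> poly_functions scale" "q \<in> poly_functions scale" "q \<noteq> (\<lambda>_. 0)"
      "\<forall>g\<in>carrier G. \<forall>v. p (\<rho> g v) * q v = p v * q (\<rho> g v)" by (auto simp: invariant_field_def)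
    obtain P Q where PQ: "repr p P" "repr q Q" using e ex_repr_poly_functions by blast
    then show "e \<in> lin_fix ground G mat gen"
      unfolding eq using e inv[OF PQ] repr_zero_iff[OF PQ(2)] by (auto simp: repr_def)
  next
    fix e assume "e \<in> lin_fix ground G mat gen"
    then obtain P Q where e: "e = P gen / Q gen" "P \<in> polys ground d" "Q \<in> polys ground d" "Q gen \<noteq> 0"
      "\<forall>g\<in>carrier G. \<forall>v. length v = d \<longrightarrow> P (mact d mat g v) * Q v = P v * Q (mact d mat g v)"
      unfolding eq by blast
    obtain p q where pq: "repr p P" "repr q Q" using e ex_repr_polys by blast
    have "p \<in> poly_functions scale" "q \<in> poly_functions scale" "\<phi> p = P gen" "\<phi> q = Q gen"
      using pq by (auto simp: repr_def)
    moreover have "q \<noteq> (\<lambda>_. 0)" using repr_zero_iff[OF pq(2)] e(4) by simp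
    moreover have "\<forall>g\<in>carrier G. \<forall>v. p (\<rho> g v) * q v = p v * q (\<rho> g v)" using inv[OF pq] e(5) by (rule iffD2)
    ultimately show "e \<in> invariant_field scale G \<rho> \<phi>"
      unfolding invariant_field_def by - (rule CollectI, rule exI[of _ p], rule exI[of _ q], simp add: e(1))
  qed
qed

end

text \<open>A field homomorphism over \<open>k\<close> preserves and reflects polynomial equations
  over \<open>k\<close>. This allows a generic point to be moved inside the universal
  domain.\<close>

lemma generic_point_image:
  fixes k :: "'a :: field set"
  assumes k: "is_subfield k" and W: "variety k n W" and x: "generic_point k n W x"
    and hom: "subfield_hom E \<psi>" and kE: "k \<subseteq> E" and const: "\<And>c. c \<in> k \<Longrightarrow> \<psi> c = c" and xE: "set x \<subseteq> E"
  shows "generic_point k n W (map \<psi> x)" and "fracs k (map \<psi> x) = \<psi> ` fracs k x"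
proof -
  obtain A B where AB: "zclosed k n A" "zclosed k n B" "W = A - B" using W by (auto simp: variety_def)
  have len: "length x = n" using x AB by (auto simp: generic_point_def zclosed_def affine_space_def)
  have P: "P (map \<psi> x) = \<psi> (P x)" "P x \<in> E" if "P \<in> polys k n" for P
    using subfield_hom_polys[OF that hom kE const len xE] polys_eval_in[OF that subfield_hom_subfield[OF hom] kE] len xE
    by (auto simp: subset_iff)
  have zero: "P (map \<psi> x) = 0 \<longleftrightarrow> P x = 0" if "P \<in> polys k n" for P
    using P[OF that] subfield_hom_eq_0_iff[OF hom] by simp
  have mem: "map \<psi> x \<in> C \<longleftrightarrow> x \<in> C" if "zclosed k n C" for C
    using that zero len by (auto simp: zclosed_def affine_space_def subset_iff)
  show "generic_point k n W (map \<psi> x)"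
    using x AB mem by (auto simp: generic_point_def)
  show "fracs k (map \<psi> x) = \<psi> ` fracs k x"
  proof -
    have "fracs k (map \<psi> x) = {P (map \<psi> x) / Q (map \<psi> x) |P Q. P \<in> polys k n \<and> Q \<in> polys k n \<and> Q (map \<psi> x) \<noteq> 0}"
      using fracs_eq[OF k, of "map \<psi> x"] len by simp
    also have "\<dots> = {\<psi> (P x / Q x) |P Q. P \<in> polys k n \<and> Q \<in> polys k n \<and> Q x \<noteq> 0}"
      using zero P subfield_hom_divide[OF hom] by (intro Collect_cong ex_cong1) (metis (no_types, lifting))
    also have "\<dots> = \<psi> ` fracs k x" unfolding fracs_eq[OF k] len by blast
    finally show ?thesis .
  qed
qed

text \<open>In the sum of two faithful representations, the no-name lemma trivializes either summand. So the
  invariants of both are the same up to independent variables, which are a step with a split torus.\<close>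

lemma torsor_tower_lin_fix:
  fixes M :: "'g \<Rightarrow> nat \<Rightarrow> nat \<Rightarrow> 'k :: {field_char_0, alg_closed_field} udom"
  assumes G: "group G" "finite (carrier G)" and M: "lin_rep ground G d M"
    and faithful: "\<And>g. g \<in> carrier G \<Longrightarrow> g \<noteq> \<one>\<^bsub>G\<^esub> \<Longrightarrow> \<exists>i<d. \<exists>j<d. M g i j \<noteq> of_bool (i = j)"
    and tower: "has_tower_rep (ground :: 'k udom set) G"
  shows "torsor_tower ground (lin_fix ground G M (map std_var [0..<d]))"
proof -
  note k = ground_subfield
  obtain m M' where M': "lin_rep (ground :: 'k udom set) G m M'"
    and faithful': "\<forall>g\<in>carrier G. g \<noteq> \<one>\<^bsub>G\<^esub> \<longrightarrow> (\<exists>i<m. \<exists>j<m. M' g i j \<noteq> of_bool (i = j))"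
    and tw: "\<And>x t. length x = m \<Longrightarrow> extendable (ground :: 'k udom set) (x @ t) \<Longrightarrow>
      torsor_tower ground (lin_fix ground G (dsum m M' triv) (x @ t))"
    using tower unfolding has_tower_rep_def by blast
  define x w :: "'k udom list" where "x = map std_var [0..<d]" and "w = map (\<lambda>i. std_var (d + i)) [0..<m]"
  have len: "length x = d" "length w = m" by (simp_all add: x_def w_def)
  have xws: "indep ground (x @ w @ map (\<lambda>i. std_var (d + m + i)) [0..<l])" for l
  proof -
    have "w = map std_var [d..<d + m]" unfolding w_def by (rule nth_equalityI) auto
    then show ?thesis using indep_std_var_append[of "d + m" l] by (simp add: x_def upt_add_eq_append[of 0])
  qed
  have xw: "indep ground (x @ w)" using xws[of 0] by simp
  have wx: "indep ground (w @ x)" using indep_swap[of ground x w "[]"] xw by simp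
  let ?K = "lin_fix ground G M x"
  obtain y where y: "\<And>s. indep ground (x @ w @ s) \<Longrightarrow> indep ground (x @ y @ s)"
    "lin_fix ground G (dsum d M M') (x @ w) = lin_fix ground G (dsum d M triv) (x @ y)"
    "lin_fix ground G (dsum d M triv) (x @ y) = fracs ?K y"
    by (rule no_name[OF k G M M' xw len faithful], assumption, assumption, rule that, assumption+)
  obtain y' where y': "\<And>s. indep ground (w @ x @ s) \<Longrightarrow> indep ground (w @ y' @ s)"
    "lin_fix ground G (dsum m M' M) (w @ x) = lin_fix ground G (dsum m M' triv) (w @ y')"
    by (rule no_name[OF k G M' M wx len(2,1) faithful'[rule_format]], assumption, assumption, rule that, assumption+)
  have "extendable ground (w @ y')"
    unfolding extendable_def
  proof (intro exI[of _ "\<lambda>i. std_var (d + m + i)"] allI)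
    show "indep ground ((w @ y') @ map (\<lambda>i. std_var (d + m + i)) [0..<l])" for l
      using y'(1)[OF indep_swap[OF xws]] by simp
  qed
  then have "torsor_tower ground (lin_fix ground G (dsum m M' triv) (w @ y'))" by (rule tw[OF len(2)])
  then have "torsor_tower ground (fracs ?K y)"
    using y(2,3) y'(2) lin_fix_swap[OF k G M len(1) M' len(2) xw] by simp
  moreover have ind: "indep (fracs ground x) y"
    using y(1)[of "[]"] xw by (simp add: indep_appendD2[OF k])
  have "indep ?K y" by (rule indep_mono[OF ind]) (auto simp: lin_fix_def fixed_def)
  moreover have "is_subfield ?K"
    unfolding lin_fix_def
    using fixed_subfield[OF lin_action(1)[OF k G _ indep_appendD1[OF xw], of M]] M len(1) by simp
  ultimately show ?thesis using torsor_tower_purely_transcendental unfolding x_def by blast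
qed

theorem proposition19:
  fixes G :: "('g, 'b) monoid_scheme"
    and scale :: "'k::{alg_closed_field, field_char_0} \<Rightarrow> 'v::ab_group_add \<Rightarrow> 'v"
    and Basis :: "'v set"
    and \<rho> :: "'g \<Rightarrow> 'v \<Rightarrow> 'v"
    and n :: nat
    and W\<^sub>0 :: "'k udom list set"
  assumes "special_solvable G"
    and "finite_dimensional_vector_space scale Basis"
    and "linear_representation scale G \<rho>"
    and "faithful_action G UNIV \<rho>"
    and "quotient_model scale G \<rho> n W\<^sub>0"
  shows "toric_rational_tower ground n W\<^sub>0"
proof -
  have G: "group G" "finite (carrier G)" using assms(1) by (auto simp: special_solvable_def)
  obtain \<phi> x where \<phi>: "generic_embedding scale \<phi>" and W: "variety ground n W\<^sub>0"
    and x: "generic_point ground n W\<^sub>0 x" "field_adjoin ground (set x) = invariant_field scale G \<rho> \<phi>"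
    using assms(5) by (auto simp: quotient_model_def)
  interpret finite_dimensional_vector_space scale Basis by (rule assms(2))
  obtain bs where bs: "set bs = Basis" "distinct bs" using finite_distinct_list[OF finite_Basis] by blast
  interpret faithful_action G UNIV \<rho> by (rule assms(4))
  interpret V: generic_representation scale Basis bs \<phi> G \<rho>
    by (intro generic_representation.intro generic_representation_axioms.intro linear_coordinates.intro
        linear_coordinates_axioms.intro assms(2,4) bs \<phi>)
      (use assms(3) in \<open>auto simp: linear_representation_def\<close>)
  let ?k = "ground :: 'k udom set" and ?z = "map std_var [0..<V.d] :: 'k udom list"
  have x_eq: "fracs ?k x = lin_fix ?k G V.mat V.gen" using x(2) V.invariant_field_eq by (simp add: fracs_def)
  \<comment> \<open>The generic point of the representation is moved to the standard variables,
    because these are visibly followed by further independent ones.\<close>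
  define \<psi> where "\<psi> = subst_map ?k V.gen ?z"
  have eqv: "eqv ?k V.gen ?z" by (rule indep_eqv[OF V.indep_gen indep_std_var]) simp
  have "set x \<subseteq> fracs ?k V.gen" using x_eq fracs_gens[of x ?k] by (auto simp: lin_fix_def fixed_def)
  note gen = generic_point_image[OF ground_subfield W x(1) subst_map_hom[OF ground_subfield eqv] fracs_base
      subst_map_const[OF ground_subfield eqv] this, folded \<psi>_def]
  have "extendable ?k []" unfolding extendable_def using indep_std_var by auto
  then have "has_tower_rep ?k G"
    by (intro has_tower_rep_special_solvable assms(1) ground_subfield ground_primitive_root)
  then have "torsor_tower ?k (lin_fix ?k G V.mat ?z)"
    by (intro torsor_tower_lin_fix G V.lin_rep_mat V.mat_faithful)
  moreover have "fracs ?k (map \<psi> x) = lin_fix ?k G V.mat ?z"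
    using gen(2) subst_map_lin_fix[OF ground_subfield G(1) _ V.indep_gen indep_std_var, of V.mat V.d] V.lin_rep_mat
    by (simp add: x_eq \<psi>_def)
  ultimately show ?thesis
    by (intro torsor_tower_toric_rational_tower[OF ground_subfield _ W gen(1)])
qed

end
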